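(* Let $Z\subseteq\mathbb{R}^N$ be a bounded domain with $C^2$ boundary, let $\{\lambda_n\}_{n\ge 1}$ be the increasing sequence of distinct eigenvalues of $(-\Delta,H^1_0(Z))$ with eigenspaces $E(\lambda_n)$, and fix an integer $k\geq 1$. Let $j:Z\times\mathbb{R}\to\mathbb{R}$ satisfy the following: (i) for all $\zeta\in\mathbb{R}$ the function $z\mapsto j(z,\zeta)$ is measurable, and $j(z,0)=0$ for a.a. $z\in Z$; (ii) for a.a. $z\in Z$ the function $\zeta\mapsto j(z,\zeta)$ is locally Lipschitz; (iii) there are $a_1\in L^\infty(Z)$, $c_1>0$ and $1\le r<2^*$ such that for a.a. $z\in Z$, all $\zeta\in\mathbb{R}$ and all $u\in\partial j(z,\zeta)$, $|u|\le a_1(z)+c_1|\zeta|^{r-1}$; (iv) $u\zeta-2j(z,\zeta)\to-\infty$ as $|\zeta|\to+\infty$, uniformly for a.a. $z\in Z$ and all $u\in\partial j(z,\zeta)$ (that is, for every $\eta>0$ there is $M>0$ such that $u\zeta-2j(z,\zeta)\le-\eta$ for a.a. $z\in Z$, all $|\zeta|\ge M$ and all $u\in\partial j(z,\zeta)$); (v) there is $l\in L^\infty(Z)$ with $l(z)\le\lambda_{k+1}-\lambda_k$ for a.a. $z\in Z$, with strict inequality on a set of positive measure, such that for a.a. $z\in Z$, all $\zeta_1\ne\zeta_2$ in $\mathbb{R}$ and all $v_1\in\partial j(z,\zeta_1)$, $v_2\in\partial j(z,\zeta_2)$, $\frac{v_1-v_2}{\zeta_1-\zeta_2}\le l(z)$;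 (vi) there are an integer $m\in[1,k]$, a function $\beta\in L^\infty(Z)$ with $\beta\le 0$ a.e., and $\delta_0>0$ such that $\beta(z)\le\lambda_m-\lambda_k$ for a.a. $z\in Z$, with strict inequality on a set of positive measure, and for a.a. $z\in Z$ and all $\zeta$ with $0<|\zeta|\le\delta_0$, $\lambda_{m-1}-\lambda_k\le\frac{2j(z,\zeta)}{\zeta^2}\le\beta(z)$ (for $m=1$ the lower bound is void); (vii) there is $\gamma\in L^\infty(Z)$, $\gamma\ge0$ a.e., with $\gamma(z)\le\lambda_{k+1}-\lambda_k$ for a.a. $z\in Z$ and strict inequality on a set of positive measure, such that $0\le\liminf_{|\zeta|\to+\infty}\frac{2j(z,\zeta)}{\zeta^2}\le\limsup_{|\zeta|\to+\infty}\frac{2j(z,\zeta)}{\zeta^2}\le\gamma(z)$ uniformly for a.a. $z\in Z$. Let $\varphi:H^1_0(Z)\to\mathbb{R}$, $\varphi(x)=\frac12\|\nabla x\|_2^2-\frac{\lambda_k}{2}\|x\|_2^2-\int_Zj(z,x(z))\,dz$, and put $\bar H_0=\bigoplus_{i=1}^kE(\lambda_i)$, $\hat H=\overline{\bigoplus_{i=k+1}^\infty E(\lambda_i)}$. Then there exists a continuous map $\vartheta:\bar H_0\to\hat H$ such that for every $u\in\bar H_0$, $$\inf_{v\in\hat H}\varphi(u+v)=\varphi(u+\vartheta(u)),$$ and $\vartheta(u)$ is the unique solution $v\in\hat H$ of the operator inclusion (with $u\in\bar H_0$ fixed) $$0\in p_{\hat H^*}\,\partial\varphi(u+v).$$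
   Context: $2^*=\frac{2N}{N-2}$ if $N>2$ and $2^*=+\infty$ if $N\le 2$. $\|\cdot\|_2$ is the $L^2$ norm. For a locally Lipschitz function $\varphi:X\to\mathbb{R}$ on a Banach space $X$, the generalized directional derivative is $\varphi^0(x;h)=\limsup_{x'\to x,\ t\searrow0}\frac{\varphi(x'+th)-\varphi(x')}{t}$ and the Clarke subdifferential is $\partial\varphi(x)=\{x^*\in X^*:\langle x^*,h\rangle\le\varphi^0(x;h)\ \forall h\in X\}$. $\partial j(z,\zeta)$ denotes the Clarke subdifferential of $j(z,\cdot)$ at $\zeta$. The functional $\varphi$ in the claim is locally Lipschitz on $H^1_0(Z)$. The uniform limits in (vii) mean: for every $\varepsilon>0$ there is $M>0$ such that $-\varepsilon\le 2j(z,\zeta)/\zeta^2\le\gamma(z)+\varepsilon$ for a.a. $z\in Z$ and all $|\zeta|\ge M$. The closure defining $\hat H$ is taken in $H^1_0(Z)$, so $H^1_0(Z)=\bar H_0\oplus\hat H$ (orthogonal direct sum) and $(H^1_0(Z))^*=H^{-1}(Z)=\bar H_0^*\oplus\hat H^*$. $p_{\hat H^*}:H^{-1}(Z)\to\hat H^*$ is the orthogonal projection onto $\hat H^*=[\bar H_0^*]^\perp$; it is the adjoint of the inclusion $\hat H\hookrightarrow H^1_0(Z)$, i.e. restriction of functionals to $\hat H$. $p_{\hat H^*}\partial\varphi(x)$ is the image of the set $\partial\varphi(x)$. *)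

theory Defs
  imports "HOL-Analysis.Analysis"
begin

section \<open>The space \<open>L\<^sup>2(\<real>\<^sup>N)\<close>\<close>

definition sq_integrable :: "('a::euclidean_space \<Rightarrow> 'b::euclidean_space) \<Rightarrow> bool" where
  "sq_integrable f \<longleftrightarrow>
     f \<in> borel_measurable lebesgue \<and> integrable lebesgue (\<lambda>z. (norm (f z))\<^sup>2)"

definition L2_rel ::
    "('a::euclidean_space \<Rightarrow> 'b::euclidean_space) \<Rightarrow> ('a \<Rightarrow> 'b) \<Rightarrow> bool" where
  "L2_rel f g \<longleftrightarrow> sq_integrable f \<and> sq_integrable g \<and> (AE z in lebesgue. f z = g z)"

lemma sq_integrable_zero: "sq_integrable (\<lambda>_. 0)"
  by (simp add: sq_integrable_def)

lemma sq_integrable_scaleR: "sq_integrable f \<Longrightarrow> sq_integrable (\<lambda>z. c *\<^sub>R f z)"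
  by (auto simp: sq_integrable_def power_mult_distrib)

lemma sq_integrable_add:
  assumes "sq_integrable f" "sq_integrable g"
  shows "sq_integrable (\<lambda>z. f z + g z)"
proof -
  have m: "f \<in> borel_measurable lebesgue" "g \<in> borel_measurable lebesgue"
    and i: "integrable lebesgue (\<lambda>z. 2 * (norm (f z))\<^sup>2 + 2 * (norm (g z))\<^sup>2)"
    using assms by (auto simp: sq_integrable_def)
  have "(norm (f z + g z))\<^sup>2 \<le> 2 * (norm (f z))\<^sup>2 + 2 * (norm (g z))\<^sup>2" for z
  proof -
    have "(norm (f z + g z))\<^sup>2 \<le> (norm (f z) + norm (g z))\<^sup>2"
      by (intro power_mono norm_triangle_ineq) simp
    also have "\<dots> \<le> 2 * (norm (f z))\<^sup>2 + 2 * (norm (g z))\<^sup>2"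
      using zero_le_power2[of "norm (f z) - norm (g z)"]
      by (simp add: power2_eq_square algebra_simps)
    finally show ?thesis .
  qed
  then have "integrable lebesgue (\<lambda>z. (norm (f z + g z))\<^sup>2)"
    by (intro Bochner_Integration.integrable_bound[OF i]) (use m in \<open>auto\<close>)
  with m show ?thesis by (auto simp: sq_integrable_def)
qed

lemma sq_integrable_inner:
  assumes "sq_integrable f" "sq_integrable g"
  shows "integrable lebesgue (\<lambda>z. f z \<bullet> g z)"
proof -
  have m: "f \<in> borel_measurable lebesgue" "g \<in> borel_measurable lebesgue"
    and i: "integrable lebesgue (\<lambda>z. (norm (f z))\<^sup>2 + (norm (g z))\<^sup>2)"
    using assms by (auto simp: sq_integrable_def)
  have "\<bar>f z \<bullet> g z\<bar> \<le> (norm (f z))\<^sup>2 + (norm (g z))\<^sup>2" for z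
  proof -
    have "\<bar>f z \<bullet> g z\<bar> \<le> norm (f z) * norm (g z)" by (rule Cauchy_Schwarz_ineq2)
    also have "\<dots> \<le> (norm (f z))\<^sup>2 + (norm (g z))\<^sup>2"
      using sum_squares_bound[of "norm (f z)" "norm (g z)"]
        mult_nonneg_nonneg[OF norm_ge_zero[of "f z"] norm_ge_zero[of "g z"]]
      by linarith
    finally show ?thesis .
  qed
  then show ?thesis
    by (intro Bochner_Integration.integrable_bound[OF i]) (use m in \<open>auto\<close>)
qed

quotient_type (overloaded) ('a, 'b) L2 = "'a::euclidean_space \<Rightarrow> 'b::euclidean_space" / partial: L2_rel
proof (rule part_equivpI)
  show "\<exists>f::'a \<Rightarrow> 'b. L2_rel f f"
    using sq_integrable_zero by (auto simp: L2_rel_def)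
  show "symp (L2_rel :: ('a \<Rightarrow> 'b) \<Rightarrow> _)"
    by (auto simp: symp_def L2_rel_def elim: eventually_mono)
  show "transp (L2_rel :: ('a \<Rightarrow> 'b) \<Rightarrow> _)"
    by (rule transpI) (auto simp: L2_rel_def elim: eventually_elim2)
qed

instantiation L2 :: (euclidean_space, euclidean_space) real_inner
begin

lift_definition zero_L2 :: "('a, 'b) L2" is "\<lambda>_. 0"
  by (simp add: L2_rel_def sq_integrable_zero)

lift_definition plus_L2 :: "('a, 'b) L2 \<Rightarrow> ('a, 'b) L2 \<Rightarrow> ('a, 'b) L2" is "\<lambda>f g z. f z + g z"
  unfolding L2_rel_def by (auto intro: sq_integrable_add elim: eventually_elim2)

lift_definition scaleR_L2 :: "real \<Rightarrow> ('a, 'b) L2 \<Rightarrow> ('a, 'b) L2" is "\<lambda>c f z. c *\<^sub>R f z"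
  unfolding L2_rel_def by (auto intro: sq_integrable_scaleR elim: eventually_mono)

definition uminus_L2 :: "('a, 'b) L2 \<Rightarrow> ('a, 'b) L2" where
  "uminus_L2 x = (-1) *\<^sub>R x"

definition minus_L2 :: "('a, 'b) L2 \<Rightarrow> ('a, 'b) L2 \<Rightarrow> ('a, 'b) L2" where
  "minus_L2 x y = x + (- y)"

lift_definition inner_L2 :: "('a, 'b) L2 \<Rightarrow> ('a, 'b) L2 \<Rightarrow> real"
  is "\<lambda>f g. \<integral>z. f z \<bullet> g z \<partial>lebesgue"
proof -
  fix f f' g g' :: "'a \<Rightarrow> 'b"
  assume *: "L2_rel f f'" "L2_rel g g'"
  then have "AE z in lebesgue. f z \<bullet> g z = f' z \<bullet> g' z"
    by (auto simp: L2_rel_def elim: eventually_elim2)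
  moreover have "(\<lambda>z. f z \<bullet> g z) \<in> borel_measurable lebesgue"
    "(\<lambda>z. f' z \<bullet> g' z) \<in> borel_measurable lebesgue"
    using * by (auto simp: L2_rel_def sq_integrable_def intro: borel_measurable_inner)
  ultimately show "(\<integral>z. f z \<bullet> g z \<partial>lebesgue) = (\<integral>z. f' z \<bullet> g' z \<partial>lebesgue)"
    by (intro integral_cong_AE)
qed

definition norm_L2 :: "('a, 'b) L2 \<Rightarrow> real" where
  "norm_L2 x = sqrt (x \<bullet> x)"

definition dist_L2 :: "('a, 'b) L2 \<Rightarrow> ('a, 'b) L2 \<Rightarrow> real" where
  "dist_L2 x y = norm (x - y)"

definition sgn_L2 :: "('a, 'b) L2 \<Rightarrow> ('a, 'b) L2" where
  "sgn_L2 x = inverse (norm x) *\<^sub>R x"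

definition uniformity_L2 :: "(('a, 'b) L2 \<times> ('a, 'b) L2) filter" where
  "uniformity_L2 = (INF e\<in>{0<..}. principal {(x, y). dist x y < e})"

definition open_L2 :: "('a, 'b) L2 set \<Rightarrow> bool" where
  "open_L2 U \<longleftrightarrow> (\<forall>x\<in>U. eventually (\<lambda>(x', y). x' = x \<longrightarrow> y \<in> U) uniformity)"

instance
proof
  fix x y z :: "('a, 'b) L2" and a b :: real
  show "x + y + z = x + (y + z)"
    by transfer (auto simp: L2_rel_def add.assoc intro!: sq_integrable_add)
  show "x + y = y + x"
    by transfer (auto simp: L2_rel_def add.commute intro!: sq_integrable_add)
  show "0 + x = x"
    by transfer (auto simp: L2_rel_def)
  show "- x + x = 0"
    unfolding uminus_L2_def by transfer (auto simp: L2_rel_def sq_integrable_zero)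
  show "x - y = x + - y" by (simp add: minus_L2_def)
  show "a *\<^sub>R (x + y) = a *\<^sub>R x + a *\<^sub>R y"
    by transfer (auto simp: L2_rel_def scaleR_add_right
        intro!: sq_integrable_add sq_integrable_scaleR)
  show "(a + b) *\<^sub>R x = a *\<^sub>R x + b *\<^sub>R x"
    by transfer (auto simp: L2_rel_def scaleR_add_left
        intro!: sq_integrable_add sq_integrable_scaleR)
  show "a *\<^sub>R b *\<^sub>R x = (a * b) *\<^sub>R x"
    by transfer (auto simp: L2_rel_def intro!: sq_integrable_scaleR)
  show "1 *\<^sub>R x = x" by transfer (auto simp: L2_rel_def)
  show "dist x y = norm (x - y)" by (rule dist_L2_def)
  show "sgn x = inverse (norm x) *\<^sub>R x" by (rule sgn_L2_def)
  show "uniformity = (INF e\<in>{0<..}. principal {(x, y::('a, 'b) L2). dist x y < e})"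
    by (rule uniformity_L2_def)
  show "open U \<longleftrightarrow> (\<forall>x\<in>U. eventually (\<lambda>(x', y). x' = x \<longrightarrow> y \<in> U) uniformity)"
    for U :: "('a, 'b) L2 set" by (rule open_L2_def)
  show "norm x = sqrt (x \<bullet> x)" by (rule norm_L2_def)
  show "x \<bullet> y = y \<bullet> x" by transfer (simp add: inner_commute)
  show "(x + y) \<bullet> z = x \<bullet> z + y \<bullet> z"
    by transfer (auto simp: inner_add_left L2_rel_def sq_integrable_inner)
  show "(a *\<^sub>R x) \<bullet> y = a * (x \<bullet> y)" by transfer simp
  show "0 \<le> x \<bullet> x" by transfer simp
  show "x \<bullet> x = 0 \<longleftrightarrow> x = 0"
  proof transfer
    fix f :: "'a \<Rightarrow> 'b" assume "L2_rel f f"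
    then have "sq_integrable f" by (simp add: L2_rel_def)
    moreover from sq_integrable_inner[OF this this]
    have "(\<integral>z. f z \<bullet> f z \<partial>lebesgue) = 0 \<longleftrightarrow> (AE z in lebesgue. f z \<bullet> f z = 0)"
      by (intro integral_nonneg_eq_0_iff_AE) auto
    ultimately show "(\<integral>z. f z \<bullet> f z \<partial>lebesgue) = 0 \<longleftrightarrow> L2_rel f (\<lambda>_. 0)"
      by (simp add: L2_rel_def sq_integrable_zero)
  qed
qed

end

section \<open>Domains and Sobolev spaces\<close>

definition grad :: "('a::euclidean_space \<Rightarrow> real) \<Rightarrow> 'a \<Rightarrow> 'a" where
  "grad f x = (\<Sum>b\<in>Basis. frechet_derivative f (at x) b *\<^sub>R b)"

primrec Ck :: "nat \<Rightarrow> ('a::euclidean_space \<Rightarrow> real) \<Rightarrow> bool" where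
  "Ck 0 f \<longleftrightarrow> continuous_on UNIV f"
| "Ck (Suc n) f \<longleftrightarrow> (\<forall>x. f differentiable (at x)) \<and>
     (\<forall>b\<in>Basis. Ck n (\<lambda>x. frechet_derivative f (at x) b))"

text \<open>Near each boundary point, \<open>Z\<close> is the strict epigraph, in a unit direction \<open>e\<close>, of a
  \<open>C\<^sup>2\<close> function on the hyperplane \<open>e\<^sup>\<bottom>\<close>. That function is given as the restriction
  to \<open>e\<^sup>\<bottom>\<close> of a \<open>C\<^sup>2\<close> function \<open>\<psi>\<close> on the whole space, which is no loss of generality
  (compose with the orthogonal projection).\<close>

definition C2_boundary :: "'a::euclidean_space set \<Rightarrow> bool" where
  "C2_boundary Z \<longleftrightarrow>
     (\<forall>p\<in>frontier Z. \<exists>r>0. \<exists>e \<psi>. norm e = 1 \<and> Ck 2 \<psi> \<and>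
        Z \<inter> ball p r = {y \<in> ball p r. \<psi> (y - (y \<bullet> e) *\<^sub>R e) < y \<bullet> e})"

definition bounded_C2_domain :: "'a::euclidean_space set \<Rightarrow> bool" where
  "bounded_C2_domain Z \<longleftrightarrow>
     Z \<noteq> {} \<and> open Z \<and> connected Z \<and> bounded Z \<and> C2_boundary Z"

definition Linf :: "'a::euclidean_space set \<Rightarrow> ('a \<Rightarrow> real) set" where
  "Linf Z = {a \<in> borel_measurable (lebesgue_on Z). \<exists>C. AE z in lebesgue_on Z. \<bar>a z\<bar> \<le> C}"

definition test_functions :: "'a::euclidean_space set \<Rightarrow> ('a \<Rightarrow> real) set" where
  "test_functions Z =
     {f. (\<forall>n. Ck n f) \<and> compact (closure {x. f x \<noteq> 0}) \<and> closure {x. f x \<noteq> 0} \<subseteq> Z}"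

text \<open>Functions in \<open>H\<^sup>1\<^sub>0(Z)\<close> are extended by zero to the whole space, and \<open>u\<close> is represented by
  the pair \<open>(u, \<nabla>u)\<close> in \<open>L\<^sup>2 \<times> L\<^sup>2\<close>. The norm of the product is then
  \<open>(\<parallel>u\<parallel>\<^sup>2 + \<parallel>\<nabla>u\<parallel>\<^sup>2)\<^sup>1\<^sup>/\<^sup>2\<close>, the norm of \<open>H\<^sup>1\<close>, and the closure below is the usual
  closure of \<open>C\<^sub>c\<^sup>\<infinity>(Z)\<close>. The second component is the weak gradient of the first and is
  determined by it.\<close>

type_synonym 'a H1 = "('a, real) L2 \<times> ('a, 'a) L2"

definition H10 :: "'a::euclidean_space set \<Rightarrow> 'a H1 set" where
  "H10 Z = closure ((\<lambda>f. (abs_L2 f, abs_L2 (grad f))) ` test_functions Z)"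

abbreviation fun_of :: "'a::euclidean_space H1 \<Rightarrow> 'a \<Rightarrow> real" where
  "fun_of x \<equiv> rep_L2 (fst x)"

lemma sq_integrable_compact_support:
  fixes f :: "'a::euclidean_space \<Rightarrow> 'b::euclidean_space"
  assumes c: "continuous_on UNIV f" and K: "compact K" and s: "\<And>x. x \<notin> K \<Longrightarrow> f x = 0"
  shows "sq_integrable f"
proof -
  have "(\<lambda>x. indicator K x *\<^sub>R (norm (f x))\<^sup>2) = (\<lambda>x. (norm (f x))\<^sup>2)"
    using s by (auto simp: indicator_def fun_eq_iff)
  moreover have "integrable lborel (\<lambda>x. indicator K x *\<^sub>R (norm (f x))\<^sup>2)"
    by (intro borel_integrable_compact K continuous_intros continuous_on_subset[OF c]) simp
  ultimately have "integrable lebesgue (\<lambda>x. (norm (f x))\<^sup>2)"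
    by (simp add: integrable_completion borel_measurable_integrable)
  moreover have "f \<in> borel_measurable lebesgue"
    using borel_measurable_continuous_onI[OF c] by (simp add: measurable_completion)
  ultimately show ?thesis by (simp add: sq_integrable_def)
qed

lemma test_functions_sq_integrable:
  assumes "f \<in> test_functions Z"
  shows "sq_integrable f" "sq_integrable (grad f)"
proof -
  let ?K = "closure {x. f x \<noteq> 0}"
  have K: "compact ?K" and C: "\<And>n. Ck n f" using assms by (auto simp: test_functions_def)
  have out: "f x = 0" if "x \<notin> ?K" for x
    using that closure_subset[of "{x. f x \<noteq> 0}"] by auto
  show "sq_integrable f"
    by (rule sq_integrable_compact_support[OF _ K out]) (use C[of 0] in simp)
  have "continuous_on UNIV (grad f)"
    unfolding grad_def using C[of "Suc 0"]
    by (intro continuous_on_sum continuous_on_scaleR continuous_on_const) simp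
  moreover have "grad f x = 0" if "x \<notin> ?K" for x
  proof -
    have "((\<lambda>_. 0) has_derivative (\<lambda>_. 0)) (at x)" by simp
    then have "(f has_derivative (\<lambda>_. 0)) (at x)"
    proof (rule has_derivative_transform_within_open)
      show "open (- ?K)" by (simp add: open_Compl)
      show "x \<in> - ?K" using that by blast
    qed (metis out ComplD)
    then show ?thesis by (simp add: grad_def frechet_derivative_at[symmetric])
  qed
  ultimately show "sq_integrable (grad f)"
    by (rule sq_integrable_compact_support[OF _ K])
qed

section \<open>The spectrum of the Dirichlet Laplacian\<close>

text \<open>Eigenfunctions are weak solutions in \<open>H\<^sup>1\<^sub>0(Z)\<close> of \<open>- \<Delta> u = \<mu> u\<close>.\<close>

definition eigenspace :: "'a::euclidean_space set \<Rightarrow> real \<Rightarrow> 'a H1 set" where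
  "eigenspace Z \<mu> = {x \<in> H10 Z. \<forall>y \<in> H10 Z. snd x \<bullet> snd y = \<mu> * (fst x \<bullet> fst y)}"

definition eigenvalues :: "'a::euclidean_space set \<Rightarrow> real set" where
  "eigenvalues Z = {\<mu>. \<exists>x \<in> eigenspace Z \<mu>. x \<noteq> 0}"

definition H_bar :: "'a::euclidean_space set \<Rightarrow> (nat \<Rightarrow> real) \<Rightarrow> nat \<Rightarrow> 'a H1 set" where
  "H_bar Z lam k = span (\<Union>i\<in>{1..k}. eigenspace Z (lam i))"

definition H_hat :: "'a::euclidean_space set \<Rightarrow> (nat \<Rightarrow> real) \<Rightarrow> nat \<Rightarrow> 'a H1 set" where
  "H_hat Z lam k = closure (span (\<Union>i\<in>{k+1..}. eigenspace Z (lam i)))"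

section \<open>Clarke's subdifferential\<close>

text \<open>The Banach space is a (closed) linear subspace \<open>X\<close> of a normed space; elements of its
  dual are functions on \<open>X\<close>, hence \<open>undefined\<close> outside of \<open>X\<close>.\<close>

definition dual :: "'x::real_normed_vector set \<Rightarrow> ('x \<Rightarrow> real) set" where
  "dual X = {\<xi> \<in> extensional X.
     (\<forall>x\<in>X. \<forall>y\<in>X. \<xi> (x + y) = \<xi> x + \<xi> y) \<and>
     (\<forall>c. \<forall>x\<in>X. \<xi> (c *\<^sub>R x) = c * \<xi> x) \<and>
     (\<exists>C. \<forall>x\<in>X. \<bar>\<xi> x\<bar> \<le> C * norm x)}"

definition clarke_deriv ::
    "'x::real_normed_vector set \<Rightarrow> ('x \<Rightarrow> real) \<Rightarrow> 'x \<Rightarrow> 'x \<Rightarrow> ereal" where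
  "clarke_deriv X f x h =
     Limsup (inf (nhds x) (principal X) \<times>\<^sub>F at_right 0)
       (\<lambda>(x', t). ereal ((f (x' + t *\<^sub>R h) - f x') / t))"

definition clarke_subdiff ::
    "'x::real_normed_vector set \<Rightarrow> ('x \<Rightarrow> real) \<Rightarrow> 'x \<Rightarrow> ('x \<Rightarrow> real) set" where
  "clarke_subdiff X f x = {\<xi> \<in> dual X. \<forall>h\<in>X. ereal (\<xi> h) \<le> clarke_deriv X f x h}"

text \<open>On the real line, a functional \<open>h \<mapsto> u h\<close> is identified with the number \<open>u\<close>.\<close>

definition clarke_subdiff_real :: "(real \<Rightarrow> real) \<Rightarrow> real \<Rightarrow> real set" where
  "clarke_subdiff_real f \<zeta> = {u. (\<lambda>h. u * h) \<in> clarke_subdiff UNIV f \<zeta>}"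

definition locally_lipschitz :: "(real \<Rightarrow> real) \<Rightarrow> bool" where
  "locally_lipschitz f \<longleftrightarrow> (\<forall>x. \<exists>r>0. \<exists>L. L-lipschitz_on (ball x r) f)"

section \<open>The functional\<close>

definition crit_exp :: "nat \<Rightarrow> ereal" where
  "crit_exp N = (if N > 2 then ereal (2 * real N / (real N - 2)) else \<infinity>)"

text \<open>In contrast to \<open>powr\<close>, this gives \<open>0\<^sup>0 = 1\<close>.\<close>

definition abs_pow :: "real \<Rightarrow> real \<Rightarrow> real" where
  "abs_pow \<zeta> s = (if s = 0 then 1 else \<bar>\<zeta>\<bar> powr s)"

definition energy ::
    "'a::euclidean_space set \<Rightarrow> ('a \<Rightarrow> real \<Rightarrow> real) \<Rightarrow> real \<Rightarrow> 'a H1 \<Rightarrow> real" where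
  "energy Z j \<mu> x =
     1 / 2 * (norm (snd x))\<^sup>2 - \<mu> / 2 * (norm (fst x))\<^sup>2
       - (\<integral>z. j z (fun_of x z) \<partial>lebesgue_on Z)"

end

theory Submission
  imports Defs "HOL-Complex_Analysis.Complex_Analysis" "HOL-Probability.Distributions"
begin

text \<open>The functional is strongly convex on every translate of \<open>H_hat\<close>, and everything else follows from
  that.

  Monotonicity of \<open>\<partial>j(z, \<cdot>)\<close> up to \<open>l(z)\<close> says that \<open>\<zeta> \<mapsto> j(z, \<zeta>) - l(z) \<zeta>\<^sup>2 / 2\<close> is concave
  (\<open>semiconcave_clarke\<close>). Together with \<open>j(z, 0) = 0\<close> and the quadratic bound at infinity this gives
  quadratic growth of \<open>j(z, \<cdot>)\<close> and linear growth of its slopes, so that the integral functional is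
  locally Lipschitz on \<open>L\<^sup>2\<close>. For \<open>x - y = v\<close> in \<open>H_hat\<close>
  the deviation of \<open>\<phi>\<close> from convexity along the segment is governed by the quadratic form
  \<open>\<parallel>\<nabla>v\<parallel>\<^sup>2 - \<lambda>\<^sub>k \<parallel>v\<parallel>\<^sup>2 - \<integral> l v\<^sup>2\<close>, which is \<open>\<parallel>\<nabla>v\<parallel>\<^sup>2 - \<lambda>\<^bsub>k+1\<^esub> \<parallel>v\<parallel>\<^sup>2 + \<integral> \<delta> v\<^sup>2\<close> with
  \<open>\<delta> = \<lambda>\<^bsub>k+1\<^esub> - \<lambda>\<^sub>k - l \<ge> 0\<close>.

  This form dominates a multiple of \<open>\<parallel>v\<parallel>\<^sup>2\<close> in \<open>H\<^sup>1\<close> (\<open>coercive_with_weight\<close>): beyond the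
  eigenspace of \<open>\<lambda>\<^bsub>k+1\<^esub>\<close> there is a spectral gap, and on that eigenspace, which is
  finite-dimensional by a quantitative form of Rellich's theorem (\<open>H10_compactness\<close>), the weight
  \<open>\<delta>\<close> is definite because an eigenfunction that vanishes on a set of positive measure vanishes
  (\<open>eigenfunction_unique_continuation\<close>). For the latter, evolve a cut off eigenfunction \<open>\<eta> u\<close> by
  \<open>exp(t (\<Delta> + \<mu>))\<close>. For \<open>t > 0\<close> the result extends holomorphically along every line. Near a point
  where \<open>\<eta> = 1\<close> the extension is stationary up to an error that is bounded uniformly in \<open>t\<close>, since
  \<open>(\<Delta> + \<mu>)(\<eta> u)\<close> lives away from that point and the Gaussian kernel is tiny there. Hence \<open>u\<close>
  itself is holomorphic along lines, and the identity theorem, Fubini and connectedness finish the argument.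

  Strong convexity gives the unique minimiser \<open>\<theta> u\<close> on \<open>u + H_hat\<close>, with quadratic growth around it,
  and with the Lipschitz bound its continuity in \<open>u\<close> (\<open>fibrewise_minimiser\<close>). At a point \<open>u + v\<close> with
  \<open>v \<noteq> \<theta> u\<close> the direction \<open>\<theta> u - v\<close> has negative generalized derivative, so no subgradient
  vanishes on \<open>H_hat\<close> (\<open>clarke_deriv_descent\<close>). At the minimiser one has to produce a subgradient of
  \<open>\<phi>\<close> on the whole space that vanishes on \<open>H_hat\<close>. After adding a multiple of \<open>\<parallel>h\<parallel>\<^sub>2\<^sup>2\<close> the
  increment of \<open>\<phi>\<close> is convex in \<open>h\<close> and nonnegative on \<open>H_hat\<close>; a Hahn-Banach argument yields a linear
  minorant that vanishes on \<open>H_hat\<close>, and the added term is of second order, so the minorant is a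
  Clarke subgradient (\<open>minimiser_clarke_critical\<close>).\<close>

section \<open>The Hilbert space of square integrable functions\<close>

lemma sq_integrable_rep_L2: "sq_integrable (rep_L2 x)"
  using Quotient3_rep_reflp[OF Quotient3_L2, of x] by (simp add: L2_rel_def)

lemma abs_rep_L2: "abs_L2 (rep_L2 x) = x"
  using Quotient3_abs_rep[OF Quotient3_L2] .

lemma abs_L2_eq_iff:
  assumes "sq_integrable f" "sq_integrable g"
  shows "abs_L2 f = abs_L2 g \<longleftrightarrow> (AE z in lebesgue. f z = g z)"
  using Quotient3_rel[OF Quotient3_L2, of f g] assms by (auto simp: L2_rel_def)

lemma rep_abs_L2: "sq_integrable f \<Longrightarrow> AE z in lebesgue. rep_L2 (abs_L2 f) z = f z"
  using abs_L2_eq_iff[of "rep_L2 (abs_L2 f)" f] by (simp add: sq_integrable_rep_L2 abs_rep_L2)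

lemma L2_eqI: "AE z in lebesgue. rep_L2 x z = rep_L2 y z \<Longrightarrow> x = y"
  using abs_L2_eq_iff[of "rep_L2 x" "rep_L2 y"] by (simp add: sq_integrable_rep_L2 abs_rep_L2)

lemma inner_abs_L2:
  assumes "sq_integrable f" "sq_integrable g"
  shows "abs_L2 f \<bullet> abs_L2 g = (\<integral>z. f z \<bullet> g z \<partial>lebesgue)"
  by (rule inner_L2.abs_eq) (use assms in \<open>auto simp: L2_rel_def\<close>)

lemma inner_L2_eq: "x \<bullet> y = (\<integral>z. rep_L2 x z \<bullet> rep_L2 y z \<partial>lebesgue)"
  using inner_abs_L2[OF sq_integrable_rep_L2[of x] sq_integrable_rep_L2[of y]]
  by (simp add: abs_rep_L2)

lemma norm_L2_eq: "(norm x)\<^sup>2 = (\<integral>z. (norm (rep_L2 x z))\<^sup>2 \<partial>lebesgue)"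
  by (simp add: power2_norm_eq_inner inner_L2_eq)

lemma norm_abs_L2: "sq_integrable f \<Longrightarrow> (norm (abs_L2 f))\<^sup>2 = (\<integral>z. (norm (f z))\<^sup>2 \<partial>lebesgue)"
  by (simp add: power2_norm_eq_inner inner_abs_L2)

lemma add_abs_L2:
  "sq_integrable f \<Longrightarrow> sq_integrable g \<Longrightarrow> abs_L2 f + abs_L2 g = abs_L2 (\<lambda>z. f z + g z)"
  by (rule plus_L2.abs_eq) (auto simp: L2_rel_def)

lemma scaleR_abs_L2: "sq_integrable f \<Longrightarrow> c *\<^sub>R abs_L2 f = abs_L2 (\<lambda>z. c *\<^sub>R f z)"
  by (rule scaleR_L2.abs_eq) (auto simp: L2_rel_def)

lemma sq_integrable_diff:
  "sq_integrable f \<Longrightarrow> sq_integrable g \<Longrightarrow> sq_integrable (\<lambda>z. f z - g z)"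
  using sq_integrable_add[of f "\<lambda>z. (-1) *\<^sub>R g z"] sq_integrable_scaleR[of g "-1"] by simp

lemma diff_abs_L2:
  "sq_integrable f \<Longrightarrow> sq_integrable g \<Longrightarrow> abs_L2 f - abs_L2 g = abs_L2 (\<lambda>z. f z - g z)"
proof -
  assume f: "sq_integrable f" and g: "sq_integrable g"
  have "abs_L2 f - abs_L2 g = abs_L2 f + (-1) *\<^sub>R abs_L2 g" by simp
  also have "\<dots> = abs_L2 (\<lambda>z. f z + (-1) *\<^sub>R g z)"
    unfolding scaleR_abs_L2[OF g] by (rule add_abs_L2[OF f sq_integrable_scaleR[OF g]])
  finally show ?thesis by simp
qed

lemma rep_L2_add: "AE z in lebesgue. rep_L2 (x + y) z = rep_L2 x z + rep_L2 y z"
  using rep_abs_L2[OF sq_integrable_add[OF sq_integrable_rep_L2[of x] sq_integrable_rep_L2[of y]]]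
    add_abs_L2[OF sq_integrable_rep_L2[of x] sq_integrable_rep_L2[of y]]
  by (simp add: abs_rep_L2)

lemma rep_L2_diff: "AE z in lebesgue. rep_L2 (x - y) z = rep_L2 x z - rep_L2 y z"
  using rep_abs_L2[OF sq_integrable_diff[OF sq_integrable_rep_L2[of x] sq_integrable_rep_L2[of y]]]
    diff_abs_L2[OF sq_integrable_rep_L2[of x] sq_integrable_rep_L2[of y]]
  by (simp add: abs_rep_L2)

lemma rep_L2_scaleR: "AE z in lebesgue. rep_L2 (c *\<^sub>R x) z = c *\<^sub>R rep_L2 x z"
  using rep_abs_L2[OF sq_integrable_scaleR[OF sq_integrable_rep_L2[of x], of c]]
    scaleR_abs_L2[OF sq_integrable_rep_L2[of x], of c]
  by (simp add: abs_rep_L2)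

lemma rep_L2_zero: "AE z in lebesgue. rep_L2 0 z = 0"
  using rep_abs_L2[OF sq_integrable_zero] by (simp add: zero_L2_def)

lemma measurable_rep_L2 [measurable]: "rep_L2 x \<in> borel_measurable lebesgue"
  using sq_integrable_rep_L2[of x] by (simp add: sq_integrable_def)

text \<open>Multiplying by a strictly positive square integrable weight turns an \<open>L\<^sup>2\<close>-Cauchy sequence
  into an \<open>L\<^sup>1\<close>-Cauchy one, which has an almost everywhere convergent subsequence. Fatou's lemma
  then shows that the pointwise limit is the limit in \<open>L\<^sup>2\<close>.\<close>

lemma L2_Cauchy_convergent:
  fixes X :: "nat \<Rightarrow> ('a::euclidean_space, 'b::euclidean_space) L2"
  assumes X: "Cauchy X"
  shows "convergent X"
proof -
  obtain h :: "'a \<Rightarrow> ennreal" where h: "h \<in> borel_measurable lborel"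
    "(\<integral>\<^sup>+x. h x \<partial>lborel) \<noteq> \<infinity>" "\<And>x. 0 < h x \<and> h x < \<infinity>"
    using sigma_finite_measure.Ex_finite_integrable_function[OF sigma_finite_lborel] by auto
  define w where "w x = min 1 (enn2real (h x))" for x
  have w: "w \<in> borel_measurable lborel" "\<And>x. 0 < w x" "\<And>x. w x \<le> 1"
    using h(1,3) unfolding w_def by (measurable, auto simp: enn2real_positive_iff)
  have "integrable lborel w"
  proof (rule integrableI_nonneg)
    have "(\<integral>\<^sup>+x. ennreal (w x) \<partial>lborel) \<le> (\<integral>\<^sup>+x. h x \<partial>lborel)"
    proof (rule nn_integral_mono)
      fix x
      have "ennreal (w x) \<le> ennreal (enn2real (h x))" by (rule ennreal_leI) (simp add: w_def)
      also have "\<dots> = h x" using h(3)[of x] by simp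
      finally show "ennreal (w x) \<le> h x" .
    qed
    then show "(\<integral>\<^sup>+x. ennreal (w x) \<partial>lborel) < \<infinity>"
      using h(2) by (simp add: less_top[symmetric] top_unique) (metis neq_top_trans)
  qed (use w in \<open>auto simp: less_imp_le\<close>)
  note w = w this
  have wl: "w \<in> borel_measurable lebesgue" "integrable lebesgue w"
    using w by (auto simp: integrable_completion intro: measurable_completion)
  have w2: "integrable lebesgue (\<lambda>x. (w x)\<^sup>2)"
  proof (rule Bochner_Integration.integrable_bound[OF wl(2)])
    have "(w x)\<^sup>2 \<le> w x" for x
      using w(2,3)[of x] by (simp add: power2_eq_square mult_left_le_one_le)
    then show "AE x in lebesgue. norm ((w x)\<^sup>2) \<le> norm (w x)" using w(2) by (auto simp: less_imp_le)
  qed (use wl in measurable)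
  have sqw: "sq_integrable w" using wl w2 by (simp add: sq_integrable_def)
  define W where "W = norm (abs_L2 w :: ('a, real) L2)"
  have L1: "integrable lebesgue (\<lambda>z. w z * norm (rep_L2 x z))"
    and L1b: "(\<integral>z. w z * norm (rep_L2 x z) \<partial>lebesgue) \<le> W * norm x"
    for x :: "('a, 'b) L2"
  proof -
    have s: "sq_integrable (\<lambda>z. norm (rep_L2 x z))"
      using sq_integrable_rep_L2[of x] by (auto simp: sq_integrable_def)
    show "integrable lebesgue (\<lambda>z. w z * norm (rep_L2 x z))"
      using sq_integrable_inner[OF sqw s] by simp
    have "(\<integral>z. w z * norm (rep_L2 x z) \<partial>lebesgue) = abs_L2 w \<bullet> abs_L2 (\<lambda>z. norm (rep_L2 x z))"
      by (simp add: inner_abs_L2[OF sqw s])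
    also have "\<dots> \<le> W * norm (abs_L2 (\<lambda>z. norm (rep_L2 x z)))"
      unfolding W_def by (rule norm_cauchy_schwarz)
    also have "norm (abs_L2 (\<lambda>z. norm (rep_L2 x z))) = norm x"
      by (rule power2_eq_imp_eq) (use norm_abs_L2[OF s] norm_L2_eq[of x] in simp_all)
    finally show "(\<integral>z. w z * norm (rep_L2 x z) \<partial>lebesgue) \<le> W * norm x" .
  qed
  define s where "s n z = w z *\<^sub>R rep_L2 (X n) z" for n z
  have si: "integrable lebesgue (s n)" for n
    using L1[of "X n"] unfolding s_def
    by (subst integrable_norm_iff[symmetric]) (use wl w(2) in \<open>auto simp: abs_of_pos\<close>)
  have sC: "\<exists>N. \<forall>i\<ge>N. \<forall>j\<ge>N. (LINT x|lebesgue. norm (s i x - s j x)) < e" if "e > 0" for e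
  proof -
    have "0 \<le> W" by (simp add: W_def)
    obtain N where N: "\<And>i j. i \<ge> N \<Longrightarrow> j \<ge> N \<Longrightarrow> norm (X i - X j) < e / (W + 1)"
      using CauchyD[OF X, of "e / (W + 1)"] \<open>e > 0\<close> \<open>0 \<le> W\<close> by auto
    have "(LINT x|lebesgue. norm (s i x - s j x)) < e" if "i \<ge> N" "j \<ge> N" for i j
    proof -
      have "(LINT x|lebesgue. norm (s i x - s j x))
          = (LINT x|lebesgue. w x * norm (rep_L2 (X i - X j) x))"
      proof (rule integral_cong_AE)
        show "AE x in lebesgue. norm (s i x - s j x) = w x * norm (rep_L2 (X i - X j) x)"
          using rep_L2_diff[of "X i" "X j"]
          by eventually_elim (use w(2) in \<open>simp add: s_def scaleR_diff_right[symmetric] abs_of_pos\<close>)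
      qed (use si wl in measurable)
      also have "\<dots> \<le> W * norm (X i - X j)" by (rule L1b)
      also have "\<dots> \<le> W * (e / (W + 1))"
        using N[OF that] \<open>0 \<le> W\<close> by (intro mult_left_mono) auto
      also have "\<dots> < e" using \<open>e > 0\<close> \<open>0 \<le> W\<close> by (simp add: field_simps)
      finally show ?thesis .
    qed
    then show ?thesis by blast
  qed
  obtain r where r: "strict_mono r" "AE x in lebesgue. Cauchy (\<lambda>i. s (r i) x)"
    by (rule cauchy_L1_AE_cauchy_subseq[OF si sC])
  define g where "g z = lim (\<lambda>i. rep_L2 (X (r i)) z)" for z
  have lim: "AE z in lebesgue. (\<lambda>i. rep_L2 (X (r i)) z) \<longlonglongrightarrow> g z"
    using r(2)
  proof eventually_elim
    case (elim z)
    then obtain l where "(\<lambda>i. s (r i) z) \<longlonglongrightarrow> l"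
      using Cauchy_convergent convergent_def by blast
    then have "(\<lambda>i. inverse (w z) *\<^sub>R s (r i) z) \<longlonglongrightarrow> inverse (w z) *\<^sub>R l"
      by (intro tendsto_intros)
    then have "(\<lambda>i. rep_L2 (X (r i)) z) \<longlonglongrightarrow> inverse (w z) *\<^sub>R l"
      using w(2)[of z] by (simp add: s_def)
    then show ?case unfolding g_def by (metis limI)
  qed
  have gm [measurable]: "g \<in> borel_measurable lebesgue"
    unfolding g_def by measurable
  have fatou: "integrable lebesgue (\<lambda>z. (norm (rep_L2 (X n) z - g z))\<^sup>2) \<and>
      (\<integral>z. (norm (rep_L2 (X n) z - g z))\<^sup>2 \<partial>lebesgue) \<le> e\<^sup>2"
    if e: "e \<ge> 0" and n: "\<And>m. m \<ge> n \<Longrightarrow> norm (X n - X m) \<le> e" for e n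
  proof -
    let ?h = "\<lambda>m z. (norm (rep_L2 (X n) z - rep_L2 (X (r m)) z))\<^sup>2"
    have hint: "integrable lebesgue (?h m)" for m
      using sq_integrable_diff[OF sq_integrable_rep_L2 sq_integrable_rep_L2]
      by (auto simp: sq_integrable_def)
    have hb: "(\<integral>z. ?h m z \<partial>lebesgue) \<le> e\<^sup>2" if "m \<ge> n" for m
    proof -
      have "(\<integral>z. ?h m z \<partial>lebesgue) = (norm (X n - X (r m)))\<^sup>2"
        using norm_abs_L2[OF sq_integrable_diff[OF sq_integrable_rep_L2[of "X n"] sq_integrable_rep_L2[of "X (r m)"]]]
        by (simp add: diff_abs_L2[symmetric] sq_integrable_rep_L2 abs_rep_L2)
      also have "\<dots> \<le> e\<^sup>2"
        using n[of "r m"] that seq_suble[OF r(1), of m] by (intro power_mono) auto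
      finally show ?thesis .
    qed
    have "(\<integral>\<^sup>+z. ennreal ((norm (rep_L2 (X n) z - g z))\<^sup>2) \<partial>lebesgue)
        = (\<integral>\<^sup>+z. liminf (\<lambda>m. ennreal (?h m z)) \<partial>lebesgue)"
    proof (rule nn_integral_cong_AE)
      show "AE z in lebesgue. ennreal ((norm (rep_L2 (X n) z - g z))\<^sup>2) = liminf (\<lambda>m. ennreal (?h m z))"
        using lim
      proof eventually_elim
        case (elim z)
        have "(\<lambda>m. ennreal (?h m z)) \<longlonglongrightarrow> ennreal ((norm (rep_L2 (X n) z - g z))\<^sup>2)"
          by (intro tendsto_ennrealI tendsto_intros elim)
        from lim_imp_Liminf[OF _ this] show ?case by simp
      qed
    qed
    also have "\<dots> \<le> liminf (\<lambda>m. \<integral>\<^sup>+z. ennreal (?h m z) \<partial>lebesgue)"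
      by (rule nn_integral_liminf) measurable
    also have "\<dots> = liminf (\<lambda>m. ennreal (\<integral>z. ?h m z \<partial>lebesgue))"
      by (subst nn_integral_eq_integral[OF hint]) auto
    also have "\<dots> \<le> liminf (\<lambda>m::nat. ennreal (e\<^sup>2))"
      by (rule Liminf_mono) (use hb in \<open>auto simp: eventually_sequentially intro!: ennreal_leI\<close>)
    finally have *: "(\<integral>\<^sup>+z. ennreal ((norm (rep_L2 (X n) z - g z))\<^sup>2) \<partial>lebesgue) \<le> ennreal (e\<^sup>2)"
      by (simp add: Liminf_const)
    have int: "integrable lebesgue (\<lambda>z. (norm (rep_L2 (X n) z - g z))\<^sup>2)"
      by (rule integrableI_nonneg) (use * in \<open>auto simp: less_top[symmetric] top_unique\<close>)
    with * show ?thesis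
      by (simp add: nn_integral_eq_integral)
  qed
  have fatou': "\<exists>N. \<forall>n\<ge>N. integrable lebesgue (\<lambda>z. (norm (rep_L2 (X n) z - g z))\<^sup>2) \<and>
      (\<integral>z. (norm (rep_L2 (X n) z - g z))\<^sup>2 \<partial>lebesgue) \<le> e\<^sup>2" if "e > 0" for e
  proof -
    obtain N where "\<And>i j. i \<ge> N \<Longrightarrow> j \<ge> N \<Longrightarrow> norm (X i - X j) < e"
      using CauchyD[OF X \<open>e > 0\<close>] by auto
    then have "\<And>n m. n \<ge> N \<Longrightarrow> m \<ge> n \<Longrightarrow> norm (X n - X m) \<le> e"
      by (meson le_trans less_imp_le)
    then show ?thesis using fatou[of e] \<open>e > 0\<close> by (meson less_imp_le)
  qed
  obtain N where "integrable lebesgue (\<lambda>z. (norm (rep_L2 (X N) z - g z))\<^sup>2)"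
    using fatou'[of 1] by auto
  then have "sq_integrable (\<lambda>z. rep_L2 (X N) z - g z)"
    by (simp add: sq_integrable_def)
  from sq_integrable_diff[OF sq_integrable_rep_L2[of "X N"] this]
  have sg: "sq_integrable g" by simp
  have "X \<longlonglongrightarrow> abs_L2 g"
  proof (rule LIMSEQ_I)
    fix e :: real assume "e > 0"
    obtain N where N: "\<And>n. n \<ge> N \<Longrightarrow> (\<integral>z. (norm (rep_L2 (X n) z - g z))\<^sup>2 \<partial>lebesgue) \<le> (e/2)\<^sup>2"
      using fatou'[of "e/2"] \<open>e > 0\<close> by auto
    have "norm (X n - abs_L2 g) < e" if "n \<ge> N" for n
    proof -
      have "(norm (X n - abs_L2 g))\<^sup>2 = (\<integral>z. (norm (rep_L2 (X n) z - g z))\<^sup>2 \<partial>lebesgue)"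
        using norm_abs_L2[OF sq_integrable_diff[OF sq_integrable_rep_L2[of "X n"] sg]]
        by (simp add: diff_abs_L2[symmetric] sq_integrable_rep_L2 abs_rep_L2 sg)
      also have "\<dots> \<le> (e/2)\<^sup>2" by (rule N[OF that])
      finally have "(norm (X n - abs_L2 g))\<^sup>2 \<le> (e/2)\<^sup>2" .
      then have "norm (X n - abs_L2 g) \<le> e / 2"
        by (rule power2_le_imp_le) (use \<open>e > 0\<close> in simp)
      then show ?thesis using \<open>e > 0\<close> by simp
    qed
    then show "\<exists>no. \<forall>n\<ge>no. norm (X n - abs_L2 g) < e" by blast
  qed
  then show ?thesis by (auto simp: convergent_def)
qed

instance L2 :: (euclidean_space, euclidean_space) complete_space
  by standard (rule L2_Cauchy_convergent)

section \<open>Minimisation of strongly convex functionals\<close>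

text \<open>Comparison with the point where the segment from \<open>0\<close> to \<open>w\<close> leaves a small ball bounds \<open>f w\<close>
  from below. By convexity at midpoints minimising sequences are Cauchy, hence
  convergent. Comparing the minimiser with nearby points of the segment towards
  \<open>w\<close> gives the quadratic growth.\<close>

lemma strongly_convex_minimum:
  fixes f :: "'a::{real_normed_vector, complete_space} \<Rightarrow> real"
  assumes S: "subspace S" "closed S" and cont: "continuous_on S f" and c: "c > 0"
    and sc: "\<And>x y t. x \<in> S \<Longrightarrow> y \<in> S \<Longrightarrow> 0 \<le> t \<Longrightarrow> t \<le> 1 \<Longrightarrow>
      f ((1 - t) *\<^sub>R x + t *\<^sub>R y) \<le> (1 - t) * f x + t * f y - c / 2 * (t * (1 - t)) * (norm (x - y))\<^sup>2"
  obtains v where "v \<in> S" "\<And>w. w \<in> S \<Longrightarrow> f v + c / 2 * (norm (w - v))\<^sup>2 \<le> f w"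
proof -
  have 0: "0 \<in> S" using S subspace_0 by blast
  obtain d where d: "d > 0" "\<And>x. x \<in> S \<Longrightarrow> norm x < d \<Longrightarrow> \<bar>f x - f 0\<bar> < 1"
    using cont 0 unfolding continuous_on_iff
    by (metis dist_0_norm dist_real_def dist_commute zero_less_one)
  define \<delta> where "\<delta> = d / 2"
  have \<delta>: "\<delta> > 0" "\<And>x. x \<in> S \<Longrightarrow> norm x \<le> \<delta> \<Longrightarrow> f 0 - 1 \<le> f x"
    using d by (force simp: \<delta>_def)+
  define B where "B = 1 / \<delta> + c * \<delta> / 2"
  have B: "B > 0" using c \<delta> by (simp add: B_def add_pos_pos)
  have below: "f 0 - B\<^sup>2 / (2 * c) - 1 \<le> f w" if w: "w \<in> S" for w
  proof (cases "norm w \<le> \<delta>")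
    case True
    have "B\<^sup>2 / (2 * c) \<ge> 0" using c by simp
    then show ?thesis using \<delta>(2)[OF w True] by linarith
  next
    case False
    define n where "n = norm w"
    define t where "t = \<delta> / n"
    have n: "n > \<delta>" using False by (simp add: n_def)
    then have t: "0 < t" "t \<le> 1" using \<delta> by (auto simp: t_def)
    have "norm (t *\<^sub>R w) \<le> \<delta>" using \<delta> n by (simp add: t_def n_def[symmetric])
    then have "f 0 - 1 \<le> f ((1 - t) *\<^sub>R 0 + t *\<^sub>R w)"
      using \<delta>(2)[of "t *\<^sub>R w"] S(1) w by (simp add: subspace_scale)
    also have "\<dots> \<le> (1 - t) * f 0 + t * f w - c / 2 * (t * (1 - t)) * n\<^sup>2"
      using sc[OF 0 w, of t] t by (simp add: n_def)
    finally have "t * (f 0 - 1 / t + c / 2 * (1 - t) * n\<^sup>2) \<le> t * f w"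
      using t(1) by (simp add: algebra_simps)
    then have *: "f 0 - 1 / t + c / 2 * (1 - t) * n\<^sup>2 \<le> f w" using t(1) by simp
    have "0 < n" using n \<delta> by simp
    then have "- (1 / t) + c / 2 * (1 - t) * n\<^sup>2 = c / 2 * n\<^sup>2 - B * n"
      using \<delta>(1) by (simp add: t_def B_def field_simps power2_eq_square)
    also have "c / 2 * n\<^sup>2 - B * n + B\<^sup>2 / (2 * c) = (c * n - B)\<^sup>2 / (2 * c)"
      using c by (simp add: field_simps power2_eq_square)
    then have "c / 2 * n\<^sup>2 - B * n \<ge> - (B\<^sup>2 / (2 * c))"
      using c by (smt (verit) divide_nonneg_pos zero_le_power2)
    finally show ?thesis using * by linarith
  qed
  define m where "m = Inf (f ` S)"
  have bdd: "bdd_below (f ` S)" using below by (intro bdd_belowI2)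
  have m: "m \<le> f w" if "w \<in> S" for w
    unfolding m_def using bdd that by (intro cInf_lower) auto
  have "\<exists>x\<in>S. f x < m + 1 / (Suc n)" for n
  proof -
    have "Inf (f ` S) < m + 1 / Suc n" by (simp add: m_def)
    then have "\<exists>a \<in> f ` S. a < m + 1 / Suc n" by (intro cInf_lessD) (use 0 in blast)+
    then show ?thesis by simp
  qed
  then obtain x where x: "\<And>n. x n \<in> S" "\<And>n. f (x n) < m + 1 / (Suc n)" by metis
  have mid: "(norm (a - b))\<^sup>2 \<le> 4 / c * ((f a - m) + (f b - m))" if "a \<in> S" "b \<in> S" for a b
  proof -
    have "m \<le> f ((1 - 1/2) *\<^sub>R a + (1/2) *\<^sub>R b)"
      using that S(1) by (intro m subspace_add subspace_scale) auto
    also have "\<dots> \<le> (1 - 1/2) * f a + 1/2 * f b - c / 2 * (1/2 * (1 - 1/2)) * (norm (a - b))\<^sup>2"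
      using that by (intro sc) auto
    finally show ?thesis using c by (simp add: field_simps)
  qed
  have "Cauchy x"
  proof (rule metric_CauchyI)
    fix e :: real assume e: "e > 0"
    obtain N where N: "1 / Suc N < c * e\<^sup>2 / 8"
      using reals_Archimedean[of "c * e\<^sup>2 / 8"] c e by (auto simp: inverse_eq_divide)
    have small: "f (x i) - m < c * e\<^sup>2 / 8" if "i \<ge> N" for i
    proof -
      have "1 / Suc i \<le> 1 / Suc N" using that by (intro divide_left_mono) auto
      with x(2)[of i] N show ?thesis by linarith
    qed
    have "dist (x i) (x j) < e" if "i \<ge> N" "j \<ge> N" for i j
    proof -
      have "(norm (x i - x j))\<^sup>2 \<le> 4 / c * ((f (x i) - m) + (f (x j) - m))"
        by (rule mid[OF x(1) x(1)])
      also have "\<dots> < 4 / c * (c * e\<^sup>2 / 8 + c * e\<^sup>2 / 8)"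
        using c add_strict_mono[OF small[OF that(1)] small[OF that(2)]]
        by (intro mult_strict_left_mono) auto
      also have "\<dots> = e\<^sup>2" using c by simp
      finally have "(norm (x i - x j))\<^sup>2 < e\<^sup>2" .
      then show ?thesis using e by (simp add: dist_norm power2_less_imp_less)
    qed
    then show "\<exists>M. \<forall>m\<ge>M. \<forall>n\<ge>M. dist (x m) (x n) < e" by blast
  qed
  then obtain v where v: "x \<longlonglongrightarrow> v" using Cauchy_convergent convergent_def by blast
  have vS: "v \<in> S" using closed_sequentially[OF S(2)] x(1) v by blast
  have "(\<lambda>n. f (x n)) \<longlonglongrightarrow> f v"
    using continuous_on_tendsto_compose[OF cont v vS] x(1) by simp
  moreover have "(\<lambda>n. m + 1 / (Suc n)) \<longlonglongrightarrow> m + 0"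
    using LIMSEQ_inverse_real_of_nat by (intro tendsto_add tendsto_const) (simp add: inverse_eq_divide)
  ultimately have "f v \<le> m + 0" by (rule LIMSEQ_le) (use x(2) in \<open>auto intro: less_imp_le\<close>)
  with m[OF vS] have fv: "f v = m" by simp
  have "f v + c / 2 * (norm (w - v))\<^sup>2 \<le> f w" if w: "w \<in> S" for w
  proof -
    have "c / 2 * (norm (w - v))\<^sup>2 \<le> f w - f v"
    proof (rule field_le_mult_one_interval)
      fix z :: real assume z: "0 < z" "z < 1"
      have "f v \<le> f ((1 - (1 - z)) *\<^sub>R v + (1 - z) *\<^sub>R w)"
        unfolding fv using vS w S(1) by (intro m subspace_add subspace_scale) auto
      also have "\<dots> \<le> z * f v + (1 - z) * f w - c / 2 * ((1 - z) * z) * (norm (w - v))\<^sup>2"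
        using sc[OF vS w, of "1 - z"] z by (simp add: norm_minus_commute)
      finally have "(1 - z) * (z * (c / 2 * (norm (w - v))\<^sup>2)) \<le> (1 - z) * (f w - f v)"
        by (simp add: algebra_simps)
      then show "z * (c / 2 * (norm (w - v))\<^sup>2) \<le> f w - f v" using z by simp
    qed
    then show ?thesis by simp
  qed
  with vS that show ?thesis by blast
qed

section \<open>Linear minorants of convex functions\<close>

text \<open>Zorn's lemma on the graphs of the partial linear minorants. A graph is a linear subspace of
  \<open>X \<times> \<real>\<close> below \<open>P\<close>; it is automatically single-valued because a line \<open>{0} \<times> \<real>\<close> does not lie
  below \<open>P\<close>. Convexity leaves room for a value at any new point.\<close>

lemma convex_linear_minorant:
  fixes P :: "'a::real_vector \<Rightarrow> real"
  assumes X: "subspace X" and Y: "subspace Y" and YX: "Y \<subseteq> X"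
    and conv: "\<And>x y t. x \<in> X \<Longrightarrow> y \<in> X \<Longrightarrow> 0 \<le> t \<Longrightarrow> t \<le> 1 \<Longrightarrow>
      P ((1 - t) *\<^sub>R x + t *\<^sub>R y) \<le> (1 - t) * P x + t * P y"
    and pos: "\<And>y. y \<in> Y \<Longrightarrow> 0 \<le> P y"
  obtains \<xi> where "\<And>x y. x \<in> X \<Longrightarrow> y \<in> X \<Longrightarrow> \<xi> (x + y) = \<xi> x + \<xi> y"
    "\<And>c x. x \<in> X \<Longrightarrow> \<xi> (c *\<^sub>R x) = c * \<xi> x"
    "\<And>y. y \<in> Y \<Longrightarrow> \<xi> y = 0" "\<And>x. x \<in> X \<Longrightarrow> \<xi> x \<le> P x"
proof -
  define \<G> where "\<G> = {G :: ('a \<times> real) set. subspace G \<and> Y \<times> {0} \<subseteq> G \<and> fst ` G \<subseteq> X \<and>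
    (\<forall>(x, a) \<in> G. a \<le> P x)}"
  have "Y \<times> {0} \<in> \<G>"
    using Y YX pos by (auto simp: \<G>_def subspace_def zero_prod_def)
  moreover have "\<Union>C \<in> \<G>" if C: "C \<noteq> {}" "subset.chain \<G> C" for C
  proof -
    have CG: "C \<subseteq> \<G>" and tot: "\<And>A B. A \<in> C \<Longrightarrow> B \<in> C \<Longrightarrow> A \<subseteq> B \<or> B \<subseteq> A"
      using C(2) by (auto simp: subset_chain_def)
    have sub: "\<And>A. A \<in> C \<Longrightarrow> subspace A" using CG by (auto simp: \<G>_def)
    have "subspace (\<Union>C)"
    proof (rule subspaceI)
      show "0 \<in> \<Union>C" using C(1) sub subspace_0 by blast
    next
      fix x y assume "x \<in> \<Union>C" "y \<in> \<Union>C"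
      then obtain A B where AB: "A \<in> C" "B \<in> C" "x \<in> A" "y \<in> B" by blast
      then have "x + y \<in> A \<or> x + y \<in> B" using tot[OF AB(1,2)] sub subspace_add by blast
      then show "x + y \<in> \<Union>C" using AB by blast
    next
      fix c :: real and x assume "x \<in> \<Union>C"
      then show "c *\<^sub>R x \<in> \<Union>C" using sub subspace_scale by blast
    qed
    moreover have "Y \<times> {0} \<subseteq> \<Union>C"
    proof -
      obtain A where "A \<in> C" using C(1) by blast
      moreover from this have "Y \<times> {0} \<subseteq> A" using CG by (auto simp: \<G>_def)
      ultimately show ?thesis by blast
    qed
    moreover have "x \<in> X \<and> a \<le> P x" if xa: "(x, a) \<in> \<Union>C" for x a
    proof -
      obtain A where A: "A \<in> C" "(x, a) \<in> A" using xa by blast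
      then have "fst ` A \<subseteq> X" "\<forall>(x, a) \<in> A. a \<le> P x" using CG by (auto simp: \<G>_def)
      then show ?thesis using A(2) by force
    qed
    ultimately show ?thesis unfolding \<G>_def by fastforce
  qed
  ultimately obtain G where G: "G \<in> \<G>" and max: "\<And>H. H \<in> \<G> \<Longrightarrow> G \<subseteq> H \<Longrightarrow> H = G"
    using subset_Zorn_nonempty[of \<G>] by (metis empty_iff)
  have sG: "subspace G" and YG: "Y \<times> {0} \<subseteq> G" and GX: "\<And>x a. (x, a) \<in> G \<Longrightarrow> x \<in> X"
    and GP: "\<And>x a. (x, a) \<in> G \<Longrightarrow> a \<le> P x"
    using G by (auto simp: \<G>_def)
  have G0: "(0, 0) \<in> G" using subspace_0[OF sG] by (simp add: zero_prod_def)
  have Gadd: "\<And>x a y b. (x, a) \<in> G \<Longrightarrow> (y, b) \<in> G \<Longrightarrow> (x + y, a + b) \<in> G"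
    using subspace_add[OF sG] by fastforce
  have Gsc: "\<And>x a c. (x, a) \<in> G \<Longrightarrow> (c *\<^sub>R x, c * a) \<in> G"
    using subspace_scale[OF sG] by fastforce
  have Gzero: "a = 0" if "(0, a) \<in> G" for a
  proof (rule ccontr)
    assume "a \<noteq> 0"
    have "(0, ((\<bar>P 0\<bar> + 1) / a) * a) \<in> G"
      using Gsc[OF that, of "(\<bar>P 0\<bar> + 1) / a"] by simp
    then have "\<bar>P 0\<bar> + 1 \<le> P 0" using GP \<open>a \<noteq> 0\<close> by fastforce
    then show False by simp
  qed
  have uniq: "a = b" if "(x, a) \<in> G" "(x, b) \<in> G" for x a b
    using Gadd[OF that(1) Gsc[OF that(2), of "-1"]] Gzero[of "a - b"] by simp
  have dom: "\<exists>a. (x0, a) \<in> G" if x0: "x0 \<in> X" for x0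
  proof (rule ccontr)
    assume nex: "\<nexists>a. (x0, a) \<in> G"
    define A where "A = {(b - P (y - s *\<^sub>R x0)) / s |y b s. (y, b) \<in> G \<and> s > 0}"
    have key: "(b1 - P (y1 - s *\<^sub>R x0)) / s \<le> (P (y2 + t *\<^sub>R x0) - b2) / t"
      if g1: "(y1, b1) \<in> G" and g2: "(y2, b2) \<in> G" and st: "s > 0" "t > 0" for y1 b1 y2 b2 s t
    proof -
      define \<tau> where "\<tau> = s / (s + t)"
      have \<tau>: "0 \<le> \<tau>" "\<tau> \<le> 1" "1 - \<tau> = t / (s + t)" using st by (auto simp: \<tau>_def field_simps)
      have "(1 - \<tau>) * b1 + \<tau> * b2 \<le> P ((1 - \<tau>) *\<^sub>R y1 + \<tau> *\<^sub>R y2)"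
        by (intro GP Gadd Gsc g1 g2)
      also have "(1 - \<tau>) *\<^sub>R y1 + \<tau> *\<^sub>R y2
          = (1 - \<tau>) *\<^sub>R (y1 - s *\<^sub>R x0) + \<tau> *\<^sub>R (y2 + t *\<^sub>R x0)
            + ((1 - \<tau>) * s - \<tau> * t) *\<^sub>R x0"
        by (simp add: algebra_simps)
      also have "(1 - \<tau>) * s - \<tau> * t = 0" using st by (simp add: \<tau>_def field_simps)
      also have "P ((1 - \<tau>) *\<^sub>R (y1 - s *\<^sub>R x0) + \<tau> *\<^sub>R (y2 + t *\<^sub>R x0) + 0 *\<^sub>R x0)
          \<le> (1 - \<tau>) * P (y1 - s *\<^sub>R x0) + \<tau> * P (y2 + t *\<^sub>R x0)"
        using conv[of "y1 - s *\<^sub>R x0" "y2 + t *\<^sub>R x0" \<tau>] \<tau>(1,2) X GX[OF g1] GX[OF g2] x0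
        by (simp add: subspace_add subspace_diff subspace_scale)
      finally have "(1 - \<tau>) * (b1 - P (y1 - s *\<^sub>R x0)) \<le> \<tau> * (P (y2 + t *\<^sub>R x0) - b2)"
        by (simp add: algebra_simps)
      then have "t / (s + t) * (b1 - P (y1 - s *\<^sub>R x0)) \<le> s / (s + t) * (P (y2 + t *\<^sub>R x0) - b2)"
        unfolding \<tau>(3) by (simp add: \<tau>_def)
      then have "t * (b1 - P (y1 - s *\<^sub>R x0)) \<le> s * (P (y2 + t *\<^sub>R x0) - b2)"
        using st by (simp add: divide_le_cancel)
      then show ?thesis using st by (simp add: field_simps)
    qed
    define \<alpha> where "\<alpha> = Sup A"
    have ub: "\<alpha> \<le> (P (y + t *\<^sub>R x0) - b) / t" if "(y, b) \<in> G" "t > 0" for y b t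
      unfolding \<alpha>_def
    proof (rule cSup_least)
      have "(0 - P (0 - 1 *\<^sub>R x0)) / 1 \<in> A" unfolding A_def using G0 zero_less_one by blast
      then show "A \<noteq> {}" by blast
    qed (use key that in \<open>auto simp: A_def\<close>)
    have lb: "(b - P (y - s *\<^sub>R x0)) / s \<le> \<alpha>" if "(y, b) \<in> G" "s > 0" for y b s
      unfolding \<alpha>_def
    proof (rule cSup_upper)
      show "bdd_above A"
      proof (rule bdd_aboveI)
        fix a assume "a \<in> A"
        then obtain y b s where "(y, b) \<in> G" "s > 0" "a = (b - P (y - s *\<^sub>R x0)) / s"
          unfolding A_def by blast
        then show "a \<le> (P (0 + 1 *\<^sub>R x0) - 0) / 1" using key[OF _ G0 _ zero_less_one] by metis
      qed
    qed (use that in \<open>auto simp: A_def\<close>)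
    define H where "H = span (insert (x0, \<alpha>) G)"
    have "H \<in> \<G>"
    proof -
      have "Y \<times> {0} \<subseteq> H" unfolding H_def
        by (rule order_trans[OF YG order_trans[OF subset_insertI span_superset]])
      moreover have "x \<in> X \<and> a \<le> P x" if xa: "(x, a) \<in> H" for x a
      proof -
        obtain k where "(x, a) - k *\<^sub>R (x0, \<alpha>) \<in> span G"
          using xa unfolding H_def span_insert by blast
        then have g: "(x - k *\<^sub>R x0, a - k * \<alpha>) \<in> G" using span_eq_iff[THEN iffD2, OF sG] by simp
        have "x - k *\<^sub>R x0 + k *\<^sub>R x0 \<in> X" using GX[OF g] x0 X by (meson subspace_add subspace_scale)
        moreover have "a \<le> P x"
        proof (cases "k = 0")
          case True then show ?thesis using GP[OF g] by simp
        next
          case False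
          then consider "k > 0" | "k < 0" by linarith
          then show ?thesis
          proof cases
            case 1 then show ?thesis using ub[OF g 1] by (simp add: field_simps)
          next
            case 2 then show ?thesis using lb[OF g, of "- k"] by (simp add: field_simps)
          qed
        qed
        ultimately show ?thesis by simp
      qed
      ultimately show ?thesis unfolding \<G>_def using subspace_span by (auto simp: H_def)
    qed
    moreover have "G \<subseteq> H" unfolding H_def
      by (rule order_trans[OF subset_insertI span_superset])
    ultimately have "H = G" using max by blast
    moreover have "(x0, \<alpha>) \<in> H" unfolding H_def by (simp add: span_base)
    ultimately show False using nex by blast
  qed
  define \<xi> where "\<xi> x = (THE a. (x, a) \<in> G)" for x
  have \<xi>: "(x, \<xi> x) \<in> G" if "x \<in> X" for x
    unfolding \<xi>_def using dom[OF that] uniq by (metis theI)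
  have \<xi>eq: "\<xi> x = a" if "(x, a) \<in> G" for x a
    using \<xi>[OF GX[OF that]] uniq that by blast
  show ?thesis
  proof (rule that[of \<xi>])
    show "\<xi> (x + y) = \<xi> x + \<xi> y" if "x \<in> X" "y \<in> X" for x y
      using \<xi>eq Gadd \<xi> that by blast
    show "\<xi> (c *\<^sub>R x) = c * \<xi> x" if "x \<in> X" for c x
      using \<xi>eq Gsc \<xi> that by blast
    show "\<xi> y = 0" if "y \<in> Y" for y using \<xi>eq YG that by blast
    show "\<xi> x \<le> P x" if "x \<in> X" for x using GP \<xi> that by blast
  qed
qed

section \<open>Clarke's calculus\<close>

text \<open>The base point in Clarke's derivative may move: difference quotients along any curve \<open>\<gamma>\<close> that
  tends to \<open>x\<close> inside \<open>X\<close> bound it from below.\<close>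

lemma clarke_deriv_ge:
  assumes \<gamma>: "(\<gamma> \<longlongrightarrow> x) (at_right 0)" "\<forall>\<^sub>F t in at_right 0. \<gamma> t \<in> X"
    and le: "\<forall>\<^sub>F t in at_right 0. \<psi> t \<le> (f (\<gamma> t + t *\<^sub>R h) - f (\<gamma> t)) / t"
    and \<psi>: "(\<psi> \<longlongrightarrow> c) (at_right 0)"
  shows "ereal c \<le> clarke_deriv X f x h"
proof -
  let ?F = "inf (nhds x) (principal X) \<times>\<^sub>F at_right (0::real)"
  let ?u = "\<lambda>(x', t). ereal ((f (x' + t *\<^sub>R h) - f x') / t)"
  have lim: "filterlim (\<lambda>t. (\<gamma> t, t)) ?F (at_right 0)"
    using \<gamma> by (intro filterlim_Pair filterlim_ident) (auto simp: filterlim_inf filterlim_principal)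
  show ?thesis
    unfolding clarke_deriv_def
  proof (rule ccontr)
    assume "\<not> ereal c \<le> Limsup ?F ?u"
    then have "Limsup ?F ?u < ereal c" by (simp only: not_le)
    then obtain y where y: "Limsup ?F ?u < ereal y" "ereal y < ereal c"
      using ereal_dense2 by blast
    then have "eventually (\<lambda>p. ?u p < ereal y) ?F"
      using Limsup_le_iff[of ?F ?u "Limsup ?F ?u"] by blast
    then have "\<forall>\<^sub>F t in at_right 0. ?u (\<gamma> t, t) < ereal y"
      using lim by (auto simp: filterlim_iff)
    moreover have "\<forall>\<^sub>F t in at_right 0. y < \<psi> t"
      using order_tendstoD(1)[OF \<psi>] y(2) by simp
    ultimately have "\<forall>\<^sub>F t in at_right (0::real). False"
      using le by eventually_elim auto
    then show False by (simp add: trivial_limit_at_right_real)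
  qed
qed

text \<open>Fermat's rule. At a minimum the quotients start at \<open>x\<close>; at a maximum they have to end at \<open>x\<close>, so
  the base point is \<open>x - t h\<close>.\<close>

lemma clarke_subdiff_real_extremum:
  assumes q: "(q has_real_derivative D) (at x)" and e: "e > 0"
    and ext: "(\<forall>y. \<bar>y - x\<bar> < e \<longrightarrow> f x - q x \<le> f y - q y) \<or>
              (\<forall>y. \<bar>y - x\<bar> < e \<longrightarrow> f y - q y \<le> f x - q x)"
  shows "D \<in> clarke_subdiff_real f x"
proof -
  have "(\<lambda>h. D * h) \<in> dual UNIV"
    by (auto simp: dual_def algebra_simps abs_mult intro!: exI[of _ "\<bar>D\<bar>"])
  moreover have "ereal (D * h) \<le> clarke_deriv UNIV f x h" for h
    using ext
  proof
    assume min: "\<forall>y. \<bar>y - x\<bar> < e \<longrightarrow> f x - q x \<le> f y - q y"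
    have "((\<lambda>t. q (x + t * h)) has_real_derivative D * h) (at 0)"
      by (rule DERIV_chain'[where g = q]) (auto intro!: derivative_eq_intros q)
    then have "((\<lambda>t. (q (x + t * h) - q x) / t) \<longlongrightarrow> D * h) (at 0)"
      by (simp add: has_field_derivative_iff)
    then have lim: "((\<lambda>t. (q (x + t * h) - q x) / t) \<longlongrightarrow> D * h) (at_right 0)"
      by (rule filterlim_mono) (auto simp: at_within_le_nhds intro: at_le)
    have "((\<lambda>t. \<bar>(x + t * h) - x\<bar>) \<longlongrightarrow> \<bar>(x + 0 * h) - x\<bar>) (at_right 0)"
      by (intro tendsto_intros)
    then have small: "\<forall>\<^sub>F t in at_right 0. \<bar>(x + t * h) - x\<bar> < e"
      using e by (intro order_tendstoD(2)) auto
    show ?thesis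
    proof (rule clarke_deriv_ge[where \<gamma> = "\<lambda>_. x", OF _ _ _ lim])
      show "\<forall>\<^sub>F t in at_right 0. (q (x + t * h) - q x) / t \<le> (f (x + t *\<^sub>R h) - f x) / t"
        using small eventually_at_right_less[of 0]
      proof eventually_elim
        case (elim t)
        then have "q (x + t * h) - q x \<le> f (x + t * h) - f x" using min by (smt (verit))
        then show ?case using elim by (simp add: divide_right_mono)
      qed
    qed auto
  next
    assume max: "\<forall>y. \<bar>y - x\<bar> < e \<longrightarrow> f y - q y \<le> f x - q x"
    have "((\<lambda>t. q (x - t * h)) has_real_derivative D * (- h)) (at 0)"
      by (rule DERIV_chain'[where g = q]) (auto intro!: derivative_eq_intros q)
    then have "((\<lambda>t. - ((q (x - t * h) - q x) / t)) \<longlongrightarrow> - (D * (- h))) (at 0)"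
      by (intro tendsto_minus) (simp add: has_field_derivative_iff)
    then have "((\<lambda>t. (q x - q (x - t * h)) / t) \<longlongrightarrow> D * h) (at 0)"
      by (simp add: minus_divide_left)
    then have lim: "((\<lambda>t. (q x - q (x - t * h)) / t) \<longlongrightarrow> D * h) (at_right 0)"
      by (rule filterlim_mono) (auto simp: at_within_le_nhds intro: at_le)
    have "((\<lambda>t. \<bar>(x - t * h) - x\<bar>) \<longlongrightarrow> \<bar>(x - 0 * h) - x\<bar>) (at_right 0)"
      by (intro tendsto_intros)
    then have small: "\<forall>\<^sub>F t in at_right 0. \<bar>(x - t * h) - x\<bar> < e"
      using e by (intro order_tendstoD(2)) auto
    have "((\<lambda>t. x - t * h) \<longlongrightarrow> x - 0 * h) (at_right 0)"
      by (intro tendsto_intros)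
    then have \<gamma>: "((\<lambda>t. x - t * h) \<longlongrightarrow> x) (at_right 0)" by simp
    show ?thesis
    proof (rule clarke_deriv_ge[where \<gamma> = "\<lambda>t. x - t * h", OF \<gamma> _ _ lim])
      show "\<forall>\<^sub>F t in at_right 0. (q x - q (x - t * h)) / t
          \<le> (f (x - t * h + t *\<^sub>R h) - f (x - t * h)) / t"
        using small eventually_at_right_less[of 0]
      proof eventually_elim
        case (elim t)
        then have "q x - q (x - t * h) \<le> f x - f (x - t * h)" using max by (smt (verit))
        then show ?case using elim by (simp add: divide_right_mono)
      qed
    qed auto
  qed
  ultimately show ?thesis by (simp add: clarke_subdiff_real_def clarke_subdiff_def)
qed

text \<open>Rolle's argument: \<open>f - q\<close> has an extremum inside the interval. Besides linear \<open>q\<close>, which gives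
  Lebourg's theorem, quadratic \<open>q\<close> will be used.\<close>

lemma clarke_mean_value:
  assumes ab: "a < b" and f: "continuous_on {a..b} f"
    and q: "\<And>x. (q has_real_derivative q' x) (at x)"
    and eq: "f a - q a = f b - q b"
  shows "\<exists>x. a < x \<and> x < b \<and> q' x \<in> clarke_subdiff_real f x"
proof -
  let ?g = "\<lambda>x. f x - q x"
  have "continuous_on {a..b} q"
    by (rule DERIV_continuous_on) (rule has_field_derivative_at_within[OF q])
  then have g: "continuous_on {a..b} ?g" by (intro continuous_on_diff f)
  obtain u where u: "u \<in> {a..b}" "\<And>y. y \<in> {a..b} \<Longrightarrow> ?g u \<le> ?g y"
    using continuous_attains_inf[OF _ _ g] ab by force
  obtain v where v: "v \<in> {a..b}" "\<And>y. y \<in> {a..b} \<Longrightarrow> ?g y \<le> ?g v"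
    using continuous_attains_sup[OF _ _ g] ab by force
  have near: "\<exists>e>0. \<forall>y. \<bar>y - x\<bar> < e \<longrightarrow> y \<in> {a..b}" if "a < x" "x < b" for x
    using that by (intro exI[of _ "min (x - a) (b - x)"]) auto
  show ?thesis
  proof (cases "a < u \<and> u < b")
    case True
    then obtain e where "e > 0" "\<And>y. \<bar>y - u\<bar> < e \<Longrightarrow> y \<in> {a..b}" using near by blast
    then show ?thesis using True u(2) clarke_subdiff_real_extremum[OF q, of e u f] by blast
  next
    case False
    then have gu: "?g u = ?g a" using u(1) eq by (auto simp: not_less)
    show ?thesis
    proof (cases "a < v \<and> v < b")
      case True
      then obtain e where "e > 0" "\<And>y. \<bar>y - v\<bar> < e \<Longrightarrow> y \<in> {a..b}" using near by blast
      then show ?thesis using True v(2) clarke_subdiff_real_extremum[OF q, of e v f] by blast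
    next
      case False
      then have gv: "?g v = ?g a" using v(1) eq by (auto simp: not_less)
      have const: "?g y = ?g a" if "y \<in> {a..b}" for y using u(2) v(2) that gu gv by force
      define m where "m = (a + b) / 2"
      have m: "a < m" "m < b" using ab by (auto simp: m_def)
      then obtain e where e: "e > 0" "\<And>y. \<bar>y - m\<bar> < e \<Longrightarrow> y \<in> {a..b}" using near by blast
      have "f m - q m \<le> f y - q y" if "\<bar>y - m\<bar> < e" for y
        unfolding const[OF e(2)[OF that]] using const[of m] m by simp
      then have "q' m \<in> clarke_subdiff_real f m"
        using clarke_subdiff_real_extremum[OF q e(1)] by blast
      then show ?thesis using m by blast
    qed
  qed
qed

text \<open>Concavity of \<open>\<lambda>x. f x - l / 2 * x\<^sup>2\<close>, with the quadratic terms collected.\<close>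

definition semiconcave :: "real \<Rightarrow> (real \<Rightarrow> real) \<Rightarrow> bool" where
  "semiconcave l f \<longleftrightarrow> (\<forall>a b t. 0 \<le> t \<longrightarrow> t \<le> 1 \<longrightarrow>
     (1 - t) * f a + t * f b - l / 2 * (t * (1 - t)) * (a - b)\<^sup>2 \<le> f ((1 - t) * a + t * b))"

lemma semiconcaveD:
  "semiconcave l f \<Longrightarrow> 0 \<le> t \<Longrightarrow> t \<le> 1 \<Longrightarrow>
     (1 - t) * f a + t * f b - l / 2 * (t * (1 - t)) * (a - b)\<^sup>2 \<le> f ((1 - t) * a + t * b)"
  by (auto simp: semiconcave_def)

text \<open>Otherwise the chords of \<open>\<lambda>x. f x - l / 2 * x\<^sup>2\<close> over two adjacent intervals have increasing slopes
  \<open>s1 < s2\<close>. The mean value theorem turns them into subgradients \<open>l * x1 + s1\<close> and \<open>l * x2 + s2\<close> of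
  \<open>f\<close>, whose difference quotient exceeds \<open>l\<close>.\<close>

lemma semiconcave_clarke:
  assumes f: "continuous_on UNIV f"
    and mono: "\<And>x1 x2 v1 v2. x1 \<noteq> x2 \<Longrightarrow> v1 \<in> clarke_subdiff_real f x1 \<Longrightarrow>
      v2 \<in> clarke_subdiff_real f x2 \<Longrightarrow> (v1 - v2) / (x1 - x2) \<le> l"
  shows "semiconcave l f"
proof -
  have main: "(1 - t) * f a + t * f b - l / 2 * (t * (1 - t)) * (a - b)\<^sup>2 \<le> f ((1 - t) * a + t * b)"
    if ab: "a < b" and t: "0 < t" "t < 1" for a b t
  proof (rule ccontr)
    define c where "c = (1 - t) * a + t * b"
    define g where "g x = f x - l / 2 * x\<^sup>2" for x
    assume "\<not> ?thesis"
    then have lt: "f c < (1 - t) * f a + t * f b - l / 2 * (t * (1 - t) * (a - b)\<^sup>2)"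
      by (simp add: c_def not_le mult.assoc)
    have id: "(1 - t) * a\<^sup>2 + t * b\<^sup>2 - c\<^sup>2 = t * (1 - t) * (a - b)\<^sup>2"
      by (simp add: c_def power2_eq_square algebra_simps)
    have "(1 - t) * g a + t * g b - g c
        = (1 - t) * f a + t * f b - f c - l / 2 * ((1 - t) * a\<^sup>2 + t * b\<^sup>2 - c\<^sup>2)"
      by (simp add: g_def field_simps)
    then have "g c < (1 - t) * g a + t * g b" using lt unfolding id by linarith
    then have *: "(1 - t) * (g c - g a) < t * (g b - g c)" by (simp add: algebra_simps)
    have ca: "c - a = t * (b - a)" and bc: "b - c = (1 - t) * (b - a)"
      by (auto simp: c_def algebra_simps)
    have c: "a < c" "c < b" using ca bc ab t by (metis diff_gt_0_iff_gt mult_pos_pos)+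
    define s1 where "s1 = (g c - g a) / (c - a)"
    define s2 where "s2 = (g b - g c) / (b - c)"
    have "s1 < s2"
      unfolding s1_def s2_def ca bc using * ab t
      by (simp add: divide_less_eq less_divide_eq mult.commute mult.left_commute)
    have *: "\<exists>x. y < x \<and> x < y' \<and> l * x + s \<in> clarke_subdiff_real f x"
      if "y < y'" and s: "s = (g y' - g y) / (y' - y)" for y y' s
    proof (rule clarke_mean_value[where q = "\<lambda>x. l / 2 * x\<^sup>2 + s * x"])
      show "((\<lambda>x. l / 2 * x\<^sup>2 + s * x) has_real_derivative l * x + s) (at x)" for x
        by (auto intro!: derivative_eq_intros)
      have "s * (y' - y) = g y' - g y" using that by simp
      then show "f y - (l / 2 * y\<^sup>2 + s * y) = f y' - (l / 2 * y'\<^sup>2 + s * y')"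
        by (simp add: g_def algebra_simps)
    qed (use that continuous_on_subset[OF f] in auto)
    obtain x1 where x1: "a < x1" "x1 < c" "l * x1 + s1 \<in> clarke_subdiff_real f x1"
      using *[OF c(1) s1_def] by blast
    obtain x2 where x2: "c < x2" "x2 < b" "l * x2 + s2 \<in> clarke_subdiff_real f x2"
      using *[OF c(2) s2_def] by blast
    have "((l * x2 + s2) - (l * x1 + s1)) / (x2 - x1) \<le> l"
      using x1 x2 by (intro mono) auto
    then have "(l * x2 + s2) - (l * x1 + s1) \<le> l * (x2 - x1)"
      using x1 x2 by (simp add: divide_le_eq)
    with \<open>s1 < s2\<close> show False by (simp add: algebra_simps)
  qed
  show ?thesis unfolding semiconcave_def
  proof (intro allI impI)
    fix a b t :: real assume t: "0 \<le> t" "t \<le> 1"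
    consider "t = 0" | "t = 1" | "a = b" | "0 < t" "t < 1" "a < b" | "0 < t" "t < 1" "b < a"
      using t by linarith
    then show "(1 - t) * f a + t * f b - l / 2 * (t * (1 - t)) * (a - b)\<^sup>2 \<le> f ((1 - t) * a + t * b)"
    proof cases
      case 4 then show ?thesis by (intro main)
    next
      case 5 then show ?thesis
        using main[of b a "1 - t"] by (simp add: power2_commute algebra_simps)
    qed (auto simp: algebra_simps)
  qed
qed

text \<open>A concave function of quadratic growth has slopes of linear growth: compare the slope
  between \<open>a\<close> and \<open>b\<close> with the slope between \<open>b\<close> and a point at distance \<open>1 + \<bar>a\<bar> + \<bar>b\<bar>\<close> beyond.\<close>

lemma semiconcave_lipschitz:
  assumes f: "semiconcave l f" and l: "\<bar>l\<bar> \<le> L" and K: "\<And>x. \<bar>f x\<bar> \<le> K * (1 + x\<^sup>2)"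
  shows "\<bar>f a - f b\<bar> \<le> (7 * K + L) * (1 + \<bar>a\<bar> + \<bar>b\<bar>) * \<bar>a - b\<bar>"
proof -
  have K0: "0 \<le> K" using K[of 0] by simp
  have half: "f a - f b \<le> (7 * K + L) * (1 + \<bar>a\<bar> + \<bar>b\<bar>) * \<bar>a - b\<bar>" if ab: "a \<noteq> b" for a b
  proof -
    define R where "R = 1 + \<bar>a\<bar> + \<bar>b\<bar>"
    define D where "D = \<bar>b - a\<bar>"
    define e where "e = b + R * sgn (b - a)"
    define t where "t = D / (D + R)"
    have R: "R \<ge> 1" by (simp add: R_def)
    have D: "D > 0" using ab by (simp add: D_def)
    have t: "0 < t" "t < 1" "t \<le> D / R" "1 - t = R / (D + R)"
      using R D by (auto simp: t_def field_simps)
    have ea: "e - a = (D + R) * sgn (b - a)"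
      by (simp add: e_def D_def algebra_simps sgn_if)
    have "t * (e - a) = D * sgn (b - a)" unfolding ea t_def using R D by simp
    also have "\<dots> = b - a" by (simp add: D_def sgn_if)
    finally have b: "(1 - t) * a + t * e = b" by (simp add: algebra_simps)
    have sq: "(a - e)\<^sup>2 = (D + R)\<^sup>2"
      using ea ab by (simp add: power2_commute[of a e] power_mult_distrib sgn_if)
    have "t * (D + R) = D" "(1 - t) * (D + R) = R"
      unfolding t(4) unfolding t_def using R D by simp_all
    moreover have "t * (1 - t) * (a - e)\<^sup>2 = (t * (D + R)) * ((1 - t) * (D + R))"
      unfolding sq by (simp only: power2_eq_square mult.assoc mult.left_commute mult.commute)
    ultimately have "t * (1 - t) * (a - e)\<^sup>2 = D * R" by simp
    then have s: "l / 2 * (t * (1 - t)) * (a - e)\<^sup>2 = l / 2 * (D * R)" by simp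
    have "(1 - t) * f a + t * f e - l / 2 * (D * R) \<le> f b"
      using semiconcaveD[OF f, of t a e] t b s by simp
    then have "f a - f b \<le> t * (f a - f e) + l / 2 * (D * R)" by (simp add: algebra_simps)
    also have "t * (f a - f e) \<le> D / R * (7 * K * R\<^sup>2)"
    proof -
      have "\<bar>R * sgn (b - a)\<bar> \<le> R" using R by (simp add: sgn_if)
      moreover have "\<bar>b\<bar> \<le> R" by (simp add: R_def)
      ultimately have "\<bar>e\<bar> \<le> 2 * R"
        using abs_triangle_ineq[of b "R * sgn (b - a)"] unfolding e_def by linarith
      then have "e\<^sup>2 \<le> (2 * R)\<^sup>2" by (rule power2_le_iff_abs_le[THEN iffD2, rotated]) (use R in simp)
      moreover have "a\<^sup>2 \<le> R\<^sup>2" by (rule power2_le_iff_abs_le[THEN iffD2]) (auto simp: R_def)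
      moreover have "1 \<le> R\<^sup>2" using R by (simp add: power2_eq_square mult_ge1_I)
      ultimately have "2 + a\<^sup>2 + e\<^sup>2 \<le> 7 * R\<^sup>2" unfolding power_mult_distrib by simp
      then have "K * (2 + a\<^sup>2 + e\<^sup>2) \<le> K * (7 * R\<^sup>2)" using K0 by (rule mult_left_mono)
      moreover have "f a - f e \<le> K * (1 + a\<^sup>2) + K * (1 + e\<^sup>2)" using K[of a] K[of e] by linarith
      ultimately have "f a - f e \<le> 7 * K * R\<^sup>2" by (simp add: algebra_simps)
      then have "t * (f a - f e) \<le> t * (7 * K * R\<^sup>2)" using t by (intro mult_left_mono) auto
      also have "\<dots> \<le> D / R * (7 * K * R\<^sup>2)" using t K0 by (intro mult_right_mono) auto
      finally show ?thesis .
    qed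
    also have "D / R * (7 * K * R\<^sup>2) = 7 * K * R * D" using R by (simp add: power2_eq_square)
    also have "l / 2 * (D * R) \<le> L * (D * R)"
      using l R D by (intro mult_right_mono) auto
    finally have "f a - f b \<le> (7 * K + L) * R * D" by (simp add: algebra_simps)
    then show ?thesis by (simp add: R_def D_def abs_minus_commute)
  qed
  show ?thesis
  proof (cases "a = b")
    case False
    then show ?thesis using half[of a b] half[of b a]
      by (simp add: abs_le_iff abs_minus_commute algebra_simps)
  qed simp
qed

text \<open>Between \<open>- M\<close> and \<open>M\<close> the chord through the end points bounds \<open>f\<close> from below. For the upper
  bound, \<open>0\<close> lies between \<open>x\<close> and one of the end points, and \<open>f 0 = 0\<close>.\<close>

lemma semiconcave_quadratic_growth:
  assumes f: "semiconcave l f" and l: "\<bar>l\<bar> \<le> L" and f0: "f 0 = 0"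
    and M: "M > 0" and G: "\<And>x. \<bar>x\<bar> \<ge> M \<Longrightarrow> \<bar>f x\<bar> \<le> G * x\<^sup>2"
  shows "\<bar>f x\<bar> \<le> (G + 2 * G * M\<^sup>2 + 4 * L * M\<^sup>2) * (1 + x\<^sup>2)"
proof -
  have "0 \<le> \<bar>f M\<bar>" by simp
  also have "\<bar>f M\<bar> \<le> G * M\<^sup>2" using G[of M] M by simp
  finally have G0: "0 \<le> G" using M by (simp add: zero_le_mult_iff)
  have L0: "0 \<le> L" using l by linarith
  have nn: "0 \<le> G * M\<^sup>2" "0 \<le> L * M\<^sup>2" "0 \<le> G * x\<^sup>2" "0 \<le> G * M\<^sup>2 * x\<^sup>2" "0 \<le> L * M\<^sup>2 * x\<^sup>2"
    using G0 L0 by auto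
  show ?thesis
  proof (cases "\<bar>x\<bar> \<ge> M")
    case True
    have "(G + 2 * G * M\<^sup>2 + 4 * L * M\<^sup>2) * (1 + x\<^sup>2) = G * x\<^sup>2 +
        (G + 2 * (G * M\<^sup>2) + 4 * (L * M\<^sup>2) + 2 * (G * M\<^sup>2 * x\<^sup>2) + 4 * (L * M\<^sup>2 * x\<^sup>2))"
      by (simp add: algebra_simps)
    then show ?thesis using G[OF True] nn G0 by linarith
  next
    case False
    define t where "t = (x + M) / (2 * M)"
    have t: "0 \<le> t" "t \<le> 1" using False M by (auto simp: t_def field_simps)
    have tx: "(1 - t) * (- M) + t * M = x" using M by (simp add: t_def field_simps)
    have lo: "(1 - t) * f (- M) + t * f M - l / 2 * (t * (1 - t)) * (- M - M)\<^sup>2 \<le> f x"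
      using semiconcaveD[OF f t, of "- M" M] unfolding tx .
    have fM: "\<bar>f (- M)\<bar> \<le> G * M\<^sup>2" "\<bar>f M\<bar> \<le> G * M\<^sup>2" using G[of M] G[of "- M"] M by auto
    have lt: "\<bar>l / 2 * (s * (1 - s)) * y\<^sup>2\<bar> \<le> 2 * (L * M\<^sup>2)"
      if "0 \<le> s" "s \<le> 1" "\<bar>y\<bar> \<le> 2 * M" for s y
    proof -
      have "s * (1 - s) \<le> 1 * 1" using that by (intro mult_mono) auto
      moreover have "y\<^sup>2 \<le> (2 * M)\<^sup>2" using that M by (intro power2_le_iff_abs_le[THEN iffD2]) auto
      ultimately have "(\<bar>l\<bar> / 2 * (s * (1 - s))) * y\<^sup>2 \<le> (L / 2 * 1) * (2 * M)\<^sup>2"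
        using l that L0 by (intro mult_mono) auto
      then show ?thesis using that by (simp add: abs_mult power_mult_distrib)
    qed
    have conv: "\<bar>(1 - t) * f (- M) + t * f M\<bar> \<le> G * M\<^sup>2"
    proof -
      have "\<bar>(1 - t) * f (- M) + t * f M\<bar> \<le> (1 - t) * \<bar>f (- M)\<bar> + t * \<bar>f M\<bar>"
        using t by (metis abs_mult abs_of_nonneg abs_triangle_ineq diff_ge_0_iff_ge)
      also have "\<dots> \<le> (1 - t) * (G * M\<^sup>2) + t * (G * M\<^sup>2)"
        using t fM by (intro add_mono mult_left_mono) auto
      finally show ?thesis by (simp add: algebra_simps)
    qed
    have lower: "- (G * M\<^sup>2 + 2 * L * M\<^sup>2) \<le> f x"
      using lo conv lt[of t "- M - M", OF t] M by (simp only: abs_le_iff) linarith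
    have upper: "f x \<le> 2 * (G * M\<^sup>2 + 2 * L * M\<^sup>2)"
    proof -
      define y where "y = (if x \<ge> 0 then - M else M)"
      define s where "s = \<bar>x\<bar> / (\<bar>x\<bar> + M)"
      have s: "0 \<le> s" "s \<le> 1" "1 / 2 \<le> 1 - s" using False M by (auto simp: s_def field_simps)
      have "(1 - s) * x + s * y = 0" using M by (auto simp: s_def y_def field_simps)
      then have *: "(1 - s) * f x + s * f y - l / 2 * (s * (1 - s)) * (x - y)\<^sup>2 \<le> 0"
        using semiconcaveD[OF f s(1,2), of x y] f0 by simp
      have "\<bar>x - y\<bar> \<le> 2 * M" using False by (auto simp: y_def)
      note 1 = lt[OF s(1,2) this]
      have "\<bar>s * f y\<bar> \<le> 1 * (G * M\<^sup>2)"
        unfolding abs_mult using s fM M by (intro mult_mono) (auto simp: y_def)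
      then have "(1 - s) * f x \<le> G * M\<^sup>2 + 2 * L * M\<^sup>2"
        using * 1 by (simp only: abs_le_iff) linarith
      moreover have "1 / 2 * f x \<le> (1 - s) * f x" if "f x \<ge> 0"
        using s that by (intro mult_right_mono)
      ultimately show ?thesis using nn by (cases "f x \<ge> 0") auto
    qed
    have "\<bar>f x\<bar> \<le> 2 * (G * M\<^sup>2 + 2 * L * M\<^sup>2)" using lower upper nn by (simp add: abs_le_iff)
    moreover have "(G + 2 * G * M\<^sup>2 + 4 * L * M\<^sup>2) * (1 + x\<^sup>2) = 2 * (G * M\<^sup>2 + 2 * L * M\<^sup>2) +
        (G + G * x\<^sup>2 + 2 * (G * M\<^sup>2 * x\<^sup>2) + 4 * (L * M\<^sup>2 * x\<^sup>2))"
      by (simp add: algebra_simps)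
    ultimately have "\<bar>f x\<bar> \<le> (G + 2 * G * M\<^sup>2 + 4 * L * M\<^sup>2) * (1 + x\<^sup>2)"
      using nn G0 by linarith
    then show ?thesis .
  qed
qed

section \<open>Integral functionals\<close>

text \<open>By completeness of Lebesgue measure.\<close>

lemma measurable_lebesgue_on_AE:
  fixes f g :: "'a::euclidean_space \<Rightarrow> real"
  assumes Z: "Z \<in> sets lebesgue" and f: "f \<in> borel_measurable (lebesgue_on Z)"
    and eq: "AE z in lebesgue_on Z. f z = g z"
  shows "g \<in> borel_measurable (lebesgue_on Z)"
proof -
  obtain N where N: "N \<in> null_sets (lebesgue_on Z)"
    and fg: "\<And>z. z \<in> space (lebesgue_on Z) - N \<Longrightarrow> f z = g z"
    by (rule AE_E3[OF eq]) blast
  have NZ: "N \<subseteq> Z" "N \<in> null_sets lebesgue"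
    using N Z by (auto simp: null_sets_restrict_space)
  show ?thesis
  proof (rule measurableI)
    fix S :: "real set" assume S: "S \<in> sets borel"
    have "g -` S \<inter> N \<in> null_sets lebesgue"
      by (rule null_sets_completion_subset[OF _ NZ(2)]) simp
    then have "g -` S \<inter> N \<in> sets (lebesgue_on Z)"
      using Z NZ(1) by (auto simp: sets_restrict_space_iff)
    moreover have "(f -` S \<inter> space (lebesgue_on Z)) - N \<in> sets (lebesgue_on Z)"
      using measurable_sets[OF f S] N by (intro sets.Diff) auto
    ultimately have "(f -` S \<inter> space (lebesgue_on Z) - N) \<union> (g -` S \<inter> N) \<in> sets (lebesgue_on Z)"
      by (intro sets.Un)
    also have "(f -` S \<inter> space (lebesgue_on Z) - N) \<union> (g -` S \<inter> N) = g -` S \<inter> space (lebesgue_on Z)"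
      using fg NZ(1) by (auto simp: space_restrict_space)
    finally show "g -` S \<inter> space (lebesgue_on Z) \<in> sets (lebesgue_on Z)" .
  qed auto
qed

text \<open>Dyadic approximations of \<open>x\<close> take countably many values; continuity of \<open>j z\<close> passes to the limit.\<close>

lemma caratheodory_measurable:
  fixes j :: "'a::euclidean_space \<Rightarrow> real \<Rightarrow> real"
  assumes Z: "Z \<in> sets lebesgue"
    and j: "\<And>\<zeta>. (\<lambda>z. j z \<zeta>) \<in> borel_measurable (lebesgue_on Z)"
    and cont: "AE z in lebesgue_on Z. continuous_on UNIV (j z)"
    and x [measurable]: "x \<in> borel_measurable (lebesgue_on Z)"
  shows "(\<lambda>z. j z (x z)) \<in> borel_measurable (lebesgue_on Z)"
proof -
  define a where "a n z = real_of_int \<lfloor>x z * 2 ^ n\<rfloor> / 2 ^ n" for n z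
  have a: "(\<lambda>n. a n z) \<longlonglongrightarrow> x z" for z
  proof (rule Lim_null_comparison[where g = "\<lambda>n. (1/2::real) ^ n", THEN LIM_zero_cancel])
    show "\<forall>\<^sub>F n in sequentially. norm (a n z - x z) \<le> (1/2) ^ n"
    proof (rule always_eventually, rule allI)
      fix n
      have "\<bar>real_of_int \<lfloor>x z * 2 ^ n\<rfloor> - x z * 2 ^ n\<bar> \<le> 1" by linarith
      then have "\<bar>real_of_int \<lfloor>x z * 2 ^ n\<rfloor> - x z * 2 ^ n\<bar> / 2 ^ n \<le> 1 / 2 ^ n"
        by (intro divide_right_mono) auto
      moreover have "a n z - x z = (real_of_int \<lfloor>x z * 2 ^ n\<rfloor> - x z * 2 ^ n) / 2 ^ n"
        by (simp add: a_def diff_divide_distrib)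
      ultimately show "norm (a n z - x z) \<le> (1/2) ^ n" by (simp add: power_one_over)
    qed
  qed (auto intro: LIMSEQ_power_zero)
  have m: "(\<lambda>z. j z (a n z)) \<in> borel_measurable (lebesgue_on Z)" for n
    unfolding a_def
    by (rule measurable_compose_countable[where g = "\<lambda>z. \<lfloor>x z * 2 ^ n\<rfloor>"]) (auto intro: j)
  have "(\<lambda>z. lim (\<lambda>n. j z (a n z))) \<in> borel_measurable (lebesgue_on Z)"
    by (rule borel_measurable_lim_metric) (rule m)
  moreover have "AE z in lebesgue_on Z. lim (\<lambda>n. j z (a n z)) = j z (x z)"
    using cont
  proof eventually_elim
    case (elim z)
    have "(\<lambda>n. j z (a n z)) \<longlonglongrightarrow> j z (x z)"
      using continuous_on_tendsto_compose[OF elim a] by simp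
    then show ?case by (rule limI)
  qed
  ultimately show ?thesis by (rule measurable_lebesgue_on_AE[OF Z])
qed

text \<open>What the variational argument uses of the nonlinearity. The Lipschitz constant of \<open>j z\<close> grows
  only linearly; this is what makes the integral functional locally Lipschitz on \<open>L\<^sup>2\<close>.\<close>

locale semiconcave_nonlinearity =
  fixes Z :: "'a::euclidean_space set" and j :: "'a \<Rightarrow> real \<Rightarrow> real" and l :: "'a \<Rightarrow> real"
    and K C L :: real
  assumes Z: "Z \<in> lmeasurable"
    and meas: "\<And>\<zeta>. (\<lambda>z. j z \<zeta>) \<in> borel_measurable (lebesgue_on Z)"
    and l_meas [measurable]: "l \<in> borel_measurable (lebesgue_on Z)"
    and l_bound: "AE z in lebesgue_on Z. \<bar>l z\<bar> \<le> L"
    and cont: "AE z in lebesgue_on Z. continuous_on UNIV (j z)"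
    and growth: "AE z in lebesgue_on Z. \<forall>\<zeta>. \<bar>j z \<zeta>\<bar> \<le> K * (1 + \<zeta>\<^sup>2)"
    and lip: "AE z in lebesgue_on Z. \<forall>a b. \<bar>j z a - j z b\<bar> \<le> C * (1 + \<bar>a\<bar> + \<bar>b\<bar>) * \<bar>a - b\<bar>"
    and semi: "AE z in lebesgue_on Z. semiconcave (l z) (j z)"
begin

lemma Z_sets: "Z \<in> sets lebesgue" using Z by blast

lemma AE_onI: "AE z in lebesgue. P z \<Longrightarrow> AE z in lebesgue_on Z. P z"
  using Z_sets by (simp add: AE_restrict_space_iff) (auto elim: eventually_mono)

lemma meas_onI: "f \<in> borel_measurable lebesgue \<Longrightarrow> f \<in> borel_measurable (lebesgue_on Z)"
  by (rule measurable_restrict_space1)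

lemma integrable_onI:
  fixes f :: "'a \<Rightarrow> real"
  shows "integrable lebesgue f \<Longrightarrow> integrable (lebesgue_on Z) f"
  using Z_sets integrable_mult_indicator[OF Z_sets, of f] by (simp add: integrable_restrict_space)

lemma integrable_const_on: "integrable (lebesgue_on Z) (\<lambda>_. c::real)"
proof -
  have "integrable lebesgue (indicator Z :: 'a \<Rightarrow> real)"
    using Z by (intro integrable_real_indicator) (auto simp: fmeasurable_def)
  then have "integrable (lebesgue_on Z) (\<lambda>_. 1::real)"
    using Z_sets by (simp add: integrable_restrict_space)
  from integrable_mult_right[OF this, of c] show ?thesis by simp
qed

definition J :: "('a, real) L2 \<Rightarrow> real" where
  "J x = (\<integral>z. j z (rep_L2 x z) \<partial>lebesgue_on Z)"

lemma rep_meas_on [measurable]: "rep_L2 x \<in> borel_measurable (lebesgue_on Z)"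
  by (rule meas_onI) (rule measurable_rep_L2)

lemma sq_rep_on: "integrable (lebesgue_on Z) (\<lambda>z. (rep_L2 x z)\<^sup>2)" for x :: "('a, real) L2"
  using sq_integrable_rep_L2[of x] by (intro integrable_onI) (simp add: sq_integrable_def)

lemma J_measurable [measurable]: "(\<lambda>z. j z (rep_L2 x z)) \<in> borel_measurable (lebesgue_on Z)"
  by (rule caratheodory_measurable[OF Z_sets meas cont rep_meas_on])

lemma J_integrable: "integrable (lebesgue_on Z) (\<lambda>z. j z (rep_L2 x z))"
proof (rule Bochner_Integration.integrable_bound)
  show "integrable (lebesgue_on Z) (\<lambda>z. K * (1 + (rep_L2 x z)\<^sup>2))"
    using sq_rep_on by (intro integrable_mult_right Bochner_Integration.integrable_add integrable_const_on)
  show "AE z in lebesgue_on Z. norm (j z (rep_L2 x z)) \<le> norm (K * (1 + (rep_L2 x z)\<^sup>2))"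
    using growth by eventually_elim (metis abs_ge_self order_trans real_norm_def)
qed measurable

lemma l_integrable: "integrable (lebesgue_on Z) (\<lambda>z. l z * (rep_L2 x z)\<^sup>2)"
proof (rule Bochner_Integration.integrable_bound)
  show "integrable (lebesgue_on Z) (\<lambda>z. L * (rep_L2 x z)\<^sup>2)"
    by (intro integrable_mult_right sq_rep_on)
  show "AE z in lebesgue_on Z. norm (l z * (rep_L2 x z)\<^sup>2) \<le> norm (L * (rep_L2 x z)\<^sup>2)"
    using l_bound by eventually_elim (auto simp: abs_mult intro!: mult_right_mono)
qed measurable

lemma l_integral_le: "(\<integral>z. l z * (rep_L2 x z)\<^sup>2 \<partial>lebesgue_on Z) \<le> \<bar>L\<bar> * (norm x)\<^sup>2"
proof -
  have "(\<integral>z. l z * (rep_L2 x z)\<^sup>2 \<partial>lebesgue_on Z) \<le> (\<integral>z. \<bar>L\<bar> * (rep_L2 x z)\<^sup>2 \<partial>lebesgue_on Z)"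
    using l_bound
    by (intro integral_mono_AE l_integrable integrable_mult_right sq_rep_on)
      (auto elim!: eventually_mono intro!: mult_right_mono)
  also have "\<dots> = \<bar>L\<bar> * (\<integral>z. indicator Z z *\<^sub>R (rep_L2 x z)\<^sup>2 \<partial>lebesgue)"
    using Z_sets by (simp add: integral_restrict_space)
  also have "(\<integral>z. indicator Z z *\<^sub>R (rep_L2 x z)\<^sup>2 \<partial>lebesgue) \<le> (\<integral>z. (rep_L2 x z)\<^sup>2 \<partial>lebesgue)"
    using sq_integrable_rep_L2[of x] Z_sets
    by (intro integral_mono integrable_mult_indicator) (auto simp: sq_integrable_def indicator_def)
  also have "\<dots> = (norm x)\<^sup>2" by (simp add: norm_L2_eq)
  finally show ?thesis by (simp add: mult_left_mono)
qed

text \<open>Cauchy-Schwarz, with \<open>1 + \<bar>x\<bar> + \<bar>y\<bar>\<close> as one of the factors.\<close>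

lemma J_lipschitz:
  "\<bar>J x - J y\<bar> \<le> \<bar>C\<bar> * (sqrt (measure lebesgue Z) + norm x + norm y) * norm (x - y)"
proof -
  let ?X = "\<lambda>z. \<bar>rep_L2 x z\<bar>" and ?Y = "\<lambda>z. \<bar>rep_L2 y z\<bar>" and ?D = "\<lambda>z. \<bar>rep_L2 (x - y) z\<bar>"
  let ?I = "indicator Z :: 'a \<Rightarrow> real"
  have sq: "sq_integrable ?X" "sq_integrable ?Y" "sq_integrable ?D"
    using sq_integrable_rep_L2[of x] sq_integrable_rep_L2[of y] sq_integrable_rep_L2[of "x - y"]
    by (auto simp: sq_integrable_def)
  have I: "sq_integrable ?I"
    using Z by (auto simp: sq_integrable_def fmeasurable_def power2_eq_square
        simp flip: indicator_inter_arith)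
  have abs_norm: "norm (abs_L2 (\<lambda>z. \<bar>rep_L2 w z\<bar>)) = norm w" if "sq_integrable (\<lambda>z. \<bar>rep_L2 w z\<bar>)"
    for w :: "('a, real) L2"
    by (rule power2_eq_imp_eq) (use norm_abs_L2[OF that] norm_L2_eq[of w] in simp_all)
  have I_norm: "norm (abs_L2 ?I) = sqrt (measure lebesgue Z)"
    using norm_abs_L2[OF I] Z by (intro real_sqrt_unique[symmetric])
      (auto simp: power2_eq_square simp flip: indicator_inter_arith)
  have w: "sq_integrable (\<lambda>z. ?I z + ?X z + ?Y z)"
    using sq_integrable_add[OF sq_integrable_add[OF I sq(1)] sq(2)] by simp
  have wint: "integrable lebesgue (\<lambda>z. (?I z + ?X z + ?Y z) * ?D z)"
    using sq_integrable_inner[OF w sq(3)] by simp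
  have "\<bar>J x - J y\<bar> = \<bar>\<integral>z. j z (rep_L2 x z) - j z (rep_L2 y z) \<partial>lebesgue_on Z\<bar>"
    unfolding J_def by (subst Bochner_Integration.integral_diff) (auto intro: J_integrable)
  also have "\<dots> \<le> (\<integral>z. \<bar>j z (rep_L2 x z) - j z (rep_L2 y z)\<bar> \<partial>lebesgue_on Z)"
    by (rule integral_abs_bound)
  also have "\<dots> \<le> (\<integral>z. \<bar>C\<bar> * ((?I z + ?X z + ?Y z) * ?D z) \<partial>lebesgue_on Z)"
  proof (intro integral_mono_AE integrable_abs Bochner_Integration.integrable_diff J_integrable
      integrable_mult_right integrable_onI wint)
    have inZ: "AE z in lebesgue_on Z. z \<in> Z" by (rule AE_I2) (simp add: space_restrict_space)
    show "AE z in lebesgue_on Z. \<bar>j z (rep_L2 x z) - j z (rep_L2 y z)\<bar>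
        \<le> \<bar>C\<bar> * ((?I z + ?X z + ?Y z) * ?D z)"
      using lip AE_onI[OF rep_L2_diff[of x y]] inZ
    proof eventually_elim
      case (elim z)
      have "\<bar>j z (rep_L2 x z) - j z (rep_L2 y z)\<bar> \<le> C * ((1 + ?X z + ?Y z) * ?D z)"
        using elim by (simp add: mult.assoc)
      also have "\<dots> \<le> \<bar>C\<bar> * ((1 + ?X z + ?Y z) * ?D z)" by (intro mult_right_mono) auto
      finally show ?case using elim by simp
    qed
  qed
  also have "\<dots> = \<bar>C\<bar> * (\<integral>z. indicator Z z *\<^sub>R ((?I z + ?X z + ?Y z) * ?D z) \<partial>lebesgue)"
    using Z_sets by (simp add: integral_restrict_space)
  also have "\<dots> \<le> \<bar>C\<bar> * (\<integral>z. (?I z + ?X z + ?Y z) * ?D z \<partial>lebesgue)"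
    using wint Z_sets
    by (intro mult_left_mono integral_mono integrable_mult_indicator) (auto simp: indicator_def)
  also have "(\<integral>z. (?I z + ?X z + ?Y z) * ?D z \<partial>lebesgue)
      = abs_L2 (\<lambda>z. ?I z + ?X z + ?Y z) \<bullet> abs_L2 ?D"
    by (simp add: inner_abs_L2[OF w sq(3)])
  also have "\<dots> \<le> norm (abs_L2 (\<lambda>z. ?I z + ?X z + ?Y z)) * norm (abs_L2 ?D)"
    by (rule norm_cauchy_schwarz)
  also have "abs_L2 (\<lambda>z. ?I z + ?X z + ?Y z) = abs_L2 ?I + abs_L2 ?X + abs_L2 ?Y"
    by (simp add: add_abs_L2 I sq sq_integrable_add[OF I sq(1)])
  also have "norm (abs_L2 ?D) = norm (x - y)" by (rule abs_norm[OF sq(3)])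
  also have "norm (abs_L2 ?I + abs_L2 ?X + abs_L2 ?Y) * norm (x - y)
      \<le> (sqrt (measure lebesgue Z) + norm x + norm y) * norm (x - y)"
    using norm_triangle_ineq[of "abs_L2 ?I + abs_L2 ?X" "abs_L2 ?Y"]
      norm_triangle_ineq[of "abs_L2 ?I" "abs_L2 ?X"] abs_norm[OF sq(1)] abs_norm[OF sq(2)] I_norm
    by (intro mult_right_mono) auto
  finally show ?thesis by (simp add: mult_left_mono mult.assoc)
qed

lemma J_semiconcave:
  assumes t: "0 \<le> t" "t \<le> 1"
  shows "(1 - t) * J x + t * J y
      - 1 / 2 * (t * (1 - t)) * (\<integral>z. l z * (rep_L2 (x - y) z)\<^sup>2 \<partial>lebesgue_on Z)
    \<le> J ((1 - t) *\<^sub>R x + t *\<^sub>R y)"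
proof -
  have "(1 - t) * J x + t * J y
      - 1 / 2 * (t * (1 - t)) * (\<integral>z. l z * (rep_L2 (x - y) z)\<^sup>2 \<partial>lebesgue_on Z)
    = (\<integral>z. (1 - t) * j z (rep_L2 x z) + t * j z (rep_L2 y z)
        - 1 / 2 * (t * (1 - t)) * (l z * (rep_L2 (x - y) z)\<^sup>2) \<partial>lebesgue_on Z)"
    unfolding J_def
    by (simp add: J_integrable l_integrable del: times_divide_eq_left)
  also have "\<dots> \<le> J ((1 - t) *\<^sub>R x + t *\<^sub>R y)"
    unfolding J_def
  proof (intro integral_mono_AE Bochner_Integration.integrable_add Bochner_Integration.integrable_diff
      integrable_mult_right J_integrable l_integrable)
    show "AE z in lebesgue_on Z. (1 - t) * j z (rep_L2 x z) + t * j z (rep_L2 y z)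
        - 1 / 2 * (t * (1 - t)) * (l z * (rep_L2 (x - y) z)\<^sup>2)
        \<le> j z (rep_L2 ((1 - t) *\<^sub>R x + t *\<^sub>R y) z)"
      using semi AE_onI[OF rep_L2_diff[of x y]] AE_onI[OF rep_L2_scaleR[of "1 - t" x]]
        AE_onI[OF rep_L2_scaleR[of t y]] AE_onI[OF rep_L2_add[of "(1 - t) *\<^sub>R x" "t *\<^sub>R y"]]
    proof eventually_elim
      case (elim z)
      have "1 / 2 * (t * (1 - t)) * (l z * (rep_L2 (x - y) z)\<^sup>2)
          = l z / 2 * (t * (1 - t)) * (rep_L2 x z - rep_L2 y z)\<^sup>2"
        unfolding elim(2) by simp
      then show ?case using semiconcaveD[OF elim(1) t, of "rep_L2 x z" "rep_L2 y z"]
        unfolding elim(5) elim(3) elim(4) real_scaleR_def by linarith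
    qed
  qed
  finally show ?thesis .
qed

end

section \<open>Smooth functions and cutoffs\<close>

lemma Ck_SucI:
  assumes "\<And>x. (f has_derivative f' x) (at x)" "\<And>b. b \<in> Basis \<Longrightarrow> Ck n (\<lambda>x. f' x b)"
  shows "Ck (Suc n) f"
proof -
  have "frechet_derivative f (at x) = f' x" for x
    using frechet_derivative_at[OF assms(1)] by simp
  then show ?thesis using assms by (auto simp: differentiable_def)
qed

lemma Ck_Suc_has_derivative:
  "Ck (Suc n) f \<Longrightarrow> (f has_derivative frechet_derivative f (at x)) (at x)"
  by (simp add: frechet_derivative_works)

lemma Ck_SucD: "Ck (Suc n) f \<Longrightarrow> Ck n f"
proof (induction n arbitrary: f)
  case 0
  then show ?case
    by (auto intro!: continuous_at_imp_continuous_on differentiable_imp_continuous_within)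
next
  case (Suc n)
  then show ?case by simp
qed

lemma Ck_Suc_pd: "Ck (Suc n) f \<Longrightarrow> b \<in> Basis \<Longrightarrow> Ck n (\<lambda>x. frechet_derivative f (at x) b)"
  by simp

lemma Ck_continuous: "Ck n f \<Longrightarrow> continuous_on UNIV f"
proof (induction n)
  case (Suc n)
  then show ?case using Ck_SucD by blast
qed simp

lemma Ck_const: "Ck n (\<lambda>x. c)"
proof (induction n arbitrary: c)
  case (Suc n)
  show ?case by (rule Ck_SucI[where f' = "\<lambda>_ _. 0"]) (auto intro: Suc)
qed simp

lemma Ck_linear: "bounded_linear f \<Longrightarrow> Ck n f"
proof (cases n)
  case (Suc m)
  assume "bounded_linear f"
  then show ?thesis unfolding Suc
    by (intro Ck_SucI[where f' = "\<lambda>_. f"] Ck_const) (rule bounded_linear_imp_has_derivative)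
qed (auto intro: linear_continuous_on)

lemma Ck_add: "Ck n f \<Longrightarrow> Ck n g \<Longrightarrow> Ck n (\<lambda>x. f x + g x)"
proof (induction n arbitrary: f g)
  case (Suc n)
  show ?case
    by (rule Ck_SucI[where f' = "\<lambda>x h. frechet_derivative f (at x) h + frechet_derivative g (at x) h"])
      (use Suc in \<open>auto intro!: has_derivative_add Ck_Suc_has_derivative\<close>)
qed (simp add: continuous_on_add)

lemma Ck_mult: "Ck n f \<Longrightarrow> Ck n g \<Longrightarrow> Ck n (\<lambda>x. f x * g x)"
proof (induction n arbitrary: f g)
  case (Suc n)
  show ?case
  proof (rule Ck_SucI)
    show "((\<lambda>x. f x * g x) has_derivative
        (\<lambda>h. f x * frechet_derivative g (at x) h + frechet_derivative f (at x) h * g x)) (at x)" for x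
      by (intro has_derivative_mult Ck_Suc_has_derivative[OF Suc.prems(1)]
          Ck_Suc_has_derivative[OF Suc.prems(2)])
    show "Ck n (\<lambda>x. f x * frechet_derivative g (at x) b + frechet_derivative f (at x) b * g x)"
      if "b \<in> Basis" for b
      by (intro Ck_add Suc.IH Ck_Suc_pd[OF Suc.prems(1) that] Ck_Suc_pd[OF Suc.prems(2) that]
          Ck_SucD[OF Suc.prems(1)] Ck_SucD[OF Suc.prems(2)])
  qed
qed (simp add: continuous_on_mult)

text \<open>The outer function comes with all its derivatives \<open>D m\<close>, since the induction on \<open>n\<close> has to pass
  from \<open>D m\<close> to \<open>D (Suc m)\<close>.\<close>

lemma Ck_compose:
  fixes D :: "nat \<Rightarrow> real \<Rightarrow> real"
  assumes D: "\<And>m y. (D m has_real_derivative D (Suc m) y) (at y)"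
  shows "Ck n f \<Longrightarrow> Ck n (\<lambda>x. D m (f x))"
proof (induction n arbitrary: f m)
  case 0
  have "continuous_on UNIV (D m)" using D by (meson DERIV_isCont continuous_at_imp_continuous_on)
  from continuous_on_compose2[OF this, of UNIV f] 0 show ?case by simp
next
  case (Suc n)
  show ?case
  proof (rule Ck_SucI)
    show "((\<lambda>x. D m (f x)) has_derivative
        (\<lambda>h. D (Suc m) (f x) * frechet_derivative f (at x) h)) (at x)" for x
      using has_derivative_compose[OF Ck_Suc_has_derivative[OF Suc.prems]
          D[of m, unfolded has_field_derivative_def]] .
    show "Ck n (\<lambda>x. D (Suc m) (f x) * frechet_derivative f (at x) b)" if "b \<in> Basis" for b
      by (intro Ck_mult Suc.IH Ck_Suc_pd[OF Suc.prems that] Ck_SucD[OF Suc.prems])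
  qed
qed

lemma Ck_dist_sq: "Ck n (\<lambda>y. (norm (y - x))\<^sup>2)"
proof -
  have lin: "Ck m (\<lambda>y. 2 * ((y - x) \<bullet> b))" for b m
  proof -
    have "Ck m (\<lambda>y. 2 * (y \<bullet> b) + (- 2) * (x \<bullet> b))"
      by (intro Ck_add Ck_const Ck_linear bounded_linear_const_mult bounded_linear_inner_left)
    then show ?thesis by (simp add: inner_diff_left algebra_simps)
  qed
  show ?thesis
  proof (cases n)
    case 0
    then show ?thesis by (auto intro!: continuous_intros)
  next
    case (Suc m)
    show ?thesis unfolding Suc power2_norm_eq_inner
      by (rule Ck_SucI[OF _ lin]) (auto intro!: derivative_eq_intros simp: inner_commute)
  qed
qed

text \<open>\<open>exp (- 1 / x)\<close>, continued by \<open>0\<close>: all its derivatives have the form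
  \<open>p (1 / x) exp (- 1 / x)\<close> with a polynomial \<open>p\<close>.\<close>

primrec flat_poly :: "nat \<Rightarrow> real poly" where
  "flat_poly 0 = 1"
| "flat_poly (Suc n) = [:0, 0, 1:] * (flat_poly n - pderiv (flat_poly n))"

definition flat :: "nat \<Rightarrow> real \<Rightarrow> real" where
  "flat n x = (if x > 0 then poly (flat_poly n) (1 / x) * exp (- (1 / x)) else 0)"

lemma poly_exp_decay: "((\<lambda>y. poly p y * exp (- y)) \<longlongrightarrow> 0) at_top" for p :: "real poly"
proof -
  have "((\<lambda>y. \<Sum>i\<le>degree p. coeff p i * (y ^ i / exp y)) \<longlongrightarrow> (\<Sum>i\<le>degree p. coeff p i * 0)) at_top"
    by (intro tendsto_sum tendsto_mult tendsto_const tendsto_power_div_exp_0)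
  then show ?thesis by (simp add: poly_altdef exp_minus divide_inverse sum_distrib_right mult.assoc)
qed

lemma flat_decay: "((\<lambda>x. poly p (1 / x) * exp (- (1 / x))) \<longlongrightarrow> 0) (at_right 0)" for p :: "real poly"
  using filterlim_compose[OF poly_exp_decay[of p] filterlim_inverse_at_top_right]
  by (simp add: inverse_eq_divide)

lemma flat_deriv: "(flat n has_real_derivative flat (Suc n) x) (at x)"
proof -
  consider "x > 0" | "x < 0" | "x = 0" by linarith
  then show ?thesis
  proof cases
    case 1
    have "((\<lambda>x. poly (flat_poly n) (1 / x) * exp (- (1 / x))) has_real_derivative flat (Suc n) x) (at x)"
      using 1 by (auto intro!: derivative_eq_intros DERIV_chain2[OF poly_DERIV]
          simp: flat_def field_simps power2_eq_square)
    then show ?thesis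
      by (rule has_field_derivative_transform_within_open[where S = "{0<..}"])
        (use 1 in \<open>auto simp: flat_def\<close>)
  next
    case 2
    have "((\<lambda>x. 0) has_real_derivative flat (Suc n) x) (at x)" using 2 by (simp add: flat_def)
    then show ?thesis
      by (rule has_field_derivative_transform_within_open[where S = "{..<0}"])
        (use 2 in \<open>auto simp: flat_def\<close>)
  next
    case 3
    have "((\<lambda>h. flat n h / h) \<longlongrightarrow> 0) (at_right 0)"
    proof (rule Lim_transform_eventually[OF flat_decay[of "[:0, 1:] * flat_poly n"]])
      show "\<forall>\<^sub>F h in at_right 0. poly ([:0, 1:] * flat_poly n) (1 / h) * exp (- (1 / h)) = flat n h / h"
        using eventually_at_right_less[of 0] by eventually_elim (simp add: flat_def)
    qed
    moreover have "((\<lambda>h. flat n h / h) \<longlongrightarrow> 0) (at_left 0)"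
    proof (rule Lim_transform_eventually[OF tendsto_const])
      show "\<forall>\<^sub>F h in at_left 0. 0 = flat n h / h"
        by (auto simp: eventually_at_filter flat_def)
    qed
    ultimately have "((\<lambda>h. flat n h / h) \<longlongrightarrow> 0) (at 0)" by (simp add: filterlim_at_split)
    then show ?thesis using 3 by (simp add: has_field_derivative_iff flat_def)
  qed
qed

lemma flat_0: "flat 0 x = (if x > 0 then exp (- (1 / x)) else 0)"
  by (simp add: flat_def)

text \<open>The inner \<open>flat 0\<close> vanishes on the small ball and is at least \<open>a\<close> outside of the large one, where
  the outer \<open>flat 0\<close> then receives a nonpositive argument.\<close>

lemma smooth_cutoff:
  fixes x :: "'a::euclidean_space"
  assumes rR: "0 < r" "r < R"
  obtains \<eta> where "\<And>n. Ck n \<eta>" "\<And>y. y \<in> cball x r \<Longrightarrow> \<eta> y = 1" "\<And>y. y \<notin> cball x R \<Longrightarrow> \<eta> y = 0"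
proof
  define a where "a = flat 0 (R\<^sup>2 - r\<^sup>2)"
  define c where "c = flat 0 a"
  define \<eta> where "\<eta> y = 1 / c * flat 0 (a + (- 1) * flat 0 ((norm (y - x))\<^sup>2 + (- (r\<^sup>2))))" for y
  have "r\<^sup>2 < R\<^sup>2" using rR by (simp add: power_strict_mono)
  then have a: "a > 0" by (simp add: a_def flat_0)
  then have c: "c > 0" by (simp add: c_def flat_0)
  show "Ck n \<eta>" for n
    unfolding \<eta>_def
    by (intro Ck_mult Ck_const Ck_compose[where D = flat] Ck_add Ck_dist_sq flat_deriv)
  show "\<eta> y = 1" if "y \<in> cball x r" for y
  proof -
    have "(norm (y - x))\<^sup>2 \<le> r\<^sup>2"
      using that by (intro power_mono) (auto simp: dist_norm norm_minus_commute)
    then have "flat 0 ((norm (y - x))\<^sup>2 + (- (r\<^sup>2))) = 0" by (simp add: flat_0)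
    then show ?thesis using c by (simp add: \<eta>_def c_def)
  qed
  show "\<eta> y = 0" if "y \<notin> cball x R" for y
  proof -
    have "R\<^sup>2 < (norm (y - x))\<^sup>2"
      using that rR by (intro power_strict_mono) (auto simp: dist_norm norm_minus_commute)
    with \<open>r\<^sup>2 < R\<^sup>2\<close> have "a \<le> flat 0 ((norm (y - x))\<^sup>2 + (- (r\<^sup>2)))"
      by (simp add: a_def flat_0 frac_le)
    then show ?thesis by (simp add: \<eta>_def flat_0)
  qed
qed

abbreviation pd :: "'a::euclidean_space \<Rightarrow> ('a \<Rightarrow> real) \<Rightarrow> 'a \<Rightarrow> real" where
  "pd b f \<equiv> (\<lambda>x. frechet_derivative f (at x) b)"

definition laplacian :: "('a::euclidean_space \<Rightarrow> real) \<Rightarrow> 'a \<Rightarrow> real" where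
  "laplacian f x = (\<Sum>b\<in>Basis. pd b (pd b f) x)"

lemma Ck_pd: "(\<And>n. Ck n f) \<Longrightarrow> b \<in> Basis \<Longrightarrow> Ck n (pd b f)"
  by (metis Ck.simps(2))

lemma grad_inner: "Ck (Suc n) f \<Longrightarrow> grad f x \<bullet> h = frechet_derivative f (at x) h"
proof -
  assume "Ck (Suc n) f"
  then have lin: "linear (frechet_derivative f (at x))"
    using has_derivative_linear[OF Ck_Suc_has_derivative] by blast
  have "frechet_derivative f (at x) h = frechet_derivative f (at x) (\<Sum>b\<in>Basis. (h \<bullet> b) *\<^sub>R b)"
    by (simp add: euclidean_representation)
  also have "\<dots> = (\<Sum>b\<in>Basis. (h \<bullet> b) * frechet_derivative f (at x) b)"
    by (simp add: linear_sum[OF lin] linear_cmul[OF lin])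
  finally show ?thesis
    by (simp add: grad_def inner_sum_left inner_commute[of h] mult.commute)
qed

lemma grad_continuous: "(\<And>n. Ck n f) \<Longrightarrow> continuous_on UNIV (grad f)"
  unfolding grad_def
  by (intro continuous_on_sum continuous_on_scaleR continuous_on_const Ck_continuous[of 0] Ck_pd)

lemma test_functionsI:
  assumes C: "\<And>n. Ck n f" and K: "compact K" "K \<subseteq> Z" and s: "\<And>x. x \<notin> K \<Longrightarrow> f x = 0"
  shows "f \<in> test_functions Z"
proof -
  have "closure {x. f x \<noteq> 0} \<subseteq> K"
    using s K by (intro closure_minimal compact_imp_closed) auto
  moreover from this have "compact (closure {x. f x \<noteq> 0})"
    using K(1) by (meson closed_closure compact_eq_bounded_closed bounded_subset)
  ultimately show ?thesis using C K by (auto simp: test_functions_def)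
qed

lemma test_functionsE:
  assumes "f \<in> test_functions Z"
  obtains K where "compact K" "K \<subseteq> Z" "\<And>x. x \<notin> K \<Longrightarrow> f x = 0"
    "\<And>x h. x \<notin> K \<Longrightarrow> frechet_derivative f (at x) h = 0"
proof
  let ?K = "closure {x. f x \<noteq> 0}"
  show "compact ?K" "?K \<subseteq> Z" using assms by (auto simp: test_functions_def)
  show out: "f x = 0" if "x \<notin> ?K" for x
    using that closure_subset[of "{x. f x \<noteq> 0}"] by auto
  show "frechet_derivative f (at x) h = 0" if "x \<notin> ?K" for x h
  proof -
    have "((\<lambda>_. 0) has_derivative (\<lambda>_. 0)) (at x)" by simp
    then have "(f has_derivative (\<lambda>_. 0)) (at x)"
    proof (rule has_derivative_transform_within_open)
      show "open (- ?K)" by (simp add: open_Compl)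
      show "x \<in> - ?K" using that by blast
    qed (metis out ComplD)
    then show ?thesis by (simp add: frechet_derivative_at[symmetric])
  qed
qed

lemma test_functions_Ck: "f \<in> test_functions Z \<Longrightarrow> Ck n f"
  by (simp add: test_functions_def)

lemma test_functions_pd: "f \<in> test_functions Z \<Longrightarrow> b \<in> Basis \<Longrightarrow> pd b f \<in> test_functions Z"
proof -
  assume f: "f \<in> test_functions Z" and b: "b \<in> Basis"
  obtain K where "compact K" "K \<subseteq> Z" "\<And>x h. x \<notin> K \<Longrightarrow> frechet_derivative f (at x) h = 0"
    using test_functionsE[OF f] by metis
  then show ?thesis by (intro test_functionsI[where K = K] Ck_pd test_functions_Ck[OF f] b)
qed

lemma test_functions_mult:
  "f \<in> test_functions Z \<Longrightarrow> (\<And>n. Ck n g) \<Longrightarrow> (\<lambda>x. f x * g x) \<in> test_functions Z"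
proof -
  assume f: "f \<in> test_functions Z" and g: "\<And>n. Ck n g"
  obtain K where "compact K" "K \<subseteq> Z" "\<And>x. x \<notin> K \<Longrightarrow> f x = 0"
    using test_functionsE[OF f] by metis
  then show ?thesis
    by (intro test_functionsI[where K = K] Ck_mult test_functions_Ck[OF f] g) auto
qed

lemma test_functions_add:
  assumes "f \<in> test_functions Z" "g \<in> test_functions Z"
  shows "(\<lambda>x. f x + g x) \<in> test_functions Z"
proof -
  obtain K where K: "compact K" "K \<subseteq> Z" "\<And>x. x \<notin> K \<Longrightarrow> f x = 0"
    using test_functionsE[OF assms(1)] by metis
  obtain K' where K': "compact K'" "K' \<subseteq> Z" "\<And>x. x \<notin> K' \<Longrightarrow> g x = 0"
    using test_functionsE[OF assms(2)] by metis
  show ?thesis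
    using K K' by (intro test_functionsI[where K = "K \<union> K'"] Ck_add)
      (auto intro: test_functions_Ck[OF assms(1)] test_functions_Ck[OF assms(2)] compact_Un)
qed

lemma test_functions_scale: "f \<in> test_functions Z \<Longrightarrow> (\<lambda>x. c * f x) \<in> test_functions Z"
  using test_functions_mult[of f Z "\<lambda>_. c"] by (simp add: Ck_const mult.commute)

lemma pd_add:
  "(\<And>n. Ck n f) \<Longrightarrow> (\<And>n. Ck n g) \<Longrightarrow> pd b (\<lambda>x. f x + g x) x = pd b f x + pd b g x"
  by (subst frechet_derivative_at[symmetric,
        OF has_derivative_add[OF Ck_Suc_has_derivative[of 0 f] Ck_Suc_has_derivative[of 0 g]]]) auto

lemma pd_mult:
  assumes "\<And>n. Ck n f" "\<And>n. Ck n g"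
  shows "pd b (\<lambda>x. f x * g x) x = f x * pd b g x + pd b f x * g x"
  by (subst frechet_derivative_at[symmetric,
        OF has_derivative_mult[OF Ck_Suc_has_derivative[of 0 f] Ck_Suc_has_derivative[of 0 g]]])
    (use assms in auto)

lemma laplacian_mult:
  assumes f: "\<And>n. Ck n f" and g: "\<And>n. Ck n g"
  shows "laplacian (\<lambda>x. f x * g x) x =
    f x * laplacian g x + 2 * (\<Sum>b\<in>Basis. pd b f x * pd b g x) + laplacian f x * g x"
proof -
  have "pd b (pd b (\<lambda>x. f x * g x)) x
      = f x * pd b (pd b g) x + 2 * (pd b f x * pd b g x) + pd b (pd b f) x * g x" if b: "b \<in> Basis" for b
  proof -
    have "pd b (\<lambda>x. f x * pd b g x + pd b f x * g x) x
        = pd b (\<lambda>x. f x * pd b g x) x + pd b (\<lambda>x. pd b f x * g x) x"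
      by (rule pd_add) (intro Ck_mult f g Ck_pd b)+
    then show ?thesis
      unfolding pd_mult[OF f g] pd_mult[OF f Ck_pd[OF g b]] pd_mult[OF Ck_pd[OF f b] g]
      by simp
  qed
  then have "laplacian (\<lambda>x. f x * g x) x = (\<Sum>b\<in>Basis. f x * pd b (pd b g) x
      + 2 * (pd b f x * pd b g x) + pd b (pd b f) x * g x)"
    unfolding laplacian_def by (intro sum.cong) auto
  then show ?thesis
    by (simp add: sum.distrib laplacian_def sum_distrib_left sum_distrib_right)
qed

section \<open>Translations\<close>

lemma sq_integrable_lborel:
  fixes f :: "'a::euclidean_space \<Rightarrow> real"
  assumes "f \<in> borel_measurable borel"
  shows "sq_integrable f \<longleftrightarrow> integrable lborel (\<lambda>z. (f z)\<^sup>2)"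
  using assms unfolding sq_integrable_def
  by (simp add: integrable_completion measurable_completion)

lemma integrable_lborel_translate:
  fixes f :: "'a::euclidean_space \<Rightarrow> real"
  assumes "integrable lborel f"
  shows "integrable lborel (\<lambda>z. f (z + h))" "(\<integral>z. f (z + h) \<partial>lborel) = (\<integral>z. f z \<partial>lborel)"
proof -
  have d: "distr lborel borel ((+) h) = lborel" by (rule lborel_distr_plus)
  have f: "f \<in> borel_measurable borel" using borel_measurable_integrable[OF assms] by simp
  have "integrable (distr lborel borel ((+) h)) f" using assms d by simp
  then show "integrable lborel (\<lambda>z. f (z + h))"
    using integrable_distr_eq[of "(+) h" lborel borel f] f by (simp add: add.commute)
  show "(\<integral>z. f (z + h) \<partial>lborel) = (\<integral>z. f z \<partial>lborel)"
    using integral_distr[of "(+) h" lborel borel f] f d by (simp add: add.commute)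
qed

lemma AE_lborel_translate:
  assumes "AE z in lborel. P z"
  shows "AE z in lborel. P (z + h :: 'a::euclidean_space)"
proof -
  obtain N where N: "N \<in> null_sets lborel" "\<And>z. z \<in> space lborel - N \<Longrightarrow> P z"
    by (rule AE_E3[OF assms]) blast
  have "AE z in lborel. z \<notin> N" by (rule AE_not_in[OF N(1)])
  then have "AE z in distr lborel borel ((+) h). z \<notin> N" unfolding lborel_distr_plus .
  then have "AE z in lborel. h + z \<notin> N"
    using N(1) by (subst (asm) AE_distr_iff) (auto simp: null_sets_def)
  then show ?thesis by eventually_elim (use N(2) in \<open>auto simp: add.commute\<close>)
qed

text \<open>Translations and Fubini's theorem refer to \<open>lborel\<close>, hence the need for a Borel measurable
  representative.\<close>

definition borel_rep :: "('a::euclidean_space, real) L2 \<Rightarrow> 'a \<Rightarrow> real" where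
  "borel_rep x = (SOME f. f \<in> borel_measurable borel \<and> (AE z in lborel. rep_L2 x z = f z))"

lemma borel_rep:
  shows borel_rep_measurable [measurable]: "borel_rep x \<in> borel_measurable borel"
    and borel_rep_AE: "AE z in lborel. rep_L2 x z = borel_rep x z"
proof -
  have "\<exists>f. f \<in> borel_measurable borel \<and> (AE z in lborel. rep_L2 x z = f z)"
    using completion_ex_borel_measurable_real[OF measurable_rep_L2[of x]] by auto
  from someI_ex[OF this] show "borel_rep x \<in> borel_measurable borel"
    "AE z in lborel. rep_L2 x z = borel_rep x z"
    by (auto simp: borel_rep_def)
qed

lemma borel_rep_sq: "sq_integrable (borel_rep x)"
proof -
  have i: "integrable lebesgue (\<lambda>z. (rep_L2 x z)\<^sup>2)"
    using sq_integrable_rep_L2[of x] by (simp add: sq_integrable_def)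
  have ae: "AE z in lebesgue. (rep_L2 x z)\<^sup>2 = (borel_rep x z)\<^sup>2"
    using AE_completion[OF borel_rep_AE[of x]] by eventually_elim simp
  have "(\<lambda>z. (borel_rep x z)\<^sup>2) \<in> borel_measurable lebesgue"
    by (rule measurable_completion) measurable
  from integrable_cong_AE_imp[OF i this ae]
  have "integrable lebesgue (\<lambda>z. (borel_rep x z)\<^sup>2)" .
  then show ?thesis by (simp add: sq_integrable_def measurable_completion)
qed

lemma abs_borel_rep: "abs_L2 (borel_rep x) = x"
proof -
  have "abs_L2 (borel_rep x) = abs_L2 (rep_L2 x)"
    by (subst abs_L2_eq_iff[OF borel_rep_sq sq_integrable_rep_L2])
      (use AE_completion[OF borel_rep_AE[of x]] in eventually_elim, simp)
  then show ?thesis by (simp add: abs_rep_L2)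
qed

lemma abs_L2_borel_eq_iff:
  fixes f g :: "'a::euclidean_space \<Rightarrow> real"
  assumes "sq_integrable f" "sq_integrable g"
  shows "abs_L2 f = abs_L2 g \<longleftrightarrow> (AE z in lborel. f z = g z)"
  using abs_L2_eq_iff[OF assms] by (simp add: AE_completion_iff)

lemma sq_integrable_translate:
  fixes f :: "'a::euclidean_space \<Rightarrow> real"
  assumes f: "f \<in> borel_measurable borel" "sq_integrable f"
  shows "sq_integrable (\<lambda>z. f (z + h))"
  using integrable_lborel_translate(1)[of "\<lambda>z. (f z)\<^sup>2" h] f
  by (simp add: sq_integrable_lborel)

lemma integral_sq_translate:
  fixes f :: "'a::euclidean_space \<Rightarrow> real"
  assumes f: "f \<in> borel_measurable borel" "sq_integrable f"
  shows "norm (abs_L2 (\<lambda>z. f (z + h))) = norm (abs_L2 f)"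
proof (rule power2_eq_imp_eq)
  have "(\<lambda>z. f (z + h)) \<in> borel_measurable borel" using f(1) by measurable
  then show "(norm (abs_L2 (\<lambda>z. f (z + h))))\<^sup>2 = (norm (abs_L2 f))\<^sup>2"
    using integrable_lborel_translate(2)[of "\<lambda>z. (f z)\<^sup>2" h] f
    by (simp add: norm_abs_L2 sq_integrable_translate integral_completion sq_integrable_lborel)
qed auto

definition translate :: "'a \<Rightarrow> ('a::euclidean_space, real) L2 \<Rightarrow> ('a, real) L2" where
  "translate h x = abs_L2 (\<lambda>z. borel_rep x (z + h))"

lemma translate_abs:
  assumes f: "f \<in> borel_measurable borel" "sq_integrable f"
  shows "translate h (abs_L2 f) = abs_L2 (\<lambda>z. f (z + h))"
proof -
  have "AE z in lborel. borel_rep (abs_L2 f) z = f z"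
    using abs_borel_rep[of "abs_L2 f"] by (simp add: abs_L2_borel_eq_iff borel_rep_sq f)
  from AE_lborel_translate[OF this, of h] show ?thesis
    unfolding translate_def
    by (simp add: abs_L2_borel_eq_iff sq_integrable_translate borel_rep_sq f)
qed

lemma norm_translate: "norm (translate h x) = norm x"
  by (simp add: translate_def integral_sq_translate borel_rep_sq abs_borel_rep)

lemma translate_diff: "translate h (x - y) = translate h x - translate h y"
proof -
  have "translate h (abs_L2 (\<lambda>z. borel_rep x z - borel_rep y z))
      = abs_L2 (\<lambda>z. borel_rep x (z + h) - borel_rep y (z + h))"
    by (rule translate_abs) (auto intro: sq_integrable_diff borel_rep_sq)
  then show ?thesis
    by (simp add: diff_abs_L2[symmetric] borel_rep_sq abs_borel_rep sq_integrable_translate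
        translate_def)
qed

lemma translate_add: "translate h (translate k x) = translate (k + h) x"
  unfolding translate_def[of k]
  by (subst translate_abs) (auto simp: translate_def sq_integrable_translate borel_rep_sq ac_simps)

lemma continuous_translate: "continuous_on S (translate h)"
proof (rule continuous_onI)
  fix x e assume "(e::real) > 0"
  then show "\<exists>d>0. \<forall>x'\<in>S. dist x' x < d \<longrightarrow> dist (translate h x') (translate h x) \<le> e"
    by (intro exI[of _ e]) (auto simp: dist_norm translate_diff[symmetric] norm_translate)
qed

section \<open>Difference quotients of test functions\<close>

lemma test_function_borel: "f \<in> test_functions Z \<Longrightarrow> f \<in> borel_measurable borel"
  using Ck_continuous[OF test_functions_Ck[of f Z 0]] by (rule borel_measurable_continuous_onI)

lemma test_function_lipschitz:
  assumes f: "f \<in> test_functions Z"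
  obtains C where "C \<ge> 0" "\<And>x y. \<bar>f x - f y\<bar> \<le> C * norm (x - y)"
proof -
  have C: "\<And>n. Ck n f" using f by (rule test_functions_Ck)
  obtain K where K: "compact K" "\<And>x h. x \<notin> K \<Longrightarrow> frechet_derivative f (at x) h = 0"
    using test_functionsE[OF f] by metis
  have "compact (grad f ` K)"
    by (intro compact_continuous_image continuous_on_subset[OF grad_continuous[OF C]] K) simp
  then obtain B where B: "\<And>x. x \<in> K \<Longrightarrow> norm (grad f x) \<le> B"
    by (meson bounded_iff compact_imp_bounded image_eqI)
  define C' where "C' = max B 0"
  have bd: "norm (grad f x) \<le> C'" for x
    using B[of x] K(2)[of x] by (cases "x \<in> K") (auto simp: C'_def grad_def)
  have "norm (f x - f y) \<le> C' * norm (x - y)" for x y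
  proof (rule differentiable_bound[where S = UNIV and f' = "\<lambda>x. frechet_derivative f (at x)"])
    show "(f has_derivative frechet_derivative f (at x)) (at x within UNIV)" for x
      using Ck_Suc_has_derivative[OF C] by simp
    show "onorm (frechet_derivative f (at x)) \<le> C'" for x
    proof (rule onorm_bound)
      fix h
      have "norm (frechet_derivative f (at x) h) = \<bar>grad f x \<bullet> h\<bar>" by (simp add: grad_inner[OF C])
      also have "\<dots> \<le> norm (grad f x) * norm h" by (rule Cauchy_Schwarz_ineq2)
      also have "\<dots> \<le> C' * norm h" using bd by (intro mult_right_mono) auto
      finally show "norm (frechet_derivative f (at x) h) \<le> C' * norm h" .
    qed (simp add: C'_def)
  qed auto
  then show ?thesis using that[of C'] by (auto simp: C'_def)
qed

definition diff_quot :: "('a::euclidean_space \<Rightarrow> real) \<Rightarrow> 'a \<Rightarrow> nat \<Rightarrow> 'a \<Rightarrow> real" where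
  "diff_quot f h n z = real (Suc n) * (f (z + (1 / real (Suc n)) *\<^sub>R h) - f z)"

lemma diff_quot_tendsto:
  assumes f: "f \<in> test_functions Z"
  shows "(\<lambda>n. diff_quot f h n z) \<longlonglongrightarrow> grad f z \<bullet> h"
proof -
  have C: "\<And>n. Ck n f" using f by (rule test_functions_Ck)
  have "((\<lambda>t. f (z + t *\<^sub>R h)) has_derivative (\<lambda>t. frechet_derivative f (at z) (t *\<^sub>R h))) (at 0)"
    by (rule has_derivative_compose[where f = "\<lambda>t. z + t *\<^sub>R h"])
      (auto intro!: derivative_eq_intros Ck_Suc_has_derivative[OF C])
  then have "((\<lambda>t. f (z + t *\<^sub>R h)) has_real_derivative grad f z \<bullet> h) (at 0)"
    unfolding has_field_derivative_def
    by (rule has_derivative_eq_rhs) (auto simp: grad_inner[OF C, symmetric])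
  then have "((\<lambda>t. (f (z + t *\<^sub>R h) - f z) / t) \<longlongrightarrow> grad f z \<bullet> h) (at 0)"
    by (simp add: has_field_derivative_iff)
  moreover have "filterlim (\<lambda>n. 1 / real (Suc n)) (at 0) sequentially"
    using LIMSEQ_inverse_real_of_nat by (auto simp: filterlim_at inverse_eq_divide)
  ultimately have "(\<lambda>n. (f (z + (1 / real (Suc n)) *\<^sub>R h) - f z) / (1 / real (Suc n)))
      \<longlonglongrightarrow> grad f z \<bullet> h"
    by (rule filterlim_compose)
  then show ?thesis by (simp add: diff_quot_def mult.commute del: of_nat_Suc)
qed

lemma diff_quot_bound:
  assumes f: "f \<in> test_functions Z"
  obtains B R where "\<And>n z. \<bar>diff_quot f h n z\<bar> \<le> B * indicator (cball 0 R) z"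
    "\<And>z. \<bar>grad f z \<bullet> h\<bar> \<le> B * indicator (cball 0 R) z"
proof -
  obtain C where C: "C \<ge> 0" "\<And>x y. \<bar>f x - f y\<bar> \<le> C * norm (x - y)"
    by (rule test_function_lipschitz[OF f]) blast
  obtain K where K: "compact K" "\<And>x. x \<notin> K \<Longrightarrow> f x = 0"
    using test_functionsE[OF f] by metis
  obtain r where r: "\<And>x. x \<in> K \<Longrightarrow> norm x \<le> r"
    using compact_imp_bounded[OF K(1)] bounded_iff by blast
  have out: "f x = 0" if "norm x > r" for x using K(2) r that by force
  define R where "R = r + norm h"
  have 1: "\<bar>diff_quot f h n z\<bar> \<le> C * norm h * indicator (cball 0 R) z" for n z
  proof (cases "norm z \<le> R")
    case True
    have "\<bar>f (z + (1 / real (Suc n)) *\<^sub>R h) - f z\<bar> \<le> C * norm ((1 / real (Suc n)) *\<^sub>R h)"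
      using C(2)[of "z + (1 / real (Suc n)) *\<^sub>R h" z] by simp
    then have "real (Suc n) * \<bar>f (z + (1 / real (Suc n)) *\<^sub>R h) - f z\<bar>
        \<le> real (Suc n) * (C * norm ((1 / real (Suc n)) *\<^sub>R h))"
      by (intro mult_left_mono) auto
    then show ?thesis using True by (simp add: diff_quot_def abs_mult del: of_nat_Suc)
  next
    case False
    have "norm ((1 / real (Suc n)) *\<^sub>R h) \<le> norm h"
      by (simp add: divide_le_eq mult_le_cancel_left1 field_simps)
    moreover have "norm z \<le> norm (z + (1 / real (Suc n)) *\<^sub>R h) + norm ((1 / real (Suc n)) *\<^sub>R h)"
      by (metis add_diff_cancel_right' norm_triangle_ineq4)
    ultimately have "norm (z + (1 / real (Suc n)) *\<^sub>R h) > r" "norm z > r"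
      using False norm_ge_zero[of h] unfolding R_def by linarith+
    then show ?thesis using out by (simp add: diff_quot_def False)
  qed
  have 2: "\<bar>grad f z \<bullet> h\<bar> \<le> C * norm h * indicator (cball 0 R) z" for z
    using LIMSEQ_le_const2[OF tendsto_rabs[OF diff_quot_tendsto[OF f, of h z]]] 1 by blast
  show ?thesis using that[OF 1 2] .
qed

lemma integrable_indicator_cball: "integrable lborel (indicator (cball 0 R) :: 'a::euclidean_space \<Rightarrow> real)"
proof (rule integrable_real_indicator)
  show "emeasure lborel (cball (0::'a) R) < \<infinity>" by (rule emeasure_bounded_finite) simp
qed simp

lemma integral_diff_quot_sq:
  assumes f: "f \<in> test_functions Z"
  shows "(\<lambda>n. \<integral>z. (diff_quot f h n z)\<^sup>2 \<partial>lborel) \<longlonglongrightarrow> (\<integral>z. (grad f z \<bullet> h)\<^sup>2 \<partial>lborel)"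
proof -
  obtain B R where B: "\<And>n z. \<bar>diff_quot f h n z\<bar> \<le> B * indicator (cball 0 R) z"
    by (rule diff_quot_bound[OF f]) blast
  have [measurable]: "f \<in> borel_measurable borel" using test_function_borel[OF f] .
  have [measurable]: "grad f \<in> borel_measurable borel"
    by (intro borel_measurable_continuous_onI grad_continuous test_functions_Ck[OF f])
  show ?thesis
  proof (rule integral_dominated_convergence[where w = "\<lambda>z. B\<^sup>2 * indicator (cball 0 R) z"])
    show "AE z in lborel. (\<lambda>n. (diff_quot f h n z)\<^sup>2) \<longlonglongrightarrow> (grad f z \<bullet> h)\<^sup>2"
      by (intro AE_I2 tendsto_power diff_quot_tendsto[OF f])
    show "AE z in lborel. norm ((diff_quot f h n z)\<^sup>2) \<le> B\<^sup>2 * indicator (cball 0 R) z" for n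
    proof (rule AE_I2)
      fix z
      have "\<bar>diff_quot f h n z\<bar>\<^sup>2 \<le> (B * indicator (cball 0 R) z)\<^sup>2"
        using B by (intro power_mono) auto
      then show "norm ((diff_quot f h n z)\<^sup>2) \<le> B\<^sup>2 * indicator (cball 0 R) z"
        by (auto simp: power_mult_distrib indicator_def)
    qed
  qed (auto simp: diff_quot_def integrable_indicator_cball)
qed

text \<open>The integrals of the difference quotients vanish by translation invariance.\<close>

lemma integral_pd_eq_0:
  assumes f: "f \<in> test_functions Z"
  shows "(\<integral>z. grad f z \<bullet> h \<partial>lborel) = 0"
proof -
  obtain B R where B: "\<And>n z. \<bar>diff_quot f h n z\<bar> \<le> B * indicator (cball 0 R) z"
    by (rule diff_quot_bound[OF f]) blast
  have [measurable]: "f \<in> borel_measurable borel" using test_function_borel[OF f] .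
  have [measurable]: "grad f \<in> borel_measurable borel"
    by (intro borel_measurable_continuous_onI grad_continuous test_functions_Ck[OF f])
  have "(\<lambda>n. \<integral>z. diff_quot f h n z \<partial>lborel) \<longlonglongrightarrow> (\<integral>z. grad f z \<bullet> h \<partial>lborel)"
  proof (rule integral_dominated_convergence[where w = "\<lambda>z. B * indicator (cball 0 R) z"])
    show "AE z in lborel. (\<lambda>n. diff_quot f h n z) \<longlonglongrightarrow> grad f z \<bullet> h"
      by (intro AE_I2 diff_quot_tendsto[OF f])
  qed (use B in \<open>auto simp: diff_quot_def integrable_indicator_cball\<close>)
  moreover have "(\<integral>z. diff_quot f h n z \<partial>lborel) = 0" for n
  proof -
    obtain K where K: "compact K" "\<And>x. x \<notin> K \<Longrightarrow> f x = 0"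
      using test_functionsE[OF f] by metis
    have "integrable lborel (\<lambda>x. indicator K x *\<^sub>R f x)"
      by (intro borel_integrable_compact K continuous_on_subset[OF Ck_continuous[OF test_functions_Ck[OF f]]])
        simp
    moreover have "(\<lambda>x. indicator K x *\<^sub>R f x) = f" using K(2) by (auto simp: indicator_def fun_eq_iff)
    ultimately have i: "integrable lborel f" by simp
    show ?thesis
      unfolding diff_quot_def using i integrable_lborel_translate[OF i]
      by (simp del: of_nat_Suc)
  qed
  ultimately show ?thesis by (simp add: LIMSEQ_const_iff)
qed

section \<open>Functions in \<open>H\<^sup>1\<^sub>0\<close>\<close>

text \<open>Identities and estimates pass in this way from test functions to \<open>H\<^sup>1\<^sub>0\<close>.\<close>

lemma H10_closure_property:
  assumes "closed {x. P x}" "\<And>f. f \<in> test_functions Z \<Longrightarrow> P (abs_L2 f, abs_L2 (grad f))" "x \<in> H10 Z"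
  shows "P x"
proof -
  have "H10 Z \<subseteq> {x. P x}"
    unfolding H10_def by (rule closure_minimal) (use assms in auto)
  then show ?thesis using assms(3) by blast
qed

lemma test_in_H10: "f \<in> test_functions Z \<Longrightarrow> (abs_L2 f, abs_L2 (grad f)) \<in> H10 Z"
  unfolding H10_def by (rule closure_subset[THEN subsetD]) blast

lemma closed_H10: "closed (H10 Z)"
  by (simp add: H10_def)

lemma subspace_closure_normed:
  fixes S :: "'a::real_normed_vector set"
  assumes S: "subspace S"
  shows "subspace (closure S)"
proof (rule subspaceI)
  show "0 \<in> closure S" using subspace_0[OF S] closure_subset by blast
  fix x assume x: "x \<in> closure S"
  then obtain X where X: "\<And>n. X n \<in> S" "X \<longlonglongrightarrow> x" by (auto simp: closure_sequential)
  show "c *\<^sub>R x \<in> closure S" for c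
    unfolding closure_sequential
    by (rule exI[of _ "\<lambda>n. c *\<^sub>R X n"]) (auto intro!: tendsto_intros X subspace_scale[OF S])
  fix y assume y: "y \<in> closure S"
  then obtain Y where Y: "\<And>n. Y n \<in> S" "Y \<longlonglongrightarrow> y" by (auto simp: closure_sequential)
  show "x + y \<in> closure S"
    unfolding closure_sequential
    by (rule exI[of _ "\<lambda>n. X n + Y n"]) (auto intro!: tendsto_intros X Y subspace_add[OF S])
qed

lemma grad_add: "(\<And>n. Ck n f) \<Longrightarrow> (\<And>n. Ck n g) \<Longrightarrow> grad (\<lambda>x. f x + g x) z = grad f z + grad g z"
  unfolding grad_def by (simp add: pd_add scaleR_add_left sum.distrib)

lemma grad_scale: "(\<And>n. Ck n f) \<Longrightarrow> grad (\<lambda>x. c * f x) z = c *\<^sub>R grad f z"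
proof -
  assume f: "\<And>n. Ck n f"
  have "pd b (\<lambda>x. c * f x) z = c * pd b f z" for b
    using pd_mult[of "\<lambda>_. c" f, where x = z and b = b] pd_mult[of f "\<lambda>_. c"] f
    by (simp add: Ck_const)
  then show ?thesis by (simp add: grad_def scaleR_sum_right)
qed

lemma subspace_H10:
  fixes Z :: "'a::euclidean_space set"
  shows "subspace (H10 Z)"
  unfolding H10_def
proof (rule subspace_closure_normed, rule subspaceI)
  let ?i = "\<lambda>f::'a \<Rightarrow> real. (abs_L2 f, abs_L2 (grad f))"
  have z: "(\<lambda>_. 0) \<in> test_functions Z"
    by (rule test_functionsI[where K = "{}"]) (auto intro: Ck_const)
  have "grad (\<lambda>_::'a. 0::real) = (\<lambda>_. 0)"
    using grad_scale[of "\<lambda>_. 0" 0] by (auto simp: Ck_const fun_eq_iff)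
  then have "0 = ?i (\<lambda>_. 0)" by (simp add: zero_prod_def zero_L2_def)
  then show "0 \<in> ?i ` test_functions Z" using z by blast
next
  let ?i = "\<lambda>f::'a \<Rightarrow> real. (abs_L2 f, abs_L2 (grad f))"
  fix x y assume "x \<in> ?i ` test_functions Z" "y \<in> ?i ` test_functions Z"
  then obtain f g where fg: "f \<in> test_functions Z" "g \<in> test_functions Z" "x = ?i f" "y = ?i g"
    by blast
  have "grad (\<lambda>z. f z + g z) = (\<lambda>z. grad f z + grad g z)"
    using grad_add[OF test_functions_Ck[OF fg(1)] test_functions_Ck[OF fg(2)]] by (rule ext)
  then have "x + y = ?i (\<lambda>z. f z + g z)"
    using fg by (simp add: add_abs_L2 test_functions_sq_integrable)
  then show "x + y \<in> ?i ` test_functions Z" using fg test_functions_add by blast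
next
  let ?i = "\<lambda>f::'a \<Rightarrow> real. (abs_L2 f, abs_L2 (grad f))"
  fix x c assume "x \<in> ?i ` test_functions Z"
  then obtain f where f: "f \<in> test_functions Z" "x = ?i f" by blast
  have "grad (\<lambda>z. c * f z) = (\<lambda>z. c *\<^sub>R grad f z)"
    using grad_scale[OF test_functions_Ck[OF f(1)]] by (rule ext)
  then have "c *\<^sub>R x = ?i (\<lambda>z. c * f z)"
    using f by (simp add: scaleR_abs_L2 test_functions_sq_integrable)
  then show "c *\<^sub>R x \<in> ?i ` test_functions Z" using f test_functions_scale by blast
qed

lemma continuous_fst_snd [continuous_intros]:
  "continuous_on S (fst :: 'a::euclidean_space H1 \<Rightarrow> _)"
  "continuous_on S (snd :: 'a::euclidean_space H1 \<Rightarrow> _)"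
  by (intro continuous_intros)+

text \<open>Both sides are continuous in \<open>x\<close>; for test functions the integral of the derivative of a product
  vanishes.\<close>

lemma H10_weak_gradient:
  assumes x: "x \<in> H10 Z" and g: "g \<in> test_functions Y" and b: "b \<in> Basis"
  shows "fst x \<bullet> abs_L2 (pd b g) = - (snd x \<bullet> abs_L2 (\<lambda>z. g z *\<^sub>R b))"
  using _ _ x
proof (rule H10_closure_property)
  show "closed {x. fst x \<bullet> abs_L2 (pd b g) = - (snd x \<bullet> abs_L2 (\<lambda>z. g z *\<^sub>R b))}"
    by (intro closed_Collect_eq continuous_intros)
next
  fix f assume f: "f \<in> test_functions Z"
  note Cf = test_functions_Ck[OF f] and Cg = test_functions_Ck[OF g]
  note sq = test_functions_sq_integrable[OF f]
    test_functions_sq_integrable(1)[OF test_functions_pd[OF g b]]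
  have [measurable]: "f \<in> borel_measurable borel" "g \<in> borel_measurable borel"
      "pd b g \<in> borel_measurable borel"
    using test_function_borel f g test_functions_pd[OF g b] by blast+
  have [measurable]: "grad f \<in> borel_measurable borel"
    by (intro borel_measurable_continuous_onI grad_continuous Cf)
  have sg: "sq_integrable (\<lambda>z. g z *\<^sub>R b)"
    using test_functions_sq_integrable(1)[OF g] b
    by (auto simp: sq_integrable_def power_mult_distrib)
  have i1: "integrable lebesgue (\<lambda>z. f z * pd b g z)"
    using sq_integrable_inner[OF sq(1,3)] by simp
  have i2: "integrable lebesgue (\<lambda>z. (grad f z \<bullet> b) * g z)"
    using sq_integrable_inner[OF sq(2) sg] by (simp add: mult.commute)
  have fg: "(\<lambda>z. f z * g z) \<in> test_functions Z" by (rule test_functions_mult[OF f Cg])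
  have "grad (\<lambda>z. f z * g z) z \<bullet> b = f z * pd b g z + (grad f z \<bullet> b) * g z" for z
    using pd_mult[OF Cf Cg, where b = b and x = z] grad_inner[OF test_functions_Ck[OF fg], of z b]
      grad_inner[OF Cf, of z b] by simp
  then have "0 = (\<integral>z. f z * pd b g z + (grad f z \<bullet> b) * g z \<partial>lborel)"
    using integral_pd_eq_0[OF fg, of b] by simp
  also have "\<dots> = (\<integral>z. f z * pd b g z + (grad f z \<bullet> b) * g z \<partial>lebesgue)"
    by (subst integral_completion) auto
  also have "\<dots> = (\<integral>z. f z * pd b g z \<partial>lebesgue) + (\<integral>z. (grad f z \<bullet> b) * g z \<partial>lebesgue)"
    by (rule Bochner_Integration.integral_add[OF i1 i2])
  finally show "fst (abs_L2 f, abs_L2 (grad f)) \<bullet> abs_L2 (pd b g)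
      = - (snd (abs_L2 f, abs_L2 (grad f)) \<bullet> abs_L2 (\<lambda>z. g z *\<^sub>R b))"
    by (simp add: inner_abs_L2 sq sg mult.commute)
qed

text \<open>Orthogonality to all functions that vanish on \<open>Z\<close> is a closed condition.\<close>

lemma H10_zero_outside:
  assumes Z: "Z \<in> sets lebesgue" and x: "x \<in> H10 Z"
  shows "AE z in lebesgue. z \<notin> Z \<longrightarrow> fun_of x z = 0"
proof -
  have "\<forall>g. sq_integrable g \<and> (\<forall>z\<in>Z. g z = 0) \<longrightarrow> fst x \<bullet> abs_L2 g = 0"
    using _ _ x
  proof (rule H10_closure_property)
    show "closed {x :: 'a H1. \<forall>g. sq_integrable g \<and> (\<forall>z\<in>Z. g z = 0) \<longrightarrow> fst x \<bullet> abs_L2 g = 0}"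
      by (intro closed_Collect_all closed_Collect_imp open_Collect_const closed_Collect_eq
          continuous_intros)
  next
    fix f assume f: "f \<in> test_functions Z"
    have "f z = 0" if "z \<notin> Z" for z using test_functionsE[OF f] that by (metis subset_iff)
    then have "(\<lambda>z. f z * g z) = (\<lambda>_. 0)" if "\<forall>z\<in>Z. g z = 0" for g
      using that by (metis mult_eq_0_iff)
    then show "\<forall>g. sq_integrable g \<and> (\<forall>z\<in>Z. g z = 0) \<longrightarrow>
        fst (abs_L2 f, abs_L2 (grad f)) \<bullet> abs_L2 g = 0"
      using test_functions_sq_integrable(1)[OF f] by (auto simp: inner_abs_L2)
  qed
  note * = this[rule_format]
  define g where "g z = indicator (- Z) z * fun_of x z" for z
  have mZ: "- Z \<in> sets lebesgue" using Z by (simp add: Compl_in_sets_lebesgue)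
  have g2: "(\<lambda>z. (norm (g z))\<^sup>2) = (\<lambda>z. indicator (- Z) z *\<^sub>R (fun_of x z)\<^sup>2)"
    by (auto simp: g_def indicator_def fun_eq_iff)
  have "g \<in> borel_measurable lebesgue"
    unfolding g_def[abs_def]
    by (intro borel_measurable_times borel_measurable_indicator mZ measurable_rep_L2)
  then have sg: "sq_integrable g"
    unfolding sq_integrable_def g2
    using mZ sq_integrable_rep_L2[of "fst x"] integrable_mult_indicator[OF mZ, of "\<lambda>z. (fun_of x z)\<^sup>2"]
    by (auto simp: sq_integrable_def)
  have "0 = fst x \<bullet> abs_L2 g" using *[of g] sg by (simp add: g_def)
  also have "\<dots> = (\<integral>z. fun_of x z \<bullet> g z \<partial>lebesgue)"
    using inner_abs_L2[OF sq_integrable_rep_L2[of "fst x"] sg] by (simp add: abs_rep_L2)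
  also have "\<dots> = (\<integral>z. (norm (g z))\<^sup>2 \<partial>lebesgue)"
    by (rule Bochner_Integration.integral_cong) (auto simp: g_def indicator_def power2_eq_square)
  finally have "AE z in lebesgue. (norm (g z))\<^sup>2 = 0"
    using sg by (subst (asm) eq_commute, subst (asm) integral_nonneg_eq_0_iff_AE)
      (auto simp: sq_integrable_def)
  then show ?thesis by eventually_elim (auto simp: g_def)
qed

lemma abs_L2_sum:
  "finite I \<Longrightarrow> (\<And>i. i \<in> I \<Longrightarrow> sq_integrable (f i)) \<Longrightarrow>
    sq_integrable (\<lambda>z. \<Sum>i\<in>I. f i z) \<and> abs_L2 (\<lambda>z. \<Sum>i\<in>I. f i z) = (\<Sum>i\<in>I. abs_L2 (f i))"
proof (induction I rule: finite_induct)
  case empty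
  then show ?case by (simp add: sq_integrable_zero zero_L2_def)
next
  case (insert i I)
  then show ?case by (auto simp: add_abs_L2[symmetric] intro: sq_integrable_add)
qed

text \<open>A second integration by parts moves all derivatives to the test function. From here on only the
  \<open>L\<^sup>2\<close> function \<open>fst e\<close> matters.\<close>

lemma eigenfunction_weak_equation:
  assumes e: "e \<in> eigenspace Z \<mu>" and g: "g \<in> test_functions Z"
  shows "fst e \<bullet> abs_L2 (\<lambda>z. laplacian g z + \<mu> * g z) = 0"
proof -
  have eH: "e \<in> H10 Z" using e by (simp add: eigenspace_def)
  note pdt = test_functions_pd[OF g]
  have sgb: "sq_integrable (\<lambda>z. pd b g z *\<^sub>R b)" if "b \<in> Basis" for b
    using test_functions_sq_integrable(1)[OF pdt[OF that]] that
    by (auto simp: sq_integrable_def power_mult_distrib)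
  have sl: "sq_integrable (pd b (pd b g))" if "b \<in> Basis" for b
    by (rule test_functions_sq_integrable(1)[OF test_functions_pd[OF pdt[OF that] that]])
  note lap = abs_L2_sum[of Basis "\<lambda>b. pd b (pd b g)", OF _ sl]
  have "\<mu> * (fst e \<bullet> abs_L2 g) = snd e \<bullet> abs_L2 (grad g)"
    using e test_in_H10[OF g] by (auto simp: eigenspace_def)
  also have "abs_L2 (grad g) = (\<Sum>b\<in>Basis. abs_L2 (\<lambda>z. pd b g z *\<^sub>R b))"
    using abs_L2_sum[of Basis "\<lambda>b z. pd b g z *\<^sub>R b"] sgb by (simp add: grad_def[abs_def])
  also have "snd e \<bullet> \<dots> = (\<Sum>b\<in>Basis. - (fst e \<bullet> abs_L2 (pd b (pd b g))))"
    unfolding inner_sum_right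
    by (rule sum.cong) (simp_all add: H10_weak_gradient[OF eH pdt])
  also have "\<dots> = - (fst e \<bullet> abs_L2 (laplacian g))"
    using lap by (simp add: sum_negf inner_sum_right laplacian_def[abs_def])
  finally have "fst e \<bullet> abs_L2 (laplacian g) + \<mu> * (fst e \<bullet> abs_L2 g) = 0" by simp
  moreover have "abs_L2 (\<lambda>z. laplacian g z + \<mu> * g z) = abs_L2 (laplacian g) + \<mu> *\<^sub>R abs_L2 g"
  proof -
    have "sq_integrable (laplacian g)" using lap by (simp add: laplacian_def[abs_def])
    from add_abs_L2[OF this sq_integrable_scaleR[OF test_functions_sq_integrable(1)[OF g], of \<mu>]]
    show ?thesis by (simp add: scaleR_abs_L2[OF test_functions_sq_integrable(1)[OF g]])
  qed
  ultimately show ?thesis by (simp add: inner_add_right)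
qed

lemma translate_multiple:
  "norm (translate (real k *\<^sub>R h) x - x) \<le> real k * norm (translate h x - x)"
proof (induction k)
  case 0
  show ?case by (simp add: translate_def abs_borel_rep)
next
  case (Suc k)
  have "translate (real (Suc k) *\<^sub>R h) x - x
      = translate h (translate (real k *\<^sub>R h) x - x) + (translate h x - x)"
    by (simp add: translate_diff translate_add algebra_simps)
  then have "norm (translate (real (Suc k) *\<^sub>R h) x - x)
      \<le> norm (translate h (translate (real k *\<^sub>R h) x - x)) + norm (translate h x - x)"
    by (metis norm_triangle_ineq)
  with Suc show ?case by (simp add: norm_translate algebra_simps)
qed

text \<open>The \<open>L\<^sup>2\<close> modulus of continuity is subadditive along multiples of a step, so it is at most the
  limit of the difference quotients.\<close>

lemma H10_translate:
  assumes x: "x \<in> H10 Z"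
  shows "norm (translate h (fst x) - fst x) \<le> norm h * norm (snd x)"
  using _ _ x
proof (rule H10_closure_property)
  show "closed {x :: 'a H1. norm (translate h (fst x) - fst x) \<le> norm h * norm (snd x)}"
    by (intro closed_Collect_le continuous_intros
        continuous_on_compose2[OF continuous_translate[of UNIV]]) auto
next
  fix f assume f: "f \<in> test_functions Z"
  have fb [measurable]: "f \<in> borel_measurable borel" using test_function_borel[OF f] .
  have gb [measurable]: "grad f \<in> borel_measurable borel"
    by (intro borel_measurable_continuous_onI grad_continuous test_functions_Ck[OF f])
  note sq = test_functions_sq_integrable[OF f]
  let ?F = "abs_L2 f"
  have "(norm (translate h ?F - ?F))\<^sup>2 \<le> (\<integral>z. (diff_quot f h n z)\<^sup>2 \<partial>lborel)" for n
  proof -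
    let ?h = "(1 / real (Suc n)) *\<^sub>R h"
    have eq: "real (Suc n) *\<^sub>R (translate ?h ?F - ?F) = abs_L2 (diff_quot f h n)"
      by (simp add: translate_abs sq diff_abs_L2 scaleR_abs_L2 sq_integrable_translate
          sq_integrable_diff diff_quot_def[abs_def] del: of_nat_Suc)
    have sd: "sq_integrable (diff_quot f h n)"
      using sq_integrable_scaleR[OF sq_integrable_diff[OF sq_integrable_translate[OF fb sq(1), of ?h] sq(1)],
          of "real (Suc n)"]
      by (simp add: diff_quot_def[abs_def] del: of_nat_Suc)
    have "norm (translate h ?F - ?F) \<le> real (Suc n) * norm (translate ?h ?F - ?F)"
      using translate_multiple[of "Suc n" ?h ?F] by (simp del: of_nat_Suc)
    also have "\<dots> = norm (abs_L2 (diff_quot f h n))"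
      unfolding eq[symmetric] by (simp del: of_nat_Suc)
    finally have "(norm (translate h ?F - ?F))\<^sup>2 \<le> (norm (abs_L2 (diff_quot f h n)))\<^sup>2"
      by (intro power_mono) auto
    also have "\<dots> = (\<integral>z. (diff_quot f h n z)\<^sup>2 \<partial>lebesgue)"
      by (simp add: norm_abs_L2[OF sd])
    also have "\<dots> = (\<integral>z. (diff_quot f h n z)\<^sup>2 \<partial>lborel)"
      by (rule integral_completion) (simp add: diff_quot_def)
    finally show ?thesis .
  qed
  then have "(norm (translate h ?F - ?F))\<^sup>2 \<le> (\<integral>z. (grad f z \<bullet> h)\<^sup>2 \<partial>lborel)"
    by (intro LIMSEQ_le_const[OF integral_diff_quot_sq[OF f]]) blast
  also have "\<dots> \<le> (\<integral>z. (norm h)\<^sup>2 * (norm (grad f z))\<^sup>2 \<partial>lborel)"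
  proof (rule integral_mono_AE')
    have "integrable lborel (\<lambda>z. (norm (grad f z))\<^sup>2)"
      using sq(2) by (simp add: sq_integrable_def integrable_completion)
    then show "integrable lborel (\<lambda>z. (norm h)\<^sup>2 * (norm (grad f z))\<^sup>2)" by simp
    show "AE z in lborel. (grad f z \<bullet> h)\<^sup>2 \<le> (norm h)\<^sup>2 * (norm (grad f z))\<^sup>2"
    proof (rule AE_I2)
      fix z
      have "\<bar>grad f z \<bullet> h\<bar>\<^sup>2 \<le> (norm (grad f z) * norm h)\<^sup>2"
        by (intro power_mono Cauchy_Schwarz_ineq2) auto
      then show "(grad f z \<bullet> h)\<^sup>2 \<le> (norm h)\<^sup>2 * (norm (grad f z))\<^sup>2"
        by (simp add: power_mult_distrib mult.commute)
    qed
  qed auto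
  also have "\<dots> = (norm h)\<^sup>2 * (norm (abs_L2 (grad f)))\<^sup>2"
    by (simp add: norm_abs_L2[OF sq(2)] integral_completion)
  finally have "(norm (translate h ?F - ?F))\<^sup>2 \<le> (norm h * norm (abs_L2 (grad f)))\<^sup>2"
    by (simp add: power_mult_distrib)
  then show "norm (translate h (fst (abs_L2 f, abs_L2 (grad f))) - fst (abs_L2 f, abs_L2 (grad f)))
      \<le> norm h * norm (snd (abs_L2 f, abs_L2 (grad f)))"
    by (auto intro: power2_le_imp_le)
qed

section \<open>Compactness and finite-dimensional eigenspaces\<close>

text \<open>The difference of the two sides is the variance of \<open>f\<close> over the ball, multiplied by its volume.\<close>

lemma ball_variance:
  fixes f :: "'a::euclidean_space \<Rightarrow> real" and p :: 'a and r c :: real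
  assumes f: "continuous_on UNIV f" and r: "r > 0"
  defines "\<beta> \<equiv> measure lborel (ball p r)"
  defines "m \<equiv> (\<integral>y. indicator (ball p r) y * f y \<partial>lborel) / \<beta>"
  shows "ennreal (\<beta> * (c - m)\<^sup>2) \<le> (\<integral>\<^sup>+y. ennreal (indicator (ball p r) y * (c - f y)\<^sup>2) \<partial>lborel)"
proof -
  have \<beta>: "\<beta> > 0" using content_ball_pos[OF r, of p] by (simp add: \<beta>_def)
  have [measurable]: "f \<in> borel_measurable borel" by (rule borel_measurable_continuous_onI[OF f])
  have int: "integrable lborel (\<lambda>y. indicator (ball p r) y * g y)" if g: "continuous_on UNIV g"
    for g :: "'a \<Rightarrow> real"
  proof -
    have [measurable]: "g \<in> borel_measurable borel" by (rule borel_measurable_continuous_onI[OF g])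
    have "integrable lborel (\<lambda>y. indicator (cball p r) y *\<^sub>R g y)"
      by (intro borel_integrable_compact continuous_on_subset[OF g]) auto
    then show ?thesis
      by (rule Bochner_Integration.integrable_bound) (auto simp: indicator_def)
  qed
  have i0: "(\<integral>y. indicator (ball p r) y \<partial>lborel) = \<beta>" by (simp add: \<beta>_def)
  have i1: "(\<integral>y. indicator (ball p r) y * f y \<partial>lborel) = \<beta> * m" using \<beta> by (simp add: m_def)
  define q where "q = (\<integral>y. indicator (ball p r) y * (f y)\<^sup>2 \<partial>lborel)"
  have ex: "(\<integral>y. indicator (ball p r) y * (a - f y)\<^sup>2 \<partial>lborel) = a\<^sup>2 * \<beta> - 2 * a * (\<beta> * m) + q" for a
  proof -
    have "(\<integral>y. indicator (ball p r) y * (a - f y)\<^sup>2 \<partial>lborel)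
        = (\<integral>y. a\<^sup>2 * (indicator (ball p r) y * 1) - 2 * a * (indicator (ball p r) y * f y)
          + indicator (ball p r) y * (f y)\<^sup>2 \<partial>lborel)"
      by (rule Bochner_Integration.integral_cong) (auto simp: power2_diff algebra_simps)
    also have "\<dots> = a\<^sup>2 * (\<integral>y. indicator (ball p r) y * 1 \<partial>lborel)
        - 2 * a * (\<integral>y. indicator (ball p r) y * f y \<partial>lborel) + q"
      unfolding q_def
      by (subst Bochner_Integration.integral_add Bochner_Integration.integral_diff
          | intro integrable_mult_right int Bochner_Integration.integrable_diff continuous_intros f
          | simp)+
    finally show ?thesis by (simp add: i1 \<beta>_def)
  qed
  have "0 \<le> (\<integral>y. indicator (ball p r) y * (m - f y)\<^sup>2 \<partial>lborel)" by simp
  then have "0 \<le> q - \<beta> * m\<^sup>2" unfolding ex by (simp add: power2_eq_square algebra_simps)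
  then have "\<beta> * (c - m)\<^sup>2 \<le> c\<^sup>2 * \<beta> - 2 * c * (\<beta> * m) + q"
    by (simp add: power2_eq_square algebra_simps)
  also have "\<dots> = (\<integral>y. indicator (ball p r) y * (c - f y)\<^sup>2 \<partial>lborel)" by (simp add: ex)
  finally have "ennreal (\<beta> * (c - m)\<^sup>2) \<le> ennreal (\<integral>y. indicator (ball p r) y * (c - f y)\<^sup>2 \<partial>lborel)"
    by (rule ennreal_leI)
  also have "\<dots> = (\<integral>\<^sup>+y. ennreal (indicator (ball p r) y * (c - f y)\<^sup>2) \<partial>lborel)"
    by (subst nn_integral_eq_integral) (auto intro!: int continuous_intros f)
  finally show ?thesis .
qed

lemma nn_integral_lborel_translate:
  assumes [measurable]: "f \<in> borel_measurable borel"
  shows "(\<integral>\<^sup>+y. f y \<partial>lborel) = (\<integral>\<^sup>+h. f (z + h :: 'a::euclidean_space) \<partial>lborel)"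
proof -
  have "(\<integral>\<^sup>+y. f y \<partial>lborel) = (\<integral>\<^sup>+y. f y \<partial>(distr lborel borel ((+) z)))"
    by (simp only: lborel_distr_plus)
  also have "\<dots> = (\<integral>\<^sup>+h. f (z + h) \<partial>lborel)" by (rule nn_integral_distr) auto
  finally show ?thesis .
qed

lemma ennreal_mult_plus:
  "0 \<le> x \<Longrightarrow> 0 \<le> y \<Longrightarrow> 0 \<le> w \<Longrightarrow> ennreal (x * y + w) = ennreal x * ennreal y + ennreal w"
  by (simp add: ennreal_plus ennreal_mult)

text \<open>Rellich's theorem in quantitative form. Near each of finitely many points covering \<open>Z\<close>,
  replace the function by its mean over a ball of radius \<open>2 \<epsilon>\<close>; by the translation estimate the
  error is at most a multiple of \<open>\<epsilon>\<close> times the norm of the gradient, with a factor that depends on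
  the dimension only.\<close>

lemma H10_compactness:
  fixes Z :: "'a::euclidean_space set"
  assumes Z: "bounded Z" and \<delta>: "\<delta> > 0"
  shows "\<exists>(F :: 'a set) g. finite F \<and>
    (\<forall>x\<in>H10 Z. (norm (fst x))\<^sup>2 \<le> \<delta> * (norm (snd x))\<^sup>2 + (\<Sum>p\<in>F. (g p \<bullet> fst x)\<^sup>2))"
proof -
  have fin: "emeasure lborel (ball p r) < top" "emeasure lborel (ball p r) \<noteq> top" for p :: 'a and r
    using emeasure_bounded_finite[OF bounded_ball, of p r] by auto
  define vol where "vol r = measure lborel (ball (0::'a) r)" for r
  have vol: "vol r > 0" "measure lborel (ball p r) = vol r" if "r > 0" for r and p :: 'a
    using that content_ball_pos[OF that, of "0::'a"] content_ball_conv_unit_ball[of r p]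
      content_ball_conv_unit_ball[of r "0::'a"] by (simp_all add: vol_def)
  have vol_scale: "vol (c * r) = c ^ DIM('a) * vol r" if "c > 0" "r > 0" for c r
    unfolding vol_def using that content_ball_conv_unit_ball[of "c * r" "0::'a"]
      content_ball_conv_unit_ball[of r "0::'a"] by (simp add: power_mult_distrib)
  define A where "A = 2 * ((3/2) ^ DIM('a) * 9 :: real)"
  have A: "A > 0" by (simp add: A_def)
  define \<epsilon> where "\<epsilon> = sqrt (\<delta> / A)"
  have \<epsilon>: "\<epsilon> > 0" using A \<delta> by (simp add: \<epsilon>_def)
  have \<epsilon>A: "A * \<epsilon>\<^sup>2 = \<delta>" using A \<delta> by (simp add: \<epsilon>_def)
  have v32: "vol (3 * \<epsilon>) = (3/2) ^ DIM('a) * vol (2 * \<epsilon>)"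
    using vol_scale[of "3/2" "2 * \<epsilon>"] \<epsilon> by simp
  have "compact (closure Z)" using Z by simp
  then obtain F where F: "finite F" "closure Z \<subseteq> (\<Union>p\<in>F. ball p \<epsilon>)"
    using compactE_image[of "closure Z" "closure Z" "\<lambda>p. ball p \<epsilon>"] \<epsilon>
    by (metis (no_types, lifting) UN_I centre_in_ball open_ball subsetI)
  define \<beta> where "\<beta> = vol (2 * \<epsilon>)"
  have \<beta>: "\<beta> > 0" using vol \<epsilon> by (simp add: \<beta>_def)
  define I where "I p = (indicator (ball p (2 * \<epsilon>)) :: 'a \<Rightarrow> real)" for p
  have sI: "sq_integrable (I p)" for p
  proof -
    have "integrable lborel (I p)" unfolding I_def
      by (intro integrable_real_indicator) (use fin in auto)
    moreover have "(\<lambda>z. (I p z)\<^sup>2) = I p" by (auto simp: I_def indicator_def fun_eq_iff)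
    ultimately show ?thesis by (subst sq_integrable_lborel) (auto simp: I_def)
  qed
  define c where "c = sqrt (2 * vol \<epsilon>) / \<beta>"
  define g where "g p = c *\<^sub>R abs_L2 (I p)" for p
  have main: "(norm (abs_L2 f))\<^sup>2 \<le> \<delta> * (norm (abs_L2 (grad f)))\<^sup>2 + (\<Sum>p\<in>F. (g p \<bullet> abs_L2 f)\<^sup>2)"
    if f: "f \<in> test_functions Z" for f
  proof -
    have fc: "continuous_on UNIV f" by (rule Ck_continuous[OF test_functions_Ck[OF f, of 0]])
    have [measurable]: "f \<in> borel_measurable borel" using test_function_borel[OF f] .
    note sq = test_functions_sq_integrable[OF f]
    define m where "m p = (\<integral>y. indicator (ball p (2 * \<epsilon>)) y * f y \<partial>lborel) / \<beta>" for p
    have gm: "(g p \<bullet> abs_L2 f)\<^sup>2 = 2 * vol \<epsilon> * (m p)\<^sup>2" for p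
    proof -
      have "abs_L2 (I p) \<bullet> abs_L2 f = (\<integral>y. I p y * f y \<partial>lebesgue)"
        by (simp add: inner_abs_L2 sI sq)
      also have "\<dots> = (\<integral>y. I p y * f y \<partial>lborel)"
        unfolding I_def
        by (intro integral_completion borel_measurable_times borel_measurable_indicator) simp_all
      finally have "g p \<bullet> abs_L2 f = c * (\<beta> * m p)" using \<beta> by (simp add: g_def m_def I_def)
      then show ?thesis using \<beta> vol(1)[OF \<epsilon>] by (simp add: c_def power_mult_distrib)
    qed
    define W where "W z = (\<integral>\<^sup>+h. ennreal (indicator (ball 0 (3 * \<epsilon>)) h * (f z - f (z + h))\<^sup>2) \<partial>lborel)" for z
    have joint: "(\<lambda>(z, h). ennreal (indicator (ball 0 (3 * \<epsilon>)) h * (f z - f (z + h))\<^sup>2))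
        \<in> borel_measurable (lborel \<Otimes>\<^sub>M lborel)"
    proof -
      have "(\<lambda>x. (f (fst x) - f (fst x + snd x))\<^sup>2) \<in> borel_measurable borel"
        by (intro borel_measurable_continuous_onI continuous_intros continuous_on_compose2[OF fc]) auto
      moreover have "(indicator (UNIV \<times> ball 0 (3 * \<epsilon>)) :: 'a \<times> 'a \<Rightarrow> real) \<in> borel_measurable borel"
        by (intro borel_measurable_indicator borel_open open_Times) auto
      ultimately have "(\<lambda>x. ennreal (indicator (UNIV \<times> ball 0 (3 * \<epsilon>)) x
          * (f (fst x) - f (fst x + snd x))\<^sup>2)) \<in> borel_measurable (borel :: ('a \<times> 'a) measure)"
        by (intro measurable_compose[OF _ measurable_ennreal] borel_measurable_times)
      then show ?thesis
        unfolding lborel_prod by (simp add: case_prod_beta' indicator_times)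
    qed
    have W_meas [measurable]: "W \<in> borel_measurable borel"
      using lborel.borel_measurable_nn_integral[OF joint] by (simp add: W_def[abs_def])
    have pt: "ennreal ((f z)\<^sup>2) \<le> ennreal (2 / \<beta>) * W z
        + (\<Sum>p\<in>F. ennreal (2 * (m p)\<^sup>2) * indicator (ball p \<epsilon>) z)" for z
    proof (cases "z \<in> Z")
      case False
      then have "f z = 0" using test_functionsE[OF f] by (metis subset_iff)
      then show ?thesis by simp
    next
      case True
      then have "z \<in> (\<Union>p\<in>F. ball p \<epsilon>)" using F(2) closure_subset[of Z] by (meson subsetD)
      then obtain p where p: "p \<in> F" "z \<in> ball p \<epsilon>" by (rule UN_E)
      have "ennreal (\<beta> * (f z - m p)\<^sup>2)
          \<le> (\<integral>\<^sup>+y. ennreal (indicator (ball p (2 * \<epsilon>)) y * (f z - f y)\<^sup>2) \<partial>lborel)"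
        using ball_variance[OF fc, of "2 * \<epsilon>" p "f z"] \<epsilon> vol(2)[of "2 * \<epsilon>" p]
        by (simp add: m_def \<beta>_def)
      also have "\<dots> = (\<integral>\<^sup>+h. ennreal (indicator (ball p (2 * \<epsilon>)) (z + h) * (f z - f (z + h))\<^sup>2) \<partial>lborel)"
        by (rule nn_integral_lborel_translate)
          (intro measurable_compose[OF _ measurable_ennreal] borel_measurable_times
            borel_measurable_indicator borel_measurable_power borel_measurable_diff, simp_all)
      also have "\<dots> \<le> W z"
        unfolding W_def
      proof (intro nn_integral_mono ennreal_leI mult_right_mono)
        fix h
        have "dist 0 h \<le> dist (z + h) p + dist p z"
          using dist_triangle[of "z + h" z p] by (simp add: dist_norm)
        then show "indicat_real (ball p (2 * \<epsilon>)) (z + h) \<le> indicat_real (ball 0 (3 * \<epsilon>)) h"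
          using p(2) by (auto simp: indicator_def dist_commute)
      qed auto
      finally have w: "ennreal (\<beta> * (f z - m p)\<^sup>2) \<le> W z" .
      have "(f z)\<^sup>2 \<le> 2 * (f z - m p)\<^sup>2 + 2 * (m p)\<^sup>2"
        using zero_le_power2[of "f z - 2 * m p"] by (simp add: power2_eq_square algebra_simps)
      also have "\<dots> = 2 / \<beta> * (\<beta> * (f z - m p)\<^sup>2) + 2 * (m p)\<^sup>2" using \<beta> by simp
      finally have "ennreal ((f z)\<^sup>2) \<le> ennreal (2 / \<beta> * (\<beta> * (f z - m p)\<^sup>2) + 2 * (m p)\<^sup>2)"
        by (rule ennreal_leI)
      also have "\<dots> = ennreal (2 / \<beta>) * ennreal (\<beta> * (f z - m p)\<^sup>2) + ennreal (2 * (m p)\<^sup>2)"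
        by (rule ennreal_mult_plus) (use \<beta> in auto)
      also have "\<dots> \<le> ennreal (2 / \<beta>) * W z
          + (\<Sum>p\<in>F. ennreal (2 * (m p)\<^sup>2) * indicator (ball p \<epsilon>) z)"
      proof (intro add_mono mult_left_mono w)
        have "ennreal (2 * (m p)\<^sup>2) = (\<Sum>p\<in>{p}. ennreal (2 * (m p)\<^sup>2) * indicator (ball p \<epsilon>) z)"
          using p(2) by simp
        also have "\<dots> \<le> (\<Sum>p\<in>F. ennreal (2 * (m p)\<^sup>2) * indicator (ball p \<epsilon>) z)"
          using p(1) F(1) by (intro sum_mono2) auto
        finally show "ennreal (2 * (m p)\<^sup>2) \<le> (\<Sum>p\<in>F. ennreal (2 * (m p)\<^sup>2) * indicator (ball p \<epsilon>) z)" .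
      qed auto
      finally show ?thesis .
    qed
    have Wint: "(\<integral>\<^sup>+z. W z \<partial>lborel) \<le> ennreal (vol (3 * \<epsilon>) * (9 * \<epsilon>\<^sup>2 * (norm (abs_L2 (grad f)))\<^sup>2))"
    proof -
      let ?k = "(3 * \<epsilon> * norm (abs_L2 (grad f)))\<^sup>2"
      have "(\<integral>\<^sup>+z. W z \<partial>lborel)
          = (\<integral>\<^sup>+h. \<integral>\<^sup>+z. ennreal (indicator (ball 0 (3 * \<epsilon>)) h * (f z - f (z + h))\<^sup>2) \<partial>lborel \<partial>lborel)"
        unfolding W_def by (rule lborel_pair.Fubini'[OF joint, symmetric])
      also have "\<dots> \<le> (\<integral>\<^sup>+(h::'a). ennreal ?k * indicator (ball 0 (3 * \<epsilon>)) h \<partial>lborel)"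
      proof (rule nn_integral_mono)
        fix h :: 'a
        show "(\<integral>\<^sup>+z. ennreal (indicator (ball 0 (3 * \<epsilon>)) h * (f z - f (z + h))\<^sup>2) \<partial>lborel)
            \<le> ennreal ?k * indicator (ball 0 (3 * \<epsilon>)) h"
        proof (cases "h \<in> ball 0 (3 * \<epsilon>)")
          case True
          have sd: "sq_integrable (\<lambda>z. f (z + h) - f z)"
            by (intro sq_integrable_diff sq_integrable_translate sq test_function_borel[OF f])
          have "(\<integral>\<^sup>+z. ennreal ((f (z + h) - f z)\<^sup>2) \<partial>lborel)
              = ennreal (\<integral>z. (f (z + h) - f z)\<^sup>2 \<partial>lborel)"
            using sd by (intro nn_integral_eq_integral) (auto simp: sq_integrable_lborel)
          also have "(\<integral>z. (f (z + h) - f z)\<^sup>2 \<partial>lborel) = (norm (abs_L2 (\<lambda>z. f (z + h) - f z)))\<^sup>2"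
            by (simp add: norm_abs_L2[OF sd] integral_completion)
          also have "abs_L2 (\<lambda>z. f (z + h) - f z) = translate h (abs_L2 f) - abs_L2 f"
            by (simp add: translate_abs sq diff_abs_L2 sq_integrable_translate)
          also have "(norm (translate h (abs_L2 f) - abs_L2 f))\<^sup>2 \<le> ?k"
          proof (rule power_mono)
            have "norm (translate h (abs_L2 f) - abs_L2 f) \<le> norm h * norm (abs_L2 (grad f))"
              using H10_translate[OF test_in_H10[OF f], of h] by simp
            also have "\<dots> \<le> 3 * \<epsilon> * norm (abs_L2 (grad f))"
              using True by (intro mult_right_mono) auto
            finally show "norm (translate h (abs_L2 f) - abs_L2 f) \<le> 3 * \<epsilon> * norm (abs_L2 (grad f))" .
          qed auto
          finally show ?thesis using True by (simp add: power2_commute[of "f _" "f (_ + h)"] ennreal_leI)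
        qed simp
      qed
      also have "\<dots> = ennreal ?k * emeasure lborel (ball (0::'a) (3 * \<epsilon>))"
        by (simp add: nn_integral_cmult_indicator)
      also have "emeasure lborel (ball (0::'a) (3 * \<epsilon>)) = ennreal (vol (3 * \<epsilon>))"
        unfolding vol_def by (rule emeasure_eq_ennreal_measure)
          (rule fin)
      also have "ennreal ?k * ennreal (vol (3 * \<epsilon>)) = ennreal (?k * vol (3 * \<epsilon>))"
        using vol(1)[of "3 * \<epsilon>"] \<epsilon> by (simp add: ennreal_mult)
      finally show ?thesis by (simp add: power_mult_distrib mult.commute)
    qed
    have volF: "emeasure lborel (ball p \<epsilon>) = ennreal (vol \<epsilon>)" for p :: 'a
      using vol(2)[OF \<epsilon>, of p] emeasure_eq_ennreal_measure[of lborel "ball p \<epsilon>"]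
      by (simp add: fin)
    have "ennreal ((norm (abs_L2 f))\<^sup>2) = ennreal (\<integral>z. (f z)\<^sup>2 \<partial>lborel)"
      by (simp add: norm_abs_L2[OF sq(1)] integral_completion)
    also have "\<dots> = (\<integral>\<^sup>+z. ennreal ((f z)\<^sup>2) \<partial>lborel)"
      using sq(1) by (intro nn_integral_eq_integral[symmetric]) (auto simp: sq_integrable_lborel)
    also have "\<dots> \<le> (\<integral>\<^sup>+z. ennreal (2 / \<beta>) * W z
        + (\<Sum>p\<in>F. ennreal (2 * (m p)\<^sup>2) * indicator (ball p \<epsilon>) z) \<partial>lborel)"
      by (rule nn_integral_mono) (rule pt)
    also have "\<dots> = ennreal (2 / \<beta>) * (\<integral>\<^sup>+z. W z \<partial>lborel)
        + (\<Sum>p\<in>F. ennreal (2 * (m p)\<^sup>2) * ennreal (vol \<epsilon>))"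
    proof -
      have "(\<integral>\<^sup>+z. ennreal (2 / \<beta>) * W z
          + (\<Sum>p\<in>F. ennreal (2 * (m p)\<^sup>2) * indicator (ball p \<epsilon>) z) \<partial>lborel)
        = (\<integral>\<^sup>+z. ennreal (2 / \<beta>) * W z \<partial>lborel)
          + (\<integral>\<^sup>+z. (\<Sum>p\<in>F. ennreal (2 * (m p)\<^sup>2) * indicator (ball p \<epsilon>) z) \<partial>lborel)"
        by (intro nn_integral_add borel_measurable_sum borel_measurable_times_ennreal
            borel_measurable_indicator borel_measurable_const) (simp_all add: W_meas)
      also have "(\<integral>\<^sup>+z. ennreal (2 / \<beta>) * W z \<partial>lborel) = ennreal (2 / \<beta>) * (\<integral>\<^sup>+z. W z \<partial>lborel)"
        by (rule nn_integral_cmult) (simp add: W_meas)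
      also have "(\<integral>\<^sup>+z. (\<Sum>p\<in>F. ennreal (2 * (m p)\<^sup>2) * indicator (ball p \<epsilon>) z) \<partial>lborel)
          = (\<Sum>p\<in>F. \<integral>\<^sup>+z. ennreal (2 * (m p)\<^sup>2) * indicator (ball p \<epsilon>) z \<partial>lborel)"
        by (intro nn_integral_sum borel_measurable_times_ennreal
            borel_measurable_indicator borel_measurable_const) simp_all
      also have "\<dots> = (\<Sum>p\<in>F. ennreal (2 * (m p)\<^sup>2) * ennreal (vol \<epsilon>))"
        by (intro sum.cong refl) (simp add: nn_integral_cmult_indicator volF)
      finally show ?thesis .
    qed
    also have "\<dots> \<le> ennreal (2 / \<beta>) * ennreal (vol (3 * \<epsilon>) * (9 * \<epsilon>\<^sup>2 * (norm (abs_L2 (grad f)))\<^sup>2))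
        + (\<Sum>p\<in>F. ennreal (2 * (m p)\<^sup>2) * ennreal (vol \<epsilon>))"
      by (intro add_right_mono mult_left_mono Wint) auto
    also have "\<dots> = ennreal (2 / \<beta> * (vol (3 * \<epsilon>) * (9 * \<epsilon>\<^sup>2 * (norm (abs_L2 (grad f)))\<^sup>2))
        + (\<Sum>p\<in>F. 2 * (m p)\<^sup>2 * vol \<epsilon>))"
    proof -
      have v: "0 < vol \<epsilon>" "0 < vol (3 * \<epsilon>)" using vol(1) \<epsilon> by auto
      have "(\<Sum>p\<in>F. ennreal (2 * (m p)\<^sup>2) * ennreal (vol \<epsilon>)) = (\<Sum>p\<in>F. ennreal (2 * (m p)\<^sup>2 * vol \<epsilon>))"
        using v by (intro sum.cong refl ennreal_mult[symmetric]) auto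
      also have "\<dots> = ennreal (\<Sum>p\<in>F. 2 * (m p)\<^sup>2 * vol \<epsilon>)"
        using v by (intro sum_ennreal) auto
      finally show ?thesis
        using v \<beta> by (simp only:) (intro ennreal_mult_plus[symmetric] sum_nonneg; simp)
    qed
    also have "2 / \<beta> * (vol (3 * \<epsilon>) * (9 * \<epsilon>\<^sup>2 * (norm (abs_L2 (grad f)))\<^sup>2))
        = A * \<epsilon>\<^sup>2 * (norm (abs_L2 (grad f)))\<^sup>2"
      using \<beta> by (simp add: v32 A_def \<beta>_def[symmetric])
    also have "(\<Sum>p\<in>F. 2 * (m p)\<^sup>2 * vol \<epsilon>) = (\<Sum>p\<in>F. (g p \<bullet> abs_L2 f)\<^sup>2)"
      by (simp add: gm mult_ac)
    finally have "ennreal ((norm (abs_L2 f))\<^sup>2) \<le> ennreal (A * \<epsilon>\<^sup>2 * (norm (abs_L2 (grad f)))\<^sup>2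
        + (\<Sum>p\<in>F. (g p \<bullet> abs_L2 f)\<^sup>2))" .
    then show ?thesis
      unfolding \<epsilon>A using \<delta> by (subst (asm) ennreal_le_iff) (auto intro!: add_nonneg_nonneg sum_nonneg)
  qed
  have "(norm (fst x))\<^sup>2 \<le> \<delta> * (norm (snd x))\<^sup>2 + (\<Sum>p\<in>F. (g p \<bullet> fst x)\<^sup>2)" if "x \<in> H10 Z" for x
    using _ _ that
  proof (rule H10_closure_property)
    show "closed {x. (norm (fst x))\<^sup>2 \<le> \<delta> * (norm (snd x))\<^sup>2 + (\<Sum>p\<in>F. (g p \<bullet> fst x)\<^sup>2)}"
      by (intro closed_Collect_le continuous_intros)
  qed (use main in simp)
  then show ?thesis using F(1) by blast
qed

text \<open>Restricting to the kernel of one functional loses at most one dimension.\<close>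

lemma finite_dim_of_functionals:
  fixes f :: "'i \<Rightarrow> 'a::real_vector \<Rightarrow> real"
  assumes "finite I" "subspace E" "\<And>i. i \<in> I \<Longrightarrow> linear (f i)"
    "\<And>e. e \<in> E \<Longrightarrow> (\<And>i. i \<in> I \<Longrightarrow> f i e = 0) \<Longrightarrow> e = 0"
  shows "\<exists>B. finite B \<and> E = span B"
  using assms
proof (induction I arbitrary: E rule: finite_induct)
  case empty
  then have "E = {0}" using subspace_0 by blast
  then show ?case by (intro exI[of _ "{}"]) simp
next
  case (insert i I)
  have lin: "linear (f i)" using insert.prems by simp
  define E' where "E' = {e \<in> E. f i e = 0}"
  have "subspace E'"
    using insert.prems(1) lin unfolding E'_def subspace_def
    by (auto simp: linear_add linear_cmul linear_0)
  moreover have "e = 0" if "e \<in> E'" "\<And>i. i \<in> I \<Longrightarrow> f i e = 0" for e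
    using that insert.prems(3)[of e] by (auto simp: E'_def)
  ultimately obtain B where B: "finite B" "E' = span B"
    using insert.IH[of E'] insert.prems(2) by auto
  show ?case
  proof (cases "E' = E")
    case True
    then show ?thesis using B by blast
  next
    case False
    then obtain e0 where e0: "e0 \<in> E" "f i e0 \<noteq> 0" by (auto simp: E'_def)
    have "E \<subseteq> span (insert e0 B)"
    proof
      fix e assume e: "e \<in> E"
      have "e - (f i e / f i e0) *\<^sub>R e0 \<in> E'"
        using e e0 insert.prems(1) lin
        by (simp add: E'_def subspace_diff subspace_scale linear_diff linear_cmul)
      then show "e \<in> span (insert e0 B)" unfolding B(2) span_insert by blast
    qed
    moreover have "span (insert e0 B) \<subseteq> E"
      using e0(1) insert.prems(1) B(2) span_superset[of B]
      by (intro span_minimal) (auto simp: E'_def)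
    ultimately show ?thesis using B(1) by (intro exI[of _ "insert e0 B"]) auto
  qed
qed

lemma subspace_eigenspace: "subspace (eigenspace Z \<mu>)"
  unfolding eigenspace_def
  by (rule subspaceI)
    (use subspace_H10[of Z] in \<open>auto simp: subspace_0 subspace_add subspace_scale inner_add_left distrib_left\<close>)

lemma eigenspace_norm: "e \<in> eigenspace Z \<mu> \<Longrightarrow> (norm (snd e))\<^sup>2 = \<mu> * (norm (fst e))\<^sup>2"
  by (simp add: eigenspace_def power2_norm_eq_inner)

lemma eigenspace_eq_0: "e \<in> eigenspace Z \<mu> \<Longrightarrow> fst e = 0 \<Longrightarrow> e = 0"
  using eigenspace_norm[of e Z \<mu>] by (simp add: prod_eq_iff)

text \<open>On an eigenspace \<open>\<parallel>\<nabla>e\<parallel>\<^sup>2 = \<mu> \<parallel>e\<parallel>\<^sup>2\<close>, so for \<open>\<delta> \<mu> < 1\<close> the compactness inequality says that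
  finitely many functionals separate its points.\<close>

lemma eigenspace_finite_dim:
  fixes Z :: "'a::euclidean_space set"
  assumes Z: "bounded Z"
  obtains B where "finite B" "eigenspace Z \<mu> = span B"
proof -
  define \<delta> where "\<delta> = 1 / (\<bar>\<mu>\<bar> + 1)"
  have \<delta>: "\<delta> > 0" "\<delta> * \<mu> < 1"
  proof -
    show "\<delta> > 0" by (simp add: \<delta>_def add_pos_nonneg)
    have "\<mu> < \<bar>\<mu>\<bar> + 1" by simp
    then show "\<delta> * \<mu> < 1" by (simp add: \<delta>_def divide_less_eq)
  qed
  obtain F :: "'a set" and g where F: "finite F"
    "\<And>x. x \<in> H10 Z \<Longrightarrow> (norm (fst x))\<^sup>2 \<le> \<delta> * (norm (snd x))\<^sup>2 + (\<Sum>p\<in>F. (g p \<bullet> fst x)\<^sup>2)"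
    using H10_compactness[OF Z \<delta>(1)] by blast
  have "e = 0" if e: "e \<in> eigenspace Z \<mu>" and 0: "\<And>p. p \<in> F \<Longrightarrow> g p \<bullet> fst e = 0" for e
  proof -
    have "e \<in> H10 Z" using e by (simp add: eigenspace_def)
    then have "(norm (fst e))\<^sup>2 \<le> \<delta> * \<mu> * (norm (fst e))\<^sup>2"
      using F(2)[of e] 0 eigenspace_norm[OF e] by simp
    then have "(norm (fst e))\<^sup>2 * (1 - \<delta> * \<mu>) \<le> 0" by (simp add: algebra_simps)
    then have "(norm (fst e))\<^sup>2 \<le> 0" using \<delta>(2) by (simp add: mult_le_0_iff)
    then show ?thesis using eigenspace_eq_0[OF e] by simp
  qed
  then have "\<exists>B. finite B \<and> eigenspace Z \<mu> = span B"
    by (intro finite_dim_of_functionals[where f = "\<lambda>p e. g p \<bullet> fst e", OF F(1) subspace_eigenspace])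
      (auto intro!: linearI simp: inner_add_right)
  then show ?thesis using that by blast
qed

section \<open>Integrals with a holomorphic parameter\<close>

lemma integrable_times_bounded_on:
  fixes g :: "'a::euclidean_space \<Rightarrow> real" and f :: "'a \<Rightarrow> complex"
  assumes g: "integrable lborel g" and f: "f \<in> borel_measurable borel"
    and b: "\<And>y. g y \<noteq> 0 \<Longrightarrow> norm (f y) \<le> M"
  shows "integrable lborel (\<lambda>y. of_real (g y) * f y)"
proof (rule Bochner_Integration.integrable_bound[where f = "\<lambda>y. g y * M"])
  show "(\<lambda>y. of_real (g y) * f y) \<in> borel_measurable lborel"
    using borel_measurable_integrable[OF g] f by auto
  show "AE y in lborel. norm (of_real (g y) * f y) \<le> norm (g y * M)"
  proof (rule AE_I2)
    fix y
    show "norm (of_real (g y) * f y) \<le> norm (g y * M)"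
    proof (cases "g y = 0")
      case False
      then have "norm (f y) \<le> \<bar>M\<bar>" using b[of y] by simp
      then show ?thesis by (simp add: norm_mult abs_mult mult_left_mono)
    qed simp
  qed
qed (use g in simp)

text \<open>Cauchy's inequality turns the bound of \<open>K\<close> on a compact set into a bound of the difference quotients
  that is uniform in \<open>y\<close>, and dominated convergence applies.\<close>

lemma holomorphic_parameter_integral:
  fixes g :: "'a::euclidean_space \<Rightarrow> real" and K K' :: "complex \<Rightarrow> 'a \<Rightarrow> complex"
  assumes g: "integrable lborel g" and S: "compact S" "\<And>y. y \<notin> S \<Longrightarrow> g y = 0"
    and D: "open D" "\<zeta>0 \<in> D"
    and K: "continuous_on (D \<times> UNIV) (\<lambda>(\<zeta>, y). K \<zeta> y)"
    and K': "\<And>\<zeta>. \<zeta> \<in> D \<Longrightarrow> continuous_on UNIV (K' \<zeta>)"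
    and d: "\<And>\<zeta> y. \<zeta> \<in> D \<Longrightarrow> ((\<lambda>\<zeta>. K \<zeta> y) has_field_derivative K' \<zeta> y) (at \<zeta>)"
  shows "((\<lambda>\<zeta>. \<integral>y. of_real (g y) * K \<zeta> y \<partial>lborel) has_field_derivative
      (\<integral>y. of_real (g y) * K' \<zeta>0 y \<partial>lborel)) (at \<zeta>0)"
proof -
  obtain e where e: "e > 0" "cball \<zeta>0 e \<subseteq> D" using D open_contains_cball by blast
  define d' where "d' = e / 2"
  have d': "d' > 0" using e by (simp add: d'_def)
  have "compact ((\<lambda>(\<zeta>, y). K \<zeta> y) ` (cball \<zeta>0 e \<times> S))"
    by (intro compact_continuous_image continuous_on_subset[OF K] compact_Times S(1)) (use e in auto)
  then have "bounded ((\<lambda>(\<zeta>, y). K \<zeta> y) ` (cball \<zeta>0 e \<times> S))" by (rule compact_imp_bounded)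
  then obtain M where M0: "\<forall>z \<in> (\<lambda>(\<zeta>, y). K \<zeta> y) ` (cball \<zeta>0 e \<times> S). norm z \<le> M"
    unfolding bounded_iff by (rule exE)
  have M: "norm (K \<zeta> y) \<le> M" if "\<zeta> \<in> cball \<zeta>0 e" "y \<in> S" for \<zeta> y
    using bspec[OF M0 imageI[of "(\<zeta>, y)"]] that by simp
  have Kc: "continuous_on UNIV (K \<zeta>)" if "\<zeta> \<in> D" for \<zeta>
  proof -
    have "continuous_on UNIV (\<lambda>y::'a. (\<zeta>, y))" by (intro continuous_intros)
    from continuous_on_compose2[OF K this] that show ?thesis by auto
  qed
  have Km: "K \<zeta> \<in> borel_measurable borel" if "\<zeta> \<in> D" for \<zeta>
    by (rule borel_measurable_continuous_onI[OF Kc[OF that]])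
  have K'm: "K' \<zeta> \<in> borel_measurable borel" if "\<zeta> \<in> D" for \<zeta>
    by (rule borel_measurable_continuous_onI[OF K'[OF that]])
  have gm: "g \<in> borel_measurable borel" using borel_measurable_integrable[OF g] by simp
  have lip: "norm (K \<zeta> y - K \<zeta>0 y) \<le> M / d' * norm (\<zeta> - \<zeta>0)" if \<zeta>: "\<zeta> \<in> ball \<zeta>0 d'" and y: "y \<in> S" for \<zeta> y
  proof (rule field_differentiable_bound[where S = "ball \<zeta>0 d'" and f' = "\<lambda>\<zeta>. K' \<zeta> y"])
    show "convex (ball \<zeta>0 d')" by simp
    show "\<zeta> \<in> ball \<zeta>0 d'" by (rule \<zeta>)
    show "\<zeta>0 \<in> ball \<zeta>0 d'" using d' by simp
  next
    fix z assume z: "z \<in> ball \<zeta>0 d'"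
    have sub: "cball z d' \<subseteq> cball \<zeta>0 e"
    proof
      fix w assume "w \<in> cball z d'"
      then show "w \<in> cball \<zeta>0 e" using z dist_triangle[of \<zeta>0 w z] by (simp add: d'_def)
    qed
    have sD: "cball z d' \<subseteq> D" using sub e(2) by (rule subset_trans)
    then have zD: "z \<in> D" using e d' by (meson centre_in_cball less_imp_le subsetD)
    show "((\<lambda>\<zeta>. K \<zeta> y) has_field_derivative K' z y) (at z within ball \<zeta>0 d')"
      by (rule has_field_derivative_at_within[OF d[OF zD]])
    have hol: "(\<lambda>\<zeta>. K \<zeta> y) holomorphic_on D"
      using d D(1) by (auto simp: holomorphic_on_open)
    have "norm ((deriv ^^ 1) (\<lambda>\<zeta>. K \<zeta> y) z) \<le> fact 1 * M / d' ^ 1"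
    proof (rule Cauchy_inequality)
      show "(\<lambda>\<zeta>. K \<zeta> y) holomorphic_on ball z d'"
        by (rule holomorphic_on_subset[OF hol subset_trans[OF ball_subset_cball sD]])
      show "continuous_on (cball z d') (\<lambda>\<zeta>. K \<zeta> y)"
        by (rule continuous_on_subset[OF holomorphic_on_imp_continuous_on[OF hol] sD])
      show "norm (K x y) \<le> M" if "norm (z - x) = d'" for x
      proof (rule M[OF _ y])
        have "x \<in> cball z d'" using that by (simp add: dist_norm)
        then show "x \<in> cball \<zeta>0 e" using sub by blast
      qed
    qed (rule d')
    moreover have "(deriv ^^ 1) (\<lambda>\<zeta>. K \<zeta> y) z = K' z y"
      using DERIV_imp_deriv[OF d[OF zD, of y]] by simp
    ultimately show "norm (K' z y) \<le> M / d'" by simp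
  qed
  have int: "integrable lborel (\<lambda>y. of_real (g y) * K \<zeta> y)" if "\<zeta> \<in> cball \<zeta>0 e" for \<zeta>
  proof (rule integrable_times_bounded_on[OF g, where M = M])
    show "norm (K \<zeta> y) \<le> M" if "g y \<noteq> 0" for y using M \<open>\<zeta> \<in> cball \<zeta>0 e\<close> S(2) that by blast
  qed (use that e in \<open>auto intro!: Km\<close>)
  let ?F = "\<lambda>\<zeta>. \<integral>y. of_real (g y) * K \<zeta> y \<partial>lborel"
  have "((\<lambda>\<zeta>. (?F \<zeta> - ?F \<zeta>0) / (\<zeta> - \<zeta>0)) \<longlongrightarrow> (\<integral>y. of_real (g y) * K' \<zeta>0 y \<partial>lborel))
      (at \<zeta>0 within ball \<zeta>0 d')"
    unfolding tendsto_at_iff_sequentially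
  proof (intro allI impI)
    fix X assume X: "\<forall>i. X i \<in> ball \<zeta>0 d' - {\<zeta>0}" "X \<longlonglongrightarrow> \<zeta>0"
    have Xe: "X n \<in> cball \<zeta>0 e" "X n \<in> D" "X n \<noteq> \<zeta>0" "X n \<in> ball \<zeta>0 d'" for n
    proof -
      have "X n \<in> ball \<zeta>0 d'" "X n \<noteq> \<zeta>0" using X(1) by auto
      moreover from this have "X n \<in> cball \<zeta>0 e" using d' by (simp add: d'_def)
      ultimately show "X n \<in> cball \<zeta>0 e" "X n \<in> D" "X n \<noteq> \<zeta>0" "X n \<in> ball \<zeta>0 d'" using e(2) by blast+
    qed
    have eq: "(?F (X n) - ?F \<zeta>0) / (X n - \<zeta>0)
        = (\<integral>y. of_real (g y) * ((K (X n) y - K \<zeta>0 y) / (X n - \<zeta>0)) \<partial>lborel)" for n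
    proof -
      have "?F (X n) - ?F \<zeta>0 = (\<integral>y. of_real (g y) * K (X n) y - of_real (g y) * K \<zeta>0 y \<partial>lborel)"
        by (rule Bochner_Integration.integral_diff[symmetric]) (use Xe e in \<open>auto intro!: int\<close>)
      then show ?thesis
        by (simp add: right_diff_distrib diff_divide_distrib flip: integral_divide_zero)
    qed
    have "(\<lambda>n. \<integral>y. of_real (g y) * ((K (X n) y - K \<zeta>0 y) / (X n - \<zeta>0)) \<partial>lborel)
        \<longlonglongrightarrow> (\<integral>y. of_real (g y) * K' \<zeta>0 y \<partial>lborel)"
    proof (rule integral_dominated_convergence[where w = "\<lambda>y. \<bar>g y\<bar> * (M / d')"])
      show "(\<lambda>y. of_real (g y) * K' \<zeta>0 y) \<in> borel_measurable lborel"
        using gm K'm[OF D(2)] by auto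
      show "(\<lambda>y. of_real (g y) * ((K (X n) y - K \<zeta>0 y) / (X n - \<zeta>0))) \<in> borel_measurable lborel" for n
        using gm Km[OF Xe(2)[of n]] Km[OF D(2)] by auto
      show "integrable lborel (\<lambda>y. \<bar>g y\<bar> * (M / d'))" using g by (intro integrable_mult_left integrable_abs)
      show "AE y in lborel. (\<lambda>n. of_real (g y) * ((K (X n) y - K \<zeta>0 y) / (X n - \<zeta>0)))
          \<longlonglongrightarrow> of_real (g y) * K' \<zeta>0 y"
      proof (intro AE_I2 tendsto_intros)
        fix y
        have "((\<lambda>\<zeta>. (K \<zeta> y - K \<zeta>0 y) / (\<zeta> - \<zeta>0)) \<longlongrightarrow> K' \<zeta>0 y) (at \<zeta>0)"
          using d[OF D(2)] by (simp add: has_field_derivative_iff)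
        moreover have "filterlim X (at \<zeta>0) sequentially"
          using X(2) Xe by (auto simp: filterlim_at)
        ultimately show "(\<lambda>n. (K (X n) y - K \<zeta>0 y) / (X n - \<zeta>0)) \<longlonglongrightarrow> K' \<zeta>0 y"
          by (rule filterlim_compose)
      qed
      show "AE y in lborel. norm (of_real (g y) * ((K (X n) y - K \<zeta>0 y) / (X n - \<zeta>0)))
          \<le> \<bar>g y\<bar> * (M / d')" for n
      proof (rule AE_I2)
        fix y
        show "norm (of_real (g y) * ((K (X n) y - K \<zeta>0 y) / (X n - \<zeta>0))) \<le> \<bar>g y\<bar> * (M / d')"
        proof (cases "y \<in> S")
          case True
          have "norm (K (X n) y - K \<zeta>0 y) / norm (X n - \<zeta>0) \<le> M / d'"
            using lip[OF Xe(4) True, of n] Xe(3)[of n] by (simp add: divide_le_eq)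
          then show ?thesis by (simp add: norm_mult norm_divide mult_left_mono del: times_divide_eq_right)
        qed (simp add: S(2))
      qed
    qed
    then show "((\<lambda>\<zeta>. (?F \<zeta> - ?F \<zeta>0) / (\<zeta> - \<zeta>0)) \<circ> X) \<longlonglongrightarrow> (\<integral>y. of_real (g y) * K' \<zeta>0 y \<partial>lborel)"
      unfolding comp_def eq .
  qed
  moreover have "at \<zeta>0 within ball \<zeta>0 d' = at \<zeta>0"
    by (rule at_within_open) (use d' in auto)
  ultimately show ?thesis by (simp add: has_field_derivative_iff)
qed

section \<open>Gaussian kernels\<close>

lemma integrable_exp_norm_sq:
  "integrable lborel (\<lambda>z::'a::euclidean_space. exp (- ((norm z)\<^sup>2 / 8)))"
proof (rule integrableI_nonneg)
  let ?f = "\<lambda>x::real. exp (- (x\<^sup>2 / 8))"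
  have f1: "integrable lborel ?f"
  proof -
    have "integrable lborel (\<lambda>x. sqrt (8 * pi) * normal_density 0 2 x)"
      by (intro integrable_mult_right integrable_normal_density) simp
    moreover have "sqrt (8 * pi) * normal_density 0 2 x = ?f x" for x
      by (simp add: normal_density_def mult.commute)
    ultimately show ?thesis by simp
  qed
  have "(\<integral>\<^sup>+z. ennreal (exp (- ((norm (z::'a))\<^sup>2 / 8))) \<partial>lborel)
      = (\<integral>\<^sup>+(z::'a). (\<Prod>b\<in>Basis. ennreal (?f (z \<bullet> b))) \<partial>lborel)"
  proof (rule nn_integral_cong)
    fix z :: 'a
    have "(norm z)\<^sup>2 = (\<Sum>b\<in>Basis. (z \<bullet> b)\<^sup>2)"
      unfolding power2_norm_eq_inner by (subst euclidean_inner) (simp add: power2_eq_square)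
    then have "- ((norm z)\<^sup>2 / 8) = (\<Sum>b\<in>Basis. - ((z \<bullet> b)\<^sup>2 / 8))"
      by (simp add: sum_divide_distrib sum_negf)
    then have "exp (- ((norm z)\<^sup>2 / 8)) = (\<Prod>b\<in>Basis. ?f (z \<bullet> b))"
      by (simp add: exp_sum)
    then show "ennreal (exp (- ((norm z)\<^sup>2 / 8))) = (\<Prod>b\<in>Basis. ennreal (?f (z \<bullet> b)))"
      by (simp add: prod_ennreal)
  qed
  also have "\<dots> = (\<Prod>b\<in>(Basis::'a set). \<integral>\<^sup>+x. ennreal (?f x) \<partial>lborel)"
    by (rule nn_integral_lborel_prod) auto
  also have "\<dots> < \<infinity>"
    using f1 by (simp add: nn_integral_eq_integral ennreal_power)
  finally show "(\<integral>\<^sup>+z. ennreal (exp (- ((norm (z::'a))\<^sup>2 / 8))) \<partial>lborel) < \<infinity>" .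
qed auto

lemma integrable_gauss_weight:
  "integrable lborel (\<lambda>z::'a::euclidean_space. exp (- ((norm z)\<^sup>2 / 4)) * (1 + norm z))"
proof (rule Bochner_Integration.integrable_bound[OF integrable_mult_right[OF integrable_exp_norm_sq, of 3]])
  show "AE z::'a in lborel. norm (exp (- ((norm z)\<^sup>2 / 4)) * (1 + norm z))
      \<le> norm (3 * exp (- ((norm z)\<^sup>2 / 8)))"
  proof (rule AE_I2)
    fix z :: 'a
    define t where "t = norm z"
    have "0 \<le> (t - 4)\<^sup>2" by simp
    also have "(t - 4)\<^sup>2 = t\<^sup>2 - 8 * t + 16" by (simp add: power2_eq_square algebra_simps)
    finally have "8 * t \<le> t\<^sup>2 + 16" by simp
    moreover have "0 \<le> t\<^sup>2" by simp
    ultimately have "8 * t \<le> 3 * t\<^sup>2 + 16" by linarith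
    then have "1 + t \<le> 3 * (1 + t\<^sup>2 / 8)" by simp
    also have "\<dots> \<le> 3 * exp (t\<^sup>2 / 8)" by (intro mult_left_mono exp_ge_add_one_self) simp
    finally have "exp (- (t\<^sup>2 / 4)) * (1 + t) \<le> exp (- (t\<^sup>2 / 4)) * (3 * exp (t\<^sup>2 / 8))"
      by (rule mult_left_mono) simp
    also have "\<dots> = 3 * (exp (- (t\<^sup>2 / 4)) * exp (t\<^sup>2 / 8))" by simp
    also have "exp (- (t\<^sup>2 / 4)) * exp (t\<^sup>2 / 8) = exp (- (t\<^sup>2 / 8))"
      unfolding exp_add[symmetric] by simp
    finally show "norm (exp (- ((norm z)\<^sup>2 / 4)) * (1 + norm z)) \<le> norm (3 * exp (- ((norm z)\<^sup>2 / 8)))"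
      by (simp add: t_def[symmetric] abs_mult) (simp add: t_def)
  qed
qed auto

lemma has_derivative_gauss:
  "((\<lambda>y. exp (- ((norm (y - x))\<^sup>2 / s))) has_derivative
    (\<lambda>h. exp (- ((norm (y - x))\<^sup>2 / s)) * (- (2 * ((y - x) \<bullet> h) / s)))) (at y)"
  for x :: "'a::euclidean_space"
  unfolding power2_norm_eq_inner
  by (auto intro!: derivative_eq_intros simp: inner_commute divide_inverse algebra_simps)

lemma pd_gauss:
  "pd b (\<lambda>y. exp (- ((norm (y - x))\<^sup>2 / s))) y
    = exp (- ((norm (y - x))\<^sup>2 / s)) * (- (2 * ((y - x) \<bullet> b) / s))"
  for x :: "'a::euclidean_space"
  using frechet_derivative_at[OF has_derivative_gauss[of x s y]] by metis

lemma Ck_gauss: "Ck n (\<lambda>y. exp (- ((norm (y - x))\<^sup>2 / s)))"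
  for x :: "'a::euclidean_space"
proof -
  have "Ck n (\<lambda>y. (- (1 / s)) * (norm (y - x))\<^sup>2)" by (intro Ck_mult Ck_const Ck_dist_sq)
  from Ck_compose[of "\<lambda>_. exp", OF DERIV_exp this] show ?thesis by simp
qed

lemma laplacian_gauss:
  fixes x :: "'a::euclidean_space"
  assumes s: "s \<noteq> 0"
  shows "laplacian (\<lambda>y. exp (- ((norm (y - x))\<^sup>2 / s))) y
    = exp (- ((norm (y - x))\<^sup>2 / s)) * (4 * (norm (y - x))\<^sup>2 / s\<^sup>2 - 2 * real DIM('a) / s)"
proof -
  let ?G = "\<lambda>y. exp (- ((norm (y - x))\<^sup>2 / s))"
  have 2: "pd b (pd b ?G) y = ?G y * (4 * ((y - x) \<bullet> b)\<^sup>2 / s\<^sup>2 - 2 / s)" if b: "b \<in> Basis" for b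
  proof -
    have "((\<lambda>y. ?G y * (- (2 * ((y - x) \<bullet> b) / s))) has_derivative
        (\<lambda>h. ?G y * (- (2 * (h \<bullet> b) / s)) + ?G y * (- (2 * ((y - x) \<bullet> h) / s)) * (- (2 * ((y - x) \<bullet> b) / s)))) (at y)"
      by (rule has_derivative_mult[OF has_derivative_gauss]) (auto intro!: derivative_eq_intros simp: divide_inverse)
    from fun_cong[OF frechet_derivative_at[OF this], of b]
    have "pd b (\<lambda>y. ?G y * (- (2 * ((y - x) \<bullet> b) / s))) y
        = ?G y * (- (2 * (b \<bullet> b) / s)) + ?G y * (- (2 * ((y - x) \<bullet> b) / s)) * (- (2 * ((y - x) \<bullet> b) / s))"
      by (rule sym)
    then show ?thesis
      unfolding pd_gauss using s b by (simp add: field_simps power2_eq_square)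
  qed
  have "laplacian ?G y = (\<Sum>b\<in>Basis. ?G y * (4 / s\<^sup>2 * ((y - x) \<bullet> b)\<^sup>2 - 2 / s))"
    unfolding laplacian_def by (rule sum.cong) (auto simp: 2)
  also have "\<dots> = ?G y * (4 / s\<^sup>2 * (\<Sum>b\<in>Basis. ((y - x) \<bullet> b)\<^sup>2) - real DIM('a) * (2 / s))"
    by (simp only: sum_distrib_left[symmetric] sum_subtractf sum_constant)
  also have "(\<Sum>b\<in>Basis. ((y - x) \<bullet> b)\<^sup>2) = (norm (y - x))\<^sup>2"
    unfolding power2_norm_eq_inner by (subst euclidean_inner) (simp add: power2_eq_square)
  finally show ?thesis by simp
qed

text \<open>As \<open>\<sigma> \<rightarrow> 0\<close> the Gaussian beats every power of \<open>\<sigma>\<close>.\<close>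

lemma gauss_power_bound:
  fixes \<kappa> :: real
  assumes "\<kappa> > 0"
  obtains B where "B \<ge> 0" "\<And>\<sigma>. 0 < \<sigma> \<Longrightarrow> \<sigma> \<le> 1 \<Longrightarrow> exp (- (\<kappa> / \<sigma>\<^sup>2)) / \<sigma> ^ M \<le> B"
proof
  show "0 \<le> fact M / \<kappa> ^ M" by (intro divide_nonneg_nonneg) (use assms in auto)
  fix \<sigma> :: real assume \<sigma>: "0 < \<sigma>" "\<sigma> \<le> 1"
  define t where "t = \<kappa> / \<sigma>\<^sup>2"
  have t: "t > 0" using assms \<sigma> by (simp add: t_def)
  have "(\<Sum>n\<in>{M}. t ^ n /\<^sub>R fact n) \<le> (\<Sum>n. t ^ n /\<^sub>R fact n)"
    by (rule sum_le_suminf[OF summable_exp_generic]) (use t in auto)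
  then have "t ^ M / fact M \<le> exp t"
    by (simp add: exp_def divide_inverse mult.commute)
  then have "exp (- t) \<le> fact M / t ^ M"
    using t by (simp add: exp_minus field_simps)
  also have "\<dots> = fact M / \<kappa> ^ M * (\<sigma> ^ M * \<sigma> ^ M)"
    using \<sigma> assms by (simp add: t_def power_divide power2_eq_square power_mult_distrib)
  finally have "exp (- t) / \<sigma> ^ M \<le> fact M / \<kappa> ^ M * (\<sigma> ^ M * \<sigma> ^ M) / \<sigma> ^ M"
    using \<sigma> by (intro divide_right_mono) auto
  also have "\<dots> = fact M / \<kappa> ^ M * \<sigma> ^ M" using \<sigma> by simp
  also have "\<dots> \<le> fact M / \<kappa> ^ M * 1"
    using \<sigma> assms by (intro mult_left_mono power_le_one) auto
  finally show "exp (- (\<kappa> / \<sigma>\<^sup>2)) / \<sigma> ^ M \<le> fact M / \<kappa> ^ M" by (simp add: t_def)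
qed

section \<open>Analyticity of eigenfunctions along lines\<close>

text \<open>Up to a constant factor, the kernel of \<open>exp(s\<^sup>2 (\<Delta> + \<mu>))\<close> in dimension \<open>N\<close> at squared distance \<open>q\<close>.
  Both arguments are complex: \<open>q\<close> for the extension along lines, \<open>s\<close> to differentiate in time.\<close>

definition heat :: "real \<Rightarrow> nat \<Rightarrow> complex \<Rightarrow> complex \<Rightarrow> complex" where
  "heat \<mu> N s q = exp (of_real \<mu> * s\<^sup>2 - q / (4 * s\<^sup>2)) / s ^ N"

text \<open>The squared distance between \<open>y\<close> and \<open>x + t b\<close>, extended from real \<open>t\<close> to complex \<open>\<zeta>\<close>, for unit
  vectors \<open>b\<close>.\<close>

definition qdist :: "'a::euclidean_space \<Rightarrow> 'a \<Rightarrow> complex \<Rightarrow> 'a \<Rightarrow> complex" where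
  "qdist x b \<zeta> y = of_real ((norm (y - x))\<^sup>2) - 2 * \<zeta> * of_real ((y - x) \<bullet> b) + \<zeta>\<^sup>2"

lemma qdist_of_real:
  assumes b: "b \<in> Basis"
  shows "qdist x b (of_real t) y = of_real ((norm (y - (x + t *\<^sub>R b)))\<^sup>2)"
proof -
  have "(norm (y - (x + t *\<^sub>R b)))\<^sup>2 = (norm (y - x))\<^sup>2 - 2 * t * ((y - x) \<bullet> b) + t\<^sup>2"
  proof -
    define w where "w = y - x"
    have w: "y - (x + t *\<^sub>R b) = w - t *\<^sub>R b" by (simp add: w_def)
    have "(w - t *\<^sub>R b) \<bullet> (w - t *\<^sub>R b) = w \<bullet> w - 2 * t * (w \<bullet> b) + t * t * (b \<bullet> b)"
      by (simp add: inner_diff_left inner_diff_right inner_commute algebra_simps)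
    then show ?thesis
      unfolding w w_def[symmetric] power2_norm_eq_inner using b by (simp add: power2_eq_square[of t])
  qed
  then show ?thesis unfolding qdist_def by simp
qed

lemma Re_qdist:
  assumes b: "b \<in> Basis"
  shows "Re (qdist x b \<zeta> y) = (norm (y - (x + Re \<zeta> *\<^sub>R b)))\<^sup>2 - (Im \<zeta>)\<^sup>2"
proof -
  have "Re (qdist x b \<zeta> y) = Re (qdist x b (of_real (Re \<zeta>)) y) - (Im \<zeta>)\<^sup>2"
    by (simp add: qdist_def power2_eq_square)
  then show ?thesis using qdist_of_real[OF b, of x "Re \<zeta>" y] by simp
qed

lemma heat_of_real:
  "heat \<mu> N (of_real s) (of_real Q) = of_real (exp (\<mu> * s\<^sup>2 - Q / (4 * s\<^sup>2)) / s ^ N)"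
  by (simp add: heat_def exp_of_real[symmetric])

lemma norm_heat:
  "s > 0 \<Longrightarrow> norm (heat \<mu> N (of_real s) q) = exp (\<mu> * s\<^sup>2 - Re q / (4 * s\<^sup>2)) / s ^ N"
proof -
  assume s: "s > 0"
  have "Re (of_real \<mu> * (of_real s)\<^sup>2 - q / (4 * (of_real s)\<^sup>2)) = \<mu> * s\<^sup>2 - Re q / (4 * s\<^sup>2)"
  proof -
    have "q / (4 * (of_real s)\<^sup>2) = q / of_real (4 * s\<^sup>2)" by simp
    then have "Re (q / (4 * (of_real s)\<^sup>2)) = Re q / (4 * s\<^sup>2)" by (simp only: Re_divide_of_real)
    moreover have "Re (of_real \<mu> * (of_real s)\<^sup>2) = \<mu> * s\<^sup>2" by (metis Re_complex_of_real of_real_mult of_real_power)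
    ultimately show ?thesis by simp
  qed
  then show ?thesis using s by (simp add: heat_def norm_divide norm_power)
qed

lemma heat_deriv_s:
  assumes "s \<noteq> 0"
  shows "((\<lambda>s. heat \<mu> N s q) has_field_derivative
    heat \<mu> N s q * (2 * of_real \<mu> * s + q / (2 * s ^ 3) - of_nat N / s)) (at s)"
proof -
  have ring: "E * a * I + E * (- (n * I)) = E * I * (a - n)" for E a I n :: complex
    by (simp add: algebra_simps)
  have "((\<lambda>s. exp (of_real \<mu> * s\<^sup>2 - q / (4 * s\<^sup>2)) * inverse (s ^ N)) has_field_derivative
      exp (of_real \<mu> * s\<^sup>2 - q / (4 * s\<^sup>2)) * (2 * of_real \<mu> * s + q / (2 * s ^ 3)) * inverse (s ^ N)
      + exp (of_real \<mu> * s\<^sup>2 - q / (4 * s\<^sup>2)) * (- (of_nat N * s ^ (N - 1)) / (s ^ N)\<^sup>2)) (at s)"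
    using assms
    by (auto intro!: derivative_eq_intros simp: field_simps power2_eq_square power3_eq_cube)
  moreover have "- (of_nat N * s ^ (N - 1)) / (s ^ N)\<^sup>2 = - (of_nat N / s * inverse (s ^ N))"
    using assms by (cases N) (auto simp: field_simps power2_eq_square)
  ultimately have "((\<lambda>s. exp (of_real \<mu> * s\<^sup>2 - q / (4 * s\<^sup>2)) * inverse (s ^ N)) has_field_derivative
      exp (of_real \<mu> * s\<^sup>2 - q / (4 * s\<^sup>2)) * (2 * of_real \<mu> * s + q / (2 * s ^ 3)) * inverse (s ^ N)
      + exp (of_real \<mu> * s\<^sup>2 - q / (4 * s\<^sup>2)) * (- (of_nat N / s * inverse (s ^ N)))) (at s)"
    by (simp only:)
  then show ?thesis
    unfolding heat_def divide_inverse[of "exp _"]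
    by (rule DERIV_cong) (rule ring)
qed

lemma heat_deriv_q:
  assumes "(Q has_field_derivative q') (at \<zeta>)"
  shows "((\<lambda>\<zeta>. heat \<mu> N s (Q \<zeta>)) has_field_derivative
    heat \<mu> N s (Q \<zeta>) * (- q' / (4 * s\<^sup>2))) (at \<zeta>)"
proof -
  have "((\<lambda>\<zeta>. of_real \<mu> * s\<^sup>2 - Q \<zeta> / (4 * s\<^sup>2)) has_field_derivative (0 - q' / (4 * s\<^sup>2))) (at \<zeta>)"
    by (intro DERIV_diff DERIV_const DERIV_cdivide assms)
  from DERIV_cdivide[OF DERIV_chain2[OF DERIV_exp this], of "s ^ N"]
  show ?thesis unfolding heat_def by (rule DERIV_cong) simp
qed

lemma qdist_deriv:
  "((\<lambda>\<zeta>. qdist x b \<zeta> y) has_field_derivative - 2 * of_real ((y - x) \<bullet> b) + 2 * \<zeta>) (at \<zeta>)"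
  unfolding qdist_def by (auto intro!: derivative_eq_intros)

lemma pd_eq_0_open:
  assumes "open S" "\<And>y. y \<in> S \<Longrightarrow> f y = c" "x \<in> S"
  shows "frechet_derivative f (at x) h = 0"
proof -
  have "((\<lambda>_. c) has_derivative (\<lambda>_. 0)) (at x)" by simp
  then have "(f has_derivative (\<lambda>_. 0)) (at x)"
    by (rule has_derivative_transform_within_open[OF _ assms(1,3)]) (simp add: assms(2))
  from fun_cong[OF frechet_derivative_at[OF this], of h] show ?thesis by simp
qed

text \<open>A weak solution \<open>u\<close> of \<open>- \<Delta> u = \<mu> u\<close> near \<open>x0\<close> and a cutoff \<open>\<eta>\<close> that is constant on the ball of
  radius \<open>r\<close>. The heat flow \<open>exp(t (\<Delta> + \<mu>))\<close> applied to \<open>\<eta> u\<close> is entire along every line. Its time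
  derivative sees only derivatives of \<open>\<eta>\<close>, which live at distance at least \<open>r\<close> from \<open>x0\<close>, where
  the Gaussian stays small even for slightly complex arguments. So holomorphy survives \<open>t \<rightarrow> 0\<close>.\<close>

locale cutoff_solution =
  fixes u \<eta> :: "'a::euclidean_space \<Rightarrow> real" and \<mu> r R T :: real and x0 :: 'a
  assumes r: "0 < r" "r < R"
    and u [measurable]: "u \<in> borel_measurable borel" and u_sq: "sq_integrable u"
    and \<eta>_Ck: "\<And>n. Ck n \<eta>" and \<eta>_1: "\<And>y. y \<in> cball x0 r \<Longrightarrow> \<eta> y = 1"
    and \<eta>_0: "\<And>y. y \<notin> cball x0 R \<Longrightarrow> \<eta> y = 0"
    and weak: "\<And>g. (\<And>n. Ck n g) \<Longrightarrow>
      (\<integral>y. u y * (laplacian (\<lambda>y. \<eta> y * g y) y + \<mu> * (\<eta> y * g y)) \<partial>lborel) = 0"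
    and trans: "\<And>h. norm (translate h (abs_L2 u) - abs_L2 u) \<le> T * norm h"
begin

text \<open>The function \<open>\<eta> u\<close>, and \<open>u\<close> times the first and second derivatives of the cutoff that occur in
  \<open>u \<Delta>(\<eta> G)\<close>.\<close>

definition A :: "'a \<Rightarrow> real" where "A y = u y * \<eta> y"
definition B :: "'a \<Rightarrow> 'a \<Rightarrow> real" where "B b y = u y * pd b \<eta> y"
definition C :: "'a \<Rightarrow> real" where "C y = u y * laplacian \<eta> y"

text \<open>For \<open>x\<close> within \<open>\<rho>\<close> of \<open>x0\<close>, \<open>\<bar>\<zeta>\<bar> < \<rho>\<close> and \<open>y\<close> at distance at least \<open>r\<close> from \<open>x0\<close>, the real part of the
  squared distance is at least \<open>(6 \<rho>)\<^sup>2 - \<rho>\<^sup>2 \<ge> r\<^sup>2 / 2\<close>.\<close>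

definition \<rho> where "\<rho> = r / 8"

lemma \<rho>: "\<rho> > 0" using r by (simp add: \<rho>_def)

lemma outside: "y \<notin> cball x0 R \<Longrightarrow> \<eta> y = 0" "y \<notin> cball x0 R \<Longrightarrow> pd b \<eta> y = 0"
  "y \<notin> cball x0 R \<Longrightarrow> laplacian \<eta> y = 0"
proof -
  have op: "open (- cball x0 R)" by auto
  have 1: "pd b \<eta> y = 0" if "y \<notin> cball x0 R" for b y
    by (rule pd_eq_0_open[OF op, where c = 0]) (use \<eta>_0 that in auto)
  have 2: "pd b (pd b \<eta>) y = 0" if "y \<notin> cball x0 R" for b y
    by (rule pd_eq_0_open[OF op, where c = 0]) (use 1 that in auto)
  show "y \<notin> cball x0 R \<Longrightarrow> \<eta> y = 0" "y \<notin> cball x0 R \<Longrightarrow> pd b \<eta> y = 0"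
    "y \<notin> cball x0 R \<Longrightarrow> laplacian \<eta> y = 0"
    using \<eta>_0 1 2 by (auto simp: laplacian_def)
qed

lemma inside: "y \<in> ball x0 r \<Longrightarrow> pd b \<eta> y = 0" "y \<in> ball x0 r \<Longrightarrow> laplacian \<eta> y = 0"
proof -
  have 1: "pd b \<eta> y = 0" if "y \<in> ball x0 r" for b y
    by (rule pd_eq_0_open[OF open_ball, where c = 1]) (use \<eta>_1 that in auto)
  have 2: "pd b (pd b \<eta>) y = 0" if "y \<in> ball x0 r" for b y
    by (rule pd_eq_0_open[OF open_ball, where c = 0]) (use 1 that in auto)
  show "y \<in> ball x0 r \<Longrightarrow> pd b \<eta> y = 0" "y \<in> ball x0 r \<Longrightarrow> laplacian \<eta> y = 0"
    using 1 2 by (auto simp: laplacian_def)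
qed

lemma u_times_integrable:
  assumes f: "continuous_on UNIV f" and 0: "\<And>y. y \<notin> cball x0 R \<Longrightarrow> f y = 0"
  shows "integrable lborel (\<lambda>y. u y * f y)"
proof -
  have "sq_integrable f" by (rule sq_integrable_compact_support[OF f compact_cball 0])
  from sq_integrable_inner[OF u_sq this] have "integrable lebesgue (\<lambda>y. u y * f y)" by simp
  moreover have "f \<in> borel_measurable borel" by (rule borel_measurable_continuous_onI[OF f])
  ultimately show ?thesis by (simp add: integrable_completion)
qed

lemma laplacian_continuous: "continuous_on UNIV (laplacian \<eta>)"
  unfolding laplacian_def
  by (intro continuous_on_sum Ck_continuous[of 0] Ck_pd \<eta>_Ck)

lemma A_int: "integrable lborel A"
  unfolding A_def by (rule u_times_integrable[OF Ck_continuous[OF \<eta>_Ck] outside(1)])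

lemma B_int: "b \<in> Basis \<Longrightarrow> integrable lborel (B b)"
  unfolding B_def by (rule u_times_integrable[OF Ck_continuous[OF Ck_pd[OF \<eta>_Ck]] outside(2)])

lemma C_int: "integrable lborel C"
  unfolding C_def by (rule u_times_integrable[OF laplacian_continuous outside(3)])

lemma support: "y \<notin> cball x0 R \<Longrightarrow> A y = 0" "y \<notin> cball x0 R \<Longrightarrow> B b y = 0" "y \<notin> cball x0 R \<Longrightarrow> C y = 0"
  by (simp_all add: A_def B_def C_def outside)

lemma continuous_integrable:
  assumes g: "integrable lborel g" and 0: "\<And>y. y \<notin> cball x0 R \<Longrightarrow> g y = 0" and f: "continuous_on UNIV f"
  shows "integrable lborel (\<lambda>y. complex_of_real (g y) * f y)"
proof -
  have "bounded (f ` cball x0 R)"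
    by (intro compact_imp_bounded compact_continuous_image continuous_on_subset[OF f]) auto
  then obtain M where M: "\<forall>z\<in>f ` cball x0 R. norm z \<le> M" unfolding bounded_iff by (rule exE)
  show ?thesis
  proof (rule integrable_times_bounded_on[OF g borel_measurable_continuous_onI[OF f]])
    fix y assume "g y \<noteq> 0"
    then have "y \<in> cball x0 R" using 0 by blast
    then show "norm (f y) \<le> M" using M by blast
  qed
qed

lemma continuous_qdist: "continuous_on S (\<lambda>p. qdist x b (f p) (g p))"
  if "continuous_on S f" "continuous_on S g"
  unfolding qdist_def by (intro continuous_intros that)

lemma continuous_heat: "continuous_on S (\<lambda>p. heat \<mu> DIM('a) (s p) (q p))"
  if "continuous_on S s" "continuous_on S q" "\<And>p. p \<in> S \<Longrightarrow> s p \<noteq> 0"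
  unfolding heat_def by (intro continuous_intros that) (use that(3) in auto)

text \<open>The heat flow of \<open>\<eta> u\<close> at time \<open>s\<^sup>2\<close>, at the complex point \<open>x + \<zeta> b\<close>.\<close>

definition V :: "complex \<Rightarrow> 'a \<Rightarrow> 'a \<Rightarrow> complex \<Rightarrow> complex" where
  "V s x b \<zeta> = (\<integral>y. of_real (A y) * heat \<mu> DIM('a) s (qdist x b \<zeta> y) \<partial>lborel)"

lemma heat_integral_holomorphic:
  fixes P :: "complex \<Rightarrow> 'a \<Rightarrow> complex"
  assumes g: "integrable lborel g" "\<And>y. y \<notin> cball x0 R \<Longrightarrow> g y = 0" and s: "s \<noteq> 0"
    and P: "continuous_on UNIV (\<lambda>(\<zeta>, y). P \<zeta> y)" "\<And>\<zeta>. continuous_on UNIV (P' \<zeta>)"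
    and d: "\<And>\<zeta> y. ((\<lambda>\<zeta>. P \<zeta> y) has_field_derivative P' \<zeta> y) (at \<zeta>)"
  shows "(\<lambda>\<zeta>. \<integral>y. of_real (g y) * (heat \<mu> DIM('a) s (qdist x b \<zeta> y) * P \<zeta> y) \<partial>lborel) holomorphic_on UNIV"
proof -
  let ?q' = "\<lambda>\<zeta> y. - 2 * of_real ((y - x) \<bullet> b) + 2 * \<zeta>"
  let ?K' = "\<lambda>\<zeta> y. heat \<mu> DIM('a) s (qdist x b \<zeta> y) * (- (?q' \<zeta> y) / (4 * s\<^sup>2)) * P \<zeta> y
      + heat \<mu> DIM('a) s (qdist x b \<zeta> y) * P' \<zeta> y"
  have Pc: "continuous_on UNIV (P \<zeta>)" for \<zeta>
  proof -
    have "continuous_on UNIV (\<lambda>y::'a. (\<zeta>, y))" by (intro continuous_intros)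
    from continuous_on_compose2[OF P(1) this] show ?thesis by auto
  qed
  have "((\<lambda>\<zeta>. \<integral>y. of_real (g y) * (heat \<mu> DIM('a) s (qdist x b \<zeta> y) * P \<zeta> y) \<partial>lborel) has_field_derivative
      (\<integral>y. of_real (g y) * ?K' \<zeta>0 y \<partial>lborel)) (at \<zeta>0)" for \<zeta>0
  proof (rule holomorphic_parameter_integral[OF g(1) compact_cball g(2) open_UNIV])
    show "continuous_on (UNIV \<times> UNIV) (\<lambda>(\<zeta>, y). heat \<mu> DIM('a) s (qdist x b \<zeta> y) * P \<zeta> y)"
      using P(1) unfolding case_prod_beta'
      by (intro continuous_intros continuous_heat continuous_qdist) (auto simp: s)
    show "continuous_on UNIV (?K' \<zeta>)" for \<zeta>
      by (intro continuous_intros continuous_heat continuous_qdist Pc P(2)) (auto simp: s)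
    show "((\<lambda>\<zeta>. heat \<mu> DIM('a) s (qdist x b \<zeta> y) * P \<zeta> y) has_field_derivative ?K' \<zeta> y) (at \<zeta>)" for \<zeta> y
    proof -
      have "((\<lambda>\<zeta>. qdist x b \<zeta> y) has_field_derivative ?q' \<zeta> y) (at \<zeta>)"
        by (rule qdist_deriv)
      then have "((\<lambda>\<zeta>. heat \<mu> DIM('a) s (qdist x b \<zeta> y)) has_field_derivative
          heat \<mu> DIM('a) s (qdist x b \<zeta> y) * (- (?q' \<zeta> y) / (4 * s\<^sup>2))) (at \<zeta>)"
        by (rule heat_deriv_q)
      from DERIV_mult[OF this d[of y \<zeta>]] show ?thesis by (simp add: algebra_simps)
    qed
  qed auto
  then show ?thesis by (auto simp: holomorphic_on_open)
qed

lemma V_holomorphic: "s \<noteq> 0 \<Longrightarrow> V s x b holomorphic_on UNIV"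
  using heat_integral_holomorphic[OF A_int support(1), of s "\<lambda>_ _. 1" "\<lambda>_ _. 0" x b]
  by (simp add: V_def[abs_def] case_prod_beta')

text \<open>With \<open>G\<close> the Gaussian at scale \<open>\<sigma>\<close> centred at \<open>x + \<zeta> b\<close>, these are the factors in \<open>(\<Delta> + \<mu>) G = P1 G\<close>
  and \<open>- 2 \<partial>G = P2 G\<close>, the derivative taken in direction \<open>b'\<close>. Accordingly \<open>W\<close> is
  the integral of \<open>u (\<Delta> + \<mu>)(\<eta> G)\<close>.\<close>

definition P1 :: "real \<Rightarrow> 'a \<Rightarrow> 'a \<Rightarrow> complex \<Rightarrow> 'a \<Rightarrow> complex" where
  "P1 \<sigma> x b \<zeta> y = qdist x b \<zeta> y / of_real (4 * \<sigma> ^ 4) - of_real (real DIM('a) / (2 * \<sigma>\<^sup>2)) + of_real \<mu>"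

definition P2 :: "real \<Rightarrow> 'a \<Rightarrow> 'a \<Rightarrow> 'a \<Rightarrow> complex \<Rightarrow> 'a \<Rightarrow> complex" where
  "P2 \<sigma> x b b' \<zeta> y = (of_real ((y - x) \<bullet> b') - \<zeta> * of_real (b \<bullet> b')) / of_real (\<sigma>\<^sup>2)"

definition W :: "real \<Rightarrow> 'a \<Rightarrow> 'a \<Rightarrow> complex \<Rightarrow> complex" where
  "W \<sigma> x b \<zeta> = (\<integral>y. of_real (A y) * (heat \<mu> DIM('a) (of_real \<sigma>) (qdist x b \<zeta> y) * P1 \<sigma> x b \<zeta> y) \<partial>lborel)
    - (\<Sum>b'\<in>Basis. \<integral>y. of_real (B b' y) * (heat \<mu> DIM('a) (of_real \<sigma>) (qdist x b \<zeta> y) * P2 \<sigma> x b b' \<zeta> y) \<partial>lborel)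
    + (\<integral>y. of_real (C y) * (heat \<mu> DIM('a) (of_real \<sigma>) (qdist x b \<zeta> y) * 1) \<partial>lborel)"

lemma W_holomorphic:
  assumes \<sigma>: "\<sigma> > 0"
  shows "W \<sigma> x b holomorphic_on UNIV"
  unfolding W_def
proof (intro holomorphic_on_add holomorphic_on_diff holomorphic_on_sum)
  have s: "complex_of_real \<sigma> \<noteq> 0" using \<sigma> by simp
  show "(\<lambda>\<zeta>. \<integral>y. of_real (A y) * (heat \<mu> DIM('a) (of_real \<sigma>) (qdist x b \<zeta> y) * P1 \<sigma> x b \<zeta> y) \<partial>lborel) holomorphic_on UNIV"
  proof (rule heat_integral_holomorphic[OF A_int support(1) s,
        where P' = "\<lambda>\<zeta> y. (- 2 * of_real ((y - x) \<bullet> b) + 2 * \<zeta>) / of_real (4 * \<sigma> ^ 4)"])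
    show "continuous_on UNIV (\<lambda>(\<zeta>, y). P1 \<sigma> x b \<zeta> y)"
      unfolding P1_def case_prod_beta' using \<sigma> by (intro continuous_intros continuous_qdist) auto
    show "continuous_on UNIV (\<lambda>y. (- 2 * of_real ((y - x) \<bullet> b) + 2 * \<zeta>) / complex_of_real (4 * \<sigma> ^ 4))" for \<zeta>
      using \<sigma> by (intro continuous_intros) auto
    show "((\<lambda>\<zeta>. P1 \<sigma> x b \<zeta> y) has_field_derivative (- 2 * of_real ((y - x) \<bullet> b) + 2 * \<zeta>) / of_real (4 * \<sigma> ^ 4)) (at \<zeta>)"
      for \<zeta> y
    proof -
      have "((\<lambda>\<zeta>. P1 \<sigma> x b \<zeta> y) has_field_derivative
          (- 2 * of_real ((y - x) \<bullet> b) + 2 * \<zeta>) / of_real (4 * \<sigma> ^ 4) - 0 + 0) (at \<zeta>)"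
        unfolding P1_def by (intro DERIV_add DERIV_diff DERIV_cdivide qdist_deriv DERIV_const)
      then show ?thesis by simp
    qed
  qed
  show "(\<lambda>\<zeta>. \<integral>y. of_real (B b' y) * (heat \<mu> DIM('a) (of_real \<sigma>) (qdist x b \<zeta> y) * P2 \<sigma> x b b' \<zeta> y) \<partial>lborel) holomorphic_on UNIV"
    if b': "b' \<in> Basis" for b'
  proof (rule heat_integral_holomorphic[OF B_int[OF b'] support(2) s,
        where P' = "\<lambda>\<zeta> y. - of_real (b \<bullet> b') / of_real (\<sigma>\<^sup>2)"])
    show "continuous_on UNIV (\<lambda>(\<zeta>, y). P2 \<sigma> x b b' \<zeta> y)"
      unfolding P2_def case_prod_beta' using \<sigma> by (intro continuous_intros) auto
    show "((\<lambda>\<zeta>. P2 \<sigma> x b b' \<zeta> y) has_field_derivative - of_real (b \<bullet> b') / of_real (\<sigma>\<^sup>2)) (at \<zeta>)" for \<zeta> y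
    proof -
      have "((\<lambda>\<zeta>. P2 \<sigma> x b b' \<zeta> y) has_field_derivative
          (0 - 1 * of_real (b \<bullet> b')) / of_real (\<sigma>\<^sup>2)) (at \<zeta>)"
        unfolding P2_def by (intro DERIV_diff DERIV_cdivide DERIV_cmult_right DERIV_const DERIV_ident)
      then show ?thesis by simp
    qed
  qed auto
  show "(\<lambda>\<zeta>. \<integral>y. of_real (C y) * (heat \<mu> DIM('a) (of_real \<sigma>) (qdist x b \<zeta> y) * 1) \<partial>lborel) holomorphic_on UNIV"
    by (rule heat_integral_holomorphic[OF C_int support(3) s, where P' = "\<lambda>_ _. 0"])
      (auto simp: case_prod_beta')
qed

lemma heat_integrable:
  assumes "integrable lborel g" "\<And>y. y \<notin> cball x0 R \<Longrightarrow> g y = 0" "\<sigma> > 0" "continuous_on UNIV f"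
  shows "integrable lborel (\<lambda>y. complex_of_real (g y) * (heat \<mu> DIM('a) (of_real \<sigma>) (qdist x b \<zeta> y) * f y))"
  by (intro continuous_integrable assms continuous_on_mult continuous_heat continuous_qdist
      continuous_intros) (use assms(3) in auto)

lemma P_continuous:
  "\<sigma> > 0 \<Longrightarrow> continuous_on UNIV (P1 \<sigma> x b \<zeta>)" "\<sigma> > 0 \<Longrightarrow> continuous_on UNIV (P2 \<sigma> x b b' \<zeta>)"
  unfolding P1_def P2_def by (intro continuous_intros continuous_qdist; simp)+

lemma W_eq:
  assumes \<sigma>: "\<sigma> > 0"
  shows "W \<sigma> x b \<zeta> = (\<integral>y. of_real (A y) * (heat \<mu> DIM('a) (of_real \<sigma>) (qdist x b \<zeta> y) * P1 \<sigma> x b \<zeta> y)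
    - (\<Sum>b'\<in>Basis. of_real (B b' y) * (heat \<mu> DIM('a) (of_real \<sigma>) (qdist x b \<zeta> y) * P2 \<sigma> x b b' \<zeta> y))
    + of_real (C y) * (heat \<mu> DIM('a) (of_real \<sigma>) (qdist x b \<zeta> y) * 1) \<partial>lborel)"
proof -
  have iA: "integrable lborel (\<lambda>y. of_real (A y) * (heat \<mu> DIM('a) (of_real \<sigma>) (qdist x b \<zeta> y) * P1 \<sigma> x b \<zeta> y))"
    by (rule heat_integrable[OF A_int support(1) \<sigma> P_continuous(1)[OF \<sigma>]])
  have iB: "integrable lborel (\<lambda>y. of_real (B b' y) * (heat \<mu> DIM('a) (of_real \<sigma>) (qdist x b \<zeta> y) * P2 \<sigma> x b b' \<zeta> y))"
    if "b' \<in> Basis" for b'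
    by (rule heat_integrable[OF B_int[OF that] support(2) \<sigma> P_continuous(2)[OF \<sigma>]])
  have iC: "integrable lborel (\<lambda>y. of_real (C y) * (heat \<mu> DIM('a) (of_real \<sigma>) (qdist x b \<zeta> y) * 1))"
    by (rule heat_integrable[OF C_int support(3) \<sigma> continuous_on_const])
  note iS = Bochner_Integration.integrable_sum[of Basis lborel, OF iB]
  note iAS = Bochner_Integration.integrable_diff[OF iA iS]
  show ?thesis
    unfolding W_def
    by (simp only: Bochner_Integration.integral_add[OF iAS iC] Bochner_Integration.integral_diff[OF iA iS]
        Bochner_Integration.integral_sum[of Basis lborel, OF iB])
qed

text \<open>On the real axis \<open>W\<close> is the weak eigenvalue equation tested with the cut off Gaussian.\<close>

lemma W_real:
  assumes \<sigma>: "\<sigma> > 0" and b: "b \<in> Basis"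
  shows "W \<sigma> x b (of_real t) = 0"
proof -
  define x' where "x' = x + t *\<^sub>R b"
  define s where "s = 4 * \<sigma>\<^sup>2"
  define c where "c = exp (\<mu> * \<sigma>\<^sup>2) / \<sigma> ^ DIM('a)"
  define G where "G y = exp (- ((norm (y - x'))\<^sup>2 / s))" for y
  have s: "s \<noteq> 0" using \<sigma> by (simp add: s_def)
  have G_Ck: "\<And>n. Ck n G" unfolding G_def by (rule Ck_gauss)
  have h: "heat \<mu> DIM('a) (of_real \<sigma>) (qdist x b (of_real t) y) = of_real (c * G y)" for y
    unfolding qdist_of_real[OF b] heat_of_real
    by (simp add: c_def G_def s_def x'_def exp_diff exp_minus field_simps)
  have p1: "P1 \<sigma> x b (of_real t) y = of_real (4 * (norm (y - x'))\<^sup>2 / s\<^sup>2 - 2 * real DIM('a) / s + \<mu>)" for y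
    unfolding P1_def qdist_of_real[OF b] x'_def[symmetric] s_def
    by (simp add: power_mult_distrib power_mult[symmetric])
  have p2: "P2 \<sigma> x b b' (of_real t) y = of_real (4 * ((y - x') \<bullet> b') / s)" for y b'
  proof -
    have "(y - x') \<bullet> b' = (y - x) \<bullet> b' - t * (b \<bullet> b')"
      by (simp add: x'_def inner_diff_left inner_add_left)
    moreover have "4 * a / s = a / \<sigma>\<^sup>2" for a by (simp add: s_def)
    ultimately have "4 * ((y - x') \<bullet> b') / s = ((y - x) \<bullet> b' - t * (b \<bullet> b')) / \<sigma>\<^sup>2"
      by (simp only:)
    then show ?thesis unfolding P2_def by simp
  qed
  have lap: "laplacian (\<lambda>y. \<eta> y * G y) y + \<mu> * (\<eta> y * G y)
      = \<eta> y * (G y * (4 * (norm (y - x'))\<^sup>2 / s\<^sup>2 - 2 * real DIM('a) / s + \<mu>))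
        - (\<Sum>b'\<in>Basis. pd b' \<eta> y * (G y * (4 * ((y - x') \<bullet> b') / s))) + laplacian \<eta> y * G y" for y
  proof -
    have pdG: "pd b' G y = G y * (- (2 * ((y - x') \<bullet> b') / s))" for b'
      unfolding G_def by (rule pd_gauss)
    have lG: "laplacian G y = G y * (4 * (norm (y - x'))\<^sup>2 / s\<^sup>2 - 2 * real DIM('a) / s)"
      unfolding G_def by (rule laplacian_gauss[OF s])
    have sm: "2 * (\<Sum>b'\<in>Basis. pd b' \<eta> y * pd b' G y)
        = - (\<Sum>b'\<in>Basis. pd b' \<eta> y * (G y * (4 * ((y - x') \<bullet> b') / s)))"
      unfolding pdG sum_distrib_left sum_negf[symmetric]
      by (rule sum.cong) auto
    show ?thesis unfolding laplacian_mult[OF \<eta>_Ck G_Ck] sm lG by (simp add: algebra_simps)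
  qed
  have eq: "of_real (A y) * (of_real (c * G y) * of_real (4 * (norm (y - x'))\<^sup>2 / s\<^sup>2 - 2 * real DIM('a) / s + \<mu>)) -
        (\<Sum>b'\<in>Basis. of_real (B b' y) * (of_real (c * G y) * of_real (4 * ((y - x') \<bullet> b') / s))) +
        of_real (C y) * (of_real (c * G y) * 1)
      = complex_of_real (c * (u y * (laplacian (\<lambda>y. \<eta> y * G y) y + \<mu> * (\<eta> y * G y))))" for y
  proof -
    have "c * (u y * (laplacian (\<lambda>y. \<eta> y * G y) y + \<mu> * (\<eta> y * G y)))
        = A y * (c * G y * (4 * (norm (y - x'))\<^sup>2 / s\<^sup>2 - 2 * real DIM('a) / s + \<mu>))
          - (\<Sum>b'\<in>Basis. B b' y * (c * G y * (4 * ((y - x') \<bullet> b') / s))) + C y * (c * G y)"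
      unfolding lap A_def B_def C_def
      by (simp add: algebra_simps sum_distrib_left)
    then show ?thesis
      by (simp only: of_real_mult of_real_add of_real_diff of_real_sum mult_1_right)
  qed
  have "W \<sigma> x b (of_real t) = (\<integral>y. of_real (c * (u y * (laplacian (\<lambda>y. \<eta> y * G y) y + \<mu> * (\<eta> y * G y)))) \<partial>lborel)"
    unfolding W_eq[OF \<sigma>] h p1 p2 eq ..
  also have "\<dots> = of_real (c * (\<integral>y. u y * (laplacian (\<lambda>y. \<eta> y * G y) y + \<mu> * (\<eta> y * G y)) \<partial>lborel))"
    by (simp only: integral_complex_of_real integral_mult_right_zero)
  also have "\<dots> = 0" using weak[of G, OF G_Ck] by simp
  finally show ?thesis .
qed

text \<open>The weak equation only admits real Gaussians; the identity theorem carries it to complex centres.\<close>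

lemma W_zero:
  assumes \<sigma>: "\<sigma> > 0" and b: "b \<in> Basis"
  shows "W \<sigma> x b \<zeta> = 0"
proof (rule analytic_continuation[where f = "W \<sigma> x b" and S = UNIV and U = \<real> and \<xi> = 0 and w = \<zeta>])
  show "W \<sigma> x b holomorphic_on UNIV" by (rule W_holomorphic[OF \<sigma>])
  show "0 islimpt (\<real> :: complex set)"
    unfolding islimpt_approachable
  proof (intro allI impI)
    fix e :: real assume "e > 0"
    then show "\<exists>x'\<in>\<real>. x' \<noteq> 0 \<and> dist x' (0::complex) < e"
      by (intro bexI[of _ "of_real (e / 2)"]) auto
  qed
  show "W \<sigma> x b z = 0" if "z \<in> \<real>" for z using W_real[OF \<sigma> b] that by (auto elim: Reals_cases)
qed auto

text \<open>The derivative of \<open>V\<close> in \<open>\<sigma>\<close>: the heat equation turns it into \<open>2 \<sigma> (\<Delta> + \<mu>)\<close> under the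
  integral, and the vanishing of \<open>W\<close> leaves only the terms with derivatives of the cutoff.\<close>

lemma V_deriv:
  assumes \<sigma>: "\<sigma> > 0" and b: "b \<in> Basis"
  shows "((\<lambda>s. V s x b \<zeta>) has_field_derivative
    (\<integral>y. 2 * of_real \<sigma> * heat \<mu> DIM('a) (of_real \<sigma>) (qdist x b \<zeta> y) *
      ((\<Sum>b'\<in>Basis. of_real (B b' y) * P2 \<sigma> x b b' \<zeta> y) - of_real (C y)) \<partial>lborel)) (at (of_real \<sigma>))"
proof -
  let ?h = "\<lambda>y. heat \<mu> DIM('a) (of_real \<sigma>) (qdist x b \<zeta> y)"
  let ?P = "\<lambda>s y. 2 * of_real \<mu> * s + qdist x b \<zeta> y / (2 * s ^ 3) - of_nat DIM('a) / s"
  have d: "((\<lambda>s. V s x b \<zeta>) has_field_derivative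
      (\<integral>y. of_real (A y) * (?h y * ?P (of_real \<sigma>) y) \<partial>lborel)) (at (of_real \<sigma>))"
    unfolding V_def
  proof (rule holomorphic_parameter_integral[OF A_int compact_cball support(1), where D = "- {0}"])
    show "continuous_on ((- {0}) \<times> UNIV) (\<lambda>(s, y). heat \<mu> DIM('a) s (qdist x b \<zeta> y))"
      unfolding case_prod_beta'
      by (intro continuous_heat continuous_qdist continuous_intros) auto
    show "continuous_on UNIV (\<lambda>y. heat \<mu> DIM('a) s (qdist x b \<zeta> y) * ?P s y)" if "s \<in> - {0}" for s
      using that by (intro continuous_heat continuous_qdist continuous_intros) auto
    show "((\<lambda>s. heat \<mu> DIM('a) s (qdist x b \<zeta> y)) has_field_derivative
        heat \<mu> DIM('a) s (qdist x b \<zeta> y) * ?P s y) (at s)" if "s \<in> - {0}" for s y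
      by (rule heat_deriv_s) (use that in auto)
  qed (use \<sigma> in auto)
  have P: "?P (of_real \<sigma>) y = 2 * of_real \<sigma> * P1 \<sigma> x b \<zeta> y" for y
    using \<sigma> unfolding P1_def by (simp add: field_simps power2_eq_square power3_eq_cube power4_eq_xxxx)
  have iA: "integrable lborel (\<lambda>y. of_real (A y) * (?h y * P1 \<sigma> x b \<zeta> y))"
    by (rule heat_integrable[OF A_int support(1) \<sigma> P_continuous(1)[OF \<sigma>]])
  have iB: "integrable lborel (\<lambda>y. of_real (B b' y) * (?h y * P2 \<sigma> x b b' \<zeta> y))" if "b' \<in> Basis" for b'
    by (rule heat_integrable[OF B_int[OF that] support(2) \<sigma> P_continuous(2)[OF \<sigma>]])
  have iC: "integrable lborel (\<lambda>y. of_real (C y) * (?h y * 1))"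
    by (rule heat_integrable[OF C_int support(3) \<sigma> continuous_on_const])
  note iS = Bochner_Integration.integrable_sum[of Basis lborel, OF iB]
  have "(\<integral>y. of_real (A y) * (?h y * P1 \<sigma> x b \<zeta> y) \<partial>lborel)
      = (\<Sum>b'\<in>Basis. \<integral>y. of_real (B b' y) * (?h y * P2 \<sigma> x b b' \<zeta> y) \<partial>lborel)
        - (\<integral>y. of_real (C y) * (?h y * 1) \<partial>lborel)"
    using W_zero[OF \<sigma> b, of x \<zeta>] unfolding W_def by (simp add: algebra_simps)
  also have "\<dots> = (\<integral>y. (\<Sum>b'\<in>Basis. of_real (B b' y) * (?h y * P2 \<sigma> x b b' \<zeta> y)) - of_real (C y) * (?h y * 1) \<partial>lborel)"
    by (simp only: Bochner_Integration.integral_diff[OF iS iC]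
        Bochner_Integration.integral_sum[of Basis lborel, OF iB])
  finally have "2 * of_real \<sigma> * (\<integral>y. of_real (A y) * (?h y * P1 \<sigma> x b \<zeta> y) \<partial>lborel)
      = (\<integral>y. 2 * of_real \<sigma> * ((\<Sum>b'\<in>Basis. of_real (B b' y) * (?h y * P2 \<sigma> x b b' \<zeta> y))
          - of_real (C y) * (?h y * 1)) \<partial>lborel)"
    by (simp only: integral_mult_right_zero)
  moreover have "(\<integral>y. of_real (A y) * (?h y * ?P (of_real \<sigma>) y) \<partial>lborel)
      = 2 * of_real \<sigma> * (\<integral>y. of_real (A y) * (?h y * P1 \<sigma> x b \<zeta> y) \<partial>lborel)"
    unfolding P integral_mult_right_zero[symmetric]
    by (rule Bochner_Integration.integral_cong) (simp_all add: mult_ac)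
  moreover have "2 * of_real \<sigma> * ((\<Sum>b'\<in>Basis. of_real (B b' y) * (?h y * P2 \<sigma> x b b' \<zeta> y))
          - of_real (C y) * (?h y * 1))
      = 2 * of_real \<sigma> * ?h y * ((\<Sum>b'\<in>Basis. of_real (B b' y) * P2 \<sigma> x b b' \<zeta> y) - of_real (C y))" for y
    by (simp add: right_diff_distrib sum_distrib_left mult_ac)
  ultimately have "(\<integral>y. of_real (A y) * (?h y * ?P (of_real \<sigma>) y) \<partial>lborel)
      = (\<integral>y. 2 * of_real \<sigma> * ?h y * ((\<Sum>b'\<in>Basis. of_real (B b' y) * P2 \<sigma> x b b' \<zeta> y) - of_real (C y)) \<partial>lborel)"
    by (simp only:)
  with d show ?thesis by (simp only:)
qed

definition BC :: "'a \<Rightarrow> real" where "BC y = (\<Sum>b'\<in>Basis. \<bar>B b' y\<bar>) + \<bar>C y\<bar>"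

lemma BC_int: "integrable lborel BC"
  unfolding BC_def
  by (intro Bochner_Integration.integrable_add Bochner_Integration.integrable_sum integrable_abs B_int C_int)

lemma BC_support: "y \<notin> cball x0 R \<Longrightarrow> BC y = 0" "y \<in> ball x0 r \<Longrightarrow> BC y = 0"
proof -
  show "y \<notin> cball x0 R \<Longrightarrow> BC y = 0" using support by (simp add: BC_def)
  show "y \<in> ball x0 r \<Longrightarrow> BC y = 0" using inside by (simp add: BC_def B_def C_def)
qed

text \<open>Where \<open>B\<close> or \<open>C\<close> differ from \<open>0\<close>, the Gaussian is at most \<open>exp (- r\<^sup>2 / (8 \<sigma>\<^sup>2))\<close>, which absorbs the
  negative powers of \<open>\<sigma>\<close>.\<close>

lemma kernel_bound:
  assumes x: "x \<in> ball x0 \<rho>" and \<zeta>: "\<zeta> \<in> ball 0 \<rho>" and b: "b \<in> Basis"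
    and \<sigma>: "0 < \<sigma>" "\<sigma> \<le> 1"
    and K: "exp (- (r\<^sup>2 / 8 / \<sigma>\<^sup>2)) / \<sigma> ^ (DIM('a) + 2) \<le> K" "0 \<le> K"
  shows "norm (2 * of_real \<sigma> * heat \<mu> DIM('a) (of_real \<sigma>) (qdist x b \<zeta> y) *
      ((\<Sum>b'\<in>Basis. of_real (B b' y) * P2 \<sigma> x b b' \<zeta> y) - of_real (C y)))
    \<le> 2 * exp \<bar>\<mu>\<bar> * (2 * R + 1) * K * BC y"
proof (cases "y \<in> cball x0 R - ball x0 r")
  case False
  then have "BC y = 0" using BC_support by auto
  moreover have "0 \<le> (\<Sum>b'\<in>Basis. \<bar>B b' y\<bar>)" by (rule sum_nonneg) simp
  ultimately have "(\<Sum>b'\<in>Basis. \<bar>B b' y\<bar>) = 0" "C y = 0"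
    unfolding BC_def by (smt (verit) abs_ge_zero)+
  then have "\<forall>b'\<in>Basis. B b' y = 0" by (simp add: sum_nonneg_eq_0_iff)
  then show ?thesis using \<open>C y = 0\<close> \<open>BC y = 0\<close> by simp
next
  case True
  have R: "R > 0" "\<rho> < R" using r by (auto simp: \<rho>_def)
  have n\<zeta>: "norm \<zeta> < \<rho>" using \<zeta> by simp
  have xx: "norm (x - x0) < \<rho>" using x by (simp add: dist_norm norm_minus_commute)
  have yx: "r \<le> norm (y - x0)" "norm (y - x0) \<le> R"
    using True by (auto simp: dist_norm norm_minus_commute)
  define w where "w = y - (x + Re \<zeta> *\<^sub>R b)"
  have "y - x0 = w + (x - x0) + Re \<zeta> *\<^sub>R b" by (simp add: w_def)
  then have "norm (y - x0) \<le> norm w + norm (x - x0) + norm (Re \<zeta> *\<^sub>R b)"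
    by (metis norm_triangle_ineq norm_triangle_le add_right_mono order_trans)
  moreover have "norm (Re \<zeta> *\<^sub>R b) \<le> norm \<zeta>" using b abs_Re_le_cmod[of \<zeta>] by simp
  ultimately have "6 * \<rho> \<le> norm w" using yx xx n\<zeta> by (simp add: \<rho>_def)
  then have "(6 * \<rho>)\<^sup>2 \<le> (norm w)\<^sup>2" using \<rho> by (intro power_mono) auto
  then have "36 * \<rho>\<^sup>2 \<le> (norm w)\<^sup>2" by (simp add: power_mult_distrib)
  moreover have "(Im \<zeta>)\<^sup>2 \<le> \<rho>\<^sup>2"
    using abs_Im_le_cmod[of \<zeta>] n\<zeta> \<rho> by (intro power2_le_iff_abs_le[THEN iffD2]) auto
  moreover have "r\<^sup>2 = 64 * \<rho>\<^sup>2" by (simp add: \<rho>_def power_divide)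
  ultimately have q: "r\<^sup>2 / 2 \<le> Re (qdist x b \<zeta> y)"
    unfolding Re_qdist[OF b] w_def[symmetric] using zero_le_power2[of \<rho>] by linarith
  have h: "norm (heat \<mu> DIM('a) (of_real \<sigma>) (qdist x b \<zeta> y))
      \<le> exp \<bar>\<mu>\<bar> * (exp (- (r\<^sup>2 / 8 / \<sigma>\<^sup>2)) / \<sigma> ^ DIM('a))"
  proof -
    have "r\<^sup>2 / 2 / (4 * \<sigma>\<^sup>2) \<le> Re (qdist x b \<zeta> y) / (4 * \<sigma>\<^sup>2)"
      using q \<sigma> by (intro divide_right_mono) auto
    moreover have "\<mu> * \<sigma>\<^sup>2 \<le> \<bar>\<mu>\<bar> * 1"
      using \<sigma> by (intro mult_mono) (auto simp: power_le_one)
    ultimately have "\<mu> * \<sigma>\<^sup>2 - Re (qdist x b \<zeta> y) / (4 * \<sigma>\<^sup>2) \<le> \<bar>\<mu>\<bar> + (- (r\<^sup>2 / 8 / \<sigma>\<^sup>2))"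
      by simp
    then have "exp (\<mu> * \<sigma>\<^sup>2 - Re (qdist x b \<zeta> y) / (4 * \<sigma>\<^sup>2)) \<le> exp \<bar>\<mu>\<bar> * exp (- (r\<^sup>2 / 8 / \<sigma>\<^sup>2))"
      unfolding exp_add[symmetric] by simp
    then show ?thesis using \<sigma> by (simp add: norm_heat divide_right_mono)
  qed
  have p2: "norm (P2 \<sigma> x b b' \<zeta> y) \<le> 2 * R / \<sigma>\<^sup>2" if b': "b' \<in> Basis" for b'
  proof -
    have "norm (of_real ((y - x) \<bullet> b') - \<zeta> * of_real (b \<bullet> b')) \<le> \<bar>(y - x) \<bullet> b'\<bar> + norm \<zeta> * \<bar>b \<bullet> b'\<bar>"
      by (metis norm_mult norm_of_real norm_triangle_ineq4)
    also have "\<dots> \<le> norm (y - x) * 1 + norm \<zeta> * 1"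
      using Cauchy_Schwarz_ineq2[of "y - x" b'] Cauchy_Schwarz_ineq2[of b b'] b b'
      by (intro add_mono mult_left_mono) auto
    also have "\<dots> \<le> 2 * R"
    proof -
      have "norm (y - x) \<le> norm (y - x0) + norm (x - x0)"
        using norm_triangle_ineq4[of "y - x0" "x - x0"] by simp
      moreover have "8 * \<rho> = r" by (simp add: \<rho>_def)
      ultimately show ?thesis using yx xx n\<zeta> r \<rho> by linarith
    qed
    finally show ?thesis using \<sigma> by (simp add: P2_def norm_divide divide_right_mono norm_power)
  qed
  have \<sigma>2: "1 \<le> 1 / \<sigma>\<^sup>2" using \<sigma> by (simp add: power_le_one)
  have s: "norm ((\<Sum>b'\<in>Basis. of_real (B b' y) * P2 \<sigma> x b b' \<zeta> y) - of_real (C y)) \<le> (2 * R + 1) / \<sigma>\<^sup>2 * BC y"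
  proof -
    have "norm ((\<Sum>b'\<in>Basis. of_real (B b' y) * P2 \<sigma> x b b' \<zeta> y) - of_real (C y))
        \<le> (\<Sum>b'\<in>Basis. norm (of_real (B b' y) * P2 \<sigma> x b b' \<zeta> y)) + norm (complex_of_real (C y))"
      by (intro order_trans[OF norm_triangle_ineq4] add_mono norm_sum order_refl)
    also have "\<dots> \<le> (\<Sum>b'\<in>Basis. \<bar>B b' y\<bar> * ((2 * R + 1) / \<sigma>\<^sup>2)) + \<bar>C y\<bar> * ((2 * R + 1) / \<sigma>\<^sup>2)"
    proof (intro add_mono sum_mono)
      fix b' :: 'a assume "b' \<in> Basis"
      have "norm (P2 \<sigma> x b b' \<zeta> y) \<le> (2 * R + 1) / \<sigma>\<^sup>2"
        using p2[OF \<open>b' \<in> Basis\<close>] divide_right_mono[of "2 * R" "2 * R + 1" "\<sigma>\<^sup>2"] by simp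
      then show "norm (of_real (B b' y) * P2 \<sigma> x b b' \<zeta> y) \<le> \<bar>B b' y\<bar> * ((2 * R + 1) / \<sigma>\<^sup>2)"
        unfolding norm_mult norm_of_real by (rule mult_left_mono) simp
    next
      have "1 * 1 \<le> (2 * R + 1) * (1 / \<sigma>\<^sup>2)" using R \<sigma>2 by (intro mult_mono) auto
      then have "\<bar>C y\<bar> * 1 \<le> \<bar>C y\<bar> * ((2 * R + 1) / \<sigma>\<^sup>2)" by (intro mult_left_mono) auto
      then show "norm (complex_of_real (C y)) \<le> \<bar>C y\<bar> * ((2 * R + 1) / \<sigma>\<^sup>2)" by simp
    qed
    also have "\<dots> = (2 * R + 1) / \<sigma>\<^sup>2 * BC y"
      unfolding BC_def sum_distrib_right[symmetric] by (simp only: distrib_left mult.commute)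
    finally show ?thesis .
  qed
  have BC0: "0 \<le> BC y" by (auto simp: BC_def intro!: add_nonneg_nonneg sum_nonneg)
  have "norm (2 * of_real \<sigma> * heat \<mu> DIM('a) (of_real \<sigma>) (qdist x b \<zeta> y) *
      ((\<Sum>b'\<in>Basis. of_real (B b' y) * P2 \<sigma> x b b' \<zeta> y) - of_real (C y)))
    = 2 * \<sigma> * norm (heat \<mu> DIM('a) (of_real \<sigma>) (qdist x b \<zeta> y)) *
      norm ((\<Sum>b'\<in>Basis. of_real (B b' y) * P2 \<sigma> x b b' \<zeta> y) - of_real (C y))"
    using \<sigma> by (simp add: norm_mult)
  also have "\<dots> \<le> 2 * 1 * (exp \<bar>\<mu>\<bar> * (exp (- (r\<^sup>2 / 8 / \<sigma>\<^sup>2)) / \<sigma> ^ DIM('a))) * ((2 * R + 1) / \<sigma>\<^sup>2 * BC y)"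
    using \<sigma> by (intro mult_mono h s mult_left_mono) auto
  also have "\<dots> = 2 * exp \<bar>\<mu>\<bar> * (2 * R + 1) * (exp (- (r\<^sup>2 / 8 / \<sigma>\<^sup>2)) / \<sigma> ^ (DIM('a) + 2)) * BC y"
    by (simp add: power_add power2_eq_square mult_ac)
  also have "\<dots> \<le> 2 * exp \<bar>\<mu>\<bar> * (2 * R + 1) * K * BC y"
    using K BC0 R by (intro mult_right_mono mult_left_mono) auto
  finally show ?thesis .
qed

text \<open>The time derivative is bounded down to time \<open>0\<close>, uniformly in \<open>x\<close>, \<open>b\<close> and \<open>\<zeta>\<close>.\<close>

lemma V_lipschitz:
  obtains L where "L \<ge> 0" "\<And>x b \<zeta> s s'. x \<in> ball x0 \<rho> \<Longrightarrow> b \<in> Basis \<Longrightarrow> \<zeta> \<in> ball 0 \<rho> \<Longrightarrow>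
    s \<in> {0<..1} \<Longrightarrow> s' \<in> {0<..1} \<Longrightarrow>
    norm (V (of_real s) x b \<zeta> - V (of_real s') x b \<zeta>) \<le> L * \<bar>s - s'\<bar>"
proof -
  have "r\<^sup>2 / 8 > 0" using r by simp
  then obtain K where K: "0 \<le> K"
    "\<And>\<sigma>. 0 < \<sigma> \<Longrightarrow> \<sigma> \<le> 1 \<Longrightarrow> exp (- (r\<^sup>2 / 8 / \<sigma>\<^sup>2)) / \<sigma> ^ (DIM('a) + 2) \<le> K"
    using gauss_power_bound[of "r\<^sup>2 / 8" "DIM('a) + 2"] by blast
  define c where "c = 2 * exp \<bar>\<mu>\<bar> * (2 * R + 1) * K"
  define L where "L = (\<integral>y. c * BC y \<partial>lborel)"
  have int: "integrable lborel (\<lambda>y. c * BC y)" using BC_int by simp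
  have c: "c \<ge> 0" using K r by (simp add: c_def)
  have L: "L \<ge> 0"
    unfolding L_def
  proof (rule Bochner_Integration.integral_nonneg)
    fix y
    have "0 \<le> BC y" unfolding BC_def by (intro add_nonneg_nonneg sum_nonneg) auto
    then show "0 \<le> c * BC y" using c by simp
  qed
  have "norm (V (of_real s) x b \<zeta> - V (of_real s') x b \<zeta>) \<le> L * \<bar>s - s'\<bar>"
    if x: "x \<in> ball x0 \<rho>" and b: "b \<in> Basis" and \<zeta>: "\<zeta> \<in> ball 0 \<rho>" and s: "s \<in> {0<..1}" "s' \<in> {0<..1}"
    for x b \<zeta> s s'
  proof -
    let ?D = "\<lambda>\<sigma>. \<integral>y. 2 * of_real \<sigma> * heat \<mu> DIM('a) (of_real \<sigma>) (qdist x b \<zeta> y) *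
      ((\<Sum>b'\<in>Basis. of_real (B b' y) * P2 \<sigma> x b b' \<zeta> y) - of_real (C y)) \<partial>lborel"
    have "norm (V (of_real s) x b \<zeta> - V (of_real s') x b \<zeta>)
        \<le> L * norm (complex_of_real s - complex_of_real s')"
    proof (rule field_differentiable_bound[where S = "complex_of_real ` {0<..1}" and f = "\<lambda>s. V s x b \<zeta>"
          and f' = "\<lambda>z. ?D (Re z)"])
      show "convex (complex_of_real ` {0<..1})"
        by (rule convex_linear_image) (auto intro: bounded_linear.linear[OF bounded_linear_of_real])
      fix z assume "z \<in> complex_of_real ` {0<..1}"
      then obtain \<sigma> where \<sigma>: "z = of_real \<sigma>" "0 < \<sigma>" "\<sigma> \<le> 1" by auto
      show "((\<lambda>s. V s x b \<zeta>) has_field_derivative ?D (Re z)) (at z within complex_of_real ` {0<..1})"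
        unfolding \<sigma>(1) Re_complex_of_real
        by (rule has_field_derivative_at_within[OF V_deriv[OF \<sigma>(2) b]])
      show "norm (?D (Re z)) \<le> L"
        unfolding \<sigma>(1) Re_complex_of_real L_def
      proof (rule Bochner_Integration.integral_norm_bound_integral[OF _ int])
        show "norm (2 * of_real \<sigma> * heat \<mu> DIM('a) (of_real \<sigma>) (qdist x b \<zeta> y) *
            ((\<Sum>b'\<in>Basis. of_real (B b' y) * P2 \<sigma> x b b' \<zeta> y) - of_real (C y))) \<le> c * BC y" for y
          unfolding c_def by (rule kernel_bound[OF x \<zeta> b \<sigma>(2,3) K(2)[OF \<sigma>(2,3)] K(1)])
        have iB: "integrable lborel (\<lambda>y. of_real (B b' y) * (heat \<mu> DIM('a) (of_real \<sigma>) (qdist x b \<zeta> y) * P2 \<sigma> x b b' \<zeta> y))" if "b' \<in> Basis" for b'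
          by (rule heat_integrable[OF B_int[OF that] support(2) \<sigma>(2) P_continuous(2)[OF \<sigma>(2)]])
        have iC: "integrable lborel (\<lambda>y. of_real (C y) * (heat \<mu> DIM('a) (of_real \<sigma>) (qdist x b \<zeta> y) * 1))"
          by (rule heat_integrable[OF C_int support(3) \<sigma>(2) continuous_on_const])
        have "integrable lborel (\<lambda>y. 2 * of_real \<sigma> * ((\<Sum>b'\<in>Basis. of_real (B b' y) * (heat \<mu> DIM('a) (of_real \<sigma>) (qdist x b \<zeta> y) * P2 \<sigma> x b b' \<zeta> y))
            - of_real (C y) * (heat \<mu> DIM('a) (of_real \<sigma>) (qdist x b \<zeta> y) * 1)))"
          by (intro integrable_mult_right Bochner_Integration.integrable_diff
              Bochner_Integration.integrable_sum iB iC)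
        then show "integrable lborel (\<lambda>y. 2 * of_real \<sigma> * heat \<mu> DIM('a) (of_real \<sigma>) (qdist x b \<zeta> y) *
            ((\<Sum>b'\<in>Basis. of_real (B b' y) * P2 \<sigma> x b b' \<zeta> y) - of_real (C y)))"
          by (simp add: right_diff_distrib sum_distrib_left mult_ac)
      qed
    qed (use s in auto)
    then show ?thesis by (metis norm_of_real of_real_diff)
  qed
  with L that show ?thesis by blast
qed

definition \<sigma>seq :: "nat \<Rightarrow> real" where "\<sigma>seq n = 1 / real (Suc n)"

lemma \<sigma>seq: "\<sigma>seq n \<in> {0<..1}" "\<sigma>seq \<longlonglongrightarrow> 0"
  using LIMSEQ_inverse_real_of_nat by (auto simp: \<sigma>seq_def[abs_def] inverse_eq_divide)

definition Vr :: "real \<Rightarrow> 'a \<Rightarrow> complex" where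
  "Vr \<sigma> x = (\<integral>y. of_real (A y) * heat \<mu> DIM('a) (of_real \<sigma>) (of_real ((norm (y - x))\<^sup>2)) \<partial>lborel)"

lemma V_real: "b \<in> Basis \<Longrightarrow> V (of_real \<sigma>) x b (of_real t) = Vr \<sigma> (x + t *\<^sub>R b)"
  unfolding V_def Vr_def by (simp only: qdist_of_real)

text \<open>At real points the flow depends on \<open>x + t b\<close> only, so one limit function serves all lines.\<close>

definition U :: "'a \<Rightarrow> complex" where "U x = lim (\<lambda>n. Vr (\<sigma>seq n) x)"

text \<open>Uniform limits of holomorphic functions are holomorphic.\<close>

lemma U_lines:
  assumes x: "x \<in> ball x0 \<rho>" and b: "b \<in> Basis"
  obtains h where "h holomorphic_on ball 0 \<rho>" "\<And>t. \<bar>t\<bar> < \<rho> \<Longrightarrow> h (of_real t) = U (x + t *\<^sub>R b)"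
    "\<And>t. \<bar>t\<bar> < \<rho> \<Longrightarrow> (\<lambda>n. Vr (\<sigma>seq n) (x + t *\<^sub>R b)) \<longlonglongrightarrow> U (x + t *\<^sub>R b)"
proof -
  obtain L where L: "L \<ge> 0" "\<And>\<zeta> s s'. \<zeta> \<in> ball 0 \<rho> \<Longrightarrow> s \<in> {0<..1} \<Longrightarrow> s' \<in> {0<..1} \<Longrightarrow>
      norm (V (of_real s) x b \<zeta> - V (of_real s') x b \<zeta>) \<le> L * \<bar>s - s'\<bar>"
    using V_lipschitz x b by metis
  define f where "f n \<zeta> = V (of_real (\<sigma>seq n)) x b \<zeta>" for n \<zeta>
  have "uniformly_Cauchy_on (ball 0 \<rho>) f"
  proof (rule uniformly_Cauchy_onI)
    fix e :: real assume e: "e > 0"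
    have "Cauchy \<sigma>seq" using \<sigma>seq(2) by (rule LIMSEQ_imp_Cauchy)
    then obtain M where M: "\<And>m n. m \<ge> M \<Longrightarrow> n \<ge> M \<Longrightarrow> norm (\<sigma>seq m - \<sigma>seq n) < e / (L + 1)"
      using CauchyD[of \<sigma>seq "e / (L + 1)"] e L(1) by auto
    have "dist (f m \<zeta>) (f n \<zeta>) < e" if "\<zeta> \<in> ball 0 \<rho>" "m \<ge> M" "n \<ge> M" for \<zeta> m n
    proof -
      have "dist (f m \<zeta>) (f n \<zeta>) \<le> L * \<bar>\<sigma>seq m - \<sigma>seq n\<bar>"
        unfolding dist_norm f_def by (rule L(2)[OF that(1) \<sigma>seq(1) \<sigma>seq(1)])
      also have "\<dots> \<le> L * (e / (L + 1))"
        using M[OF that(2,3)] L(1) by (intro mult_left_mono) auto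
      also have "\<dots> < e" using e L(1) by (simp add: field_simps)
      finally show ?thesis .
    qed
    then show "\<exists>M. \<forall>x\<in>ball 0 \<rho>. \<forall>m\<ge>M. \<forall>n\<ge>M. dist (f m x) (f n x) < e" by blast
  qed
  then obtain h where h: "uniform_limit (ball 0 \<rho>) f h sequentially"
    using Cauchy_uniformly_convergent uniformly_convergent_on_def by blast
  have "h holomorphic_on ball 0 \<rho>"
  proof (rule holomorphic_uniform_sequence[OF open_ball])
    show "f n holomorphic_on ball 0 \<rho>" for n
      unfolding f_def using \<sigma>seq(1)[of n]
      by (intro holomorphic_on_subset[OF V_holomorphic]) auto
    fix z :: complex assume "z \<in> ball 0 \<rho>"
    then obtain d where "d > 0" "cball z d \<subseteq> ball 0 \<rho>"
      using open_contains_cball open_ball by blast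
    then show "\<exists>d>0. cball z d \<subseteq> ball 0 \<rho> \<and> uniform_limit (cball z d) f h sequentially"
      using uniform_limit_on_subset[OF h] by blast
  qed
  moreover have lim: "(\<lambda>n. Vr (\<sigma>seq n) (x + t *\<^sub>R b)) \<longlonglongrightarrow> h (of_real t)" if "\<bar>t\<bar> < \<rho>" for t
  proof -
    have "(\<lambda>n. f n (of_real t)) \<longlonglongrightarrow> h (of_real t)"
      by (rule tendsto_uniform_limitI[OF h]) (use that in simp)
    then show ?thesis by (simp add: f_def V_real[OF b])
  qed
  moreover have "U (x + t *\<^sub>R b) = h (of_real t)" if "\<bar>t\<bar> < \<rho>" for t
    unfolding U_def using limI[OF lim[OF that]] .
  ultimately show ?thesis using that by metis
qed

text \<open>The Gaussian that the flow averages \<open>\<eta> u\<close> with, after rescaling by \<open>\<sigma>\<close>.\<close>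

definition w :: "'a \<Rightarrow> real" where "w z = exp (- ((norm z)\<^sup>2 / 4))"

definition cw :: real where "cw = (\<integral>z. w z \<partial>lborel)"

definition Pr :: "real \<Rightarrow> 'a \<Rightarrow> real" where "Pr \<sigma> x = (\<integral>z. A (x + \<sigma> *\<^sub>R z) * w z \<partial>lborel)"

lemma A_meas [measurable]: "A \<in> borel_measurable borel"
  using borel_measurable_integrable[OF A_int] by simp

lemma w_meas [measurable]: "w \<in> borel_measurable borel"
  unfolding w_def[abs_def] by measurable

lemma w_pos: "w z > 0" "w z \<le> 1" by (auto simp: w_def)

lemma w_int: "integrable lborel w" "integrable lborel (\<lambda>z. w z * norm z)"
proof -
  have b: "integrable lborel (\<lambda>z. w z * (1 + norm z))"
    unfolding w_def by (rule integrable_gauss_weight)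
  show "integrable lborel w"
  proof (rule Bochner_Integration.integrable_bound[OF b])
    have "\<bar>w z\<bar> * 1 \<le> \<bar>w z\<bar> * \<bar>1 + norm z\<bar>" for z by (intro mult_left_mono) auto
    then show "AE z in lborel. norm (w z) \<le> norm (w z * (1 + norm z))"
      by (intro AE_I2) (simp add: abs_mult)
  qed measurable
  show "integrable lborel (\<lambda>z. w z * norm z)"
  proof (rule Bochner_Integration.integrable_bound[OF b])
    have "\<bar>w z\<bar> * \<bar>norm z\<bar> \<le> \<bar>w z\<bar> * \<bar>1 + norm z\<bar>" for z by (intro mult_left_mono) auto
    then show "AE z in lborel. norm (w z * norm z) \<le> norm (w z * (1 + norm z))"
      by (intro AE_I2) (simp add: abs_mult)
  qed measurable
qed

lemma cw_pos: "cw > 0"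
proof -
  have "cw \<noteq> 0"
  proof
    assume "cw = 0"
    then have "AE z in lborel. w z = 0"
      using integral_nonneg_eq_0_iff_AE[OF w_int(1)] w_pos(1) by (auto simp: cw_def less_imp_le)
    then have "AE z::'a in lborel. False" by eventually_elim (use w_pos(1) in \<open>simp add: less_le\<close>)
    then have "ae_filter (lborel :: 'a measure) = bot" by (simp add: trivial_limit_def)
    then show False by (simp add: ae_filter_eq_bot_iff)
  qed
  moreover have "cw \<ge> 0" unfolding cw_def
    by (rule Bochner_Integration.integral_nonneg) (use w_pos(1) less_imp_le in blast)
  ultimately show ?thesis by simp
qed

lemma integral_lborel_scale:
  fixes f :: "'a \<Rightarrow> real"
  assumes c: "c > 0" and f: "f \<in> borel_measurable borel"
  shows "integrable lborel f \<Longrightarrow> integrable lborel (\<lambda>z. f (x + c *\<^sub>R z))"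
    "(\<integral>y. f y \<partial>lborel) = c ^ DIM('a) * (\<integral>z. f (x + c *\<^sub>R z) \<partial>lborel)"
proof -
  let ?T = "\<lambda>z. x + c *\<^sub>R z"
  have eq: "lborel = density (distr lborel borel ?T) (\<lambda>_. ennreal (\<bar>c\<bar> ^ DIM('a)))"
    by (rule lborel_affine) (use c in simp)
  have [measurable]: "?T \<in> lborel \<rightarrow>\<^sub>M borel" by measurable
  show "integrable lborel (\<lambda>z. f (?T z))" if i: "integrable lborel f"
  proof -
    have "integrable (density (distr lborel borel ?T) (\<lambda>_. ennreal (\<bar>c\<bar> ^ DIM('a)))) f"
      using i eq by simp
    then have "integrable (distr lborel borel ?T) (\<lambda>z. \<bar>c\<bar> ^ DIM('a) *\<^sub>R f z)"
      using f by (subst (asm) integrable_density) auto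
    then have "integrable (distr lborel borel ?T) f" using c by simp
    then show ?thesis using f by (subst (asm) integrable_distr_eq) auto
  qed
  have "(\<integral>y. f y \<partial>lborel) = (\<integral>y. f y \<partial>density (distr lborel borel ?T) (\<lambda>_. ennreal (\<bar>c\<bar> ^ DIM('a))))"
    using eq by simp
  also have "\<dots> = (\<integral>y. \<bar>c\<bar> ^ DIM('a) *\<^sub>R f y \<partial>distr lborel borel ?T)"
    using f by (intro integral_density) auto
  also have "\<dots> = (\<integral>z. \<bar>c\<bar> ^ DIM('a) *\<^sub>R f (?T z) \<partial>lborel)"
    using f by (intro integral_distr) auto
  finally show "(\<integral>y. f y \<partial>lborel) = c ^ DIM('a) * (\<integral>z. f (?T z) \<partial>lborel)" using c by simp
qed

lemma Vr_eq:
  assumes \<sigma>: "\<sigma> > 0"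
  shows "Vr \<sigma> x = of_real (exp (\<mu> * \<sigma>\<^sup>2) * Pr \<sigma> x)"
proof -
  let ?f = "\<lambda>y. A y * (exp (\<mu> * \<sigma>\<^sup>2 - (norm (y - x))\<^sup>2 / (4 * \<sigma>\<^sup>2)) / \<sigma> ^ DIM('a))"
  have "Vr \<sigma> x = (\<integral>y. complex_of_real (?f y) \<partial>lborel)"
    unfolding Vr_def heat_of_real by (simp only: of_real_mult)
  also have "\<dots> = of_real (\<integral>y. ?f y \<partial>lborel)" by (rule integral_complex_of_real)
  also have "(\<integral>y. ?f y \<partial>lborel) = \<sigma> ^ DIM('a) * (\<integral>z. ?f (x + \<sigma> *\<^sub>R z) \<partial>lborel)"
    by (rule integral_lborel_scale(2)[OF \<sigma>]) measurable
  also have "(\<lambda>z. ?f (x + \<sigma> *\<^sub>R z)) = (\<lambda>z. exp (\<mu> * \<sigma>\<^sup>2) / \<sigma> ^ DIM('a) * (A (x + \<sigma> *\<^sub>R z) * w z))"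
  proof (rule ext)
    fix z
    have 1: "(norm (x + \<sigma> *\<^sub>R z - x))\<^sup>2 / (4 * \<sigma>\<^sup>2) = (norm z)\<^sup>2 / 4"
      using \<sigma> by (simp add: power_mult_distrib)
    have 2: "exp (\<mu> * \<sigma>\<^sup>2 - (norm z)\<^sup>2 / 4) = exp (\<mu> * \<sigma>\<^sup>2) * w z"
      unfolding w_def exp_add[symmetric] by simp
    show "?f (x + \<sigma> *\<^sub>R z) = exp (\<mu> * \<sigma>\<^sup>2) / \<sigma> ^ DIM('a) * (A (x + \<sigma> *\<^sub>R z) * w z)"
      unfolding 1 2 by simp
  qed
  also have "\<sigma> ^ DIM('a) * (\<integral>z. exp (\<mu> * \<sigma>\<^sup>2) / \<sigma> ^ DIM('a) * (A (x + \<sigma> *\<^sub>R z) * w z) \<partial>lborel)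
      = exp (\<mu> * \<sigma>\<^sup>2) * Pr \<sigma> x"
    using \<sigma> by (simp only: integral_mult_right_zero Pr_def) simp
  finally show ?thesis .
qed

lemma ball_L1_L2:
  assumes f: "sq_integrable f" "f \<in> borel_measurable borel"
  shows "integrable lborel (\<lambda>x. indicator (ball x0 \<rho>) x * \<bar>f x\<bar>)"
    "(\<integral>x. indicator (ball x0 \<rho>) x * \<bar>f x\<bar> \<partial>lborel)
      \<le> norm (abs_L2 (indicator (ball x0 \<rho>) :: 'a \<Rightarrow> real)) * norm (abs_L2 f)"
proof -
  let ?I = "indicator (ball x0 \<rho>) :: 'a \<Rightarrow> real"
  have I: "sq_integrable ?I"
  proof -
    have "integrable lborel ?I"
      using emeasure_bounded_finite[OF bounded_ball, of x0 \<rho>] by (intro integrable_real_indicator) auto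
    moreover have "(\<lambda>z. (?I z)\<^sup>2) = ?I" by (auto simp: indicator_def fun_eq_iff)
    ultimately show ?thesis by (subst sq_integrable_lborel) auto
  qed
  have a: "sq_integrable (\<lambda>x. \<bar>f x\<bar>)" using f by (auto simp: sq_integrable_def)
  have fm: "(\<lambda>x. ?I x * \<bar>f x\<bar>) \<in> borel_measurable lborel"
    using f(2) by (intro borel_measurable_times borel_measurable_indicator borel_measurable_abs) auto
  show "integrable lborel (\<lambda>x. ?I x * \<bar>f x\<bar>)"
    using sq_integrable_inner[OF I a] fm by (simp add: integrable_completion)
  have "(\<integral>x. ?I x * \<bar>f x\<bar> \<partial>lborel) = abs_L2 ?I \<bullet> abs_L2 (\<lambda>x. \<bar>f x\<bar>)"
    using integral_completion[OF fm] by (simp add: inner_abs_L2[OF I a])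
  also have "\<dots> \<le> norm (abs_L2 ?I) * norm (abs_L2 (\<lambda>x. \<bar>f x\<bar>))" by (rule norm_cauchy_schwarz)
  also have "norm (abs_L2 (\<lambda>x. \<bar>f x\<bar>)) = norm (abs_L2 f)"
    by (rule power2_eq_imp_eq) (simp_all add: norm_abs_L2 a f)
  finally show "(\<integral>x. ?I x * \<bar>f x\<bar> \<partial>lborel) \<le> norm (abs_L2 ?I) * norm (abs_L2 f)" .
qed

text \<open>The translation estimate for \<open>u\<close> and the Lipschitz continuity of \<open>\<eta>\<close>.\<close>

lemma A_translation:
  obtains M where "M \<ge> 0" "\<And>h. (\<integral>\<^sup>+x. ennreal (indicator (ball x0 \<rho>) x * \<bar>A (x + h) - A x\<bar>) \<partial>lborel)
    \<le> ennreal (M * norm h)"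
proof -
  let ?I = "indicator (ball x0 \<rho>) :: 'a \<Rightarrow> real"
  have \<eta>t: "\<eta> \<in> test_functions UNIV"
    by (rule test_functionsI[where K = "cball x0 R"]) (auto intro: \<eta>_Ck \<eta>_0)
  obtain L where L: "L \<ge> 0" "\<And>x y. \<bar>\<eta> x - \<eta> y\<bar> \<le> L * norm (x - y)"
    by (rule test_function_lipschitz[OF \<eta>t]) blast
  have "bounded (\<eta> ` cball x0 R)"
    by (intro compact_imp_bounded compact_continuous_image
        continuous_on_subset[OF Ck_continuous[OF \<eta>_Ck]]) auto
  then obtain H0 where H0: "\<forall>z\<in>\<eta> ` cball x0 R. norm z \<le> H0" unfolding bounded_iff by (rule exE)
  define H where "H = max H0 0"
  have H: "H \<ge> 0" "\<bar>\<eta> y\<bar> \<le> H" for y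
  proof -
    show "H \<ge> 0" by (simp add: H_def)
    show "\<bar>\<eta> y\<bar> \<le> H"
    proof (cases "y \<in> cball x0 R")
      case True
      then have "\<bar>\<eta> y\<bar> \<le> H0" using H0 by (metis imageI real_norm_def)
      then show ?thesis by (simp add: H_def)
    qed (simp add: \<eta>_0 H_def)
  qed
  define m where "m = norm (abs_L2 ?I)"
  define M where "M = H * (m * \<bar>T\<bar>) + L * (m * norm (abs_L2 u))"
  have m: "m \<ge> 0" by (simp add: m_def)
  have "(\<integral>\<^sup>+x. ennreal (?I x * \<bar>A (x + h) - A x\<bar>) \<partial>lborel) \<le> ennreal (M * norm h)" for h
  proof -
    let ?d = "\<lambda>x. u (x + h) - u x"
    have dm: "?d \<in> borel_measurable borel" by measurable
    have ds: "sq_integrable ?d"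
      by (intro sq_integrable_diff sq_integrable_translate u u_sq)
    have dn: "norm (abs_L2 ?d) \<le> \<bar>T\<bar> * norm h"
    proof -
      have "abs_L2 ?d = translate h (abs_L2 u) - abs_L2 u"
        by (simp add: translate_abs u u_sq diff_abs_L2 sq_integrable_translate)
      then have "norm (abs_L2 ?d) \<le> T * norm h" using trans[of h] by simp
      also have "\<dots> \<le> \<bar>T\<bar> * norm h" by (intro mult_right_mono) auto
      finally show ?thesis .
    qed
    let ?b = "\<lambda>x. H * (?I x * \<bar>?d x\<bar>) + L * norm h * (?I x * \<bar>u x\<bar>)"
    have int: "integrable lborel ?b"
      by (intro Bochner_Integration.integrable_add integrable_mult_right ball_L1_L2 ds dm u u_sq)
    have "(\<integral>\<^sup>+x. ennreal (?I x * \<bar>A (x + h) - A x\<bar>) \<partial>lborel) \<le> (\<integral>\<^sup>+x. ennreal (?b x) \<partial>lborel)"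
    proof (intro nn_integral_mono ennreal_leI)
      fix x
      have "A (x + h) - A x = \<eta> (x + h) * ?d x + u x * (\<eta> (x + h) - \<eta> x)"
        by (simp add: A_def algebra_simps)
      then have "\<bar>A (x + h) - A x\<bar> \<le> \<bar>\<eta> (x + h)\<bar> * \<bar>?d x\<bar> + \<bar>u x\<bar> * \<bar>\<eta> (x + h) - \<eta> x\<bar>"
        by (metis abs_mult abs_triangle_ineq)
      also have "\<dots> \<le> H * \<bar>?d x\<bar> + \<bar>u x\<bar> * (L * norm h)"
        using L(2)[of "x + h" x] by (intro add_mono mult_right_mono mult_left_mono H) auto
      finally have "?I x * \<bar>A (x + h) - A x\<bar> \<le> ?I x * (H * \<bar>?d x\<bar> + \<bar>u x\<bar> * (L * norm h))"
        by (rule mult_left_mono) simp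
      then show "?I x * \<bar>A (x + h) - A x\<bar> \<le> ?b x" by (simp add: algebra_simps)
    qed
    also have "\<dots> = ennreal (\<integral>x. ?b x \<partial>lborel)"
      using int H L by (intro nn_integral_eq_integral) auto
    also have "(\<integral>x. ?b x \<partial>lborel)
        = H * (\<integral>x. ?I x * \<bar>?d x\<bar> \<partial>lborel) + L * norm h * (\<integral>x. ?I x * \<bar>u x\<bar> \<partial>lborel)"
      using ball_L1_L2(1)[OF ds dm] ball_L1_L2(1)[OF u_sq u]
      by (simp only: Bochner_Integration.integral_add integrable_mult_right integral_mult_right_zero)
    also have "ennreal \<dots> \<le> ennreal (H * (m * (\<bar>T\<bar> * norm h)) + L * norm h * (m * norm (abs_L2 u)))"
    proof (intro ennreal_leI add_mono mult_left_mono)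
      show "(\<integral>x. ?I x * \<bar>?d x\<bar> \<partial>lborel) \<le> m * (\<bar>T\<bar> * norm h)"
        using ball_L1_L2(2)[OF ds dm] mult_left_mono[OF dn m] unfolding m_def by (rule order_trans)
      show "(\<integral>x. ?I x * \<bar>u x\<bar> \<partial>lborel) \<le> m * norm (abs_L2 u)"
        unfolding m_def by (rule ball_L1_L2(2)[OF u_sq u])
    qed (use H L in auto)
    finally show ?thesis by (simp add: M_def algebra_simps)
  qed
  moreover have "M \<ge> 0" using H L m by (simp add: M_def)
  ultimately show ?thesis using that by blast
qed

text \<open>The translation estimate, averaged against \<open>w\<close>.\<close>

lemma Pr_L1:
  obtains M where "M \<ge> 0" "\<And>\<sigma>. \<sigma> > 0 \<Longrightarrow>
    (\<integral>\<^sup>+x. ennreal (indicator (ball x0 \<rho>) x * \<bar>Pr \<sigma> x - cw * A x\<bar>) \<partial>lborel) \<le> ennreal (M * \<sigma>)"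
proof -
  let ?I = "indicator (ball x0 \<rho>) :: 'a \<Rightarrow> real"
  have Im [measurable]: "?I \<in> borel_measurable borel" by (intro borel_measurable_indicator) auto
  obtain M where M: "M \<ge> 0" "\<And>h. (\<integral>\<^sup>+x. ennreal (?I x * \<bar>A (x + h) - A x\<bar>) \<partial>lborel) \<le> ennreal (M * norm h)"
    using A_translation by blast
  define c1 where "c1 = (\<integral>z. w z * norm (z::'a) \<partial>lborel)"
  have c1: "c1 \<ge> 0" unfolding c1_def
    by (rule Bochner_Integration.integral_nonneg) (simp add: w_pos less_imp_le)
  have "(\<integral>\<^sup>+x. ennreal (?I x * \<bar>Pr \<sigma> x - cw * A x\<bar>) \<partial>lborel) \<le> ennreal (M * c1 * \<sigma>)" if \<sigma>: "\<sigma> > 0" for \<sigma>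
  proof -
    have iAw: "integrable lborel (\<lambda>z. A (x + \<sigma> *\<^sub>R z) * w z)" for x
    proof (rule Bochner_Integration.integrable_bound[OF integral_lborel_scale(1)[OF \<sigma> A_meas A_int, of x]])
      show "AE z in lborel. norm (A (x + \<sigma> *\<^sub>R z) * w z) \<le> norm (A (x + \<sigma> *\<^sub>R z))"
        using w_pos by (intro AE_I2) (simp add: abs_mult mult_left_le less_imp_le abs_of_pos)
    qed measurable
    have "(\<integral>\<^sup>+x. ennreal (?I x * \<bar>Pr \<sigma> x - cw * A x\<bar>) \<partial>lborel)
        \<le> (\<integral>\<^sup>+x. (\<integral>\<^sup>+z. ennreal (?I x * (w z * \<bar>A (x + \<sigma> *\<^sub>R z) - A x\<bar>)) \<partial>lborel) \<partial>lborel)"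
    proof (rule nn_integral_mono)
      fix x :: 'a
      have id: "integrable lborel (\<lambda>z. A (x + \<sigma> *\<^sub>R z) * w z - w z * A x)"
        by (intro Bochner_Integration.integrable_diff iAw integrable_mult_left w_int)
      have "Pr \<sigma> x - cw * A x = (\<integral>z. A (x + \<sigma> *\<^sub>R z) * w z - w z * A x \<partial>lborel)"
        unfolding Pr_def cw_def integral_mult_left_zero[symmetric]
        by (rule Bochner_Integration.integral_diff[symmetric]) (intro iAw integrable_mult_left w_int)+
      then have "ennreal \<bar>Pr \<sigma> x - cw * A x\<bar> \<le> (\<integral>\<^sup>+z. ennreal \<bar>A (x + \<sigma> *\<^sub>R z) * w z - w z * A x\<bar> \<partial>lborel)"
        using integral_norm_bound_ennreal[OF id] by simp
      also have "\<dots> = (\<integral>\<^sup>+z. ennreal (w z * \<bar>A (x + \<sigma> *\<^sub>R z) - A x\<bar>) \<partial>lborel)"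
      proof (intro nn_integral_cong)
        fix z
        have "A (x + \<sigma> *\<^sub>R z) * w z - w z * A x = w z * (A (x + \<sigma> *\<^sub>R z) - A x)" by (simp add: algebra_simps)
        then show "ennreal \<bar>A (x + \<sigma> *\<^sub>R z) * w z - w z * A x\<bar> = ennreal (w z * \<bar>A (x + \<sigma> *\<^sub>R z) - A x\<bar>)"
          using w_pos(1)[of z] by (simp add: abs_mult)
      qed
      finally show "ennreal (?I x * \<bar>Pr \<sigma> x - cw * A x\<bar>)
          \<le> (\<integral>\<^sup>+z. ennreal (?I x * (w z * \<bar>A (x + \<sigma> *\<^sub>R z) - A x\<bar>)) \<partial>lborel)"
        by (cases "x \<in> ball x0 \<rho>") auto
    qed
    also have "\<dots> = (\<integral>\<^sup>+z. (\<integral>\<^sup>+x. ennreal (?I x * (w z * \<bar>A (x + \<sigma> *\<^sub>R z) - A x\<bar>)) \<partial>lborel) \<partial>lborel)"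
      by (rule lborel_pair.Fubini'[symmetric]) measurable
    also have "\<dots> \<le> (\<integral>\<^sup>+z. ennreal (M * \<sigma> * (w z * norm z)) \<partial>lborel)"
    proof (rule nn_integral_mono)
      fix z :: 'a
      have "(\<integral>\<^sup>+x. ennreal (?I x * (w z * \<bar>A (x + \<sigma> *\<^sub>R z) - A x\<bar>)) \<partial>lborel)
          = (\<integral>\<^sup>+x. ennreal (w z) * ennreal (?I x * \<bar>A (x + \<sigma> *\<^sub>R z) - A x\<bar>) \<partial>lborel)"
        using w_pos(1)[of z]
        by (intro nn_integral_cong) (simp add: ennreal_mult[symmetric] less_imp_le mult.left_commute)
      also have "\<dots> = ennreal (w z) * (\<integral>\<^sup>+x. ennreal (?I x * \<bar>A (x + \<sigma> *\<^sub>R z) - A x\<bar>) \<partial>lborel)"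
        by (rule nn_integral_cmult) measurable
      also have "\<dots> \<le> ennreal (w z) * ennreal (M * norm (\<sigma> *\<^sub>R z))"
        by (intro mult_left_mono M) auto
      also have "\<dots> = ennreal (M * \<sigma> * (w z * norm z))"
        using w_pos(1)[of z] M(1) \<sigma> by (simp add: ennreal_mult[symmetric] less_imp_le mult_ac)
      finally show "(\<integral>\<^sup>+x. ennreal (?I x * (w z * \<bar>A (x + \<sigma> *\<^sub>R z) - A x\<bar>)) \<partial>lborel)
          \<le> ennreal (M * \<sigma> * (w z * norm z))" .
    qed
    also have "\<dots> = ennreal (\<integral>z. M * \<sigma> * (w z * norm z) \<partial>lborel)"
      using M(1) \<sigma> w_pos(1) by (intro nn_integral_eq_integral integrable_mult_right w_int) (auto simp: less_imp_le)
    also have "(\<integral>z. M * \<sigma> * (w z * norm z) \<partial>lborel) = M * c1 * \<sigma>" by (simp add: c1_def)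
    finally show ?thesis .
  qed
  moreover have "M * c1 \<ge> 0" using M(1) c1 by simp
  ultimately show ?thesis using that by blast
qed

lemma Pr_meas [measurable]: "Pr \<sigma> \<in> borel_measurable borel"
proof -
  have "(\<lambda>(x, z). A (x + \<sigma> *\<^sub>R z) * w z) \<in> borel_measurable (lborel \<Otimes>\<^sub>M lborel)" by measurable
  from lborel.borel_measurable_lebesgue_integral[OF this]
  show ?thesis unfolding Pr_def[abs_def] by simp
qed

text \<open>The flow tends to \<open>U\<close> pointwise and to a multiple of \<open>\<eta> u\<close> in \<open>L\<^sup>1\<close>; Fatou's lemma identifies the
  limits.\<close>

lemma U_eq: "AE x in lborel. x \<in> ball x0 \<rho> \<longrightarrow> U x = of_real (cw * u x)"
proof -
  let ?I = "indicator (ball x0 \<rho>) :: 'a \<Rightarrow> real"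
  have Im [measurable]: "?I \<in> borel_measurable borel" by (intro borel_measurable_indicator) auto
  obtain M where M: "M \<ge> 0" "\<And>\<sigma>. \<sigma> > 0 \<Longrightarrow>
      (\<integral>\<^sup>+x. ennreal (?I x * \<bar>Pr \<sigma> x - cw * A x\<bar>) \<partial>lborel) \<le> ennreal (M * \<sigma>)"
    using Pr_L1 by blast
  have \<sigma>pos: "\<sigma>seq n > 0" for n using \<sigma>seq(1)[of n] by simp
  have lim: "(\<lambda>n. complex_of_real (Pr (\<sigma>seq n) x)) \<longlonglongrightarrow> U x" if x: "x \<in> ball x0 \<rho>" for x
  proof -
    obtain b :: 'a where b: "b \<in> Basis" using nonempty_Basis by blast
    have "\<forall>t. \<bar>t\<bar> < \<rho> \<longrightarrow> (\<lambda>n. Vr (\<sigma>seq n) (x + t *\<^sub>R b)) \<longlonglongrightarrow> U (x + t *\<^sub>R b)"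
      by (rule U_lines[OF x b]) blast
    from this[rule_format, of 0] have "(\<lambda>n. Vr (\<sigma>seq n) (x + 0 *\<^sub>R b)) \<longlonglongrightarrow> U (x + 0 *\<^sub>R b)"
      using \<rho> by simp
    then have "(\<lambda>n. Vr (\<sigma>seq n) x) \<longlonglongrightarrow> U x" by simp
    moreover have "(\<lambda>n. complex_of_real (exp (- (\<mu> * (\<sigma>seq n)\<^sup>2)))) \<longlonglongrightarrow> of_real (exp (- (\<mu> * 0\<^sup>2)))"
      by (intro tendsto_intros \<sigma>seq)
    ultimately have "(\<lambda>n. complex_of_real (exp (- (\<mu> * (\<sigma>seq n)\<^sup>2))) * Vr (\<sigma>seq n) x) \<longlonglongrightarrow> 1 * U x"
      by (intro tendsto_mult) auto
    moreover have "complex_of_real (exp (- (\<mu> * (\<sigma>seq n)\<^sup>2))) * Vr (\<sigma>seq n) x = of_real (Pr (\<sigma>seq n) x)" for n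
      unfolding Vr_eq[OF \<sigma>pos] of_real_mult[symmetric] mult.assoc[symmetric] exp_add[symmetric] by simp
    ultimately show ?thesis by simp
  qed
  have "(\<integral>\<^sup>+x. liminf (\<lambda>n. ennreal (?I x * \<bar>Pr (\<sigma>seq n) x - cw * A x\<bar>)) \<partial>lborel)
      \<le> liminf (\<lambda>n. \<integral>\<^sup>+x. ennreal (?I x * \<bar>Pr (\<sigma>seq n) x - cw * A x\<bar>) \<partial>lborel)"
    by (rule nn_integral_liminf) measurable
  also have "\<dots> \<le> liminf (\<lambda>n. ennreal (M * \<sigma>seq n))"
    by (intro Liminf_mono always_eventually allI M \<sigma>pos)
  also have "\<dots> = 0"
  proof -
    have "(\<lambda>n. M * \<sigma>seq n) \<longlonglongrightarrow> M * 0" by (intro tendsto_intros \<sigma>seq)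
    then have "(\<lambda>n. ennreal (M * \<sigma>seq n)) \<longlonglongrightarrow> ennreal (M * 0)" by (rule tendsto_ennrealI)
    from lim_imp_Liminf[OF _ this] show ?thesis by simp
  qed
  finally have "(\<integral>\<^sup>+x. liminf (\<lambda>n. ennreal (?I x * \<bar>Pr (\<sigma>seq n) x - cw * A x\<bar>)) \<partial>lborel) = 0" by simp
  then have "AE x in lborel. liminf (\<lambda>n. ennreal (?I x * \<bar>Pr (\<sigma>seq n) x - cw * A x\<bar>)) = 0"
    by (subst (asm) nn_integral_0_iff_AE) measurable
  then show ?thesis
  proof eventually_elim
    case (elim x)
    show ?case
    proof
      assume x: "x \<in> ball x0 \<rho>"
      have "(\<lambda>n. norm (complex_of_real (Pr (\<sigma>seq n) x) - of_real (cw * A x))) \<longlonglongrightarrow> norm (U x - of_real (cw * A x))"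
        by (intro tendsto_intros lim x)
      moreover have "norm (complex_of_real (Pr (\<sigma>seq n) x) - of_real (cw * A x)) = ?I x * \<bar>Pr (\<sigma>seq n) x - cw * A x\<bar>" for n
        using x by (simp only: of_real_diff[symmetric] norm_of_real) simp
      ultimately have "(\<lambda>n. ennreal (?I x * \<bar>Pr (\<sigma>seq n) x - cw * A x\<bar>)) \<longlonglongrightarrow> ennreal (norm (U x - of_real (cw * A x)))"
        by (intro tendsto_ennrealI) simp
      from lim_imp_Liminf[OF _ this] elim have "ennreal (norm (U x - of_real (cw * A x))) = 0" by simp
      then have "U x = of_real (cw * A x)" by simp
      moreover have "x \<in> cball x0 r" using x \<rho> by (simp add: \<rho>_def)
      ultimately show "U x = of_real (cw * u x)" using \<eta>_1 by (simp add: A_def)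
    qed
  qed
qed

end

section \<open>Unique continuation from sets of positive measure\<close>

lemma eigenfunction_analytic_on_lines:
  fixes Z :: "'a::euclidean_space set"
  assumes e: "e \<in> eigenspace Z \<mu>" and Z: "open Z" and x0: "x0 \<in> Z"
  obtains \<rho> U c where "\<rho> > 0" "ball x0 \<rho> \<subseteq> Z" "(c::real) \<noteq> 0"
    "AE x in lborel. x \<in> ball x0 \<rho> \<longrightarrow> U x = complex_of_real (c * borel_rep (fst e) x)"
    "\<And>x b. x \<in> ball x0 \<rho> \<Longrightarrow> b \<in> Basis \<Longrightarrow>
      \<exists>h. h holomorphic_on ball 0 \<rho> \<and> (\<forall>t. \<bar>t\<bar> < \<rho> \<longrightarrow> h (of_real t) = U (x + t *\<^sub>R b))"
proof -
  obtain R where R: "R > 0" "cball x0 R \<subseteq> Z" using Z x0 open_contains_cball by blast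
  define r where "r = R / 2"
  have r: "0 < r" "r < R" using R by (auto simp: r_def)
  obtain \<eta> where \<eta>: "\<And>n. Ck n \<eta>" "\<And>y. y \<in> cball x0 r \<Longrightarrow> \<eta> y = 1" "\<And>y. y \<notin> cball x0 R \<Longrightarrow> \<eta> y = 0"
    using smooth_cutoff[OF r] by metis
  let ?u = "borel_rep (fst e)"
  have eH: "e \<in> H10 Z" using e by (simp add: eigenspace_def)
  interpret cutoff_solution ?u \<eta> \<mu> r R "norm (snd e)" x0
  proof
    show "norm (translate h (abs_L2 ?u) - abs_L2 ?u) \<le> norm (snd e) * norm h" for h
      using H10_translate[OF eH, of h] by (simp add: abs_borel_rep mult.commute)
    fix g :: "'a \<Rightarrow> real" assume g: "\<And>n. Ck n g"
    let ?g = "\<lambda>y. \<eta> y * g y"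
    have t: "?g \<in> test_functions Z"
      by (rule test_functionsI[OF Ck_mult[OF \<eta>(1) g] compact_cball R(2)]) (simp add: \<eta>(3))
    note Cg = test_functions_Ck[OF t]
    let ?f = "\<lambda>z. laplacian ?g z + \<mu> * ?g z"
    have fc: "continuous_on UNIV ?f"
      unfolding laplacian_def
      by (intro continuous_intros continuous_on_sum Ck_continuous[of 0] Ck_pd Cg)
        (use Cg in \<open>auto intro: Ck_continuous[OF \<eta>(1)] Ck_continuous[OF g]\<close>)
    have f0: "?f y = 0" if "y \<notin> cball x0 R" for y
    proof -
      have op: "open (- cball x0 R)" by auto
      have 1: "pd b ?g y = 0" if "y \<notin> cball x0 R" for b y
        by (rule pd_eq_0_open[OF op, where c = 0]) (use \<eta>(3) that in auto)
      have 2: "pd b (pd b ?g) y = 0" if "y \<notin> cball x0 R" for b y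
        by (rule pd_eq_0_open[OF op, where c = 0]) (use 1 that in auto)
      show ?thesis unfolding laplacian_def using 2[OF that] \<eta>(3)[OF that] by simp
    qed
    have sf: "sq_integrable ?f" by (rule sq_integrable_compact_support[OF fc compact_cball f0])
    have fb: "?f \<in> borel_measurable borel" by (rule borel_measurable_continuous_onI[OF fc])
    have "(\<integral>y. ?u y * ?f y \<partial>lborel) = (\<integral>y. ?u y * ?f y \<partial>lebesgue)"
      using fb by (intro integral_completion[symmetric]) auto
    also have "\<dots> = abs_L2 ?u \<bullet> abs_L2 ?f"
      by (simp add: inner_abs_L2[OF borel_rep_sq sf])
    also have "\<dots> = 0" using eigenfunction_weak_equation[OF e t] by (simp add: abs_borel_rep)
    finally show "(\<integral>y. ?u y * ?f y \<partial>lborel) = 0" .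
  qed (use r \<eta> borel_rep_sq in auto)
  have "ball x0 \<rho> \<subseteq> Z"
    using R(2) r by (auto simp: \<rho>_def subset_iff)
  moreover have "\<exists>h. h holomorphic_on ball 0 \<rho> \<and> (\<forall>t. \<bar>t\<bar> < \<rho> \<longrightarrow> h (of_real t) = U (x + t *\<^sub>R b))"
    if "x \<in> ball x0 \<rho>" "b \<in> Basis" for x b
    by (rule U_lines[OF that]) blast
  ultimately show ?thesis using that[of \<rho> cw U] \<rho> cw_pos U_eq by simp
qed

text \<open>Cubes rather than balls, because the slicing below changes one coordinate at a time.\<close>

definition cube :: "'a::euclidean_space \<Rightarrow> real \<Rightarrow> 'a set" where
  "cube x0 d = {x. \<forall>b\<in>Basis. \<bar>(x - x0) \<bullet> b\<bar> < d}"

lemma open_cube: "open (cube x0 d)"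
proof -
  have "cube x0 d = (\<Inter>b\<in>Basis. {x. \<bar>(x - x0) \<bullet> b\<bar> < d})" by (auto simp: cube_def)
  also have "open \<dots>"
    by (intro open_INT finite_Basis ballI open_Collect_less continuous_intros)
  finally show ?thesis .
qed

lemma cube_subset_ball:
  assumes "real DIM('a) * d \<le> \<rho>" "d > 0"
  shows "cube x0 d \<subseteq> ball (x0::'a::euclidean_space) \<rho>"
proof
  fix x assume x: "x \<in> cube x0 d"
  have "norm (x - x0) \<le> (\<Sum>b\<in>Basis. \<bar>(x - x0) \<bullet> b\<bar>)" by (rule norm_le_l1)
  also have "\<dots> < (\<Sum>b\<in>(Basis::'a set). d)"
    using x by (intro sum_strict_mono) (auto simp: cube_def)
  also have "\<dots> \<le> \<rho>" using assms by simp
  finally show "x \<in> ball x0 \<rho>" by (simp add: dist_norm norm_minus_commute)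
qed

lemma cube_change:
  assumes "x \<in> cube x0 d" "x + t *\<^sub>R b \<in> cube x0 d" "x + s *\<^sub>R b' \<in> cube x0 d"
    "b \<in> Basis" "b' \<in> Basis" "b \<noteq> b'"
  shows "x + t *\<^sub>R b + s *\<^sub>R b' \<in> cube x0 d"
  unfolding cube_def
proof (rule CollectI, rule ballI)
  fix c :: 'a assume c: "c \<in> Basis"
  have 1: "\<bar>(x - x0) \<bullet> c\<bar> < d" "\<bar>(x + t *\<^sub>R b - x0) \<bullet> c\<bar> < d" "\<bar>(x + s *\<^sub>R b' - x0) \<bullet> c\<bar> < d"
    using assms(1-3) c by (auto simp: cube_def)
  show "\<bar>(x + t *\<^sub>R b + s *\<^sub>R b' - x0) \<bullet> c\<bar> < d"
    using 1 assms(4-6) c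
    by (cases "c = b"; cases "c = b'") (simp_all add: inner_diff_left inner_add_left inner_not_same_Basis)
qed

text \<open>Slicing in one coordinate direction after the other. By Fubini almost every point of \<open>A\<close>
  lies on a line that meets \<open>A\<close> in positive length; on the whole of such a line inside the cube
  \<open>U\<close> vanishes. These points form a set of positive measure that is invariant in the new
  direction and keeps its invariance in the directions treated before.\<close>

lemma zero_on_cube:
  fixes U :: "'a::euclidean_space \<Rightarrow> complex"
  assumes A: "A \<in> sets borel" "A \<subseteq> cube x0 d" "emeasure lborel A \<noteq> 0" "\<And>x. x \<in> A \<Longrightarrow> U x = 0"
    and lines: "\<And>x b T t. x \<in> cube x0 d \<Longrightarrow> b \<in> Basis \<Longrightarrow> infinite T \<Longrightarrow>
      (\<And>t. t \<in> T \<Longrightarrow> x + t *\<^sub>R b \<in> cube x0 d \<and> U (x + t *\<^sub>R b) = 0) \<Longrightarrow>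
      x + t *\<^sub>R b \<in> cube x0 d \<Longrightarrow> U (x + t *\<^sub>R b) = 0"
    and x: "x \<in> cube x0 d"
  shows "U x = 0"
proof -
  let ?Q = "cube x0 d"
  have Qb [measurable]: "?Q \<in> sets borel" using open_cube by (rule borel_open)
  have "finite S \<Longrightarrow> S \<subseteq> Basis \<Longrightarrow> \<exists>A. A \<in> sets borel \<and> A \<subseteq> ?Q \<and> emeasure lborel A \<noteq> 0 \<and>
    (\<forall>x\<in>A. U x = 0) \<and> (\<forall>x\<in>A. \<forall>b\<in>S. \<forall>t. x + t *\<^sub>R b \<in> ?Q \<longrightarrow> x + t *\<^sub>R b \<in> A)" for S :: "'a set"
  proof (induction S rule: finite_induct)
    case empty
    then show ?case using A by (intro exI[of _ A]) auto
  next
    case (insert b S)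
    then obtain A where A [measurable]: "A \<in> sets borel" and AQ: "A \<subseteq> ?Q" and A0: "emeasure lborel A \<noteq> 0"
      and AU: "\<And>x. x \<in> A \<Longrightarrow> U x = 0"
      and inv: "\<And>x b t. x \<in> A \<Longrightarrow> b \<in> S \<Longrightarrow> x + t *\<^sub>R b \<in> ?Q \<Longrightarrow> x + t *\<^sub>R b \<in> A"
      by auto
    have b: "b \<in> Basis" using insert by simp
    define m where "m A x = (\<integral>\<^sup>+t. indicator A (x + t *\<^sub>R b) \<partial>(lborel :: real measure))" for A :: "'a set" and x
    have joint: "(\<lambda>(x, t). indicator A (x + t *\<^sub>R b) :: ennreal) \<in> borel_measurable (lborel \<Otimes>\<^sub>M lborel)"
      if [measurable]: "A \<in> sets borel" for A
    proof -
      have "(\<lambda>p. indicator A (fst p + snd p *\<^sub>R b) :: ennreal) \<in> borel_measurable (lborel \<Otimes>\<^sub>M (lborel :: real measure))"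
        by (rule measurable_compose[OF _ borel_measurable_indicator[OF that]]) measurable
      then show ?thesis by (simp add: case_prod_beta')
    qed
    have m_meas [measurable]: "m A \<in> borel_measurable borel" if "A \<in> sets borel" for A
      using lborel.borel_measurable_nn_integral[OF joint[OF that]] by (simp add: m_def[abs_def])
    have m_shift: "m A (x + s *\<^sub>R b) = m A x" if [measurable]: "A \<in> sets borel" for A x s
    proof -
      have "(\<lambda>t. indicator A (x + t *\<^sub>R b) :: ennreal) \<in> borel_measurable borel"
        by (rule measurable_compose[OF _ borel_measurable_indicator[OF that]]) measurable
      from nn_integral_lborel_translate[OF this, of s]
      show ?thesis unfolding m_def by (simp add: scaleR_add_left add.assoc)
    qed
    have m_mono: "m A x \<le> m B x" if "\<And>t. x + t *\<^sub>R b \<in> A \<Longrightarrow> x + t *\<^sub>R b \<in> B" for A B x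
      unfolding m_def by (intro nn_integral_mono) (use that in \<open>auto simp: indicator_def\<close>)
    define A' where "A' = {x \<in> ?Q. m A x \<noteq> 0}"
    have A'b [measurable]: "A' \<in> sets borel"
    proof -
      have "A' = ?Q \<inter> (m A -` (- {0}) \<inter> space borel)" by (auto simp: A'_def)
      also have "\<dots> \<in> sets borel" using measurable_sets[OF m_meas[OF A], of "- {0}"] by auto
      finally show ?thesis .
    qed
    have zero: "U (x + t *\<^sub>R b) = 0" if x: "x \<in> A'" and t: "x + t *\<^sub>R b \<in> ?Q" for x t
    proof (rule lines[OF _ b _ _ t])
      show "x \<in> ?Q" using x by (simp add: A'_def)
      show "infinite {t. x + t *\<^sub>R b \<in> A}"
      proof
        assume fin: "finite {t. x + t *\<^sub>R b \<in> A}"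
        have "m A x = (\<integral>\<^sup>+t. indicator {t. x + t *\<^sub>R b \<in> A} t \<partial>lborel)"
          unfolding m_def by (simp add: indicator_def)
        also have "\<dots> = emeasure lborel {t. x + t *\<^sub>R b \<in> A}"
          using fin by (intro nn_integral_indicator) (auto simp: finite_imp_closed)
        also have "\<dots> = 0" using fin by (intro emeasure_lborel_countable countable_finite)
        finally show False using x by (simp add: A'_def)
      qed
    qed (use AQ AU in auto)
    define D where "D = A - A'"
    have Db [measurable]: "D \<in> sets borel" by (auto simp: D_def)
    have mD: "m D x = 0" for x
    proof (cases "\<exists>t0. x + t0 *\<^sub>R b \<in> D")
      case True
      then obtain t0 where t0: "x + t0 *\<^sub>R b \<in> D" by blast
      then have "m A (x + t0 *\<^sub>R b) = 0" using AQ by (auto simp: D_def A'_def)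
      then have "m A x = 0" using m_shift[OF A] by simp
      moreover have "m D x \<le> m A x" by (rule m_mono) (simp add: D_def)
      ultimately show ?thesis by simp
    next
      case False
      then show ?thesis by (simp add: m_def)
    qed
    have "emeasure lborel D = 0"
    proof -
      have Dt: "(\<integral>\<^sup>+x. indicator D (x + t *\<^sub>R b) \<partial>lborel) = emeasure lborel D" for t
        using nn_integral_lborel_translate[of "indicator D" "t *\<^sub>R b"] by (simp add: add.commute)
      have "(\<integral>\<^sup>+t. (\<integral>\<^sup>+x. indicator D (x + t *\<^sub>R b) \<partial>lborel) \<partial>(lborel :: real measure)) = (\<integral>\<^sup>+x. m D x \<partial>lborel)"
        unfolding m_def by (rule lborel_pair.Fubini'[OF joint[OF Db]])
      also have "\<dots> = 0" by (simp add: mD)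
      finally have "emeasure lborel D * \<infinity> = 0" by (simp add: Dt)
      then show ?thesis by (simp add: ennreal_mult_eq_top_iff)
    qed
    have "emeasure lborel A' \<noteq> 0"
    proof
      assume "emeasure lborel A' = 0"
      have "emeasure lborel A \<le> emeasure lborel (D \<union> A')"
        by (rule emeasure_mono) (auto simp: D_def)
      also have "\<dots> \<le> emeasure lborel D + emeasure lborel A'"
        by (rule emeasure_subadditive) auto
      finally show False using A0 \<open>emeasure lborel D = 0\<close> \<open>emeasure lborel A' = 0\<close> by simp
    qed
    moreover have "\<forall>x\<in>A'. U x = 0"
    proof
      fix x assume x: "x \<in> A'"
      then have "x + 0 *\<^sub>R b \<in> ?Q" by (simp add: A'_def)
      from zero[OF x this] show "U x = 0" by simp
    qed
    moreover have "x + t *\<^sub>R b' \<in> A'" if x: "x \<in> A'" and b': "b' \<in> insert b S" and t: "x + t *\<^sub>R b' \<in> ?Q" for x b' t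
    proof (cases "b' = b")
      case True
      then show ?thesis using x t m_shift[OF A, of x t] by (simp add: A'_def)
    next
      case False
      then have b'S: "b' \<in> S" "b' \<in> Basis" using b' insert.prems by auto
      have "m A x \<le> m A (x + t *\<^sub>R b')"
      proof -
        have "x + s *\<^sub>R b + t *\<^sub>R b' \<in> A" if s: "x + s *\<^sub>R b \<in> A" for s
        proof (rule inv[OF s b'S(1)])
          show "x + s *\<^sub>R b + t *\<^sub>R b' \<in> ?Q"
            by (rule cube_change) (use x s t AQ b b'S False in \<open>auto simp: A'_def\<close>)
        qed
        then have "x + t *\<^sub>R b' + s *\<^sub>R b \<in> A" if "x + s *\<^sub>R b \<in> A" for s
          using that by (metis add.assoc add.commute)
        then show ?thesis
          unfolding m_def by (intro nn_integral_mono) (auto simp: indicator_def)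
      qed
      then show ?thesis using x t by (auto simp: A'_def)
    qed
    ultimately show ?case using A'b by (intro exI[of _ A']) (auto simp: A'_def)
  qed
  from this[OF finite_Basis order_refl] obtain A where AQ: "A \<subseteq> ?Q" and A0: "emeasure lborel A \<noteq> 0"
    and AU: "\<And>x. x \<in> A \<Longrightarrow> U x = 0"
    and inv: "\<And>x b t. x \<in> A \<Longrightarrow> b \<in> Basis \<Longrightarrow> x + t *\<^sub>R b \<in> ?Q \<Longrightarrow> x + t *\<^sub>R b \<in> A"
    by blast
  obtain a where a: "a \<in> A" using A0 by (metis emeasure_empty equals0I)
  have coord: "(a + (\<Sum>b\<in>F. ((x - a) \<bullet> b) *\<^sub>R b)) \<bullet> c = (if c \<in> F then x \<bullet> c else a \<bullet> c)"
    if "c \<in> Basis" "F \<subseteq> Basis" for F c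
  proof -
    have "(\<Sum>b\<in>F. ((x - a) \<bullet> b) *\<^sub>R b) \<bullet> c = (\<Sum>b\<in>F. if b = c then (x - a) \<bullet> c else 0)"
      unfolding inner_sum_left using that by (intro sum.cong) (auto simp: inner_Basis)
    also have "\<dots> = (if c \<in> F then (x - a) \<bullet> c else 0)"
      using finite_subset[OF that(2) finite_Basis] by simp
    finally show ?thesis by (simp add: inner_add_left inner_diff_left)
  qed
  have "finite F \<Longrightarrow> F \<subseteq> Basis \<Longrightarrow> a + (\<Sum>b\<in>F. ((x - a) \<bullet> b) *\<^sub>R b) \<in> A" for F
  proof (induction F rule: finite_induct)
    case empty
    then show ?case using a by simp
  next
    case (insert b F)
    let ?y = "a + (\<Sum>b\<in>F. ((x - a) \<bullet> b) *\<^sub>R b)"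
    have eq: "a + (\<Sum>b\<in>insert b F. ((x - a) \<bullet> b) *\<^sub>R b) = ?y + ((x - a) \<bullet> b) *\<^sub>R b"
      using insert by (simp add: add_ac)
    have "a + (\<Sum>b\<in>insert b F. ((x - a) \<bullet> b) *\<^sub>R b) \<in> ?Q"
      unfolding cube_def
    proof (rule CollectI, rule ballI)
      fix c :: 'a assume c: "c \<in> Basis"
      have "a \<in> ?Q" using a AQ by blast
      then have "\<bar>(a - x0) \<bullet> c\<bar> < d" "\<bar>(x - x0) \<bullet> c\<bar> < d" using x c by (auto simp: cube_def)
      then show "\<bar>(a + (\<Sum>b\<in>insert b F. ((x - a) \<bullet> b) *\<^sub>R b) - x0) \<bullet> c\<bar> < d"
        by (simp only: inner_diff_left[of _ x0] coord[OF c insert.prems]) simp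
    qed
    then show ?case unfolding eq using insert by (intro inv) auto
  qed
  from this[OF finite_Basis order_refl] have "a + (x - a) \<in> A"
    by (simp only: euclidean_representation)
  then show ?thesis using AU by simp
qed

text \<open>An infinite set of zeros on a segment accumulates inside the disc of holomorphy, so \<open>U\<close> vanishes on
  the whole segment and the slicing argument applies.\<close>

lemma eigenfunction_zero_local:
  fixes Z :: "'a::euclidean_space set"
  assumes e: "e \<in> eigenspace Z \<mu>" and Z: "open Z" and x0: "x0 \<in> Z"
  shows "\<exists>Q. open Q \<and> x0 \<in> Q \<and> Q \<subseteq> Z \<and> (\<forall>A. A \<in> sets borel \<longrightarrow> A \<subseteq> Q \<longrightarrow> emeasure lborel A \<noteq> 0 \<longrightarrow>
    (AE x in lborel. x \<in> A \<longrightarrow> borel_rep (fst e) x = 0) \<longrightarrow> (AE x in lborel. x \<in> Q \<longrightarrow> borel_rep (fst e) x = 0))"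
proof -
  let ?u = "borel_rep (fst e)"
  obtain \<rho> U c where \<rho>: "\<rho> > 0" "ball x0 \<rho> \<subseteq> Z" and c: "c \<noteq> 0"
    and U: "AE x in lborel. x \<in> ball x0 \<rho> \<longrightarrow> U x = complex_of_real (c * ?u x)"
    and hol: "\<And>x b. x \<in> ball x0 \<rho> \<Longrightarrow> b \<in> Basis \<Longrightarrow>
      \<exists>h. h holomorphic_on ball 0 \<rho> \<and> (\<forall>t. \<bar>t\<bar> < \<rho> \<longrightarrow> h (of_real t) = U (x + t *\<^sub>R b))"
    by (rule eigenfunction_analytic_on_lines[OF e Z x0]) blast
  define d where "d = \<rho> / (4 * real DIM('a))"
  have D1: "real DIM('a) \<ge> 1" using DIM_positive[where 'a='a] by linarith
  have d: "d > 0" "real DIM('a) * d \<le> \<rho>" using \<rho> D1 by (auto simp: d_def)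
  have d4: "4 * d \<le> \<rho>"
  proof -
    have "4 * d = \<rho> / real DIM('a)" by (simp add: d_def)
    also have "\<dots> \<le> \<rho> / 1" using \<rho> D1 by (intro divide_left_mono) auto
    finally show ?thesis by simp
  qed
  have sub: "cube x0 d \<subseteq> ball x0 \<rho>" using cube_subset_ball d by blast
  have lines: "U (x + t *\<^sub>R b) = 0"
    if x: "x \<in> cube x0 d" and b: "b \<in> Basis" and T: "infinite T"
      and TQ: "\<And>t. t \<in> T \<Longrightarrow> x + t *\<^sub>R b \<in> cube x0 d \<and> U (x + t *\<^sub>R b) = 0" and t: "x + t *\<^sub>R b \<in> cube x0 d"
    for x b T t
  proof -
    have small: "\<bar>s\<bar> < 2 * d" if "x + s *\<^sub>R b \<in> cube x0 d" for s
    proof -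
      have "\<bar>(x + s *\<^sub>R b - x0) \<bullet> b\<bar> < d" "\<bar>(x - x0) \<bullet> b\<bar> < d" using that x b by (auto simp: cube_def)
      moreover have "(x + s *\<^sub>R b - x0) \<bullet> b = (x - x0) \<bullet> b + s"
        using b by (simp add: inner_diff_left inner_add_left)
      ultimately show ?thesis by linarith
    qed
    obtain h where h: "h holomorphic_on ball 0 \<rho>" "\<And>t. \<bar>t\<bar> < \<rho> \<Longrightarrow> h (of_real t) = U (x + t *\<^sub>R b)"
      using hol[of x b] x sub b by blast
    let ?T = "complex_of_real ` T"
    have "infinite ?T" using T by (simp add: finite_image_iff inj_on_def)
    moreover have TT: "?T \<subseteq> cball 0 (2 * d)" using small TQ by (auto simp: less_imp_le)
    ultimately obtain \<xi> where \<xi>: "\<xi> \<in> cball 0 (2 * d)" "\<xi> islimpt ?T"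
      using Heine_Borel_imp_Bolzano_Weierstrass[OF compact_cball] by blast
    have s: "cball 0 (2 * d) \<subseteq> ball (0::complex) \<rho>" using d4 d by (auto simp: subset_iff)
    have "h (of_real t) = 0"
    proof (rule analytic_continuation[OF h(1) open_ball connected_ball])
      show "?T \<subseteq> ball 0 \<rho>" using TT s by blast
      show "\<xi> \<in> ball 0 \<rho>" using \<xi>(1) s by blast
      show "\<xi> islimpt ?T" by (rule \<xi>(2))
      show "h z = 0" if zT: "z \<in> ?T" for z
      proof -
        obtain s where "s \<in> T" "z = of_real s" using zT by blast
        then show ?thesis using h(2)[of s] small[of s] TQ[of s] d4 d by auto
      qed
      show "complex_of_real t \<in> ball 0 \<rho>" using small[OF t] d4 d by simp
    qed
    then show ?thesis using h(2)[of t] small[OF t] d4 d by simp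
  qed
  show ?thesis
  proof (intro exI[of _ "cube x0 d"] conjI allI impI)
    show "open (cube x0 d)" by (rule open_cube)
    show "x0 \<in> cube x0 d" using d by (simp add: cube_def)
    show "cube x0 d \<subseteq> Z" using sub \<rho> by blast
    fix A assume A: "A \<in> sets borel" "A \<subseteq> cube x0 d" "emeasure lborel A \<noteq> 0"
      "AE x in lborel. x \<in> A \<longrightarrow> ?u x = 0"
    have "AE x in lborel. (x \<in> A \<longrightarrow> ?u x = 0) \<and> (x \<in> ball x0 \<rho> \<longrightarrow> U x = complex_of_real (c * ?u x))"
      using A(4) U by eventually_elim blast
    then obtain N where N: "N \<in> null_sets lborel"
      "\<And>x. x \<in> space lborel - N \<Longrightarrow> (x \<in> A \<longrightarrow> ?u x = 0) \<and> (x \<in> ball x0 \<rho> \<longrightarrow> U x = complex_of_real (c * ?u x))"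
      by (rule AE_E3) blast
    have zero: "U x = 0" if "x \<in> cube x0 d" for x
    proof (rule zero_on_cube[where A = "A - N" and U = U and ?x0.0 = x0 and d = d, OF _ _ _ _ lines that])
      show "A - N \<in> sets borel" using A(1) N(1) by auto
      show "emeasure lborel (A - N) \<noteq> 0" using emeasure_Diff_null_set[of N lborel A] N(1) A by simp
      show "U x = 0" if "x \<in> A - N" for x
      proof -
        have "x \<in> ball x0 \<rho>" using that A(2) sub by blast
        then show ?thesis using N(2)[of x] that by simp
      qed
    qed (use A(2) in auto)
    show "AE x in lborel. x \<in> cube x0 d \<longrightarrow> ?u x = 0"
      using U
    proof eventually_elim
      case (elim x)
      then show ?case using zero[of x] sub c by auto
    qed
  qed
qed

text \<open>Overlapping neighbourhoods share a set of positive measure, so the points with a neighbourhood on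
  which \<open>e\<close> vanishes form an open and closed subset of \<open>Z\<close>. It is not empty: \<open>A\<close> is covered by
  countably many neighbourhoods, one of which it meets in positive measure.\<close>

theorem eigenfunction_unique_continuation:
  fixes Z :: "'a::euclidean_space set"
  assumes e: "e \<in> eigenspace Z \<mu>" and Z: "open Z" "connected Z"
    and A: "A \<in> sets lebesgue" "A \<subseteq> Z" "emeasure lebesgue A \<noteq> 0"
    and eA: "AE z in lebesgue. z \<in> A \<longrightarrow> fun_of e z = 0"
  shows "e = 0"
proof -
  let ?u = "borel_rep (fst e)"
  define zero where "zero Q \<longleftrightarrow> (AE x in lborel. x \<in> Q \<longrightarrow> ?u x = 0)" for Q
  have mono: "zero Q \<Longrightarrow> Q' \<subseteq> Q \<Longrightarrow> zero Q'" for Q Q'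
    unfolding zero_def by (auto elim: eventually_mono)
  have "\<forall>x\<in>Z. \<exists>Q. open Q \<and> x \<in> Q \<and> Q \<subseteq> Z \<and>
      (\<forall>A. A \<in> sets borel \<longrightarrow> A \<subseteq> Q \<longrightarrow> emeasure lborel A \<noteq> 0 \<longrightarrow> zero A \<longrightarrow> zero Q)"
    unfolding zero_def using eigenfunction_zero_local[OF e Z(1)] by blast
  then obtain Q where Q: "\<And>x. x \<in> Z \<Longrightarrow> open (Q x)" "\<And>x. x \<in> Z \<Longrightarrow> x \<in> Q x" "\<And>x. x \<in> Z \<Longrightarrow> Q x \<subseteq> Z"
    and Qz: "\<And>x A. x \<in> Z \<Longrightarrow> A \<in> sets borel \<Longrightarrow> A \<subseteq> Q x \<Longrightarrow> emeasure lborel A \<noteq> 0 \<Longrightarrow> zero A \<Longrightarrow> zero (Q x)"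
    by metis
  define G where "G = {x \<in> Z. zero (Q x)}"
  have nb: "zero (Q y)" if xG: "x \<in> G" and yZ: "y \<in> Z" and ne: "Q x \<inter> Q y \<noteq> {}" for x y
  proof (rule Qz[OF yZ, of "Q x \<inter> Q y"])
    have x: "x \<in> Z" "zero (Q x)" using xG by (auto simp: G_def)
    have op: "open (Q x \<inter> Q y)" using Q x yZ by blast
    show "Q x \<inter> Q y \<in> sets borel" using op by (rule borel_open)
    show "emeasure lborel (Q x \<inter> Q y) \<noteq> 0"
    proof -
      obtain z \<epsilon> where "\<epsilon> > 0" "ball z \<epsilon> \<subseteq> Q x \<inter> Q y" using op ne open_contains_ball by blast
      then have "emeasure lborel (ball z \<epsilon>) \<le> emeasure lborel (Q x \<inter> Q y)"
        using op by (intro emeasure_mono) auto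
      moreover have "emeasure lborel (ball z \<epsilon>) \<noteq> 0"
        using content_ball_pos[OF \<open>\<epsilon> > 0\<close>, of z] by (auto simp: measure_def)
      ultimately show ?thesis by auto
    qed
    show "zero (Q x \<inter> Q y)" using mono[OF x(2)] by blast
  qed auto
  have Gop: "open G"
  proof (subst open_subopen, rule ballI)
    fix x assume x: "x \<in> G"
    have "Q x \<subseteq> G"
    proof
      fix y assume y: "y \<in> Q x"
      then have "y \<in> Z" using x Q by (auto simp: G_def)
      then show "y \<in> G" using nb[OF x] y Q(2) by (auto simp: G_def)
    qed
    then show "\<exists>T. open T \<and> x \<in> T \<and> T \<subseteq> G" using x Q by (auto simp: G_def)
  qed
  have Cop: "open (Z - G)"
  proof (subst open_subopen, rule ballI)
    fix y assume y: "y \<in> Z - G"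
    have "Q y \<subseteq> Z - G"
    proof
      fix x assume x: "x \<in> Q y"
      then have xZ: "x \<in> Z" using y Q by blast
      have "x \<notin> G" using nb[of x y] y x Q(2)[OF xZ] by (auto simp: G_def)
      then show "x \<in> Z - G" using xZ by blast
    qed
    then show "\<exists>T. open T \<and> y \<in> T \<and> T \<subseteq> Z - G" using y Q by blast
  qed
  obtain F where F: "F \<subseteq> Q ` Z" "countable F" "\<Union>F = \<Union>(Q ` Z)"
    using Lindelof[of "Q ` Z"] Q(1) by blast
  have FZ: "\<Union>F = Z" using F(3) Q by blast
  have "G \<noteq> {}"
  proof
    assume G0: "G = {}"
    have "A \<inter> P \<in> null_sets lebesgue" if P: "P \<in> F" for P
    proof -
      obtain x where x: "x \<in> Z" "P = Q x" using P F(1) by blast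
      have Pb: "P \<in> sets borel" unfolding x(2) by (rule borel_open[OF Q(1)[OF x(1)]])
      have AP: "A \<inter> P \<in> sets lebesgue" using A(1) Pb by auto
      then obtain S N N' where S: "A \<inter> P = S \<union> N" "N \<subseteq> N'" "N' \<in> null_sets lborel" "S \<in> sets lborel"
        by (rule sets_completionE)
      have "zero S"
      proof -
        have "AE z in lborel. z \<in> A \<longrightarrow> fun_of e z = 0" using eA by (simp add: AE_completion_iff)
        with borel_rep_AE[of "fst e"] show ?thesis
          unfolding zero_def by eventually_elim (use S(1) in auto)
      qed
      then have "emeasure lborel S = 0" using Qz[OF x(1), of S] S G0 x by (auto simp: G_def)
      then have "S \<in> null_sets lborel" using S(4) by auto
      then have "S \<union> N' \<in> null_sets lborel" using S(3) by blast
      then have "S \<union> N' \<in> null_sets lebesgue" by (rule null_sets_completionI)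
      then show ?thesis by (rule null_sets_completion_subset[rotated]) (use S in auto)
    qed
    then have "(\<Union>P\<in>F. A \<inter> P) \<in> null_sets lebesgue" using F(2) by (intro null_sets_UN')
    moreover have "(\<Union>P\<in>F. A \<inter> P) = A" using FZ A(2) by blast
    ultimately show False using A(3) by auto
  qed
  moreover have "G \<inter> (Z - G) \<inter> Z = {}" "Z \<subseteq> G \<union> (Z - G)" by auto
  moreover have "G \<inter> Z \<noteq> {}" using \<open>G \<noteq> {}\<close> by (auto simp: G_def)
  ultimately have "(Z - G) \<inter> Z = {}" using connectedD[OF Z(2) Gop Cop] by blast
  then have "zero (Q x)" if "x \<in> Z" for x using that by (auto simp: G_def)
  then have "zero P" if "P \<in> F" for P using that F(1) by blast
  then have "AE x in lborel. \<forall>P\<in>F. x \<in> P \<longrightarrow> ?u x = 0"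
    unfolding zero_def using F(2) by (subst AE_ball_countable) auto
  then have "AE x in lborel. x \<in> Z \<longrightarrow> ?u x = 0" by eventually_elim (use FZ in blast)
  with borel_rep_AE[of "fst e"] have "AE x in lborel. x \<in> Z \<longrightarrow> fun_of e x = 0"
    by eventually_elim simp
  then have 1: "AE x in lebesgue. x \<in> Z \<longrightarrow> fun_of e x = 0" by (rule AE_completion)
  have Zs: "Z \<in> sets lebesgue" using Z(1) by auto
  have "e \<in> H10 Z" using e by (simp add: eigenspace_def)
  from H10_zero_outside[OF Zs this] 1 rep_L2_zero have "AE x in lebesgue. fun_of e x = rep_L2 0 x"
    by eventually_elim auto
  then have "fst e = 0" by (rule L2_eqI)
  then show ?thesis using eigenspace_eq_0[OF e] by simp
qed

section \<open>Coercivity on the higher eigenspaces\<close>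

lemma finite_orthonormal_basis:
  fixes B :: "'a::real_inner set"
  assumes "finite B"
  shows "\<exists>C. finite C \<and> span C = span B \<and> (\<forall>c\<in>C. norm c = 1) \<and> pairwise orthogonal C"
  using assms
proof (induction B rule: finite_induct)
  case empty
  then show ?case by (intro exI[of _ "{}"]) auto
next
  case (insert b B)
  then obtain C where C: "finite C" "span C = span B" "\<And>c. c \<in> C \<Longrightarrow> norm c = 1" "pairwise orthogonal C"
    by auto
  define p where "p = (\<Sum>c\<in>C. (b \<bullet> c) *\<^sub>R c)"
  define b' where "b' = b - p"
  have p: "p \<in> span C" unfolding p_def by (intro span_sum span_scale span_base)
  have orth: "b' \<bullet> c = 0" if c: "c \<in> C" for c
  proof -
    have "p \<bullet> c = (\<Sum>d\<in>C. if d = c then b \<bullet> c else 0)"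
      unfolding p_def inner_sum_left
    proof (rule sum.cong[OF refl])
      fix d assume d: "d \<in> C"
      show "((b \<bullet> d) *\<^sub>R d) \<bullet> c = (if d = c then b \<bullet> c else 0)"
        using C(3)[OF c] C(4) c d by (auto simp: pairwise_def orthogonal_def power2_norm_eq_inner[symmetric])
    qed
    then show ?thesis using C(1) c by (simp add: b'_def inner_diff_left)
  qed
  have sp: "span (insert b B) = span (insert b C)" using C(2) by (metis span_insert)
  show ?case
  proof (cases "b' = 0")
    case True
    then have "b \<in> span C" using p by (simp add: b'_def)
    then have "span C = span (insert b B)" using sp span_redundant[of b C] by simp
    then show ?thesis using C by blast
  next
    case False
    define e where "e = (1 / norm b') *\<^sub>R b'"
    have e: "norm e = 1" "\<And>c. c \<in> C \<Longrightarrow> e \<bullet> c = 0" using False orth by (auto simp: e_def)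
    have b: "b = norm b' *\<^sub>R e + p" using False by (simp add: e_def b'_def)
    have pe: "p \<in> span (insert x C)" for x using p span_mono[OF subset_insertI] by blast
    have "norm b' *\<^sub>R e + p \<in> span (insert e C)"
      by (rule span_add[OF span_scale[OF span_base] pe]) simp
    then have "b \<in> span (insert e C)" using b by simp
    moreover have "b - p \<in> span (insert b C)"
      by (rule span_diff[OF span_base pe]) simp
    then have "e \<in> span (insert b C)" unfolding e_def b'_def by (rule span_scale)
    ultimately have "span (insert e C) = span (insert b C)"
      by (intro span_eq[THEN iffD2]) (auto intro: span_base)
    moreover have "pairwise orthogonal (insert e C)"
      unfolding pairwise_insert using e(2)
      by (intro conjI allI impI C(4)) (auto simp: orthogonal_def inner_commute)
    ultimately show ?thesis using C(1,3) e(1) sp by (intro exI[of _ "insert e C"]) auto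
  qed
qed

text \<open>On a finite-dimensional space an injective linear map \<open>G\<close> is bounded below: expand
  \<open>G e\<close> in an orthonormal basis of the range.\<close>

lemma finite_dim_bounded_below:
  fixes G :: "'a::real_vector \<Rightarrow> 'b::real_inner" and F :: "'a \<Rightarrow> 'c::real_normed_vector"
  assumes B: "finite B" and G: "linear G" and F: "linear F"
    and inj: "\<And>e. e \<in> span B \<Longrightarrow> G e = 0 \<Longrightarrow> F e = 0"
  shows "\<exists>C\<ge>0. \<forall>e\<in>span B. norm (F e) \<le> C * norm (G e)"
proof -
  obtain D where D: "finite D" "span D = span (G ` B)" "\<And>d. d \<in> D \<Longrightarrow> norm d = 1" "pairwise orthogonal D"
    using finite_orthonormal_basis[of "G ` B"] B by auto
  have im: "G ` span B = span (G ` B)" by (rule linear_span_image[OF G, symmetric])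
  have "\<forall>d\<in>D. \<exists>e\<in>span B. G e = d"
  proof
    fix d assume "d \<in> D"
    then have "d \<in> G ` span B" unfolding im D(2)[symmetric] by (rule span_base)
    then show "\<exists>e\<in>span B. G e = d" by blast
  qed
  then obtain g where g: "\<And>d. d \<in> D \<Longrightarrow> g d \<in> span B \<and> G (g d) = d" by metis
  define C where "C = (\<Sum>d\<in>D. norm (F (g d)))"
  have "norm (F e) \<le> C * norm (G e)" if e: "e \<in> span B" for e
  proof -
    let ?s = "\<Sum>d\<in>D. (G e \<bullet> d) *\<^sub>R g d"
    have "G e \<in> span D" using e im D(2) by blast
    then have "G e = (\<Sum>d\<in>D. (G e \<bullet> d) *\<^sub>R d)"
    proof (induction rule: span_induct_alt)
      case base
      then show ?case by simp
    next
      case (step c x y)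
      have "(\<Sum>d\<in>D. ((c *\<^sub>R x + y) \<bullet> d) *\<^sub>R d)
          = c *\<^sub>R (\<Sum>d\<in>D. (x \<bullet> d) *\<^sub>R d) + (\<Sum>d\<in>D. (y \<bullet> d) *\<^sub>R d)"
        by (simp add: inner_add_left scaleR_add_left sum.distrib scaleR_sum_right)
      also have "(\<Sum>d\<in>D. (x \<bullet> d) *\<^sub>R d) = (\<Sum>d\<in>D. if d = x then x else 0)"
        using step(1) D(3)[OF step(1)] D(4)
        by (intro sum.cong refl) (auto simp: pairwise_def orthogonal_def power2_norm_eq_inner[symmetric])
      also have "\<dots> = x" using D(1) step(1) by simp
      finally show ?case using step(2) by simp
    qed
    also have "\<dots> = G ?s" using g by (simp add: linear_sum[OF G] linear_cmul[OF G])
    finally have "G (e - ?s) = 0" by (simp add: linear_diff[OF G])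
    moreover have "e - ?s \<in> span B" using e g by (intro span_diff span_sum span_scale) auto
    ultimately have "F (e - ?s) = 0" by (intro inj)
    then have "F e = (\<Sum>d\<in>D. (G e \<bullet> d) *\<^sub>R F (g d))"
      by (simp add: linear_diff[OF F] linear_sum[OF F] linear_cmul[OF F])
    then have "norm (F e) \<le> (\<Sum>d\<in>D. norm ((G e \<bullet> d) *\<^sub>R F (g d)))"
      using norm_sum[of "\<lambda>d. (G e \<bullet> d) *\<^sub>R F (g d)" D] by (simp only:)
    also have "\<dots> \<le> (\<Sum>d\<in>D. norm (G e) * norm (F (g d)))"
    proof (rule sum_mono)
      fix d assume "d \<in> D"
      then have "\<bar>G e \<bullet> d\<bar> \<le> norm (G e)" using Cauchy_Schwarz_ineq2[of "G e" d] D(3) by simp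
      then show "norm ((G e \<bullet> d) *\<^sub>R F (g d)) \<le> norm (G e) * norm (F (g d))"
        by (simp add: mult_right_mono)
    qed
    also have "\<dots> = C * norm (G e)" by (simp add: C_def sum_distrib_left mult.commute)
    finally show ?thesis .
  qed
  moreover have "C \<ge> 0" by (simp add: C_def sum_nonneg)
  ultimately show ?thesis by blast
qed

text \<open>Its squared norm is the quadratic form \<open>\<integral> \<delta> x\<^sup>2\<close>; as a linear map it allows the comparison of
  quadratic forms by norms.\<close>

definition weight :: "('a::euclidean_space \<Rightarrow> real) \<Rightarrow> ('a, real) L2 \<Rightarrow> ('a, real) L2" where
  "weight \<delta> x = abs_L2 (\<lambda>z. sqrt (\<delta> z) * rep_L2 x z)"

context
  fixes \<delta> :: "'a::euclidean_space \<Rightarrow> real" and C :: real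
  assumes \<delta>_meas: "\<delta> \<in> borel_measurable lebesgue" and \<delta>_bound: "\<And>z. 0 \<le> \<delta> z \<and> \<delta> z \<le> C"
begin

lemma sq_integrable_weight: "sq_integrable (\<lambda>z. sqrt (\<delta> z) * rep_L2 x z)"
proof -
  have m: "(\<lambda>z. sqrt (\<delta> z) * rep_L2 x z) \<in> borel_measurable lebesgue"
    using \<delta>_meas measurable_rep_L2[of x] by measurable
  have i: "integrable lebesgue (\<lambda>z. C * (rep_L2 x z)\<^sup>2)"
    using sq_integrable_rep_L2[of x] by (simp add: sq_integrable_def)
  have "integrable lebesgue (\<lambda>z. (norm (sqrt (\<delta> z) * rep_L2 x z))\<^sup>2)"
  proof (rule Bochner_Integration.integrable_bound[OF i])
    show "(\<lambda>z. (norm (sqrt (\<delta> z) * rep_L2 x z))\<^sup>2) \<in> borel_measurable lebesgue" using m by measurable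
    show "AE z in lebesgue. norm ((norm (sqrt (\<delta> z) * rep_L2 x z))\<^sup>2) \<le> norm (C * (rep_L2 x z)\<^sup>2)"
    proof (rule AE_I2)
      fix z
      have "\<delta> z * (rep_L2 x z)\<^sup>2 \<le> \<bar>C\<bar> * (rep_L2 x z)\<^sup>2"
        using \<delta>_bound[of z] by (intro mult_right_mono) auto
      then show "norm ((norm (sqrt (\<delta> z) * rep_L2 x z))\<^sup>2) \<le> norm (C * (rep_L2 x z)\<^sup>2)"
        using \<delta>_bound[of z] by (simp add: power_mult_distrib abs_mult)
    qed
  qed
  with m show ?thesis by (simp add: sq_integrable_def)
qed

lemma norm_weight: "(norm (weight \<delta> x))\<^sup>2 = (\<integral>z. \<delta> z * (rep_L2 x z)\<^sup>2 \<partial>lebesgue)"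
  unfolding weight_def norm_abs_L2[OF sq_integrable_weight]
  by (rule Bochner_Integration.integral_cong) (use \<delta>_bound in \<open>auto simp: power_mult_distrib\<close>)

lemma weight_integrable: "integrable lebesgue (\<lambda>z. \<delta> z * (rep_L2 x z)\<^sup>2)"
proof -
  have "(\<lambda>z. (norm (sqrt (\<delta> z) * rep_L2 x z))\<^sup>2) = (\<lambda>z. \<delta> z * (rep_L2 x z)\<^sup>2)"
    using \<delta>_bound by (auto simp: power_mult_distrib)
  then show ?thesis using sq_integrable_weight[of x] by (simp add: sq_integrable_def)
qed

lemma norm_weight_le: "(norm (weight \<delta> x))\<^sup>2 \<le> C * (norm x)\<^sup>2"
proof -
  have i: "integrable lebesgue (\<lambda>z. C * (rep_L2 x z)\<^sup>2)"
    using sq_integrable_rep_L2[of x] by (simp add: sq_integrable_def)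
  have "(\<integral>z. \<delta> z * (rep_L2 x z)\<^sup>2 \<partial>lebesgue) \<le> (\<integral>z. C * (rep_L2 x z)\<^sup>2 \<partial>lebesgue)"
    using \<delta>_bound by (intro integral_mono weight_integrable i mult_right_mono) auto
  then show ?thesis by (simp add: norm_weight norm_L2_eq[of x])
qed

lemma linear_weight: "linear (weight \<delta>)"
proof (rule linearI)
  fix x y :: "('a, real) L2" and c :: real
  have "weight \<delta> x + weight \<delta> y = abs_L2 (\<lambda>z. sqrt (\<delta> z) * rep_L2 x z + sqrt (\<delta> z) * rep_L2 y z)"
    unfolding weight_def by (rule add_abs_L2[OF sq_integrable_weight sq_integrable_weight])
  also have "\<dots> = weight \<delta> (x + y)"
    unfolding weight_def
  proof (subst abs_L2_eq_iff)
    show "AE z in lebesgue. sqrt (\<delta> z) * rep_L2 x z + sqrt (\<delta> z) * rep_L2 y z = sqrt (\<delta> z) * rep_L2 (x + y) z"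
      using rep_L2_add[of x y] by eventually_elim (simp add: distrib_left)
  qed (auto intro: sq_integrable_add sq_integrable_weight)
  finally show "weight \<delta> (x + y) = weight \<delta> x + weight \<delta> y" ..
  have "c *\<^sub>R weight \<delta> x = abs_L2 (\<lambda>z. c *\<^sub>R (sqrt (\<delta> z) * rep_L2 x z))"
    unfolding weight_def by (rule scaleR_abs_L2[OF sq_integrable_weight])
  also have "\<dots> = weight \<delta> (c *\<^sub>R x)"
    unfolding weight_def
  proof (subst abs_L2_eq_iff)
    show "AE z in lebesgue. c *\<^sub>R (sqrt (\<delta> z) * rep_L2 x z) = sqrt (\<delta> z) * rep_L2 (c *\<^sub>R x) z"
      using rep_L2_scaleR[of c x] by eventually_elim simp
  qed (intro sq_integrable_scaleR sq_integrable_weight)+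
  finally show "weight \<delta> (c *\<^sub>R x) = c *\<^sub>R weight \<delta> x" ..
qed

lemma norm_weight_le': "norm (weight \<delta> x) \<le> sqrt C * norm x"
proof (rule power2_le_imp_le)
  have "0 \<le> C" using \<delta>_bound by (meson order_trans)
  then show "(norm (weight \<delta> x))\<^sup>2 \<le> (sqrt C * norm x)\<^sup>2" "0 \<le> sqrt C * norm x"
    using norm_weight_le by (simp_all add: power_mult_distrib)
qed

lemma bounded_linear_weight: "bounded_linear (weight \<delta>)"
  by (rule bounded_linear_intro[where K = "sqrt C"])
    (use linear_weight norm_weight_le' in \<open>auto simp: linear_add linear_cmul mult.commute\<close>)

lemma weight_eq_0: "weight \<delta> x = 0 \<Longrightarrow> AE z in lebesgue. \<delta> z > 0 \<longrightarrow> rep_L2 x z = 0"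
proof -
  assume "weight \<delta> x = 0"
  then have "abs_L2 (\<lambda>z. sqrt (\<delta> z) * rep_L2 x z) = abs_L2 (\<lambda>_. 0)"
    by (simp add: weight_def zero_L2_def)
  then have "AE z in lebesgue. sqrt (\<delta> z) * rep_L2 x z = 0"
    by (simp add: abs_L2_eq_iff sq_integrable_weight sq_integrable_zero)
  then show ?thesis by eventually_elim auto
qed

end

lemma eigenspace_orthogonal:
  assumes "x \<in> eigenspace Z a" "y \<in> eigenspace Z b" "a \<noteq> b"
  shows "fst x \<bullet> fst y = 0" "snd x \<bullet> snd y = 0"
proof -
  have H: "x \<in> H10 Z" "y \<in> H10 Z" using assms by (auto simp: eigenspace_def)
  have "snd x \<bullet> snd y = a * (fst x \<bullet> fst y)" using assms(1) H by (auto simp: eigenspace_def)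
  moreover have "snd y \<bullet> snd x = b * (fst y \<bullet> fst x)" using assms(2) H by (auto simp: eigenspace_def)
  ultimately show "fst x \<bullet> fst y = 0" "snd x \<bullet> snd y = 0"
    using assms(3) by (auto simp: inner_commute)
qed

lemma eigenspace_subset_H10: "eigenspace Z a \<subseteq> H10 Z"
  by (auto simp: eigenspace_def)

lemma span_eigenspaces:
  assumes "x \<in> span (\<Union>i\<in>A. eigenspace Z (lam i))"
  obtains I e where "finite I" "I \<subseteq> A" "\<And>i. i \<in> I \<Longrightarrow> e i \<in> eigenspace Z (lam i)" "x = (\<Sum>i\<in>I. e i)"
proof -
  have "\<exists>I e. finite I \<and> I \<subseteq> A \<and> (\<forall>i\<in>I. e i \<in> eigenspace Z (lam i)) \<and> x = (\<Sum>i\<in>I. e i)"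
    using assms
  proof (induction rule: span_induct_alt)
    case base
    then show ?case by (intro exI[of _ "{}"]) auto
  next
    case (step c v y)
    then obtain i I e where i: "i \<in> A" "v \<in> eigenspace Z (lam i)"
      and I: "finite I" "I \<subseteq> A" "\<And>i. i \<in> I \<Longrightarrow> e i \<in> eigenspace Z (lam i)" "y = (\<Sum>i\<in>I. e i)"
      by blast
    define f where "f n = (if n = i then c *\<^sub>R v + (if i \<in> I then e i else 0) else e n)" for n
    have "f n \<in> eigenspace Z (lam n)" if "n \<in> insert i I" for n
      using that i I(3) subspace_eigenspace[of Z "lam i"]
      by (auto simp: f_def intro!: subspace_add subspace_scale subspace_0)
    moreover have "(\<Sum>n\<in>insert i I. f n) = c *\<^sub>R v + y"
    proof -
      have "(\<Sum>n\<in>insert i I. f n) = f i + (\<Sum>n\<in>I - {i}. f n)"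
        using I(1) by (simp add: sum.insert_remove)
      also have "(\<Sum>n\<in>I - {i}. f n) = (\<Sum>n\<in>I - {i}. e n)" by (rule sum.cong) (auto simp: f_def)
      also have "f i + \<dots> = c *\<^sub>R v + y"
        using I(1) by (cases "i \<in> I") (auto simp: f_def I(4) sum.remove)
      finally show ?thesis .
    qed
    ultimately show ?case using i I by (intro exI[of _ "insert i I"] exI[of _ f]) auto
  qed
  then show ?thesis using that by blast
qed

lemma eigenvalue_nonneg: "a \<in> eigenvalues Z \<Longrightarrow> a \<ge> 0"
proof -
  assume "a \<in> eigenvalues Z"
  then obtain e where e: "e \<in> eigenspace Z a" "e \<noteq> 0" by (auto simp: eigenvalues_def)
  then have "fst e \<noteq> 0" using eigenspace_eq_0 by blast
  then have "(norm (fst e))\<^sup>2 > 0" by simp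
  moreover have "0 \<le> a * (norm (fst e))\<^sup>2" using eigenspace_norm[OF e(1)] by (metis zero_le_power2)
  ultimately show ?thesis by (simp add: zero_le_mult_iff)
qed

text \<open>Distinct eigenspaces are orthogonal for both components, so both squared norms are sums over the
  eigencomponents.\<close>

lemma spectral_gap:
  fixes lam :: "nat \<Rightarrow> real"
  assumes lam: "strict_mono_on {1..} lam" and m: "1 \<le> m"
    and w: "w \<in> span (\<Union>i\<in>{m..}. eigenspace Z (lam i))"
  shows "lam m * (norm (fst w))\<^sup>2 \<le> (norm (snd w))\<^sup>2"
    and "\<And>v j. 1 \<le> j \<Longrightarrow> j < m \<Longrightarrow> v \<in> eigenspace Z (lam j) \<Longrightarrow> fst v \<bullet> fst w = 0 \<and> snd v \<bullet> snd w = 0"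
proof -
  obtain I e where I: "finite I" "I \<subseteq> {m..}" "\<And>i. i \<in> I \<Longrightarrow> e i \<in> eigenspace Z (lam i)" "w = (\<Sum>i\<in>I. e i)"
    using span_eigenspaces[OF w] by metis
  have ne: "lam i \<noteq> lam j" if "1 \<le> i" "1 \<le> j" "i \<noteq> j" for i j
    using strict_mono_on_imp_inj_on[OF lam] that by (auto simp: inj_on_def)
  have fs: "fst w = (\<Sum>i\<in>I. fst (e i))" "snd w = (\<Sum>i\<in>I. snd (e i))"
    by (simp_all add: I(4) fst_sum snd_sum)
  have orth: "fst (e i) \<bullet> fst (e j) = 0 \<and> snd (e i) \<bullet> snd (e j) = 0" if "i \<in> I" "j \<in> I" "i \<noteq> j" for i j
    using eigenspace_orthogonal[OF I(3)[OF that(1)] I(3)[OF that(2)]] ne[of i j] that I(2) m by fastforce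
  have 1: "(norm (fst w))\<^sup>2 = (\<Sum>i\<in>I. (norm (fst (e i)))\<^sup>2)"
    unfolding fs by (rule norm_sum_Pythagorean[OF I(1)]) (use orth in \<open>auto simp: pairwise_def orthogonal_def\<close>)
  have 2: "(norm (snd w))\<^sup>2 = (\<Sum>i\<in>I. (norm (snd (e i)))\<^sup>2)"
    unfolding fs by (rule norm_sum_Pythagorean[OF I(1)]) (use orth in \<open>auto simp: pairwise_def orthogonal_def\<close>)
  have "lam m * (norm (fst w))\<^sup>2 = (\<Sum>i\<in>I. lam m * (norm (fst (e i)))\<^sup>2)" by (simp add: 1 sum_distrib_left)
  also have "\<dots> \<le> (\<Sum>i\<in>I. (norm (snd (e i)))\<^sup>2)"
  proof (rule sum_mono)
    fix i assume i: "i \<in> I"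
    then have "m \<le> i" using I(2) by auto
    then have "lam m \<le> lam i" using lam m by (cases "m = i") (auto simp: strict_mono_on_def less_imp_le)
    then show "lam m * (norm (fst (e i)))\<^sup>2 \<le> (norm (snd (e i)))\<^sup>2"
      unfolding eigenspace_norm[OF I(3)[OF i]] by (rule mult_right_mono) simp
  qed
  finally show "lam m * (norm (fst w))\<^sup>2 \<le> (norm (snd w))\<^sup>2" by (simp add: 2)
  fix v j assume j: "1 \<le> j" "j < m" "v \<in> eigenspace Z (lam j)"
  have "fst v \<bullet> fst (e i) = 0 \<and> snd v \<bullet> snd (e i) = 0" if "i \<in> I" for i
  proof -
    have "lam j \<noteq> lam i" using ne[of j i] j I(2) that by force
    then show ?thesis using eigenspace_orthogonal[OF j(3) I(3)[OF that]] by blast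
  qed
  then show "fst v \<bullet> fst w = 0 \<and> snd v \<bullet> snd w = 0" by (simp add: fs inner_sum_right)
qed

text \<open>Split \<open>v\<close> into its component \<open>e\<close> in the first eigenspace and the rest \<open>w\<close>. The rest is controlled by
  the spectral gap; \<open>e\<close> by the weight, which is definite on the finite-dimensional eigenspace
  by unique continuation.\<close>

lemma coercive_with_weight:
  fixes Z :: "'a::euclidean_space set" and \<delta> :: "'a \<Rightarrow> real"
  assumes Z: "open Z" "connected Z" "bounded Z"
    and lam: "strict_mono_on {1..} lam" "lam ` {1..} = eigenvalues Z" and k: "1 \<le> k"
    and \<delta>: "\<delta> \<in> borel_measurable lebesgue" "\<And>z. 0 \<le> \<delta> z \<and> \<delta> z \<le> C"
    and A: "A \<in> sets lebesgue" "A \<subseteq> Z" "emeasure lebesgue A \<noteq> 0" "\<And>z. z \<in> A \<Longrightarrow> \<delta> z > 0"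
  obtains c where "c > 0" "\<And>v. v \<in> H_hat Z lam k \<Longrightarrow>
    c * (norm v)\<^sup>2 \<le> (norm (snd v))\<^sup>2 - lam (k + 1) * (norm (fst v))\<^sup>2 + (norm (weight \<delta> (fst v)))\<^sup>2"
proof -
  let ?a = "lam (k + 1)" and ?b = "lam (k + 2)" and ?R = "\<lambda>v :: 'a H1. weight \<delta> (fst v)"
  let ?E = "eigenspace Z ?a"
  have nn: "0 \<le> lam i" if "1 \<le> i" for i using eigenvalue_nonneg lam(2) that by blast
  have ab: "0 < ?a" "?a < ?b"
    using strict_mono_onD[OF lam(1), of k "k + 1"] strict_mono_onD[OF lam(1), of "k + 1" "k + 2"] nn[of k] k by auto
  have linR: "linear ?R"
    using linear_compose[OF linear_fst linear_weight[OF \<delta>]] by (simp add: o_def)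
  obtain B where B: "finite B" "?E = span B" by (rule eigenspace_finite_dim[OF Z(3)])
  have "fst e = 0" if e: "e \<in> span B" and 0: "?R e = 0" for e
  proof -
    have eE: "e \<in> ?E" using e B by simp
    have "AE z in lebesgue. z \<in> A \<longrightarrow> fun_of e z = 0"
      using weight_eq_0[OF \<delta> 0] by eventually_elim (use A(4) in auto)
    then have "e = 0" by (rule eigenfunction_unique_continuation[OF eE Z(1,2) A(1-3)])
    then show ?thesis by simp
  qed
  then obtain C1 where C1: "C1 \<ge> 0" "\<And>e. e \<in> ?E \<Longrightarrow> norm (fst e) \<le> C1 * norm (?R e)"
    using finite_dim_bounded_below[OF B(1) linR linear_fst] B(2) by blast
  have C0: "0 \<le> C" using \<delta>(2) by (meson order_trans)
  define \<kappa> where "\<kappa> = 1 - ?a / ?b"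
  have \<kappa>: "\<kappa> > 0" using ab by (simp add: \<kappa>_def)
  define K where "K = C1\<^sup>2 * (2 + 2 * C / (?b * \<kappa>))"
  define c where "c = 1 / ((1 + ?a) * K + 1 / (\<kappa> * ?b) + 1 / \<kappa>)"
  have K0: "K \<ge> 0" using C0 ab \<kappa> by (simp add: K_def)
  have den: "(1 + ?a) * K + 1 / (\<kappa> * ?b) + 1 / \<kappa> > 0"
    using K0 ab \<kappa> by (intro add_nonneg_pos add_nonneg_nonneg mult_nonneg_nonneg) auto
  then have c: "c > 0" by (simp add: c_def)
  let ?P = "\<lambda>v :: 'a H1. c * (norm v)\<^sup>2 \<le> (norm (snd v))\<^sup>2 - ?a * (norm (fst v))\<^sup>2 + (norm (?R v))\<^sup>2"
  have main: "?P v" if v: "v \<in> span (\<Union>i\<in>{k+1..}. eigenspace Z (lam i))" for v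
  proof -
    have "{k+1..} = insert (k+1) {k+2..}" by auto
    then have "(\<Union>i\<in>{k+1..}. eigenspace Z (lam i)) = ?E \<union> (\<Union>i\<in>{k+2..}. eigenspace Z (lam i))" by auto
    moreover have "span ?E = ?E" by (rule span_eq_iff[THEN iffD2, OF subspace_eigenspace])
    ultimately have "v \<in> {x + y |x y. x \<in> ?E \<and> y \<in> span (\<Union>i\<in>{k+2..}. eigenspace Z (lam i))}"
      using v by (simp only: span_Un)
    then obtain e w where ew: "v = e + w" "e \<in> ?E" and w: "w \<in> span (\<Union>i\<in>{k+2..}. eigenspace Z (lam i))"
      by blast
    have o: "fst e \<bullet> fst w = 0" "snd e \<bullet> snd w = 0"
      using spectral_gap(2)[OF lam(1) _ w, of "k+1" e] ew(2) by auto
    define E2 where "E2 = (norm (fst e))\<^sup>2"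
    define W2 where "W2 = (norm (fst w))\<^sup>2"
    define G2 where "G2 = (norm (snd w))\<^sup>2"
    define R2 where "R2 = (norm (?R v))\<^sup>2"
    have nn2: "0 \<le> E2" "0 \<le> W2" "0 \<le> G2" "0 \<le> R2" by (auto simp: E2_def W2_def G2_def R2_def)
    have n1: "(norm (fst v))\<^sup>2 = E2 + W2"
      unfolding ew(1) E2_def W2_def using norm_add_Pythagorean[of "fst e" "fst w"] o by (simp add: orthogonal_def)
    have n2: "(norm (snd v))\<^sup>2 = ?a * E2 + G2"
      unfolding ew(1) E2_def G2_def eigenspace_norm[OF ew(2), symmetric]
      using norm_add_Pythagorean[of "snd e" "snd w"] o by (simp add: orthogonal_def)
    define Q where "Q = (norm (snd v))\<^sup>2 - ?a * (norm (fst v))\<^sup>2 + R2"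
    have Q: "Q = G2 - ?a * W2 + R2" by (simp add: Q_def n1 n2 algebra_simps)
    have gap: "?b * W2 \<le> G2" unfolding W2_def G2_def using spectral_gap(1)[OF lam(1) _ w] by simp
    then have W2: "W2 \<le> G2 / ?b" using ab by (simp add: pos_le_divide_eq mult.commute)
    then have "?a * W2 \<le> ?a * (G2 / ?b)" using ab by (intro mult_left_mono) auto
    then have "\<kappa> * G2 + R2 \<le> Q" by (simp add: Q \<kappa>_def algebra_simps)
    then have QG: "\<kappa> * G2 \<le> Q" and QR: "R2 \<le> Q" using nn2 \<kappa> by (smt (verit) mult_nonneg_nonneg)+
    have Q0: "0 \<le> Q" using QR nn2 by simp
    have G2: "G2 \<le> Q / \<kappa>" using QG \<kappa> by (simp add: pos_le_divide_eq mult.commute)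
    have "G2 / ?b \<le> Q / \<kappa> / ?b" using G2 ab by (intro divide_right_mono) auto
    then have W2Q: "W2 \<le> Q / (\<kappa> * ?b)" using W2 by simp
    have "E2 \<le> K * Q"
    proof -
      have "?R e = ?R v - ?R w" using linear_diff[OF linR, of v w] ew(1) by simp
      then have "norm (?R e) \<le> norm (?R v) + norm (?R w)" by (simp add: norm_triangle_ineq4)
      then have "(norm (?R e))\<^sup>2 \<le> (norm (?R v) + norm (?R w))\<^sup>2" by (intro power_mono) auto
      also have "\<dots> \<le> 2 * R2 + 2 * (norm (?R w))\<^sup>2"
        using zero_le_power2[of "norm (?R v) - norm (?R w)"] by (simp add: R2_def power2_sum power2_diff)
      also have "\<dots> \<le> 2 * Q + 2 * (C * (Q / (\<kappa> * ?b)))"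
      proof -
        have "(norm (?R w))\<^sup>2 \<le> C * W2" unfolding W2_def by (rule norm_weight_le[OF \<delta>])
        also have "\<dots> \<le> C * (Q / (\<kappa> * ?b))" using W2Q C0 by (rule mult_left_mono)
        finally show ?thesis using QR by simp
      qed
      finally have re: "(norm (?R e))\<^sup>2 \<le> (2 + 2 * C / (?b * \<kappa>)) * Q" by (simp add: algebra_simps)
      have "E2 \<le> (C1 * norm (?R e))\<^sup>2"
        unfolding E2_def using C1(2)[OF ew(2)] by (intro power_mono) auto
      also have "\<dots> \<le> C1\<^sup>2 * ((2 + 2 * C / (?b * \<kappa>)) * Q)"
        unfolding power_mult_distrib using re by (intro mult_left_mono) auto
      finally show ?thesis by (simp add: K_def mult.assoc)
    qed
    then have "(1 + ?a) * E2 \<le> (1 + ?a) * (K * Q)" using ab by (intro mult_left_mono) auto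
    moreover have "(norm v)\<^sup>2 = (1 + ?a) * E2 + W2 + G2"
    proof -
      have "(norm v)\<^sup>2 = (norm (fst v))\<^sup>2 + (norm (snd v))\<^sup>2"
        by (simp add: power2_norm_eq_inner inner_prod_def)
      then show ?thesis by (simp add: n1 n2 algebra_simps)
    qed
    ultimately have "(norm v)\<^sup>2 \<le> (1 + ?a) * (K * Q) + Q / (\<kappa> * ?b) + Q / \<kappa>" using W2Q G2 by linarith
    also have "\<dots> = ((1 + ?a) * K + 1 / (\<kappa> * ?b) + 1 / \<kappa>) * Q" by (simp add: algebra_simps)
    finally have "(norm v)\<^sup>2 \<le> Q / c" by (simp add: c_def mult.commute)
    then have "c * (norm v)\<^sup>2 \<le> Q" using c by (simp add: pos_le_divide_eq mult.commute)
    then show ?thesis by (simp add: Q_def R2_def)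
  qed
  have "closed {v. ?P v}"
    by (intro closed_Collect_le continuous_intros
        continuous_on_compose2[OF linear_continuous_on[OF bounded_linear_weight[OF \<delta>], of UNIV]]) auto
  then have "H_hat Z lam k \<subseteq> {v. ?P v}"
    unfolding H_hat_def using main by (intro closure_minimal) auto
  with c that show ?thesis by blast
qed

section \<open>Minimisation on the fibres of a functional\<close>

lemma growth_continuous:
  fixes f :: "'a::real_normed_vector \<Rightarrow> real"
  assumes lip: "\<And>x y. \<bar>f x - f y\<bar> \<le> B * (1 + norm x + norm y) * norm (x - y)"
  shows "isCont f x"
  unfolding isCont_def
proof (rule Lim_null_comparison[THEN LIM_zero_cancel])
  show "\<forall>\<^sub>F y in at x. norm (f y - f x) \<le> B * (1 + norm y + norm x) * norm (y - x)"
    using lip by simp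
  have "((\<lambda>y. B * (1 + norm y + norm x) * norm (y - x)) \<longlongrightarrow> B * (1 + norm x + norm x) * norm (x - x)) (at x)"
    by (intro tendsto_intros)
  then show "((\<lambda>y. B * (1 + norm y + norm x) * norm (y - x)) \<longlongrightarrow> 0) (at x)" by simp
qed

text \<open>For continuity, add the quadratic growth inequalities around \<open>\<theta> u\<close> and \<open>\<theta> u'\<close>, each tested with the
  other minimiser. What remains on the right are variations of \<open>f\<close> from \<open>u\<close> to \<open>u'\<close>, which the
  Lipschitz bound makes small.\<close>

lemma fibrewise_minimiser:
  fixes f :: "'a::{real_normed_vector, complete_space} \<Rightarrow> real"
  assumes S: "subspace S" "closed S" and c: "c > 0" and B: "B \<ge> 0"
    and sc: "\<And>x y t. x - y \<in> S \<Longrightarrow> 0 \<le> t \<Longrightarrow> t \<le> 1 \<Longrightarrow>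
      f ((1 - t) *\<^sub>R x + t *\<^sub>R y) \<le> (1 - t) * f x + t * f y - c / 2 * (t * (1 - t)) * (norm (x - y))\<^sup>2"
    and lip: "\<And>x y. \<bar>f x - f y\<bar> \<le> B * (1 + norm x + norm y) * norm (x - y)"
  shows "\<exists>\<theta>. continuous_on UNIV \<theta> \<and> (\<forall>u. \<theta> u \<in> S) \<and>
    (\<forall>u. \<forall>w\<in>S. f (u + \<theta> u) + c / 2 * (norm (w - \<theta> u))\<^sup>2 \<le> f (u + w))"
proof -
  have contf: "continuous_on UNIV f" by (rule continuous_at_imp_continuous_on) (simp add: growth_continuous[OF lip])
  have "\<exists>v\<in>S. \<forall>w\<in>S. f (u + v) + c / 2 * (norm (w - v))\<^sup>2 \<le> f (u + w)" for u
  proof -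
    have cS: "continuous_on S (\<lambda>v. f (u + v))"
      by (rule continuous_on_compose2[OF contf, where f = "\<lambda>v. u + v"]) (auto intro: continuous_intros)
    have convS: "f (u + ((1 - t) *\<^sub>R x + t *\<^sub>R y)) \<le> (1 - t) * f (u + x) + t * f (u + y)
        - c / 2 * (t * (1 - t)) * (norm (x - y))\<^sup>2" if "x \<in> S" "y \<in> S" "0 \<le> t" "t \<le> 1" for x y t
    proof -
      have "u + x - (u + y) \<in> S" using S(1) that by (simp add: subspace_diff)
      moreover have "(1 - t) *\<^sub>R (u + x) + t *\<^sub>R (u + y) = u + ((1 - t) *\<^sub>R x + t *\<^sub>R y)"
        by (simp add: algebra_simps)
      ultimately show ?thesis using sc[of "u + x" "u + y" t] that by simp
    qed
    show ?thesis
    proof (rule strongly_convex_minimum[OF S cS c convS])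
      fix v assume v: "v \<in> S" and m: "\<And>w. w \<in> S \<Longrightarrow> f (u + v) + c / 2 * (norm (w - v))\<^sup>2 \<le> f (u + w)"
      show ?thesis by (intro bexI[of _ v] ballI m v)
    qed
  qed
  then obtain \<theta> where \<theta>: "\<And>u. \<theta> u \<in> S"
    "\<And>u w. w \<in> S \<Longrightarrow> f (u + \<theta> u) + c / 2 * (norm (w - \<theta> u))\<^sup>2 \<le> f (u + w)"
    by metis
  have "isCont \<theta> u" for u
  proof -
    define R where "R = 4 * (1 + norm u + norm (\<theta> u))"
    define Q where "Q = 2 * B * R / c"
    have R: "R > 0" by (simp add: R_def add_pos_nonneg)
    have Q: "Q \<ge> 0" using B R c by (simp add: Q_def)
    have key: "(norm (\<theta> u' - \<theta> u))\<^sup>2 \<le> 2 * Q * norm (u' - u)"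
      if small: "norm (u' - u) \<le> 1" "Q * norm (u' - u) \<le> 1 / 2" for u'
    proof -
      define a b D e where "a = \<theta> u" and "b = \<theta> u'" and "D = norm (b - a)" and "e = norm (u' - u)"
      have D0: "D \<ge> 0" and e0: "e \<ge> 0" by (auto simp: D_def e_def)
      have nb: "norm b \<le> norm a + D" unfolding D_def by (rule norm_triangle_sub)
      have nu: "norm u' \<le> norm u + 1" using norm_triangle_sub[of u' u] small(1) by linarith
      have "f (u + a) + c / 2 * D\<^sup>2 \<le> f (u + b)"
        using \<theta>(2)[OF \<theta>(1)[of u'], of u] by (simp add: a_def b_def D_def)
      moreover have "f (u' + b) + c / 2 * D\<^sup>2 \<le> f (u' + a)"
        using \<theta>(2)[OF \<theta>(1)[of u], of u'] by (simp add: a_def b_def D_def norm_minus_commute)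
      moreover have "\<bar>f (u + b) - f (u' + b)\<bar> \<le> B * (1 + norm (u + b) + norm (u' + b)) * e"
        using lip[of "u + b" "u' + b"] by (simp add: e_def norm_minus_commute)
      moreover have "\<bar>f (u' + a) - f (u + a)\<bar> \<le> B * (1 + norm (u' + a) + norm (u + a)) * e"
        using lip[of "u' + a" "u + a"] by (simp add: e_def)
      ultimately have "c * D\<^sup>2 \<le> B * (1 + norm (u + b) + norm (u' + b)) * e
          + B * (1 + norm (u' + a) + norm (u + a)) * e"
        by (simp add: abs_le_iff)
      also have "\<dots> = B * ((1 + norm (u + b) + norm (u' + b)) + (1 + norm (u' + a) + norm (u + a))) * e"
        by (simp add: algebra_simps)
      also have "\<dots> \<le> B * (R * (1 + D)) * e"
      proof (intro mult_right_mono mult_left_mono)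
        have "2 * D \<le> R * D"
          using D0 norm_ge_zero[of u] norm_ge_zero[of "\<theta> u"] by (intro mult_right_mono) (simp_all add: R_def)
        then show "(1 + norm (u + b) + norm (u' + b)) + (1 + norm (u' + a) + norm (u + a)) \<le> R * (1 + D)"
          using norm_triangle_ineq[of u b] norm_triangle_ineq[of u' b] norm_triangle_ineq[of u' a]
            norm_triangle_ineq[of u a] nb nu by (simp add: R_def a_def distrib_left)
      qed (use B e0 in auto)
      also have "\<dots> \<le> B * (R * (2 * (1 + D\<^sup>2))) * e"
      proof (intro mult_right_mono mult_left_mono)
        have "2 * D \<le> D\<^sup>2 + 1" using zero_le_power2[of "D - 1"] by (simp add: power2_diff)
        moreover have "1 + a \<le> 2 * (1 + b)" if "2 * a \<le> b + 1" "0 \<le> b" for a b :: real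
          using that by simp
        ultimately show "1 + D \<le> 2 * (1 + D\<^sup>2)" using zero_le_power2[of D] by blast
      qed (use B R e0 in auto)
      also have "\<dots> = c * (Q * e * (1 + D\<^sup>2))" using c by (simp add: Q_def field_simps)
      finally have "D\<^sup>2 \<le> Q * e * (1 + D\<^sup>2)" using c by (simp only: mult_le_cancel_left_pos)
      then have "D\<^sup>2 \<le> Q * e + (Q * e) * D\<^sup>2" by (simp add: distrib_left)
      moreover have "(Q * e) * D\<^sup>2 \<le> 1 / 2 * D\<^sup>2"
        using small(2) by (intro mult_right_mono) (simp_all add: e_def)
      ultimately show ?thesis by (simp add: D_def a_def b_def e_def)
    qed
    show ?thesis
      unfolding isCont_def
    proof (rule Lim_null_comparison[THEN LIM_zero_cancel])
      have "((\<lambda>u'. norm (u' - u)) \<longlongrightarrow> norm (u - u)) (at u)"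
        by (intro tendsto_intros)
      then have "\<forall>\<^sub>F u' in at u. norm (u' - u) < 1" by (rule order_tendstoD(2)) simp
      moreover have "((\<lambda>u'. Q * norm (u' - u)) \<longlongrightarrow> Q * norm (u - u)) (at u)"
        by (intro tendsto_intros)
      then have "\<forall>\<^sub>F u' in at u. Q * norm (u' - u) < 1 / 2" by (rule order_tendstoD(2)) simp
      ultimately
      show "\<forall>\<^sub>F u' in at u. norm (\<theta> u' - \<theta> u) \<le> sqrt (2 * Q * norm (u' - u))"
        by eventually_elim (intro real_le_rsqrt key, auto)
      have "((\<lambda>u'. sqrt (2 * Q * norm (u' - u))) \<longlongrightarrow> sqrt (2 * Q * norm (u - u))) (at u)"
        by (intro tendsto_intros)
      then show "((\<lambda>u'. sqrt (2 * Q * norm (u' - u))) \<longlongrightarrow> 0) (at u)" by simp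
    qed
  qed
  then have "continuous_on UNIV \<theta>" by (simp add: continuous_at_imp_continuous_on)
  then show ?thesis by (intro exI[of _ \<theta>] conjI allI ballI \<theta>)
qed

section \<open>Critical points in the sense of Clarke\<close>

text \<open>Convexity along \<open>h\<close> bounds the quotient at a base point \<open>y\<close> by \<open>f (y + h) - f y\<close>, independently of the
  step length, and this is close to \<open>f (x + h) - f x\<close> for \<open>y\<close> near \<open>x\<close>.\<close>

lemma clarke_deriv_descent:
  fixes f :: "'a::real_normed_vector \<Rightarrow> real"
  assumes X: "x \<in> X" and f: "isCont f x" "isCont f (x + h)" and h: "f (x + h) < f x"
    and conv: "\<And>y t. 0 \<le> t \<Longrightarrow> t \<le> 1 \<Longrightarrow> f (y + t *\<^sub>R h) \<le> (1 - t) * f y + t * f (y + h)"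
  shows "clarke_deriv X f x h < 0"
proof -
  define s where "s = (f (x + h) - f x) / 2"
  have s: "s < 0" using h by (simp add: s_def)
  have "((\<lambda>y. f (y + h) - f y) \<longlongrightarrow> f (x + h) - f x) (nhds x)"
  proof (rule tendsto_diff)
    have "isCont (\<lambda>y. f (y + h)) x"
      by (rule isCont_o2[where g = f and f = "\<lambda>y. y + h"]) (use f in \<open>auto intro: continuous_intros\<close>)
    then show "((\<lambda>y. f (y + h)) \<longlongrightarrow> f (x + h)) (nhds x)"
      unfolding isCont_def by (rule tendsto_at_iff_tendsto_nhds[THEN iffD1])
    show "(f \<longlongrightarrow> f x) (nhds x)"
      using f(1) unfolding isCont_def by (rule tendsto_at_iff_tendsto_nhds[THEN iffD1])
  qed
  moreover have "f (x + h) - f x < s" using h by (simp add: s_def)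
  ultimately have "\<forall>\<^sub>F y in nhds x. f (y + h) - f y < s" by (rule order_tendstoD(2))
  then have 1: "\<forall>\<^sub>F y in inf (nhds x) (principal X). f (y + h) - f y < s"
    by (rule filter_leD[OF inf_le1])
  have 2: "\<forall>\<^sub>F t in at_right (0::real). 0 < t \<and> t < 1"
    by (rule eventually_at_right_real[OF zero_less_one, simplified])
  have "clarke_deriv X f x h \<le> ereal s"
    unfolding clarke_deriv_def
  proof (rule Limsup_bounded, rule eventually_mono[OF eventually_prodI[OF 1 2]])
    fix p :: "'a \<times> real"
    assume p: "f (fst p + h) - f (fst p) < s \<and> 0 < snd p \<and> snd p < 1"
    then have "f (fst p + snd p *\<^sub>R h) - f (fst p) \<le> snd p * (f (fst p + h) - f (fst p))"
      using conv[of "snd p" "fst p"] by (simp add: algebra_simps)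
    also have "\<dots> \<le> snd p * s" using p by (intro mult_left_mono) auto
    finally have "(f (fst p + snd p *\<^sub>R h) - f (fst p)) / snd p \<le> s"
      using p by (simp add: pos_divide_le_eq mult.commute)
    then show "(case p of (x', t) \<Rightarrow> ereal ((f (x' + t *\<^sub>R h) - f x') / t)) \<le> ereal s"
      by (simp add: case_prod_beta)
  qed
  also have "ereal s < 0" using s by simp
  finally show ?thesis .
qed

text \<open>A subgradient of the restriction of \<open>f\<close> to \<open>Y\<close> has to be extended to a subgradient on \<open>X\<close>. The
  increment of \<open>f\<close> plus \<open>\<Lambda> / 2 * (norm (T h))\<^sup>2\<close> is convex on \<open>X\<close> and nonnegative on \<open>Y\<close>, and the
  added term disappears in the derivative.\<close>

lemma minimiser_clarke_critical:
  fixes f :: "'a::real_normed_vector \<Rightarrow> real" and T :: "'a \<Rightarrow> 'b::real_normed_vector"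
  assumes X: "subspace X" and Y: "subspace Y" "Y \<subseteq> X" and x: "x \<in> X"
    and T: "bounded_linear T" and \<Lambda>: "\<Lambda> \<ge> 0"
    and conv: "\<And>a b t. 0 \<le> t \<Longrightarrow> t \<le> 1 \<Longrightarrow>
      f ((1 - t) *\<^sub>R a + t *\<^sub>R b) \<le> (1 - t) * f a + t * f b + \<Lambda> / 2 * (t * (1 - t)) * (norm (T (a - b)))\<^sup>2"
    and quad: "\<And>a b t. (norm (T ((1 - t) *\<^sub>R a + t *\<^sub>R b)))\<^sup>2
      = (1 - t) * (norm (T a))\<^sup>2 + t * (norm (T b))\<^sup>2 - t * (1 - t) * (norm (T (a - b)))\<^sup>2"
    and bdd: "\<And>h. norm h \<le> 1 \<Longrightarrow> f (x + h) \<le> f x + B"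
    and min: "\<And>y. y \<in> Y \<Longrightarrow> f x \<le> f (x + y)"
  obtains \<xi> where "\<xi> \<in> clarke_subdiff X f x" "\<And>y. y \<in> Y \<Longrightarrow> \<xi> y = 0"
proof -
  interpret T: bounded_linear T by (rule T)
  define P where "P h = f (x + h) - f x + \<Lambda> / 2 * (norm (T h))\<^sup>2" for h
  have Pconv: "P ((1 - t) *\<^sub>R a + t *\<^sub>R b) \<le> (1 - t) * P a + t * P b" if t: "0 \<le> t" "t \<le> 1" for a b t
  proof -
    have e: "x + ((1 - t) *\<^sub>R a + t *\<^sub>R b) = (1 - t) *\<^sub>R (x + a) + t *\<^sub>R (x + b)" by (simp add: algebra_simps)
    have "f (x + ((1 - t) *\<^sub>R a + t *\<^sub>R b)) \<le> (1 - t) * f (x + a) + t * f (x + b)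
        + \<Lambda> / 2 * (t * (1 - t)) * (norm (T (a - b)))\<^sup>2"
      unfolding e using conv[OF t, of "x + a" "x + b"] by simp
    moreover have "p - q + \<Lambda> / 2 * ((1 - t) * u + t * v - t * (1 - t) * w)
        \<le> (1 - t) * (r - q + \<Lambda> / 2 * u) + t * (s - q + \<Lambda> / 2 * v)"
      if "p \<le> (1 - t) * r + t * s + \<Lambda> / 2 * (t * (1 - t)) * w" for p q r s u v w :: real
      using that by (simp add: field_simps)
    ultimately show ?thesis unfolding P_def quad by blast
  qed
  obtain \<xi> where \<xi>: "\<And>a b. a \<in> X \<Longrightarrow> b \<in> X \<Longrightarrow> \<xi> (a + b) = \<xi> a + \<xi> b"
    "\<And>r a. a \<in> X \<Longrightarrow> \<xi> (r *\<^sub>R a) = r * \<xi> a"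
    "\<And>y. y \<in> Y \<Longrightarrow> \<xi> y = 0" "\<And>a. a \<in> X \<Longrightarrow> \<xi> a \<le> P a"
  proof (rule convex_linear_minorant[OF X Y])
    show "P ((1 - t) *\<^sub>R a + t *\<^sub>R b) \<le> (1 - t) * P a + t * P b" if "0 \<le> t" "t \<le> 1" for a b t
      by (rule Pconv[OF that])
    show "0 \<le> P y" if "y \<in> Y" for y using min[OF that] \<Lambda> by (simp add: P_def)
  qed (use that in blast)
  obtain K where K: "\<And>h. norm (T h) \<le> norm h * K" "K \<ge> 0" using T.nonneg_bounded by blast
  define M where "M = B + \<Lambda> / 2 * K\<^sup>2"
  have up: "\<xi> h \<le> M * norm h" if h: "h \<in> X" for h
  proof (cases "h = 0")
    case True
    then show ?thesis using \<xi>(2)[OF h, of 0] by simp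
  next
    case False
    define g where "g = (1 / norm h) *\<^sub>R h"
    have g: "norm g = 1" "g \<in> X" using False h X by (auto simp: g_def subspace_scale)
    have "\<xi> g \<le> P g" by (rule \<xi>(4)[OF g(2)])
    also have "\<dots> \<le> B + \<Lambda> / 2 * K\<^sup>2"
    proof -
      have "(norm (T g))\<^sup>2 \<le> K\<^sup>2" using K(1)[of g] g by (intro power_mono) auto
      then have "\<Lambda> / 2 * (norm (T g))\<^sup>2 \<le> \<Lambda> / 2 * K\<^sup>2" using \<Lambda> by (intro mult_left_mono) auto
      then show ?thesis using bdd[of g] g by (simp add: P_def)
    qed
    finally have "norm h * \<xi> g \<le> norm h * M" unfolding M_def by (intro mult_left_mono) auto
    also have "norm h * \<xi> g = \<xi> h" using \<xi>(2)[OF g(2), of "norm h"] False by (simp add: g_def)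
    finally show ?thesis by (simp add: mult.commute)
  qed
  have bound: "\<bar>\<xi> h\<bar> \<le> M * norm h" if h: "h \<in> X" for h
    using up[OF h] up[of "- h"] \<xi>(2)[OF h, of "-1"] h X by (simp add: subspace_neg abs_le_iff)
  have dual: "restrict \<xi> X \<in> dual X"
    unfolding dual_def using \<xi>(1,2) bound X
    by (auto simp: subspace_add subspace_scale intro!: exI[of _ M])
  have "ereal (\<xi> h) \<le> clarke_deriv X f x h" if h: "h \<in> X" for h
  proof (rule clarke_deriv_ge[where \<gamma> = "\<lambda>_. x" and \<psi> = "\<lambda>t. \<xi> h - \<Lambda> / 2 * t * (norm (T h))\<^sup>2"])
    show "\<forall>\<^sub>F t in at_right 0. \<xi> h - \<Lambda> / 2 * t * (norm (T h))\<^sup>2 \<le> (f (x + t *\<^sub>R h) - f x) / t"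
      using eventually_at_right_less[of "0::real"]
    proof eventually_elim
      case (elim t)
      have "t * \<xi> h \<le> P (t *\<^sub>R h)" using \<xi>(2)[OF h, of t] \<xi>(4)[of "t *\<^sub>R h"] h X by (simp add: subspace_scale)
      also have "\<dots> = f (x + t *\<^sub>R h) - f x + t * (\<Lambda> / 2 * t * (norm (T h))\<^sup>2)"
        by (simp add: P_def T.scaleR power_mult_distrib power2_eq_square)
      finally have "(\<xi> h - \<Lambda> / 2 * t * (norm (T h))\<^sup>2) * t \<le> f (x + t *\<^sub>R h) - f x"
        by (simp add: algebra_simps)
      then show ?case using elim by (subst pos_le_divide_eq)
    qed
    have "((\<lambda>t. \<xi> h - \<Lambda> / 2 * t * (norm (T h))\<^sup>2) \<longlongrightarrow> \<xi> h - \<Lambda> / 2 * 0 * (norm (T h))\<^sup>2) (at_right 0)"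
      by (intro tendsto_intros)
    then show "((\<lambda>t. \<xi> h - \<Lambda> / 2 * t * (norm (T h))\<^sup>2) \<longlongrightarrow> \<xi> h) (at_right 0)" by simp
  qed (use x in auto)
  then have "restrict \<xi> X \<in> clarke_subdiff X f x" using dual by (simp add: clarke_subdiff_def)
  moreover have "restrict \<xi> X y = 0" if "y \<in> Y" for y using \<xi>(3) that Y by auto
  ultimately show ?thesis using that by blast
qed

section \<open>The energy functional\<close>

lemma norm_sq_convex_combination:
  fixes a b :: "'a::real_inner"
  shows "(norm ((1 - t) *\<^sub>R a + t *\<^sub>R b))\<^sup>2
    = (1 - t) * (norm a)\<^sup>2 + t * (norm b)\<^sup>2 - t * (1 - t) * (norm (a - b))\<^sup>2"
  unfolding power2_norm_eq_inner
  by (simp add: inner_add_left inner_add_right inner_diff_left inner_diff_right inner_commute[of b a]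
      algebra_simps)

context semiconcave_nonlinearity
begin

lemma energy_eq:
  "energy Z j \<mu> x = 1 / 2 * (norm (snd x))\<^sup>2 - \<mu> / 2 * (norm (fst x))\<^sup>2 - J (fst x)"
  by (simp add: energy_def J_def)

text \<open>The squared norms contribute exactly, the integral by semiconcavity.\<close>

lemma energy_convexity:
  assumes t: "0 \<le> t" "t \<le> 1"
  shows "energy Z j \<mu> ((1 - t) *\<^sub>R x + t *\<^sub>R y) \<le> (1 - t) * energy Z j \<mu> x + t * energy Z j \<mu> y
    - 1 / 2 * (t * (1 - t)) * ((norm (snd (x - y)))\<^sup>2 - \<mu> * (norm (fst (x - y)))\<^sup>2
        - (\<integral>z. l z * (rep_L2 (fst (x - y)) z)\<^sup>2 \<partial>lebesgue_on Z))"
proof -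
  let ?m = "(1 - t) *\<^sub>R x + t *\<^sub>R y"
  have m: "fst ?m = (1 - t) *\<^sub>R fst x + t *\<^sub>R fst y" "snd ?m = (1 - t) *\<^sub>R snd x + t *\<^sub>R snd y" by simp_all
  have "1 / 2 * ((1 - t) * sx + t * sy - t * (1 - t) * sd) - \<mu> / 2 * ((1 - t) * fx + t * fy - t * (1 - t) * fd) - jm
      \<le> (1 - t) * (1 / 2 * sx - \<mu> / 2 * fx - jx) + t * (1 / 2 * sy - \<mu> / 2 * fy - jy)
        - 1 / 2 * (t * (1 - t)) * (sd - \<mu> * fd - i)"
    if "(1 - t) * jx + t * jy - 1 / 2 * (t * (1 - t)) * i \<le> jm" for sx sy sd fx fy fd jx jy jm i :: real
    using that by (simp add: field_simps)
  from this[OF J_semiconcave[OF t, of "fst x" "fst y"]] show ?thesis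
    unfolding energy_eq m norm_sq_convex_combination fst_diff snd_diff .
qed

lemma energy_lipschitz:
  "\<exists>B\<ge>0. \<forall>x y. \<bar>energy Z j \<mu> x - energy Z j \<mu> y\<bar> \<le> B * (1 + norm x + norm y) * norm (x - y)"
proof -
  define V where "V = sqrt (measure lebesgue Z)"
  have V: "V \<ge> 0" by (simp add: V_def)
  define B where "B = 1 / 2 + \<bar>\<mu>\<bar> / 2 + \<bar>C\<bar> * (V + 1)"
  have sq: "\<bar>(norm a)\<^sup>2 - (norm b)\<^sup>2\<bar> \<le> (1 + n + m) * d"
    if "norm a \<le> n" "norm b \<le> m" "norm (a - b) \<le> d" for a b :: "'c::real_normed_vector" and n m d :: real
  proof -
    have "(norm a)\<^sup>2 - (norm b)\<^sup>2 = (norm a + norm b) * (norm a - norm b)"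
      by (simp add: power2_eq_square algebra_simps)
    then have "\<bar>(norm a)\<^sup>2 - (norm b)\<^sup>2\<bar> = (norm a + norm b) * \<bar>norm a - norm b\<bar>"
      by (simp add: abs_mult)
    also have "\<dots> \<le> (1 + n + m) * d"
    proof (rule mult_mono)
      show "norm a + norm b \<le> 1 + n + m" "\<bar>norm a - norm b\<bar> \<le> d"
        using that norm_triangle_ineq3[of a b] by linarith+
      show "0 \<le> 1 + n + m" using that norm_ge_zero[of a] norm_ge_zero[of b] by linarith
    qed simp
    finally show ?thesis .
  qed
  have "\<bar>energy Z j \<mu> x - energy Z j \<mu> y\<bar> \<le> B * (1 + norm x + norm y) * norm (x - y)" for x y
  proof -
    let ?W = "(1 + norm x + norm y) * norm (x - y)"
    have n: "norm (fst v) \<le> norm v" "norm (snd v) \<le> norm v" for v :: "'a H1"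
      using norm_fst_le[of "fst v" "snd v"] norm_snd_le[of "snd v" "fst v"] by simp_all
    have d: "norm (fst x - fst y) \<le> norm (x - y)" "norm (snd x - snd y) \<le> norm (x - y)"
      using n[of "x - y"] by simp_all
    have 1: "\<bar>(norm (snd x))\<^sup>2 - (norm (snd y))\<^sup>2\<bar> \<le> ?W" by (intro sq n d)
    have 2: "\<bar>(norm (fst x))\<^sup>2 - (norm (fst y))\<^sup>2\<bar> \<le> ?W" by (intro sq n d)
    have 3: "\<bar>J (fst x) - J (fst y)\<bar> \<le> (\<bar>C\<bar> * (V + 1)) * ?W"
    proof -
      have "\<bar>J (fst x) - J (fst y)\<bar>
          \<le> \<bar>C\<bar> * (V + norm (fst x) + norm (fst y)) * norm (fst x - fst y)"
        unfolding V_def by (rule J_lipschitz)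
      also have "\<dots> \<le> \<bar>C\<bar> * ((V + 1) * (1 + norm x + norm y)) * norm (x - y)"
      proof (intro mult_mono mult_left_mono d)
        have "0 \<le> V * norm x" "0 \<le> V * norm y" using V by simp_all
        then show "V + norm (fst x) + norm (fst y) \<le> (V + 1) * (1 + norm x + norm y)"
          using n[of x] n[of y] by (simp add: algebra_simps)
      qed (use V in auto)
      finally show ?thesis by (simp add: mult.assoc)
    qed
    have 2: "\<bar>\<mu> / 2 * ((norm (fst x))\<^sup>2 - (norm (fst y))\<^sup>2)\<bar> \<le> \<bar>\<mu>\<bar> / 2 * ?W"
      unfolding abs_mult using 2 by (intro mult_mono) auto
    have "energy Z j \<mu> x - energy Z j \<mu> y = 1 / 2 * ((norm (snd x))\<^sup>2 - (norm (snd y))\<^sup>2)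
        - \<mu> / 2 * ((norm (fst x))\<^sup>2 - (norm (fst y))\<^sup>2) - (J (fst x) - J (fst y))"
      by (simp add: energy_eq algebra_simps)
    then have "\<bar>energy Z j \<mu> x - energy Z j \<mu> y\<bar> \<le> 1 / 2 * ?W + \<bar>\<mu>\<bar> / 2 * ?W + (\<bar>C\<bar> * (V + 1)) * ?W"
    proof (elim ssubst)
      show "\<bar>1 / 2 * ((norm (snd x))\<^sup>2 - (norm (snd y))\<^sup>2) - \<mu> / 2 * ((norm (fst x))\<^sup>2 - (norm (fst y))\<^sup>2)
          - (J (fst x) - J (fst y))\<bar> \<le> 1 / 2 * ?W + \<bar>\<mu>\<bar> / 2 * ?W + (\<bar>C\<bar> * (V + 1)) * ?W"
      proof (rule order_trans[OF abs_triangle_ineq4 add_mono[OF order_trans[OF abs_triangle_ineq4 add_mono[OF _ 2]] 3]])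
        show "\<bar>1 / 2 * ((norm (snd x))\<^sup>2 - (norm (snd y))\<^sup>2)\<bar> \<le> 1 / 2 * ?W"
          unfolding abs_mult using 1 by simp
      qed
    qed
    also have "\<dots> = B * (1 + norm x + norm y) * norm (x - y)" unfolding B_def by (simp only: distrib_right mult.assoc)
    finally show ?thesis .
  qed
  moreover have "B \<ge> 0" using V by (simp add: B_def)
  ultimately show ?thesis by blast
qed

end

lemma locally_lipschitz_continuous: "locally_lipschitz f \<Longrightarrow> continuous_on UNIV f"
proof (rule continuous_at_imp_continuous_on, rule ballI)
  fix x assume "locally_lipschitz f"
  then obtain r L where r: "r > 0" "L-lipschitz_on (ball x r) f"
    unfolding locally_lipschitz_def by meson
  have "continuous_on (ball x r) f" by (rule lipschitz_on_continuous_on[OF r(2)])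
  then show "isCont f x" using r(1) by (simp add: continuous_on_eq_continuous_at)
qed

text \<open>With \<open>\<delta> = lam (k + 1) - lam k - l\<close> on \<open>Z\<close> this is the form of \<open>coercive_with_weight\<close>, because
  functions in \<open>H\<^sup>1\<^sub>0\<close> vanish outside of \<open>Z\<close>.\<close>

lemma (in semiconcave_nonlinearity) energy_form_coercive:
  assumes Zo: "open Z" "connected Z" "bounded Z"
    and lam: "strict_mono_on {1..} lam" "lam ` {1..} = eigenvalues Z" and k: "1 \<le> k"
    and le: "AE z in lebesgue_on Z. l z \<le> lam (k + 1) - lam k"
    and pos: "emeasure (lebesgue_on Z) {z \<in> Z. l z < lam (k + 1) - lam k} > 0"
  shows "\<exists>c>0. \<forall>v\<in>H_hat Z lam k. c * (norm v)\<^sup>2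
    \<le> (norm (snd v))\<^sup>2 - lam k * (norm (fst v))\<^sup>2 - (\<integral>z. l z * (fun_of v z)\<^sup>2 \<partial>lebesgue_on Z)"
proof -
  define d where "d = lam (k + 1) - lam k"
  define D where "D = \<bar>d\<bar> + \<bar>L\<bar> + 1"
  \<comment> \<open>The truncation turns the almost everywhere bounds of \<open>l\<close> into bounds at every point.\<close>
  define \<delta> where "\<delta> z = (if z \<in> Z then max 0 (min D (d - l z)) else 0)" for z
  define A where "A = {z \<in> Z. l z < d}"
  have D: "D > 0" by (simp add: D_def add_nonneg_pos)
  have \<delta>m: "\<delta> \<in> borel_measurable lebesgue"
    unfolding \<delta>_def by (rule borel_measurable_if_I) (use Z_sets in auto)
  have \<delta>b: "0 \<le> \<delta> z \<and> \<delta> z \<le> D" for z using D by (auto simp: \<delta>_def)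
  have "A = {z \<in> space (lebesgue_on Z). l z < d}" by (simp add: A_def space_restrict_space)
  also have "\<dots> \<in> sets (lebesgue_on Z)" by measurable
  finally have As: "A \<in> sets (lebesgue_on Z)" .
  then have A: "A \<in> sets lebesgue" "A \<subseteq> Z"
    using Z_sets by (auto simp: sets_restrict_space_iff)
  have "emeasure lebesgue A = emeasure (lebesgue_on Z) A"
    using Z_sets A(2) by (simp add: emeasure_restrict_space)
  then have Ap: "emeasure lebesgue A \<noteq> 0" using pos by (simp add: A_def d_def)
  have \<delta>p: "\<delta> z > 0" if "z \<in> A" for z using that D by (auto simp: \<delta>_def A_def)
  have form: "(\<integral>z. l z * (fun_of v z)\<^sup>2 \<partial>lebesgue_on Z) + (norm (weight \<delta> (fst v)))\<^sup>2 = d * (norm (fst v))\<^sup>2"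
    if v: "v \<in> H10 Z" for v
  proof -
    have i1: "integrable lebesgue (\<lambda>z. indicator Z z *\<^sub>R (l z * (fun_of v z)\<^sup>2))"
      using l_integrable[of "fst v"] Z_sets by (simp add: integrable_restrict_space)
    have i2: "integrable lebesgue (\<lambda>z. \<delta> z * (fun_of v z)\<^sup>2)" by (rule weight_integrable[OF \<delta>m \<delta>b])
    have "(\<integral>z. l z * (fun_of v z)\<^sup>2 \<partial>lebesgue_on Z) + (norm (weight \<delta> (fst v)))\<^sup>2
        = (\<integral>z. indicator Z z *\<^sub>R (l z * (fun_of v z)\<^sup>2) + \<delta> z * (fun_of v z)\<^sup>2 \<partial>lebesgue)"
      using Z_sets by (simp add: norm_weight[OF \<delta>m \<delta>b] integral_restrict_space
          Bochner_Integration.integral_add[OF i1 i2] del: real_scaleR_def)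
    also have "\<dots> = (\<integral>z. d * (fun_of v z)\<^sup>2 \<partial>lebesgue)"
    proof (rule integral_cong_AE)
      have "AE z in lebesgue. z \<in> Z \<longrightarrow> l z \<le> d" "AE z in lebesgue. z \<in> Z \<longrightarrow> \<bar>l z\<bar> \<le> L"
        using le l_bound Z_sets by (simp_all add: AE_restrict_space_iff d_def)
      then show "AE z in lebesgue. indicator Z z *\<^sub>R (l z * (fun_of v z)\<^sup>2) + \<delta> z * (fun_of v z)\<^sup>2
          = d * (fun_of v z)\<^sup>2"
        using H10_zero_outside[OF Z_sets v]
      proof eventually_elim
        case (elim z)
        show ?case
        proof (cases "z \<in> Z")
          case True
          then have "\<delta> z = d - l z" using elim by (auto simp: \<delta>_def D_def)
          then show ?thesis using True by (simp add: left_diff_distrib)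
        next
          case False
          then show ?thesis using elim by simp
        qed
      qed
    qed (use borel_measurable_integrable[OF i1] borel_measurable_integrable[OF i2] in \<open>auto intro!: borel_measurable_add\<close>)
    also have "\<dots> = d * (norm (fst v))\<^sup>2" by (simp add: norm_L2_eq)
    finally show ?thesis .
  qed
  have hat: "H_hat Z lam k \<subseteq> H10 Z"
    unfolding H_hat_def
    by (intro closure_minimal closed_H10 span_minimal subspace_H10 UN_least eigenspace_subset_H10)
  show ?thesis
  proof (rule coercive_with_weight[OF Zo lam k \<delta>m \<delta>b A Ap \<delta>p])
    fix c :: real
    assume c: "c > 0" "\<And>v. v \<in> H_hat Z lam k \<Longrightarrow> c * (norm v)\<^sup>2
      \<le> (norm (snd v))\<^sup>2 - lam (k + 1) * (norm (fst v))\<^sup>2 + (norm (weight \<delta> (fst v)))\<^sup>2"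
    show ?thesis
    proof (intro exI[of _ c] conjI ballI c(1))
      fix v assume v: "v \<in> H_hat Z lam k"
      show "c * (norm v)\<^sup>2
        \<le> (norm (snd v))\<^sup>2 - lam k * (norm (fst v))\<^sup>2 - (\<integral>z. l z * (fun_of v z)\<^sup>2 \<partial>lebesgue_on Z)"
        using c(2)[OF v] form[OF subsetD[OF hat v]] unfolding d_def left_diff_distrib by linarith
    qed
  qed
qed

section \<open>Reduction to the lower eigenspaces\<close>

theorem proposition3p3:
  fixes Z :: "(real ^ 'n) set"
    and lam :: "nat \<Rightarrow> real"
    and k :: nat
    and j :: "real ^ 'n \<Rightarrow> real \<Rightarrow> real"
  assumes domain: "bounded_C2_domain Z"
    and lam_increasing: "strict_mono_on {1..} lam"
    and lam_eigenvalues: "lam ` {1..} = eigenvalues Z"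
    and k: "1 \<le> k"
    and i_measurable: "\<forall>\<zeta>. (\<lambda>z. j z \<zeta>) \<in> borel_measurable (lebesgue_on Z)"
    and i_zero: "AE z in lebesgue_on Z. j z 0 = 0"
    and ii: "AE z in lebesgue_on Z. locally_lipschitz (j z)"
    and iii: "\<exists>a1 c1 r. a1 \<in> Linf Z \<and> c1 > 0 \<and> 1 \<le> r \<and> ereal r < crit_exp CARD('n) \<and>
      (AE z in lebesgue_on Z. \<forall>\<zeta>. \<forall>u \<in> clarke_subdiff_real (j z) \<zeta>.
        \<bar>u\<bar> \<le> a1 z + c1 * abs_pow \<zeta> (r - 1))"
    and iv: "\<forall>\<eta>>0. \<exists>M>0. AE z in lebesgue_on Z. \<forall>\<zeta>. \<bar>\<zeta>\<bar> \<ge> M \<longrightarrow>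
      (\<forall>u \<in> clarke_subdiff_real (j z) \<zeta>. u * \<zeta> - 2 * j z \<zeta> \<le> - \<eta>)"
    and v: "\<exists>l \<in> Linf Z.
      (AE z in lebesgue_on Z. l z \<le> lam (k + 1) - lam k) \<and>
      emeasure (lebesgue_on Z) {z \<in> Z. l z < lam (k + 1) - lam k} > 0 \<and>
      (AE z in lebesgue_on Z. \<forall>\<zeta>1 \<zeta>2. \<zeta>1 \<noteq> \<zeta>2 \<longrightarrow>
        (\<forall>v1 \<in> clarke_subdiff_real (j z) \<zeta>1. \<forall>v2 \<in> clarke_subdiff_real (j z) \<zeta>2.
          (v1 - v2) / (\<zeta>1 - \<zeta>2) \<le> l z))"
    and vi: "\<exists>m \<in> {1..k}. \<exists>\<beta> \<in> Linf Z. \<exists>\<delta>0>0.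
      (AE z in lebesgue_on Z. \<beta> z \<le> 0) \<and>
      (AE z in lebesgue_on Z. \<beta> z \<le> lam m - lam k) \<and>
      emeasure (lebesgue_on Z) {z \<in> Z. \<beta> z < lam m - lam k} > 0 \<and>
      (AE z in lebesgue_on Z. \<forall>\<zeta>. 0 < \<bar>\<zeta>\<bar> \<and> \<bar>\<zeta>\<bar> \<le> \<delta>0 \<longrightarrow>
        (m = 1 \<or> lam (m - 1) - lam k \<le> 2 * j z \<zeta> / \<zeta>\<^sup>2) \<and>
        2 * j z \<zeta> / \<zeta>\<^sup>2 \<le> \<beta> z)"
    and vii: "\<exists>\<gamma> \<in> Linf Z.
      (AE z in lebesgue_on Z. \<gamma> z \<ge> 0) \<and>
      (AE z in lebesgue_on Z. \<gamma> z \<le> lam (k + 1) - lam k) \<and>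
      emeasure (lebesgue_on Z) {z \<in> Z. \<gamma> z < lam (k + 1) - lam k} > 0 \<and>
      (\<forall>\<epsilon>>0. \<exists>M>0. AE z in lebesgue_on Z. \<forall>\<zeta>. \<bar>\<zeta>\<bar> \<ge> M \<longrightarrow>
        - \<epsilon> \<le> 2 * j z \<zeta> / \<zeta>\<^sup>2 \<and> 2 * j z \<zeta> / \<zeta>\<^sup>2 \<le> \<gamma> z + \<epsilon>)"
  shows "\<exists>\<theta>. \<theta> \<in> H_bar Z lam k \<rightarrow> H_hat Z lam k \<and>
    continuous_on (H_bar Z lam k) \<theta> \<and>
    (\<forall>u \<in> H_bar Z lam k.
      (INF v \<in> H_hat Z lam k. ereal (energy Z j (lam k) (u + v)))
        = ereal (energy Z j (lam k) (u + \<theta> u)) \<and>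
      (\<forall>v \<in> H_hat Z lam k.
        (\<lambda>w \<in> H_hat Z lam k. 0)
            \<in> (\<lambda>\<xi>. restrict \<xi> (H_hat Z lam k)) `
                clarke_subdiff (H10 Z) (energy Z j (lam k)) (u + v)
          \<longleftrightarrow> v = \<theta> u))"
proof -
  define S where "S = H_hat Z lam k"
  define E where "E = energy Z j (lam k)"
  have Zo: "open Z" "connected Z" "bounded Z" using domain by (simp_all add: bounded_C2_domain_def)
  have Zl: "Z \<in> lmeasurable" using Zo by (simp add: lmeasurable_open)
  obtain l where l: "l \<in> Linf Z" and l_le: "AE z in lebesgue_on Z. l z \<le> lam (k + 1) - lam k"
    and l_pos: "emeasure (lebesgue_on Z) {z \<in> Z. l z < lam (k + 1) - lam k} > 0"
    and l_mono: "AE z in lebesgue_on Z. \<forall>\<zeta>1 \<zeta>2. \<zeta>1 \<noteq> \<zeta>2 \<longrightarrow>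
        (\<forall>v1 \<in> clarke_subdiff_real (j z) \<zeta>1. \<forall>v2 \<in> clarke_subdiff_real (j z) \<zeta>2.
          (v1 - v2) / (\<zeta>1 - \<zeta>2) \<le> l z)"
    using v by (elim bexE conjE)
  obtain L where lm: "l \<in> borel_measurable (lebesgue_on Z)" and L: "AE z in lebesgue_on Z. \<bar>l z\<bar> \<le> L"
    using l by (auto simp: Linf_def)
  obtain \<gamma> where \<gamma>: "\<gamma> \<in> Linf Z" and \<gamma>_lim: "\<forall>\<epsilon>>0. \<exists>M>0. AE z in lebesgue_on Z. \<forall>\<zeta>. \<bar>\<zeta>\<bar> \<ge> M \<longrightarrow>
        - \<epsilon> \<le> 2 * j z \<zeta> / \<zeta>\<^sup>2 \<and> 2 * j z \<zeta> / \<zeta>\<^sup>2 \<le> \<gamma> z + \<epsilon>"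
    using vii by (elim bexE conjE)
  obtain \<Gamma> where \<Gamma>: "AE z in lebesgue_on Z. \<bar>\<gamma> z\<bar> \<le> \<Gamma>" using \<gamma> by (auto simp: Linf_def)
  obtain M where M: "M > 0" and \<gamma>_M: "AE z in lebesgue_on Z. \<forall>\<zeta>. \<bar>\<zeta>\<bar> \<ge> M \<longrightarrow>
        - 1 \<le> 2 * j z \<zeta> / \<zeta>\<^sup>2 \<and> 2 * j z \<zeta> / \<zeta>\<^sup>2 \<le> \<gamma> z + 1"
    using \<gamma>_lim[rule_format, OF zero_less_one] by (elim exE conjE)
  \<comment> \<open>The limits at infinity are used with \<open>\<epsilon> = 1\<close>, to get \<open>\<bar>j z \<zeta>\<bar> \<le> G * \<zeta>\<^sup>2\<close> for \<open>\<bar>\<zeta>\<bar> \<ge> M\<close>.\<close>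
  define G where "G = (\<bar>\<Gamma>\<bar> + 1) / 2"
  define K where "K = G + 2 * G * M\<^sup>2 + 4 * L * M\<^sup>2"
  have cont: "AE z in lebesgue_on Z. continuous_on UNIV (j z)"
    using ii by eventually_elim (rule locally_lipschitz_continuous)
  have semi: "AE z in lebesgue_on Z. semiconcave (l z) (j z)"
    using cont l_mono
  proof eventually_elim
    case (elim z)
    show ?case by (rule semiconcave_clarke[OF elim(1)]) (use elim(2) in simp)
  qed
  have growth: "AE z in lebesgue_on Z. \<forall>\<zeta>. \<bar>j z \<zeta>\<bar> \<le> K * (1 + \<zeta>\<^sup>2)"
    using semi L i_zero \<Gamma> \<gamma>_M
  proof eventually_elim
    case (elim z)
    have "\<bar>j z \<zeta>\<bar> \<le> G * \<zeta>\<^sup>2" if "\<bar>\<zeta>\<bar> \<ge> M" for \<zeta>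
    proof -
      have z: "\<zeta>\<^sup>2 > 0" using that M by auto
      have "\<bar>2 * j z \<zeta> / \<zeta>\<^sup>2\<bar> \<le> \<bar>\<Gamma>\<bar> + 1"
        using elim(5)[rule_format, OF that] elim(4) by linarith
      then have "2 * \<bar>j z \<zeta>\<bar> \<le> (\<bar>\<Gamma>\<bar> + 1) * \<zeta>\<^sup>2"
        using z by (simp add: abs_mult pos_divide_le_eq)
      then show ?thesis by (simp add: G_def)
    qed
    then show ?case
      unfolding K_def by (intro allI semiconcave_quadratic_growth[OF elim(1-3) M])
  qed
  have lip: "AE z in lebesgue_on Z. \<forall>a b. \<bar>j z a - j z b\<bar> \<le> (7 * K + L) * (1 + \<bar>a\<bar> + \<bar>b\<bar>) * \<bar>a - b\<bar>"
    using semi L growth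
    by eventually_elim (intro allI semiconcave_lipschitz, auto)
  interpret semiconcave_nonlinearity Z j l K "7 * K + L" L
    by unfold_locales (use Zl i_measurable lm L cont growth lip semi in auto)
  obtain B where B0: "B \<ge> 0" and "\<forall>x y. \<bar>E x - E y\<bar> \<le> B * (1 + norm x + norm y) * norm (x - y)"
    using energy_lipschitz[of "lam k"] unfolding E_def by (elim exE conjE)
  then have B: "B \<ge> 0" "\<And>x y. \<bar>E x - E y\<bar> \<le> B * (1 + norm x + norm y) * norm (x - y)" by auto
  obtain c where c: "c > 0" and coercive: "\<forall>v\<in>S. c * (norm v)\<^sup>2
    \<le> (norm (snd v))\<^sup>2 - lam k * (norm (fst v))\<^sup>2 - (\<integral>z. l z * (fun_of v z)\<^sup>2 \<partial>lebesgue_on Z)"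
    using energy_form_coercive[OF Zo lam_increasing lam_eigenvalues k l_le l_pos]
    unfolding S_def by (elim exE conjE)
  have S: "subspace S" "closed S" "S \<subseteq> H10 Z" and bar: "H_bar Z lam k \<subseteq> H10 Z"
    unfolding S_def H_hat_def H_bar_def
    by (intro subspace_closure_normed subspace_span closed_closure closure_minimal closed_H10
        span_minimal subspace_H10 UN_least eigenspace_subset_H10)+
  have sc: "E ((1 - t) *\<^sub>R x + t *\<^sub>R y) \<le> (1 - t) * E x + t * E y - c / 2 * (t * (1 - t)) * (norm (x - y))\<^sup>2"
    if "x - y \<in> S" "0 \<le> t" "t \<le> 1" for x y t
  proof -
    have "1 / 2 * (t * (1 - t)) * (c * (norm (x - y))\<^sup>2) \<le> 1 / 2 * (t * (1 - t)) * ((norm (snd (x - y)))\<^sup>2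
        - lam k * (norm (fst (x - y)))\<^sup>2 - (\<integral>z. l z * (fun_of (x - y) z)\<^sup>2 \<partial>lebesgue_on Z))"
      using that by (intro mult_left_mono coercive[rule_format]) auto
    moreover have "c / 2 * (t * (1 - t)) * (norm (x - y))\<^sup>2 = 1 / 2 * (t * (1 - t)) * (c * (norm (x - y))\<^sup>2)"
      by simp
    ultimately show ?thesis
      using energy_convexity[OF that(2,3), of "lam k" x y] unfolding E_def by linarith
  qed
  have "\<exists>\<theta>. continuous_on UNIV \<theta> \<and> (\<forall>u. \<theta> u \<in> S) \<and>
      (\<forall>u. \<forall>w\<in>S. E (u + \<theta> u) + c / 2 * (norm (w - \<theta> u))\<^sup>2 \<le> E (u + w))"
    by (rule fibrewise_minimiser[OF S(1,2) c B(1) sc B(2)])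
  then obtain \<theta> where \<theta>_cont: "continuous_on UNIV \<theta>" and \<theta>_S: "\<forall>u. \<theta> u \<in> S"
    and \<theta>_min: "\<forall>u. \<forall>w\<in>S. E (u + \<theta> u) + c / 2 * (norm (w - \<theta> u))\<^sup>2 \<le> E (u + w)"
    by (elim exE conjE)
  note \<theta> = \<theta>_cont \<theta>_S[rule_format] \<theta>_min[rule_format]
  have min: "E (u + \<theta> u) \<le> E (u + w)" if "w \<in> S" for u w
  proof -
    have "0 \<le> c / 2 * (norm (w - \<theta> u))\<^sup>2" using c by simp
    then show ?thesis using \<theta>(3)[OF that, of u] by linarith
  qed
  have inf: "(INF v \<in> S. ereal (E (u + v))) = ereal (E (u + \<theta> u))" for u
    by (rule antisym[OF INF_lower[OF \<theta>(2)] INF_greatest]) (use min in simp)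
  have only: "v = \<theta> u"
    if v: "v \<in> S" and u: "u \<in> H10 Z" and \<xi>: "\<xi> \<in> clarke_subdiff (H10 Z) E (u + v)"
      "restrict \<xi> S = (\<lambda>w \<in> S. 0)" for u v \<xi>
  proof (rule ccontr)
    assume ne: "v \<noteq> \<theta> u"
    define h where "h = \<theta> u - v"
    have h: "h \<in> S" unfolding h_def using S(1) \<theta>(2) v by (rule subspace_diff)
    have x: "u + v \<in> H10 Z" by (rule subspace_add[OF subspace_H10 u subsetD[OF S(3) v]])
    have "0 < c / 2 * (norm (v - \<theta> u))\<^sup>2" using c ne by simp
    then have less: "E (u + v + h) < E (u + v)" using \<theta>(3)[OF v, of u] by (simp add: h_def)
    have conv: "E (y + t *\<^sub>R h) \<le> (1 - t) * E y + t * E (y + h)" if t: "0 \<le> t" "t \<le> 1" for y t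
    proof -
      have "y - (y + h) \<in> S" using h S(1) by (simp add: subspace_neg)
      moreover have "(1 - t) *\<^sub>R y + t *\<^sub>R (y + h) = y + t *\<^sub>R h" by (simp add: algebra_simps)
      moreover have "0 \<le> c / 2 * (t * (1 - t)) * (norm (y - (y + h)))\<^sup>2" using c t by simp
      ultimately show ?thesis using sc[of y "y + h" t] t by simp
    qed
    have "clarke_deriv (H10 Z) E (u + v) h < 0"
      by (rule clarke_deriv_descent[OF x _ _ less conv]) (rule growth_continuous[OF B(2)])+
    moreover have "ereal (\<xi> h) \<le> clarke_deriv (H10 Z) E (u + v) h"
      using \<xi>(1) h S(3) by (auto simp: clarke_subdiff_def)
    moreover have "\<xi> h = 0" using fun_cong[OF \<xi>(2), of h] h by simp
    ultimately show False by (simp add: zero_ereal_def)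
  qed
  have crit: "\<exists>\<xi> \<in> clarke_subdiff (H10 Z) E (u + \<theta> u). restrict \<xi> S = (\<lambda>w \<in> S. 0)"
    if u: "u \<in> H10 Z" for u
  proof (rule minimiser_clarke_critical[OF subspace_H10 S(1,3)])
    let ?x = "u + \<theta> u"
    show "?x \<in> H10 Z" by (rule subspace_add[OF subspace_H10 u subsetD[OF S(3) \<theta>(2)]])
    show "bounded_linear (fst :: (real ^ 'n) H1 \<Rightarrow> _)" by (rule bounded_linear_fst)
    \<comment> \<open>This multiple of \<open>(norm (fst h))\<^sup>2 / 2\<close> compensates the concave part of \<open>E\<close>.\<close>
    show "0 \<le> \<bar>lam k\<bar> + \<bar>L\<bar>" by simp
    show "E ((1 - t) *\<^sub>R a + t *\<^sub>R b) \<le> (1 - t) * E a + t * E b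
        + (\<bar>lam k\<bar> + \<bar>L\<bar>) / 2 * (t * (1 - t)) * (norm (fst (a - b)))\<^sup>2" if t: "0 \<le> t" "t \<le> 1" for a b t
    proof -
      let ?n = "(norm (fst (a - b)))\<^sup>2"
      have "lam k * ?n \<le> \<bar>lam k\<bar> * ?n" by (intro mult_right_mono) auto
      then have "- ((\<bar>lam k\<bar> + \<bar>L\<bar>) * ?n) \<le> (norm (snd (a - b)))\<^sup>2 - lam k * ?n
          - (\<integral>z. l z * (fun_of (a - b) z)\<^sup>2 \<partial>lebesgue_on Z)"
        using l_integral_le[of "fst (a - b)"] zero_le_power2[of "norm (snd (a - b))"]
        unfolding distrib_right by linarith
      then have "1 / 2 * (t * (1 - t)) * - ((\<bar>lam k\<bar> + \<bar>L\<bar>) * ?n) \<le> 1 / 2 * (t * (1 - t)) *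
          ((norm (snd (a - b)))\<^sup>2 - lam k * ?n - (\<integral>z. l z * (fun_of (a - b) z)\<^sup>2 \<partial>lebesgue_on Z))"
        using t by (intro mult_left_mono) auto
      moreover have "1 / 2 * (t * (1 - t)) * - ((\<bar>lam k\<bar> + \<bar>L\<bar>) * ?n)
          = - ((\<bar>lam k\<bar> + \<bar>L\<bar>) / 2 * (t * (1 - t)) * ?n)" by simp
      ultimately show ?thesis using energy_convexity[OF t, of "lam k" a b] unfolding E_def by linarith
    qed
    show "(norm (fst ((1 - t) *\<^sub>R a + t *\<^sub>R b)))\<^sup>2
        = (1 - t) * (norm (fst a))\<^sup>2 + t * (norm (fst b))\<^sup>2 - t * (1 - t) * (norm (fst (a - b)))\<^sup>2"
      for a b :: "(real ^ 'n) H1" and t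
      by (simp add: norm_sq_convex_combination)
    show "E (?x + h) \<le> E ?x + B * (2 + 2 * norm ?x)" if h: "norm h \<le> 1" for h
    proof -
      have "E (?x + h) - E ?x \<le> B * (1 + norm (?x + h) + norm ?x) * norm h"
        using B(2)[of "?x + h" ?x] by simp
      also have "\<dots> \<le> B * (2 + 2 * norm ?x) * 1"
        using norm_triangle_ineq[of ?x h] h B(1) by (intro mult_mono mult_left_mono) auto
      finally show ?thesis by simp
    qed
    show "E ?x \<le> E (?x + y)" if y: "y \<in> S" for y
      using min[OF subspace_add[OF S(1) \<theta>(2)[of u] y], of u] by (simp add: add.assoc)
  next
    fix \<xi> assume \<xi>: "\<xi> \<in> clarke_subdiff (H10 Z) E (u + \<theta> u)" "\<And>y. y \<in> S \<Longrightarrow> \<xi> y = 0"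
    have "restrict \<xi> S = (\<lambda>w \<in> S. 0)" by (rule restrict_ext) (rule \<xi>(2))
    with \<xi>(1) show ?thesis by blast
  qed
  show ?thesis
    unfolding S_def[symmetric] E_def[symmetric]
  proof (rule exI[of _ \<theta>], intro conjI ballI iffI)
    show "\<theta> \<in> H_bar Z lam k \<rightarrow> S" by (rule Pi_I) (rule \<theta>(2))
    show "continuous_on (H_bar Z lam k) \<theta>" by (rule continuous_on_subset[OF \<theta>(1)]) simp
  next
    fix u show "(INF v \<in> S. ereal (E (u + v))) = ereal (E (u + \<theta> u))" by (rule inf)
  next
    fix u v assume u: "u \<in> H_bar Z lam k" and v: "v \<in> S"
      and "(\<lambda>w \<in> S. 0) \<in> (\<lambda>\<xi>. restrict \<xi> S) ` clarke_subdiff (H10 Z) E (u + v)"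
    then obtain \<xi> where "\<xi> \<in> clarke_subdiff (H10 Z) E (u + v)" "restrict \<xi> S = (\<lambda>w \<in> S. 0)"
      by (elim imageE) simp
    then show "v = \<theta> u" by (rule only[OF v subsetD[OF bar u]])
  next
    fix u v assume u: "u \<in> H_bar Z lam k" and "v = \<theta> u"
    obtain \<xi> where "\<xi> \<in> clarke_subdiff (H10 Z) E (u + v)" "restrict \<xi> S = (\<lambda>w \<in> S. 0)"
      using crit[OF subsetD[OF bar u]] unfolding \<open>v = \<theta> u\<close> by blast
    then show "(\<lambda>w \<in> S. 0) \<in> (\<lambda>\<xi>. restrict \<xi> S) ` clarke_subdiff (H10 Z) E (u + v)"
      by (metis image_eqI)
  qed
qed

end
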